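(* Let $\mathbf{P}=\bigoplus_{i=1}^k\mathbf{P}_i$ be a direct sum of matrix polynomials $\mathbf{P}_i$ in $z=(z_1,\ldots,z_d)$ with coefficients in $\mathbb{C}^{\ell_i\times m_i}$, satisfying the approximation condition and the Archimedean condition stated in the context. Let $F$ be a rational $\alpha\times\beta$ matrix function in $z$ which is regular on $\overline{\mathcal{D}_{\mathbf{P}}}$ and satisfies $\|F\|_{\mathcal{A},\mathbf{P}}<1$. Then there exist $n=(n_1,\ldots,n_k)\in\mathbb{Z}_+^k$ and a contractive matrix $\begin{bmatrix}A&B\\C&D\end{bmatrix}$ of size $\left(\sum_{i=1}^kn_im_i+\alpha\right)\times\left(\sum_{i=1}^kn_i\ell_i+\beta\right)$, with $A$ of size $\sum_{i=1}^kn_im_i\times\sum_{i=1}^kn_i\ell_i$ and $D$ of size $\alpha\times\beta$, such that $$F(z)=D+C\,\mathbf{P}(z)_n\,(I-A\,\mathbf{P}(z)_n)^{-1}B,\quad z\in\mathcal{D}_{\mathbf{P}},\qquad\text{where }\ \mathbf{P}(z)_n=\bigoplus_{i=1}^k(\mathbf{P}_i(z)\otimes I_{n_i}).$$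
   Context: Norms of matrices are spectral norms; contractive means norm at most $1$. If $n_i=0$, the corresponding direct summand of $\mathbf{P}(z)_n$ is void. For a matrix polynomial $Q(z)=\sum_\mu Q_\mu z^\mu$ and a $d$-tuple $T$ of commuting bounded operators on a Hilbert space, $Q(T)=\sum_\mu Q_\mu\otimes T^\mu$; also $Q^*(w):=\sum_\mu Q_\mu^*w^\mu$. Domain and operator class: $\mathcal{D}_{\mathbf{P}}=\{z\in\mathbb{C}^d:\|\mathbf{P}(z)\|<1\}$, and $\mathcal{T}_{\mathbf{P}}$ is the set of $d$-tuples $T=(T_1,\ldots,T_d)$ of commuting bounded operators on a Hilbert space satisfying $\|\mathbf{P}(T)\|<1$. Approximation condition: every $d$-tuple $T$ of commuting bounded linear operators on a Hilbert space satisfying $\|\mathbf{P}(T)\|\le1$ is a norm limit of elements of $\mathcal{T}_{\mathbf{P}}$ (on the same Hilbert space). Archimedean condition: the polynomials $I_{m_j}-\mathbf{P}_j^*(w)\mathbf{P}_j(z)$, $j=1,\ldots,k$, generate an Archimedean matrix system of Hermitian quadratic modules, that is, there is a constant $c>0$ such that for every $i=1,\ldots,d$ the polynomial $c^2-w_iz_i$ (in the commuting indeterminates $w=(w_1,\ldots,w_d)$, $z=(z_1,\ldots,z_d)$) can be written as $$H_0^*(w)H_0(z)+\sum_{j=1}^kH_j^*(w)\Big((I_{m_j}-\mathbf{P}_j^*(w)\mathbf{P}_j(z))\otimes I_{n_j}\Big)H_j(z)$$ for some $n_0,\ldots,n_k\in\mathbb{N}$ and polynomial columns $H_0\in\mathbb{C}^{n_0\times1}[z]$,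 $H_j\in\mathbb{C}^{m_jn_j\times1}[z]$ (depending on $i$). In particular, $\mathcal{D}_{\mathbf{P}}$ is bounded. Agler norm: for $T\in\mathcal{T}_{\mathbf{P}}$ the Taylor joint spectrum of $T$ lies in $\mathcal{D}_{\mathbf{P}}$, so for $F$ matrix-valued and analytic on $\mathcal{D}_{\mathbf{P}}$ the operator $F(T)$ is defined entrywise by Taylor's functional calculus, and $\|F\|_{\mathcal{A},\mathbf{P}}:=\sup_{T\in\mathcal{T}_{\mathbf{P}}}\|F(T)\|$ (the supremum over all such tuples on all Hilbert spaces). A rational matrix function is regular on a set if each entry can be written as a quotient of polynomials whose denominator has no zeros on that set. *)

theory Defs
  imports
    "HOL-Analysis.Analysis"
    "HOL-Library.Poly_Mapping"
    "Jordan_Normal_Form.Matrix"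
begin

section \<open>Polynomials and matrix polynomials in commuting indeterminates\<close>

text \<open>A matrix polynomial is a matrix whose entries are polynomials; the exponent vectors \<open>\<mu>\<close> are
  finitely supported maps from the index type of the variables to the naturals.\<close>

type_synonym 'i mpoly = "('i \<Rightarrow>\<^sub>0 nat) \<Rightarrow>\<^sub>0 complex"

definition peval :: "'d::finite mpoly \<Rightarrow> complex ^ 'd \<Rightarrow> complex" where
  "peval p z = (\<Sum>\<mu>\<in>Poly_Mapping.keys p. Poly_Mapping.lookup p \<mu> *
      (\<Prod>i\<in>UNIV. vec_nth z i ^ Poly_Mapping.lookup \<mu> i))"

definition mat_peval :: "'d::finite mpoly mat \<Rightarrow> complex ^ 'd \<Rightarrow> complex mat" where
  "mat_peval Q z = map_mat (\<lambda>p. peval p z) Q"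

definition direct_sum :: "nat \<Rightarrow> (nat \<Rightarrow> 'a::zero mat) \<Rightarrow> 'a mat" where
  "direct_sum k P = diag_block_mat (map P [0..<k])"

definition kron :: "'a::times mat \<Rightarrow> 'a mat \<Rightarrow> 'a mat" where
  "kron A B = Matrix.mat (dim_row A * dim_row B) (dim_col A * dim_col B)
     (\<lambda>(r, c). A $$ (r div dim_row B, c div dim_col B) * B $$ (r mod dim_row B, c mod dim_col B))"

definition vec_l2norm :: "complex Matrix.vec \<Rightarrow> real" where
  "vec_l2norm v = sqrt (\<Sum>i<dim_vec v. (cmod (vec_index v i))\<^sup>2)"

definition spectral_norm :: "complex mat \<Rightarrow> real" where
  "spectral_norm A =
     Sup {vec_l2norm (A *\<^sub>v v) | v. v \<in> carrier_vec (dim_col A) \<and> vec_l2norm v \<le> 1}"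

definition dom_P :: "'d::finite mpoly mat \<Rightarrow> (complex ^ 'd) set" where
  "dom_P P = {z. spectral_norm (mat_peval P z) < 1}"

text \<open>Polynomials in the \<open>2d\<close> commuting indeterminates \<open>w\<^sub>i\<close> (index \<open>Inl i\<close>) and \<open>z\<^sub>i\<close> (index
  \<open>Inr i\<close>): \<open>in_z Q\<close> is \<open>Q(z)\<close>, and \<open>adj_w Q\<close> is \<open>Q\<^sup>*(w)\<close>, the conjugate transpose of the
  coefficients taken in the variables \<open>w\<close> (which are not conjugated).\<close>

definition var_z :: "'d mpoly \<Rightarrow> ('d + 'd) mpoly" where
  "var_z p = (\<Sum>\<mu>\<in>Poly_Mapping.keys p. Poly_Mapping.single
      (\<Sum>i\<in>Poly_Mapping.keys \<mu>. Poly_Mapping.single (Inr i) (Poly_Mapping.lookup \<mu> i))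
      (Poly_Mapping.lookup p \<mu>))"

definition cnj_var_w :: "'d mpoly \<Rightarrow> ('d + 'd) mpoly" where
  "cnj_var_w p = (\<Sum>\<mu>\<in>Poly_Mapping.keys p. Poly_Mapping.single
      (\<Sum>i\<in>Poly_Mapping.keys \<mu>. Poly_Mapping.single (Inl i) (Poly_Mapping.lookup \<mu> i))
      (cnj (Poly_Mapping.lookup p \<mu>)))"

definition in_z :: "'d mpoly mat \<Rightarrow> ('d + 'd) mpoly mat" where
  "in_z Q = map_mat var_z Q"

definition adj_w :: "'d mpoly mat \<Rightarrow> ('d + 'd) mpoly mat" where
  "adj_w Q = transpose_mat (map_mat cnj_var_w Q)"

definition archimedean_condition :: "nat \<Rightarrow> (nat \<Rightarrow> nat) \<Rightarrow> (nat \<Rightarrow> 'd mpoly mat) \<Rightarrow> bool" where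
  "archimedean_condition k m P \<longleftrightarrow> (\<exists>c::real. c > 0 \<and> (\<forall>i. \<exists>n0 n H0 H.
     H0 \<in> carrier_mat n0 1 \<and> (\<forall>j<k. H j \<in> carrier_mat (m j * n j) 1) \<and>
     Poly_Mapping.single 0 (complex_of_real (c\<^sup>2))
       - Poly_Mapping.single (Poly_Mapping.single (Inl i) 1 + Poly_Mapping.single (Inr i) 1) 1
     = (adj_w H0 * in_z H0) $$ (0, 0)
       + (\<Sum>j<k. (adj_w (H j) * kron (1\<^sub>m (m j) - adj_w (P j) * in_z (P j)) (1\<^sub>m (n j))
                    * in_z (H j)) $$ (0, 0))))"


section \<open>Operators on Hilbert spaces\<close>

text \<open>Up to unitary equivalence the complex Hilbert spaces are the spaces \<open>\<ell>\<^sup>2(S)\<close>, \<open>S\<close> an arbitrary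
  index set (an orthonormal basis). Here \<open>S\<close> ranges over all subsets of a type \<open>'x\<close>, and \<open>\<ell>\<^sup>2(S)\<close>
  consists of the square summable functions on \<open>'x\<close> vanishing off \<open>S\<close>. Operators are functions of
  which only the values on \<open>\<ell>\<^sup>2(S)\<close> matter.\<close>

definition ell2 :: "'x set \<Rightarrow> ('x \<Rightarrow> complex) set" where
  "ell2 S = {f. (\<forall>x. x \<notin> S \<longrightarrow> f x = 0) \<and> (\<lambda>x. (cmod (f x))\<^sup>2) summable_on UNIV}"

definition ell2_norm :: "('x \<Rightarrow> complex) \<Rightarrow> real" where
  "ell2_norm f = sqrt (\<Sum>\<^sub>\<infinity>x. (cmod (f x))\<^sup>2)"

type_synonym 'x oper = "('x \<Rightarrow> complex) \<Rightarrow> ('x \<Rightarrow> complex)"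

definition bounded_op :: "'x set \<Rightarrow> 'x oper \<Rightarrow> bool" where
  "bounded_op S A \<longleftrightarrow>
     (\<forall>f\<in>ell2 S. A f \<in> ell2 S) \<and>
     (\<forall>f\<in>ell2 S. \<forall>g\<in>ell2 S. A (\<lambda>x. f x + g x) = (\<lambda>x. A f x + A g x)) \<and>
     (\<forall>a. \<forall>f\<in>ell2 S. A (\<lambda>x. a * f x) = (\<lambda>x. a * A f x)) \<and>
     (\<exists>K. \<forall>f\<in>ell2 S. ell2_norm (A f) \<le> K * ell2_norm f)"

definition op_norm :: "'x set \<Rightarrow> 'x oper \<Rightarrow> real" where
  "op_norm S A = Sup {ell2_norm (A f) | f. f \<in> ell2 S \<and> ell2_norm f \<le> 1}"

text \<open>A matrix of operators on \<open>\<ell>\<^sup>2(S)\<close> acts between finite direct sums of copies of \<open>\<ell>\<^sup>2(S)\<close>.\<close>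

definition block_norm :: "nat \<Rightarrow> (nat \<Rightarrow> 'x \<Rightarrow> complex) \<Rightarrow> real" where
  "block_norm n v = sqrt (\<Sum>j<n. (ell2_norm (v j))\<^sup>2)"

definition opmat_apply :: "'x oper mat \<Rightarrow> (nat \<Rightarrow> 'x \<Rightarrow> complex) \<Rightarrow> (nat \<Rightarrow> 'x \<Rightarrow> complex)" where
  "opmat_apply X v = (\<lambda>i x. \<Sum>j<dim_col X. (X $$ (i, j)) (v j) x)"

definition opmat_norm :: "'x set \<Rightarrow> 'x oper mat \<Rightarrow> real" where
  "opmat_norm S X = Sup {block_norm (dim_row X) (opmat_apply X v) | v.
     (\<forall>j<dim_col X. v j \<in> ell2 S) \<and> block_norm (dim_col X) v \<le> 1}"

definition commuting_tuple :: "'x set \<Rightarrow> ('d \<Rightarrow> 'x oper) \<Rightarrow> bool" where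
  "commuting_tuple S T \<longleftrightarrow> (\<forall>i. bounded_op S (T i)) \<and>
     (\<forall>i j. \<forall>f\<in>ell2 S. T i (T j f) = T j (T i f))"

text \<open>\<open>T\<^sup>\<mu>\<close> is the product of the \<open>T\<^sub>i\<^bsup>\<mu>\<^sub>i\<^esup>\<close> in increasing order of \<open>i\<close>.\<close>

definition op_monom :: "('d::{finite,linorder} \<Rightarrow> 'x oper) \<Rightarrow> ('d \<Rightarrow>\<^sub>0 nat) \<Rightarrow> 'x oper" where
  "op_monom T \<mu> =
     foldr (\<lambda>i A. (T i ^^ Poly_Mapping.lookup \<mu> i) \<circ> A) (sorted_list_of_set UNIV) id"

definition op_peval :: "'d::{finite,linorder} mpoly \<Rightarrow> ('d \<Rightarrow> 'x oper) \<Rightarrow> 'x oper" where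
  "op_peval p T = (\<lambda>f x. \<Sum>\<mu>\<in>Poly_Mapping.keys p. Poly_Mapping.lookup p \<mu> * op_monom T \<mu> f x)"

text \<open>The \<open>(r,c)\<close> block of \<open>Q(T) = \<Sum>\<^sub>\<mu> Q\<^sub>\<mu> \<otimes> T\<^sup>\<mu>\<close> is \<open>Q\<^sub>r\<^sub>c(T)\<close>.\<close>

definition opmat_peval :: "'d::{finite,linorder} mpoly mat \<Rightarrow> ('d \<Rightarrow> 'x oper) \<Rightarrow> 'x oper mat" where
  "opmat_peval Q T = map_mat (\<lambda>p. op_peval p T) Q"

definition class_T :: "'d::{finite,linorder} mpoly mat \<Rightarrow> 'x set \<Rightarrow> ('d \<Rightarrow> 'x oper) set" where
  "class_T P S = {T. commuting_tuple S T \<and> opmat_norm S (opmat_peval P T) < 1}"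

definition approximation_condition ::
    "'x itself \<Rightarrow> 'd::{finite,linorder} mpoly mat \<Rightarrow> bool" where
  "approximation_condition _ P \<longleftrightarrow>
     (\<forall>(S::'x set) T. commuting_tuple S T \<and> opmat_norm S (opmat_peval P T) \<le> 1 \<longrightarrow>
        (\<exists>Ts. (\<forall>n. Ts n \<in> class_T P S) \<and>
              (\<forall>i. (\<lambda>n. op_norm S (\<lambda>f x. Ts n i f x - T i f x)) \<longlonglongrightarrow> 0)))"


section \<open>Taylor joint spectrum and functional calculus\<close>

text \<open>The Koszul complex of a tuple \<open>(A\<^sub>i)\<close>, \<open>i \<in> I\<close>: an element of \<open>\<Lambda>(\<complex>\<^sup>I) \<otimes> \<ell>\<^sup>2(S)\<close> is given by
  its coefficients at \<open>e\<^sub>J\<close>, \<open>J \<subseteq> I\<close>, and the coboundary is \<open>\<Sum>\<^sub>j (e\<^sub>j \<and> _) \<otimes> A\<^sub>j\<close>. All degrees are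
  treated at once.\<close>

definition koszul_forms :: "'x set \<Rightarrow> 'i set \<Rightarrow> ('i set \<Rightarrow> 'x \<Rightarrow> complex) set" where
  "koszul_forms S I = {\<omega>. \<forall>J. if J \<subseteq> I then \<omega> J \<in> ell2 S else \<omega> J = (\<lambda>_. 0)}"

definition koszul_d :: "'i::linorder set \<Rightarrow> ('i \<Rightarrow> 'x oper) \<Rightarrow>
    ('i set \<Rightarrow> 'x \<Rightarrow> complex) \<Rightarrow> ('i set \<Rightarrow> 'x \<Rightarrow> complex)" where
  "koszul_d I A \<omega> = (\<lambda>J x. if J \<subseteq> I
     then \<Sum>j\<in>J. (- 1) ^ card {i\<in>J. i < j} * A j (\<omega> (J - {j})) x else 0)"

definition koszul_exact :: "'x set \<Rightarrow> 'i::linorder set \<Rightarrow> ('i \<Rightarrow> 'x oper) \<Rightarrow> bool" where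
  "koszul_exact S I A \<longleftrightarrow> {\<omega> \<in> koszul_forms S I. koszul_d I A \<omega> = (\<lambda>_ _. 0)}
     = koszul_d I A ` koszul_forms S I"

definition taylor_spectrum ::
    "'x set \<Rightarrow> 'i::linorder set \<Rightarrow> ('i \<Rightarrow> 'x oper) \<Rightarrow> ('i \<Rightarrow> complex) set" where
  "taylor_spectrum S I A = {\<zeta>. (\<forall>i. i \<notin> I \<longrightarrow> \<zeta> i = 0) \<and>
     \<not> koszul_exact S I (\<lambda>i f x. A i f x - \<zeta> i * f x)}"

definition joint_spectrum :: "'x set \<Rightarrow> ('d::{finite,linorder} \<Rightarrow> 'x oper) \<Rightarrow> (complex ^ 'd::{finite,linorder}) set" where
  "joint_spectrum S T = {z. vec_nth z \<in> taylor_spectrum S UNIV T}"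

definition holomorphic_several :: "(complex ^ 'd::finite \<Rightarrow> complex) \<Rightarrow> (complex ^ 'd) set \<Rightarrow> bool" where
  "holomorphic_several f U \<longleftrightarrow>
     (\<forall>z\<in>U. \<exists>a. (f has_derivative (\<lambda>h. \<Sum>i\<in>UNIV. a i * vec_nth h i)) (at z))"

definition analytic_near :: "(complex ^ 'd::finite) set \<Rightarrow> (complex ^ 'd \<Rightarrow> complex) \<Rightarrow> bool" where
  "analytic_near K f \<longleftrightarrow> (\<exists>U. open U \<and> K \<subseteq> U \<and> holomorphic_several f U)"

text \<open>Taylor's functional calculus of a commuting tuple \<open>T\<close>: the continuous unital algebra
  homomorphism \<open>\<Phi>\<close> from the germs of analytic functions near the joint spectrum to the bounded
  operators that sends the \<open>i\<close>-th coordinate function to \<open>T\<^sub>i\<close> and has the spectral mapping property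
  for finite tuples. Such a \<open>\<Phi>\<close> exists (J. L. Taylor, Acta Math. 125 (1970)) and is unique
  (M. Putinar, Proc. AMS 89 (1983)) on these germs; other arguments of \<open>\<Phi>\<close> are unconstrained.\<close>

definition taylor_calculus ::
    "'x set \<Rightarrow> ('d::{finite,linorder} \<Rightarrow> 'x oper) \<Rightarrow> ((complex ^ 'd::{finite,linorder} \<Rightarrow> complex) \<Rightarrow> 'x oper) \<Rightarrow> bool" where
  "taylor_calculus S T \<Phi> \<longleftrightarrow> (let \<sigma> = joint_spectrum S T in
     (\<forall>f. analytic_near \<sigma> f \<longrightarrow> bounded_op S (\<Phi> f)) \<and>
     (\<forall>f g U. analytic_near \<sigma> f \<and> open U \<and> \<sigma> \<subseteq> U \<and> (\<forall>z\<in>U. f z = g z) \<longrightarrow>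
        (\<forall>h\<in>ell2 S. \<Phi> f h = \<Phi> g h)) \<and>
     (\<forall>h\<in>ell2 S. \<Phi> (\<lambda>_. 1) h = h) \<and>
     (\<forall>i. \<forall>h\<in>ell2 S. \<Phi> (\<lambda>z. vec_nth z i) h = T i h) \<and>
     (\<forall>f g. analytic_near \<sigma> f \<and> analytic_near \<sigma> g \<longrightarrow> (\<forall>h\<in>ell2 S.
        \<Phi> (\<lambda>z. f z + g z) h = (\<lambda>x. \<Phi> f h x + \<Phi> g h x) \<and>
        \<Phi> (\<lambda>z. f z * g z) h = \<Phi> f (\<Phi> g h))) \<and>
     (\<forall>a f. analytic_near \<sigma> f \<longrightarrow> (\<forall>h\<in>ell2 S. \<Phi> (\<lambda>z. a * f z) h = (\<lambda>x. a * \<Phi> f h x))) \<and>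
     (\<forall>U fs f. open U \<and> \<sigma> \<subseteq> U \<and> (\<forall>n::nat. holomorphic_several (fs n) U) \<and>
        holomorphic_several f U \<and>
        (\<forall>K. compact K \<and> K \<subseteq> U \<longrightarrow> uniform_limit K fs f sequentially) \<longrightarrow>
        (\<lambda>n. op_norm S (\<lambda>h x. \<Phi> (fs n) h x - \<Phi> f h x)) \<longlonglongrightarrow> 0) \<and>
     (\<forall>(N::nat) fs. (\<forall>j<N. analytic_near \<sigma> (fs j)) \<longrightarrow>
        taylor_spectrum S {..<N} (\<lambda>j. \<Phi> (fs j)) = (\<lambda>z j. if j < N then fs j z else 0) ` \<sigma>))"

text \<open>\<open>F(T)\<close>, defined entrywise.\<close>

definition calculus_mat :: "nat \<Rightarrow> nat \<Rightarrow> ((complex ^ 'd::finite \<Rightarrow> complex) \<Rightarrow> 'x oper) \<Rightarrow>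
    (complex ^ 'd \<Rightarrow> complex mat) \<Rightarrow> 'x oper mat" where
  "calculus_mat \<alpha> \<beta> \<Phi> F = Matrix.mat \<alpha> \<beta> (\<lambda>(r, c). \<Phi> (\<lambda>z. F z $$ (r, c)))"

text \<open>For \<open>F\<close> analytic on \<open>dom_P P\<close>, which contains the joint spectra of the \<open>T \<in> class_T P S\<close>, all
  Taylor calculi \<open>\<Phi>\<close> of \<open>T\<close> give the same \<open>F(T)\<close>, so the infimum merely picks the value \<open>\<parallel>F(T)\<parallel>\<close>.
  If there were no calculus for \<open>T\<close>, the infimum, and with it the norm, would be \<open>\<infinity>\<close>.\<close>

definition agler_norm :: "'x itself \<Rightarrow> 'd::{finite,linorder} mpoly mat \<Rightarrow> nat \<Rightarrow> nat \<Rightarrow>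
    (complex ^ 'd::{finite,linorder} \<Rightarrow> complex mat) \<Rightarrow> ereal" where
  "agler_norm _ P \<alpha> \<beta> F = (SUP S\<in>(UNIV :: 'x set set). SUP T\<in>class_T P S.
     INF \<Phi>\<in>{\<Phi>. taylor_calculus S T \<Phi>}. ereal (opmat_norm S (calculus_mat \<alpha> \<beta> \<Phi> F)))"


section \<open>Rational matrix functions\<close>

definition rational_regular_on ::
    "(complex ^ 'd::finite) set \<Rightarrow> nat \<Rightarrow> nat \<Rightarrow> (complex ^ 'd \<Rightarrow> complex mat) \<Rightarrow> bool" where
  "rational_regular_on X \<alpha> \<beta> F \<longleftrightarrow> (\<forall>z\<in>X. F z \<in> carrier_mat \<alpha> \<beta>) \<and>
     (\<forall>r<\<alpha>. \<forall>c<\<beta>. \<exists>p q. \<forall>z\<in>X. peval q z \<noteq> 0 \<and> F z $$ (r, c) = peval p z / peval q z)"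

end

theory Submission
  imports Defs "HOL-Library.Function_Algebras" "Jordan_Normal_Form.Determinant"
begin

text \<open>The proof combines a Positivstellensatz with a lurking contraction argument.

  After passing to a common denominator, \<open>F = Q / q\<close> with a matrix polynomial \<open>Q\<close> and a polynomial
  \<open>q\<close> without zeros on the closure of the domain. Let \<open>K\<close> be the hermitian kernel
  \<open>q(w)\<^sup>* q(z) I - Q(w)\<^sup>* Q(z)\<close>. Suppose that
  \<open>K = H\<^sub>0(w)\<^sup>* H\<^sub>0(z) + \<Sum>\<^sub>j H\<^sub>j(w)\<^sup>* ((I - P\<^sub>j(w)\<^sup>* P\<^sub>j(z)) \<otimes> I) H\<^sub>j(z)\<close> for some polynomial matrices. Moving
  the negative terms to the other side, the Gram kernel of the vectors \<open>(P(z)\<^sub>n H(z) e, q(z) e)\<close>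
  exceeds that of the vectors \<open>(H(z) e, Q(z) e)\<close> by a positive kernel, so a contractive matrix with
  blocks \<open>A, B, C, D\<close> sends the former to the latter (\<open>lurking_contraction\<close>). The two block rows
  say \<open>A P\<^sub>n H + q B = H\<close> and \<open>C P\<^sub>n H + q D = Q\<close>; eliminating \<open>H\<close>, which is possible because
  \<open>P(z)\<^sub>n\<close> is a strict contraction on the domain, gives the realization of \<open>Q / q\<close>.

  The certificate for \<open>K\<close> is \<open>positivity_certificate\<close>. The kernels of the required form make up a
  convex cone, and the Archimedean condition turns the identity kernel into an order unit
  (\<open>polys_bounded\<close>). If \<open>K\<close> were outside the cone, a linear functional would separate it
  (\<open>cone_separation\<close>), and the GNS construction would turn the functional into a tuple \<open>T\<close> of
  commuting operators, multiplication by the coordinates, with \<open>\<parallel>P(T)\<parallel> \<le> 1\<close>. It is a norm limit of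
  tuples \<open>T\<^sub>n\<close> in the class. For those, \<open>\<parallel>Q(T\<^sub>n) h\<parallel> \<le> c \<parallel>q(T\<^sub>n) h\<parallel>\<close> with a constant \<open>c < 1\<close> by the
  bound on the Agler norm (\<open>rational_function_estimate\<close>), hence the same holds for \<open>T\<close>. But the
  functional is nonpositive at \<open>K\<close>, which says \<open>\<parallel>Q(T) h\<parallel> \<ge> \<parallel>q(T) h\<parallel>\<close> for the cyclic vectors \<open>h\<close>. So
  \<open>q(T)\<close> kills the cyclic vectors and therefore vanishes.

  To contradict \<open>q(T) = 0\<close>, only the approximating tuples are examined. A finite Agler norm provides a
  Taylor calculus for every \<open>T\<^sub>n\<close>. The spectral mapping property for the empty tuple of functions
  shows that the joint spectrum of \<open>T\<^sub>n\<close> is not empty; for a single function it shows that the joint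
  spectrum lies in the domain and that \<open>\<bar>q\<bar> \<le> \<parallel>q(T\<^sub>n)\<parallel>\<close> on it. As \<open>q(T\<^sub>n)\<close> tends to \<open>q(T) = 0\<close>, the
  infimum of \<open>\<bar>q\<bar>\<close> over the domain is \<open>0\<close>. But the domain is bounded by the Archimedean condition, and
  \<open>q\<close> has no zeros on its compact closure.\<close>

section \<open>The spaces of square summable functions\<close>

lemma ell2_L2_set_le:
  assumes "f \<in> ell2 S" "finite F"
  shows "L2_set (\<lambda>x. cmod (f x)) F \<le> ell2_norm f"
proof -
  have "(\<Sum>x\<in>F. (cmod (f x))\<^sup>2) \<le> (\<Sum>\<^sub>\<infinity>x. (cmod (f x))\<^sup>2)"
    using assms by (intro finite_sum_le_infsum) (auto simp: ell2_def)
  then show ?thesis by (simp add: L2_set_def ell2_norm_def)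
qed

text \<open>Membership and norm bounds can both be read off from finite sections. This reduces the triangle
  inequality and the limit arguments below to finite sums.\<close>

lemma ell2_bounded_sections:
  assumes "\<And>x. x \<notin> S \<Longrightarrow> f x = 0"
    and bd: "\<And>F. finite F \<Longrightarrow> L2_set (\<lambda>x. cmod (f x)) F \<le> K"
  shows "f \<in> ell2 S" "ell2_norm f \<le> K"
proof -
  have K: "0 \<le> K" using bd[of "{}"] by simp
  have *: "(\<Sum>x\<in>F. (cmod (f x))\<^sup>2) \<le> K\<^sup>2" if "finite F" for F
    using bd[OF that] K by (simp add: L2_set_def real_le_lsqrt sqrt_le_D)
  then have sm: "(\<lambda>x. (cmod (f x))\<^sup>2) summable_on UNIV"
    by (intro nonneg_bdd_above_summable_on bdd_aboveI[where M = "K\<^sup>2"]) auto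
  then show "f \<in> ell2 S" using assms(1) by (auto simp: ell2_def)
  have "(\<Sum>\<^sub>\<infinity>x. (cmod (f x))\<^sup>2) \<le> K\<^sup>2"
    using sm * by (intro infsum_le_finite_sums) auto
  then show "ell2_norm f \<le> K" using K by (simp add: ell2_norm_def real_le_lsqrt)
qed

lemma ell2_zero_outside: "f \<in> ell2 S \<Longrightarrow> x \<notin> S \<Longrightarrow> f x = 0"
  by (auto simp: ell2_def)

lemma ell2_norm_nonneg [simp]: "0 \<le> ell2_norm f"
  by (simp add: ell2_norm_def infsum_nonneg)

lemma cmod_le_ell2_norm: "f \<in> ell2 S \<Longrightarrow> cmod (f x) \<le> ell2_norm f"
  using ell2_L2_set_le[of f S "{x}"] by simp

lemma ell2_zero [simp]: "(\<lambda>_. 0) \<in> ell2 S" and ell2_norm_zero [simp]: "ell2_norm (\<lambda>_. 0) = 0"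
  by (auto simp: ell2_def ell2_norm_def)

lemma ell2_add:
  assumes "f \<in> ell2 S" "g \<in> ell2 S"
  shows "(\<lambda>x. f x + g x) \<in> ell2 S" "ell2_norm (\<lambda>x. f x + g x) \<le> ell2_norm f + ell2_norm g"
proof -
  have *: "L2_set (\<lambda>x. cmod (f x + g x)) F \<le> ell2_norm f + ell2_norm g" if "finite F" for F
  proof -
    have "L2_set (\<lambda>x. cmod (f x + g x)) F \<le> L2_set (\<lambda>x. cmod (f x) + cmod (g x)) F"
      by (intro L2_set_mono) (auto simp: norm_triangle_ineq)
    also have "\<dots> \<le> L2_set (\<lambda>x. cmod (f x)) F + L2_set (\<lambda>x. cmod (g x)) F"
      by (rule L2_set_triangle_ineq)
    finally show ?thesis
      using ell2_L2_set_le[OF assms(1) that] ell2_L2_set_le[OF assms(2) that] by linarith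
  qed
  have z: "f x + g x = 0" if "x \<notin> S" for x using assms that by (simp add: ell2_zero_outside)
  show "(\<lambda>x. f x + g x) \<in> ell2 S" "ell2_norm (\<lambda>x. f x + g x) \<le> ell2_norm f + ell2_norm g"
    using ell2_bounded_sections[of S "\<lambda>x. f x + g x", OF z *] by auto
qed

lemma ell2_norm_scale: "ell2_norm (\<lambda>x. a * f x) = cmod a * ell2_norm f"
  by (simp add: ell2_norm_def norm_mult power_mult_distrib infsum_cmult_right' real_sqrt_mult)

lemma ell2_scale: "f \<in> ell2 S \<Longrightarrow> (\<lambda>x. a * f x) \<in> ell2 S"
  by (auto simp: ell2_def norm_mult power_mult_distrib intro: summable_on_cmult_right)

lemma ell2_diff:
  assumes "f \<in> ell2 S" "g \<in> ell2 S"
  shows "(\<lambda>x. f x - g x) \<in> ell2 S" "ell2_norm (\<lambda>x. f x - g x) \<le> ell2_norm f + ell2_norm g"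
  using ell2_add[OF assms(1) ell2_scale[OF assms(2), of "- 1"]] ell2_norm_scale[of "- 1" g] by auto

lemma ell2_norm_diff_commute: "ell2_norm (\<lambda>x. f x - g x) = ell2_norm (\<lambda>x. g x - f x)"
  by (simp add: ell2_norm_def norm_minus_commute)

lemma ell2_norm_triangle_diff:
  assumes "f \<in> ell2 S" "g \<in> ell2 S" "h \<in> ell2 S"
  shows "ell2_norm (\<lambda>x. f x - h x) \<le> ell2_norm (\<lambda>x. f x - g x) + ell2_norm (\<lambda>x. g x - h x)"
  using ell2_add(2)[OF ell2_diff(1)[OF assms(1,2)] ell2_diff(1)[OF assms(2,3)]] by simp

lemma ell2_norm_le_add_diff:
  assumes "f \<in> ell2 S" "g \<in> ell2 S"
  shows "ell2_norm f \<le> ell2_norm g + ell2_norm (\<lambda>x. f x - g x)"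
  using ell2_add(2)[OF assms(2) ell2_diff(1)[OF assms]] by simp

lemma ell2_sum:
  assumes "\<And>i. i \<in> I \<Longrightarrow> f i \<in> ell2 S"
  shows "(\<lambda>x. \<Sum>i\<in>I. f i x) \<in> ell2 S"
  using assms
proof (induction I rule: infinite_finite_induct)
  case (insert a I)
  then show ?case using ell2_add(1)[of "f a" S "\<lambda>x. \<Sum>i\<in>I. f i x"] by simp
qed auto

lemma ell2_norm_sum_le:
  assumes "\<And>i. i \<in> I \<Longrightarrow> f i \<in> ell2 S"
  shows "ell2_norm (\<lambda>x. \<Sum>i\<in>I. f i x) \<le> (\<Sum>i\<in>I. ell2_norm (f i))"
  using assms
proof (induction I rule: infinite_finite_induct)
  case (insert a I)
  then show ?case using ell2_add(2)[of "f a" S "\<lambda>x. \<Sum>i\<in>I. f i x"] ell2_sum[of I f S] by fastforce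
qed auto

lemma ell2_norm_eq_zero_iff:
  assumes "f \<in> ell2 S" shows "ell2_norm f = 0 \<longleftrightarrow> f = (\<lambda>_. 0)"
  using cmod_le_ell2_norm[OF assms] by fastforce

lemma ell2_norm_finite_support:
  assumes "finite F" "\<And>x. x \<notin> F \<Longrightarrow> f x = 0" 
  shows "ell2_norm f = L2_set (\<lambda>x. cmod (f x)) F" "f \<in> ell2 F"
proof -
  have "infsum (\<lambda>x. (cmod (f x))\<^sup>2) UNIV = infsum (\<lambda>x. (cmod (f x))\<^sup>2) F"
    using assms by (intro infsum_cong_neutral) auto
  then show "ell2_norm f = L2_set (\<lambda>x. cmod (f x)) F"
    using assms by (simp add: ell2_norm_def L2_set_def)
  have "(\<lambda>x. (cmod (f x))\<^sup>2) summable_on F" using assms by simp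
  then have "(\<lambda>x. (cmod (f x))\<^sup>2) summable_on UNIV"
    using assms by (subst summable_on_cong_neutral[where T = F]) auto
  then show "f \<in> ell2 F" using assms by (auto simp: ell2_def)
qed

lemma ell2_mono: "S \<subseteq> S' \<Longrightarrow> f \<in> ell2 S \<Longrightarrow> f \<in> ell2 S'"
  by (auto simp: ell2_def)

text \<open>Norms are lower semicontinuous under pointwise convergence, since they are suprema of norms
  of finite sections. Completeness is a consequence.\<close>

lemma ell2_pointwise_limit:
  assumes mem: "\<And>n. f n \<in> ell2 S" and lim: "\<And>x. (\<lambda>n. f n x) \<longlonglongrightarrow> g x"
    and bd: "eventually (\<lambda>n. ell2_norm (f n) \<le> K) sequentially"
  shows "g \<in> ell2 S" "ell2_norm g \<le> K"
proof -
  have z: "g x = 0" if "x \<notin> S" for x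
    using lim[of x] ell2_zero_outside[OF mem that] by (simp add: LIMSEQ_const_iff)
  have *: "L2_set (\<lambda>x. cmod (g x)) F \<le> K" if F: "finite F" for F
  proof (rule tendsto_upperbound)
    show "(\<lambda>n. L2_set (\<lambda>x. cmod (f n x)) F) \<longlonglongrightarrow> L2_set (\<lambda>x. cmod (g x)) F"
      unfolding L2_set_def by (intro tendsto_intros lim)
    show "eventually (\<lambda>n. L2_set (\<lambda>x. cmod (f n x)) F \<le> K) sequentially"
      using bd by eventually_elim (use ell2_L2_set_le[OF mem F] order_trans in blast)
  qed simp
  show "g \<in> ell2 S" by (rule ell2_bounded_sections(1)[of S g K]) (use z * in auto)
  show "ell2_norm g \<le> K" by (rule ell2_bounded_sections(2)[of S g K]) (use z * in auto)
qed

lemma ell2_complete: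
  assumes mem: "\<And>n. f n \<in> ell2 S"
    and cauchy: "\<And>e. 0 < e \<Longrightarrow> \<exists>M. \<forall>m\<ge>M. \<forall>n\<ge>M. ell2_norm (\<lambda>x. f m x - f n x) \<le> e"
  shows "\<exists>g\<in>ell2 S. (\<lambda>n. ell2_norm (\<lambda>x. f n x - g x)) \<longlonglongrightarrow> 0"
proof -
  have "Cauchy (\<lambda>n. f n x)" for x
  proof (rule CauchyI)
    fix e :: real assume "0 < e"
    then obtain M where "\<forall>m\<ge>M. \<forall>n\<ge>M. ell2_norm (\<lambda>x. f m x - f n x) \<le> e / 2"
      using cauchy[of "e / 2"] by auto
    moreover have "cmod (f m x - f n x) \<le> ell2_norm (\<lambda>x. f m x - f n x)" for m n
      using cmod_le_ell2_norm[OF ell2_diff(1)[OF mem mem]] .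
    moreover have "e / 2 < e" using \<open>0 < e\<close> by simp
    ultimately have "\<forall>m\<ge>M. \<forall>n\<ge>M. norm (f m x - f n x) < e"
      by (meson le_less_trans)
    then show "\<exists>M. \<forall>m\<ge>M. \<forall>n\<ge>M. norm (f m x - f n x) < e" by blast
  qed
  moreover define g where "g x = lim (\<lambda>n. f n x)" for x
  ultimately have lim: "\<And>x. (\<lambda>n. f n x) \<longlonglongrightarrow> g x"
    by (simp add: Cauchy_convergent_iff convergent_LIMSEQ_iff)
  have *: "\<exists>M. \<forall>n\<ge>M. (\<lambda>x. f n x - g x) \<in> ell2 S \<and> ell2_norm (\<lambda>x. f n x - g x) \<le> e" if "0 < e" for e
  proof -
    obtain M where M: "\<forall>m\<ge>M. \<forall>n\<ge>M. ell2_norm (\<lambda>x. f m x - f n x) \<le> e"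
      using cauchy[OF \<open>0 < e\<close>] by auto
    have "(\<lambda>x. f n x - g x) \<in> ell2 S \<and> ell2_norm (\<lambda>x. f n x - g x) \<le> e" if "n \<ge> M" for n
    proof -
      have "eventually (\<lambda>m. ell2_norm (\<lambda>x. f n x - f m x) \<le> e) sequentially"
        using M that by (auto simp: eventually_sequentially)
      moreover have "(\<lambda>m. f n x - f m x) \<longlonglongrightarrow> f n x - g x" for x
        by (intro tendsto_intros lim)
      ultimately show ?thesis
        using ell2_pointwise_limit[where f = "\<lambda>m x. f n x - f m x" and g = "\<lambda>x. f n x - g x",
            OF ell2_diff(1)[OF mem mem]] by auto
    qed
    then show ?thesis by blast
  qed
  obtain N where "(\<lambda>x. f N x - g x) \<in> ell2 S" using *[of 1] by auto
  then have "g \<in> ell2 S" using ell2_diff(1)[OF mem, of "\<lambda>x. f N x - g x" N] by simp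
  moreover have "(\<lambda>n. ell2_norm (\<lambda>x. f n x - g x)) \<longlonglongrightarrow> 0"
  proof (rule LIMSEQ_I)
    fix e :: real assume "0 < e"
    with *[of "e / 2"] obtain M where M: "\<forall>n\<ge>M. ell2_norm (\<lambda>x. f n x - g x) \<le> e / 2" by auto
    moreover have "e / 2 < e" using \<open>0 < e\<close> by simp
    ultimately have "\<forall>n\<ge>M. ell2_norm (\<lambda>x. f n x - g x) < e" by (meson le_less_trans)
    then show "\<exists>no. \<forall>n\<ge>no. norm (ell2_norm (\<lambda>x. f n x - g x) - 0) < e" by auto
  qed
  ultimately show ?thesis by blast
qed

text \<open>The error of a truncation is the tail of a convergent series. Hence the finitely supported
  functions are dense.\<close>

lemma ell2_truncations_converge:
  assumes f: "f \<in> ell2 S" and S: "S \<subseteq> range \<iota>" and inj: "inj (\<iota> :: nat \<Rightarrow> 'x)"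
  shows "(\<lambda>n. ell2_norm (\<lambda>x. (if x \<in> \<iota> ` {..<n} then f x else 0) - f x)) \<longlonglongrightarrow> 0"
proof -
  let ?h = "\<lambda>k. (cmod (f (\<iota> k)))\<^sup>2"
  have "(\<lambda>x. (cmod (f x))\<^sup>2) summable_on (range \<iota>)"
    using f by (auto simp: ell2_def intro: summable_on_subset_banach)
  then have sm: "?h summable_on UNIV"
    using summable_on_reindex[OF inj, of "\<lambda>x. (cmod (f x))\<^sup>2"] by (simp add: o_def)
  have "ell2_norm (\<lambda>x. (if x \<in> \<iota> ` {..<n} then f x else 0) - f x)
      = sqrt ((\<Sum>\<^sub>\<infinity>k. ?h k) - (\<Sum>k<n. ?h k))" for n
  proof -
    have out: "f x = 0" if "x \<notin> range \<iota>" for x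
      using S ell2_zero_outside[OF f] that by blast
    have "(\<Sum>\<^sub>\<infinity>x. (cmod ((if x \<in> \<iota> ` {..<n} then f x else 0) - f x))\<^sup>2)
        = infsum (\<lambda>x. (cmod (f x))\<^sup>2) (\<iota> ` (- {..<n}))"
    proof (rule infsum_cong_neutral)
      fix x assume "x \<in> UNIV - \<iota> ` (- {..<n})"
      then have "x \<in> \<iota> ` {..<n} \<or> x \<notin> range \<iota>" by blast
      then show "(cmod ((if x \<in> \<iota> ` {..<n} then f x else 0) - f x))\<^sup>2 = 0"
        using out[of x] by auto
    qed (use image_Int[OF inj, of "- {..<n}" "{..<n}"] in auto)
    also have "\<dots> = infsum ?h (- {..<n})"
      using inj by (subst infsum_reindex) (auto simp: inj_on_def o_def)
    also have "\<dots> = infsum ?h UNIV - infsum ?h {..<n}"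
      using infsum_Diff[OF sm, of "{..<n}"] by (simp add: Compl_eq_Diff_UNIV)
    finally show ?thesis by (simp add: ell2_norm_def)
  qed
  moreover have "(\<lambda>n. (\<Sum>\<^sub>\<infinity>k. ?h k) - (\<Sum>k<n. ?h k)) \<longlonglongrightarrow> (\<Sum>\<^sub>\<infinity>k. ?h k) - (\<Sum>\<^sub>\<infinity>k. ?h k)"
    using has_sum_imp_sums[OF has_sum_infsum[OF sm]] by (intro tendsto_intros) (simp add: sums_def)
  ultimately show ?thesis using tendsto_real_sqrt by fastforce
qed

section \<open>Bounded operators\<close>

lemma bounded_opD:
  assumes "bounded_op S A"
  shows "f \<in> ell2 S \<Longrightarrow> A f \<in> ell2 S"
    and "f \<in> ell2 S \<Longrightarrow> g \<in> ell2 S \<Longrightarrow> A (\<lambda>x. f x + g x) = (\<lambda>x. A f x + A g x)"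
    and "f \<in> ell2 S \<Longrightarrow> A (\<lambda>x. a * f x) = (\<lambda>x. a * A f x)"
  using assms by (auto simp: bounded_op_def)

lemma bounded_opI:
  assumes "\<And>f. f \<in> ell2 S \<Longrightarrow> A f \<in> ell2 S"
    and "\<And>f g. f \<in> ell2 S \<Longrightarrow> g \<in> ell2 S \<Longrightarrow> A (\<lambda>x. f x + g x) = (\<lambda>x. A f x + A g x)"
    and "\<And>a f. f \<in> ell2 S \<Longrightarrow> A (\<lambda>x. a * f x) = (\<lambda>x. a * A f x)"
    and "\<And>f. f \<in> ell2 S \<Longrightarrow> ell2_norm (A f) \<le> K * ell2_norm f"
  shows "bounded_op S A"
  unfolding bounded_op_def
proof (intro conjI)
  show "\<exists>K. \<forall>f\<in>ell2 S. ell2_norm (A f) \<le> K * ell2_norm f"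
    by (intro exI[of _ K] ballI assms(4))
qed (simp_all add: assms(1-3))

lemma bounded_op_bound:
  assumes "bounded_op S A"
  shows "\<exists>K\<ge>0. \<forall>f\<in>ell2 S. ell2_norm (A f) \<le> K * ell2_norm f"
proof -
  from assms obtain K where K: "\<forall>f\<in>ell2 S. ell2_norm (A f) \<le> K * ell2_norm f"
    unfolding bounded_op_def by fast
  have "ell2_norm (A f) \<le> max K 0 * ell2_norm f" if "f \<in> ell2 S" for f
    using bspec[OF K that] mult_right_mono[of K "max K 0" "ell2_norm f"] by simp
  then show ?thesis by (intro exI[of _ "max K 0"]) simp
qed

lemma bounded_op_zero: "bounded_op S A \<Longrightarrow> A (\<lambda>_. 0) = (\<lambda>_. 0)"
  using bounded_opD(3)[of S A "\<lambda>_. 0" 0] by simp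

lemma bounded_op_diff:
  assumes "bounded_op S A" "f \<in> ell2 S" "g \<in> ell2 S"
  shows "A (\<lambda>x. f x - g x) = (\<lambda>x. A f x - A g x)"
  using bounded_opD(2)[OF assms(1,2) ell2_scale[OF assms(3), of "- 1"]]
    bounded_opD(3)[OF assms(1,3), of "- 1"] by simp

lemma bounded_op_id: "bounded_op S id" "bounded_op S (\<lambda>f. f)"
  by (rule bounded_opI[where K = 1]; simp)+

lemma bounded_op_const_zero: "bounded_op S (\<lambda>f x. 0)"
  by (rule bounded_opI[where K = 0]) auto

lemma bounded_op_comp:
  assumes "bounded_op S A" "bounded_op S B"
  shows "bounded_op S (\<lambda>f. A (B f))"
proof -
  obtain K where K: "0 \<le> K" "\<forall>f\<in>ell2 S. ell2_norm (A f) \<le> K * ell2_norm f"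
    using bounded_op_bound[OF assms(1)] by auto
  obtain K' where K': "0 \<le> K'" "\<forall>f\<in>ell2 S. ell2_norm (B f) \<le> K' * ell2_norm f"
    using bounded_op_bound[OF assms(2)] by auto
  have "ell2_norm (A (B f)) \<le> (K * K') * ell2_norm f" if "f \<in> ell2 S" for f
    using K(2)[rule_format, OF bounded_opD(1)[OF assms(2) that]] mult_left_mono[OF K'(2)[rule_format, OF that] K(1)]
    by (simp add: mult.assoc)
  then show ?thesis
    by (intro bounded_opI[where K = "K * K'"])
      (simp_all add: bounded_opD[OF assms(1)] bounded_opD[OF assms(2)])
qed

lemma bounded_op_add:
  assumes "bounded_op S A" "bounded_op S B"
  shows "bounded_op S (\<lambda>f x. A f x + B f x)"
proof -
  obtain K where K: "0 \<le> K" "\<forall>f\<in>ell2 S. ell2_norm (A f) \<le> K * ell2_norm f"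
    using bounded_op_bound[OF assms(1)] by auto
  obtain K' where K': "0 \<le> K'" "\<forall>f\<in>ell2 S. ell2_norm (B f) \<le> K' * ell2_norm f"
    using bounded_op_bound[OF assms(2)] by auto
  have "ell2_norm (\<lambda>x. A f x + B f x) \<le> (K + K') * ell2_norm f" if "f \<in> ell2 S" for f
    using ell2_add(2)[OF bounded_opD(1)[OF assms(1) that] bounded_opD(1)[OF assms(2) that]]
      K(2)[rule_format, OF that] K'(2)[rule_format, OF that] by (simp add: algebra_simps)
  then show ?thesis
    by (intro bounded_opI[where K = "K + K'"])
      (simp_all add: bounded_opD[OF assms(1)] bounded_opD[OF assms(2)] ell2_add distrib_left add_ac)
qed

lemma bounded_op_scale:
  assumes "bounded_op S A"
  shows "bounded_op S (\<lambda>f x. a * A f x)"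
proof -
  obtain K where K: "0 \<le> K" "\<forall>f\<in>ell2 S. ell2_norm (A f) \<le> K * ell2_norm f"
    using bounded_op_bound[OF assms(1)] by auto
  have "ell2_norm (\<lambda>x. a * A f x) \<le> cmod a * K * ell2_norm f" if "f \<in> ell2 S" for f
    using mult_left_mono[OF K(2)[rule_format, OF that], of "cmod a"] by (simp add: ell2_norm_scale mult.assoc)
  then show ?thesis
    by (intro bounded_opI[where K = "cmod a * K"])
      (simp_all add: bounded_opD[OF assms(1)] ell2_scale algebra_simps)
qed

lemma bounded_op_diff_op:
  assumes "bounded_op S A" "bounded_op S B"
  shows "bounded_op S (\<lambda>f x. A f x - B f x)"
  using bounded_op_add[OF assms(1) bounded_op_scale[OF assms(2), of "- 1"]] by simp

lemma bounded_op_sum_op: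
  assumes "\<And>i. i \<in> I \<Longrightarrow> bounded_op S (A i)"
  shows "bounded_op S (\<lambda>f x. \<Sum>i\<in>I. A i f x)"
  using assms
proof (induction I rule: infinite_finite_induct)
  case (insert a I)
  then show ?case using bounded_op_add[of S "A a" "\<lambda>f x. \<Sum>i\<in>I. A i f x"] by simp
qed (auto intro: bounded_op_const_zero)

text \<open>A supremum of reals is meaningful only for a set that is bounded above; boundedness of the operator
  provides this. A vector of arbitrary norm is rescaled to the unit ball.\<close>

lemma op_norm_bound:
  assumes A: "bounded_op S A" and f: "f \<in> ell2 S"
  shows "ell2_norm (A f) \<le> op_norm S A * ell2_norm f"
proof (cases "ell2_norm f = 0")
  case True
  then have "f = (\<lambda>_. 0)" using ell2_norm_eq_zero_iff[OF f] by simp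
  then show ?thesis using bounded_op_zero[OF A] by simp
next
  case False
  then have pos: "0 < ell2_norm f" using ell2_norm_nonneg[of f] by (simp add: less_le)
  obtain K where K: "0 \<le> K" "\<forall>f\<in>ell2 S. ell2_norm (A f) \<le> K * ell2_norm f"
    using bounded_op_bound[OF A] by auto
  have bdd: "bdd_above {ell2_norm (A f) | f. f \<in> ell2 S \<and> ell2_norm f \<le> 1}"
  proof (rule bdd_aboveI[of _ K])
    fix y assume "y \<in> {ell2_norm (A f) | f. f \<in> ell2 S \<and> ell2_norm f \<le> 1}"
    then obtain f where "y = ell2_norm (A f)" "f \<in> ell2 S" "ell2_norm f \<le> 1" by blast
    then show "y \<le> K" using bspec[OF K(2), of f] mult_left_mono[of "ell2_norm f" 1 K] K(1) by simp
  qed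
  define g where "g = (\<lambda>x. of_real (inverse (ell2_norm f)) * f x)"
  have g: "g \<in> ell2 S" "ell2_norm g \<le> 1"
    using pos by (auto simp: g_def ell2_norm_scale norm_inverse intro: ell2_scale[OF f])
  have "ell2_norm (A g) \<le> op_norm S A"
    unfolding op_norm_def using g by (intro cSup_upper bdd) auto
  moreover have "ell2_norm (A g) = inverse (ell2_norm f) * ell2_norm (A f)"
    unfolding g_def by (simp add: bounded_opD(3)[OF A f] ell2_norm_scale norm_inverse)
  ultimately show ?thesis using pos by (simp add: field_simps)
qed

lemma squeeze_zero:
  fixes a b :: "nat \<Rightarrow> real"
  assumes "\<And>n. 0 \<le> a n" "\<And>n. a n \<le> b n" "b \<longlonglongrightarrow> 0"
  shows "a \<longlonglongrightarrow> 0"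
  by (rule tendsto_sandwich[OF _ _ tendsto_const assms(3)]) (use assms in auto)

lemma bounded_op_continuous:
  assumes A: "bounded_op S A" and f: "\<And>n. f n \<in> ell2 S" "g \<in> ell2 S"
    and lim: "(\<lambda>n. ell2_norm (\<lambda>x. f n x - g x)) \<longlonglongrightarrow> 0"
  shows "(\<lambda>n. ell2_norm (\<lambda>x. A (f n) x - A g x)) \<longlonglongrightarrow> 0"
proof -
  obtain K where K: "0 \<le> K" "\<forall>f\<in>ell2 S. ell2_norm (A f) \<le> K * ell2_norm f"
    using bounded_op_bound[OF A] by auto
  have "ell2_norm (\<lambda>x. A (f n) x - A g x) \<le> K * ell2_norm (\<lambda>x. f n x - g x)" for n
    using K(2)[rule_format, OF ell2_diff(1)[OF f(1) f(2)]] bounded_op_diff[OF A f(1) f(2)] by simp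
  then show ?thesis
    by (intro squeeze_zero[OF _ _ tendsto_mult_right_zero[OF lim, of K]]) auto
qed

lemma ell2_norm_tendsto:
  assumes f: "\<And>n. f n \<in> ell2 S" "g \<in> ell2 S"
    and lim: "(\<lambda>n. ell2_norm (\<lambda>x. f n x - g x)) \<longlonglongrightarrow> 0"
  shows "(\<lambda>n. ell2_norm (f n)) \<longlonglongrightarrow> ell2_norm g"
proof (rule Lim_transform_bound[OF _ lim, THEN LIM_zero_cancel])
  show "\<forall>\<^sub>F n in sequentially. norm (ell2_norm (f n) - ell2_norm g) \<le> norm (ell2_norm (\<lambda>x. f n x - g x))"
  proof (intro always_eventually allI)
    fix n
    show "norm (ell2_norm (f n) - ell2_norm g) \<le> norm (ell2_norm (\<lambda>x. f n x - g x))"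
      using ell2_norm_le_add_diff[OF f(1)[of n] f(2)] ell2_norm_le_add_diff[OF f(2) f(1)[of n]]
        ell2_norm_diff_commute[of "f n" g] by simp
  qed
qed

lemma ell2_limit_add:
  assumes "\<And>n. f n \<in> ell2 S" "g \<in> ell2 S" "\<And>n. f' n \<in> ell2 S" "g' \<in> ell2 S"
    and "(\<lambda>n. ell2_norm (\<lambda>x. f n x - g x)) \<longlonglongrightarrow> 0" "(\<lambda>n. ell2_norm (\<lambda>x. f' n x - g' x)) \<longlonglongrightarrow> 0"
  shows "(\<lambda>n. ell2_norm (\<lambda>x. (f n x + f' n x) - (g x + g' x))) \<longlonglongrightarrow> 0"
proof -
  have "ell2_norm (\<lambda>x. (f n x + f' n x) - (g x + g' x))
      \<le> ell2_norm (\<lambda>x. f n x - g x) + ell2_norm (\<lambda>x. f' n x - g' x)" for n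
    using ell2_add(2)[OF ell2_diff(1)[OF assms(1,2)] ell2_diff(1)[OF assms(3,4)], of n n]
    by (simp add: algebra_simps)
  then show ?thesis
    using tendsto_add[OF assms(5,6)] by (intro squeeze_zero[OF ell2_norm_nonneg]) simp_all
qed

lemma ell2_limit_sum:
  assumes "\<And>i n. i \<in> I \<Longrightarrow> f i n \<in> ell2 S" "\<And>i. i \<in> I \<Longrightarrow> g i \<in> ell2 S"
    and "\<And>i. i \<in> I \<Longrightarrow> (\<lambda>n. ell2_norm (\<lambda>x. f i n x - g i x)) \<longlonglongrightarrow> 0"
  shows "(\<lambda>n. ell2_norm (\<lambda>x. (\<Sum>i\<in>I. f i n x) - (\<Sum>i\<in>I. g i x))) \<longlonglongrightarrow> 0"
  using assms
proof (induction I rule: infinite_finite_induct)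
  case (insert a I)
  have "(\<lambda>n. ell2_norm (\<lambda>x. (f a n x + (\<Sum>i\<in>I. f i n x)) - (g a x + (\<Sum>i\<in>I. g i x)))) \<longlonglongrightarrow> 0"
    by (rule ell2_limit_add[where S = S]) (use insert in \<open>auto intro: ell2_sum\<close>)
  then show ?case using insert by simp
qed auto

text \<open>A bounded operator is determined by, and can be prescribed on, the finitely supported
  functions.\<close>

definition finsupp :: "'x set \<Rightarrow> ('x \<Rightarrow> complex) set" where
  "finsupp S = {f. finite {x. f x \<noteq> 0} \<and> (\<forall>x. x \<notin> S \<longrightarrow> f x = 0)}"

lemma finsuppI: "finite F \<Longrightarrow> (\<And>x. f x \<noteq> 0 \<Longrightarrow> x \<in> F) \<Longrightarrow> (\<And>x. x \<notin> S \<Longrightarrow> f x = 0) \<Longrightarrow> f \<in> finsupp S"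
  unfolding finsupp_def using finite_subset[of "{x. f x \<noteq> 0}" F] by blast

lemma finsuppD: "f \<in> finsupp S \<Longrightarrow> finite {x. f x \<noteq> 0}" "f \<in> finsupp S \<Longrightarrow> x \<notin> S \<Longrightarrow> f x = 0"
  by (simp_all add: finsupp_def)

lemma finsupp_ell2:
  assumes "f \<in> finsupp S" shows "f \<in> ell2 S"
proof (rule ell2_mono)
  show "f \<in> ell2 {x. f x \<noteq> 0}"
    by (rule ell2_norm_finite_support(2)) (use finsuppD(1)[OF assms] in simp_all)
  show "{x. f x \<noteq> 0} \<subseteq> S" using finsuppD(2)[OF assms] by fast
qed

lemma finsupp_add:
  assumes "f \<in> finsupp S" "g \<in> finsupp S" shows "(\<lambda>x. f x + g x) \<in> finsupp S"
proof (rule finsuppI)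
  show "finite ({x. f x \<noteq> 0} \<union> {x. g x \<noteq> 0})" using assms by (simp add: finsuppD(1))
  show "x \<in> {x. f x \<noteq> 0} \<union> {x. g x \<noteq> 0}" if "f x + g x \<noteq> 0" for x using that by auto
qed (simp add: finsuppD(2)[OF assms(1)] finsuppD(2)[OF assms(2)])

lemma finsupp_scale:
  assumes "f \<in> finsupp S" shows "(\<lambda>x. a * f x) \<in> finsupp S"
  by (rule finsuppI[OF finsuppD(1)[OF assms]]) (use finsuppD(2)[OF assms] in simp_all)

lemma truncation_finsupp:
  assumes "f \<in> ell2 S" "finite F" shows "(\<lambda>x. if x \<in> F then f x else 0) \<in> finsupp S"
proof (rule finsuppI[OF assms(2)])
  show "x \<in> F" if "(if x \<in> F then f x else 0) \<noteq> 0" for x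
    using that by (cases "x \<in> F") simp_all
qed (simp add: ell2_zero_outside[OF assms(1)])

text \<open>The images of the truncations of a vector form a Cauchy sequence. Linearity and the bound pass to
  its limit.\<close>

lemma bounded_op_extension:
  fixes T0 :: "('x \<Rightarrow> complex) \<Rightarrow> 'y \<Rightarrow> complex"
  assumes S: "S \<subseteq> range (\<iota> :: nat \<Rightarrow> 'x)" "inj \<iota>"
    and mem: "\<And>f. f \<in> finsupp S \<Longrightarrow> T0 f \<in> ell2 S'"
    and add: "\<And>f g. f \<in> finsupp S \<Longrightarrow> g \<in> finsupp S \<Longrightarrow> T0 (\<lambda>x. f x + g x) = (\<lambda>y. T0 f y + T0 g y)"
    and scale: "\<And>a f. f \<in> finsupp S \<Longrightarrow> T0 (\<lambda>x. a * f x) = (\<lambda>y. a * T0 f y)"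
    and bound: "\<And>f. f \<in> finsupp S \<Longrightarrow> ell2_norm (T0 f) \<le> K * ell2_norm f"
  obtains T where "\<And>f. f \<in> ell2 S \<Longrightarrow> T f \<in> ell2 S'"
    and "\<And>f g. f \<in> ell2 S \<Longrightarrow> g \<in> ell2 S \<Longrightarrow> T (\<lambda>x. f x + g x) = (\<lambda>y. T f y + T g y)"
    and "\<And>a f. f \<in> ell2 S \<Longrightarrow> T (\<lambda>x. a * f x) = (\<lambda>y. a * T f y)"
    and "\<And>f. f \<in> ell2 S \<Longrightarrow> ell2_norm (T f) \<le> K * ell2_norm f"
    and "\<And>f. f \<in> finsupp S \<Longrightarrow> T f = T0 f"
proof -
  define cut where "cut n f = (\<lambda>x. if x \<in> \<iota> ` {..<n} then f x else 0)" for n and f :: "'x \<Rightarrow> complex"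
  have cut: "cut n f \<in> finsupp S" if "f \<in> ell2 S" for n f
    unfolding cut_def by (rule truncation_finsupp[OF that]) simp
  have cutlim: "(\<lambda>n. ell2_norm (\<lambda>x. cut n f x - f x)) \<longlonglongrightarrow> 0" if "f \<in> ell2 S" for f
    unfolding cut_def by (rule ell2_truncations_converge[OF that S])
  have diff: "T0 (\<lambda>x. f x - g x) = (\<lambda>y. T0 f y - T0 g y)" "(\<lambda>x. f x - g x) \<in> finsupp S"
    if "f \<in> finsupp S" "g \<in> finsupp S" for f g
    using add[OF that(1) finsupp_scale[OF that(2), of "- 1"]] scale[OF that(2), of "- 1"]
      finsupp_add[OF that(1) finsupp_scale[OF that(2), of "- 1"]] by auto
  define T where "T f y = lim (\<lambda>n. T0 (cut n f) y)" for f y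
  have limT: "T f \<in> ell2 S' \<and> (\<lambda>n. ell2_norm (\<lambda>y. T0 (cut n f) y - T f y)) \<longlonglongrightarrow> 0
      \<and> (\<forall>y. (\<lambda>n. T0 (cut n f) y) \<longlonglongrightarrow> T f y)" if f: "f \<in> ell2 S" for f
  proof -
    have "\<exists>M. \<forall>m\<ge>M. \<forall>n\<ge>M. ell2_norm (\<lambda>y. T0 (cut m f) y - T0 (cut n f) y) \<le> e" if "0 < e" for e
    proof -
      \<comment> \<open>The factor \<open>t\<close> is positive even if \<open>K = 0\<close>. Truncations closer than \<open>d\<close> to \<open>f\<close> have images
        at distance at most \<open>e\<close>.\<close>
      define t where "t = \<bar>K\<bar> + 1"
      have t: "0 < t" by (simp add: t_def)
      define d where "d = e / (2 * t)"
      have dK: "t * (d + d) = e" using t by (simp add: d_def field_simps)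
      have d: "0 < d" using that t by (simp add: d_def)
      obtain M where M: "\<And>n. n \<ge> M \<Longrightarrow> ell2_norm (\<lambda>x. cut n f x - f x) < d"
        using LIMSEQ_D[OF cutlim[OF f] d] by auto
      have "ell2_norm (\<lambda>y. T0 (cut m f) y - T0 (cut n f) y) \<le> e" if mn: "m \<ge> M" "n \<ge> M" for m n
      proof -
        have "ell2_norm (\<lambda>y. T0 (cut m f) y - T0 (cut n f) y) \<le> K * ell2_norm (\<lambda>x. cut m f x - cut n f x)"
          using bound[OF diff(2)[OF cut[OF f] cut[OF f]]] diff(1)[OF cut[OF f] cut[OF f]] by simp
        also have "\<dots> \<le> t * ell2_norm (\<lambda>x. cut m f x - cut n f x)"
          by (intro mult_right_mono) (auto simp: t_def)
        also have "ell2_norm (\<lambda>x. cut m f x - cut n f x) \<le> d + d"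
          using ell2_norm_triangle_diff[OF finsupp_ell2[OF cut[OF f]] f finsupp_ell2[OF cut[OF f]], of m n]
            M[OF mn(1)] M[OF mn(2)] ell2_norm_diff_commute[of f "cut n f"] by simp
        finally show ?thesis using dK t by (simp add: mult_left_mono)
      qed
      then show ?thesis by blast
    qed
    note c = ell2_complete[of "\<lambda>n. T0 (cut n f)" S', OF mem[OF cut[OF f]] this]
    obtain g where g: "g \<in> ell2 S'" "(\<lambda>n. ell2_norm (\<lambda>y. T0 (cut n f) y - g y)) \<longlonglongrightarrow> 0"
      by (rule bexE[OF c that])
    have "(\<lambda>n. T0 (cut n f) y) \<longlonglongrightarrow> g y" for y
    proof (rule Lim_transform_bound[OF _ g(2), THEN LIM_zero_cancel], intro always_eventually allI)
      fix n
      show "norm (T0 (cut n f) y - g y) \<le> norm (ell2_norm (\<lambda>y. T0 (cut n f) y - g y))"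
        using cmod_le_ell2_norm[OF ell2_diff(1)[OF mem[OF cut[OF f]] g(1)], of n y] by simp
    qed
    moreover from this have "T f = g" unfolding T_def by (auto intro: limI)
    ultimately show ?thesis using g by simp
  qed
  show ?thesis
  proof
    show "T f \<in> ell2 S'" if "f \<in> ell2 S" for f using limT[OF that] by simp
    show "T (\<lambda>x. f x + g x) = (\<lambda>y. T f y + T g y)" if "f \<in> ell2 S" "g \<in> ell2 S" for f g
    proof
      fix y
      have "cut n (\<lambda>x. f x + g x) = (\<lambda>x. cut n f x + cut n g x)" for n by (auto simp: cut_def)
      then have "T0 (cut n (\<lambda>x. f x + g x)) y = T0 (cut n f) y + T0 (cut n g) y" for n
        using add[OF cut[OF that(1)] cut[OF that(2)]] by simp
      moreover have "(\<lambda>n. T0 (cut n f) y + T0 (cut n g) y) \<longlonglongrightarrow> T f y + T g y"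
        using limT[OF that(1)] limT[OF that(2)] by (intro tendsto_add) auto
      ultimately show "T (\<lambda>x. f x + g x) y = T f y + T g y" by (simp add: T_def limI)
    qed
    show "T (\<lambda>x. a * f x) = (\<lambda>y. a * T f y)" if "f \<in> ell2 S" for a f
    proof
      fix y
      have "cut n (\<lambda>x. a * f x) = (\<lambda>x. a * cut n f x)" for n by (auto simp: cut_def)
      then have "T0 (cut n (\<lambda>x. a * f x)) y = a * T0 (cut n f) y" for n
        using scale[OF cut[OF that]] by simp
      moreover have "(\<lambda>n. a * T0 (cut n f) y) \<longlonglongrightarrow> a * T f y"
        using limT[OF that] by (intro tendsto_mult_left) auto
      ultimately show "T (\<lambda>x. a * f x) y = a * T f y" by (simp add: T_def limI)
    qed
    show "ell2_norm (T f) \<le> K * ell2_norm f" if f: "f \<in> ell2 S" for f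
    proof (rule tendsto_le[OF _ tendsto_mult_left ])
      show "(\<lambda>n. ell2_norm (cut n f)) \<longlonglongrightarrow> ell2_norm f"
        by (rule ell2_norm_tendsto[OF finsupp_ell2[OF cut[OF f]] f cutlim[OF f]])
      show "(\<lambda>n. ell2_norm (T0 (cut n f))) \<longlonglongrightarrow> ell2_norm (T f)"
        by (rule ell2_norm_tendsto[OF mem[OF cut[OF f]]]) (use limT[OF f] in auto)
      show "\<forall>\<^sub>F n in sequentially. ell2_norm (T0 (cut n f)) \<le> K * ell2_norm (cut n f)"
        using bound[OF cut[OF f]] by simp
    qed simp
    show "T f = T0 f" if f: "f \<in> finsupp S" for f
    proof -
      have "finite (\<iota> -` {x. f x \<noteq> 0})"
        using f S(2) by (intro finite_vimageI) (auto simp: finsupp_def)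
      then obtain N where N: "\<And>k. f (\<iota> k) \<noteq> 0 \<Longrightarrow> k < N"
        by (metis (mono_tags, lifting) finite_nat_set_iff_bounded mem_Collect_eq vimageI)
      have "cut n f = f" if "n \<ge> N" for n
      proof
        fix x show "cut n f x = f x"
        proof (cases "f x = 0")
          case False
          then obtain k where "x = \<iota> k" using f S(1) by (auto simp: finsupp_def)
          then show ?thesis using N[of k] False that by (auto simp: cut_def)
        qed (simp add: cut_def)
      qed
      then have "\<forall>\<^sub>F n in sequentially. T0 (cut n f) y = T0 f y" for y
        unfolding eventually_sequentially by (intro exI[of _ N]) simp
      then show ?thesis
        unfolding T_def by (auto intro!: ext limI tendsto_eventually)
    qed
  qed
qed

section \<open>Matrices and polynomials of operators\<close>

lemma block_norm_L2_set: "block_norm n v = L2_set (\<lambda>j. ell2_norm (v j)) {..<n}"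
  by (simp add: block_norm_def L2_set_def)

lemma block_norm_nonneg [simp]: "0 \<le> block_norm n v"
  by (simp add: block_norm_L2_set)

lemma block_norm_scale: "block_norm n (\<lambda>j x. a * v j x) = cmod a * block_norm n v"
  by (simp add: block_norm_L2_set ell2_norm_scale L2_set_right_distrib)

lemma ell2_norm_le_block_norm: "j < n \<Longrightarrow> ell2_norm (v j) \<le> block_norm n v"
  unfolding block_norm_L2_set by (rule member_le_L2_set) auto

lemma block_norm_tendsto:
  assumes "\<And>j. j < n \<Longrightarrow> (\<lambda>N. ell2_norm (v N j)) \<longlonglongrightarrow> ell2_norm (w j)"
  shows "(\<lambda>N. block_norm n (v N)) \<longlonglongrightarrow> block_norm n w"
  unfolding block_norm_def by (intro tendsto_intros assms) simp

lemma opmat_apply_mem: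
  assumes "\<And>i j. i < dim_row X \<Longrightarrow> j < dim_col X \<Longrightarrow> bounded_op S (X $$ (i, j))"
    and "\<And>j. j < dim_col X \<Longrightarrow> v j \<in> ell2 S" and "i < dim_row X"
  shows "opmat_apply X v i \<in> ell2 S"
  unfolding opmat_apply_def
  by (intro ell2_sum bounded_opD(1)[OF assms(1)] assms(2,3)) (use assms(3) in auto)

text \<open>The entries being bounded, a crude estimate by the sum of their bounds shows that the supremum is
  finite.\<close>

lemma opmat_norm_bound:
  assumes X: "\<And>i j. i < dim_row X \<Longrightarrow> j < dim_col X \<Longrightarrow> bounded_op S (X $$ (i, j))"
    and v: "\<And>j. j < dim_col X \<Longrightarrow> v j \<in> ell2 S"
  shows "block_norm (dim_row X) (opmat_apply X v) \<le> opmat_norm S X * block_norm (dim_col X) v"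
proof (cases "block_norm (dim_col X) v = 0")
  case True
  then have "v j = (\<lambda>_. 0)" if "j < dim_col X" for j
    using ell2_norm_le_block_norm[OF that, of v] ell2_norm_eq_zero_iff[OF v[OF that]]
      ell2_norm_nonneg[of "v j"] by simp
  then have "opmat_apply X v i = (\<lambda>_. 0)" if "i < dim_row X" for i
    using bounded_op_zero[OF X[OF that]] by (simp add: opmat_apply_def)
  then have "block_norm (dim_row X) (opmat_apply X v) = 0"
    by (simp add: block_norm_def)
  then show ?thesis using True by simp
next
  case False
  then have pos: "0 < block_norm (dim_col X) v"
    using block_norm_nonneg[of "dim_col X" v] by (simp add: less_le)
  let ?A = "{block_norm (dim_row X) (opmat_apply X v) | v.
     (\<forall>j<dim_col X. v j \<in> ell2 S) \<and> block_norm (dim_col X) v \<le> 1}"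
  have "\<exists>K. \<forall>i<dim_row X. \<forall>j<dim_col X. \<forall>f\<in>ell2 S. ell2_norm ((X $$ (i,j)) f) \<le> K i j * ell2_norm f \<and> 0 \<le> K i j"
    using bounded_op_bound[OF X] by metis
  then obtain K where K: "\<forall>i<dim_row X. \<forall>j<dim_col X. \<forall>f\<in>ell2 S. ell2_norm ((X $$ (i,j)) f) \<le> K i j * ell2_norm f \<and> 0 \<le> K i j"
    by (rule exE)
  have bdd: "bdd_above ?A"
  proof (rule bdd_aboveI[of _ "\<Sum>i<dim_row X. \<Sum>j<dim_col X. K i j"])
    fix y assume "y \<in> ?A"
    then obtain v where y: "y = block_norm (dim_row X) (opmat_apply X v)"
      and v: "\<forall>j<dim_col X. v j \<in> ell2 S" "block_norm (dim_col X) v \<le> 1" by auto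
    have "y \<le> (\<Sum>i<dim_row X. ell2_norm (opmat_apply X v i))"
      unfolding y block_norm_L2_set by (rule L2_set_le_sum) simp
    also have "\<dots> \<le> (\<Sum>i<dim_row X. \<Sum>j<dim_col X. K i j)"
    proof (rule sum_mono)
      fix i assume "i \<in> {..<dim_row X}"
      then have i: "i < dim_row X" by simp
      have "ell2_norm (opmat_apply X v i) \<le> (\<Sum>j<dim_col X. ell2_norm ((X $$ (i,j)) (v j)))"
        unfolding opmat_apply_def
        by (rule ell2_norm_sum_le[where S = S]) (use bounded_opD(1)[OF X[OF i]] v(1) in simp)
      also have "\<dots> \<le> (\<Sum>j<dim_col X. K i j)"
      proof (rule sum_mono)
        fix j assume "j \<in> {..<dim_col X}"
        then have j: "j < dim_col X" "v j \<in> ell2 S" using v(1) by auto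
        have "ell2_norm (v j) \<le> 1" using ell2_norm_le_block_norm[OF j(1), of v] v(2) by simp
        then have "K i j * ell2_norm (v j) \<le> K i j"
          using K i j mult_left_mono[of "ell2_norm (v j)" 1 "K i j"] by simp
        then show "ell2_norm ((X $$ (i,j)) (v j)) \<le> K i j" using K i j order_trans by blast
      qed
      finally show "ell2_norm (opmat_apply X v i) \<le> (\<Sum>j<dim_col X. K i j)" .
    qed
    finally show "y \<le> (\<Sum>i<dim_row X. \<Sum>j<dim_col X. K i j)" .
  qed
  define a where "a = complex_of_real (inverse (block_norm (dim_col X) v))"
  have a: "cmod a = inverse (block_norm (dim_col X) v)" using pos by (simp add: a_def norm_inverse)
  define w where "w = (\<lambda>j x. a * v j x)"
  have w: "\<forall>j<dim_col X. w j \<in> ell2 S" "block_norm (dim_col X) w \<le> 1"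
    using pos a by (auto simp: w_def block_norm_scale intro: ell2_scale[OF v])
  have "block_norm (dim_row X) (opmat_apply X w) \<le> opmat_norm S X"
    unfolding opmat_norm_def using w by (intro cSup_upper bdd) auto
  moreover have "block_norm (dim_row X) (opmat_apply X w)
      = block_norm (dim_row X) (\<lambda>i x. a * opmat_apply X v i x)"
    unfolding block_norm_def w_def opmat_apply_def
    by (intro arg_cong[where f = sqrt] sum.cong refl)
      (simp add: bounded_opD(3)[OF X v] sum_distrib_left)
  ultimately show ?thesis using pos a by (simp add: block_norm_scale field_simps)
qed

lemma opmat_norm_le:
  assumes "\<And>v. \<forall>j<dim_col X. v j \<in> ell2 S \<Longrightarrow>
      block_norm (dim_row X) (opmat_apply X v) \<le> K * block_norm (dim_col X) v" and "0 \<le> K"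
  shows "opmat_norm S X \<le> K"
  unfolding opmat_norm_def
proof (rule cSup_least)
  show "{block_norm (dim_row X) (opmat_apply X v) |v.
      (\<forall>j<dim_col X. v j \<in> ell2 S) \<and> block_norm (dim_col X) v \<le> 1} \<noteq> {}"
    by (auto intro!: exI[of _ "\<lambda>_ _. 0"] simp: block_norm_def)
  fix y assume "y \<in> {block_norm (dim_row X) (opmat_apply X v) |v.
      (\<forall>j<dim_col X. v j \<in> ell2 S) \<and> block_norm (dim_col X) v \<le> 1}"
  then obtain v where "y = block_norm (dim_row X) (opmat_apply X v)"
    "\<forall>j<dim_col X. v j \<in> ell2 S" "block_norm (dim_col X) v \<le> 1" by auto
  then show "y \<le> K" using assms(1)[of v] mult_left_mono[OF _ assms(2), of "block_norm (dim_col X) v" 1] by simp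
qed

lemma bounded_op_funpow: "bounded_op S A \<Longrightarrow> bounded_op S (A ^^ n)"
proof (induction n)
  case (Suc n)
  then show ?case using bounded_op_comp[of S A "A ^^ n"] by (simp add: o_def)
qed (simp add: bounded_op_id)

lemma bounded_op_monom:
  assumes "\<And>i. bounded_op S (T i)"
  shows "bounded_op S (op_monom T \<mu>)"
proof -
  have "bounded_op S (foldr (\<lambda>i A. (T i ^^ Poly_Mapping.lookup \<mu> i) \<circ> A) is id)" for "is"
  proof (induction "is")
    case (Cons i "is")
    then show ?case
      using bounded_op_comp[OF bounded_op_funpow[OF assms] Cons.IH] by (simp add: o_def)
  qed (simp add: bounded_op_id)
  then show ?thesis by (simp add: op_monom_def)
qed

lemma bounded_op_peval:
  assumes "\<And>i. bounded_op S (T i)"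
  shows "bounded_op S (op_peval p T)"
  unfolding op_peval_def by (intro bounded_op_sum_op bounded_op_scale bounded_op_monom assms)

lemma op_peval_zero [simp]: "op_peval 0 T = (\<lambda>f x. 0)"
  by (simp add: op_peval_def)

text \<open>Norm convergence with an explicit rate \<open>e\<close>, from which the rate of a product can be computed.\<close>

definition op_tendsto :: "'x set \<Rightarrow> (nat \<Rightarrow> 'x oper) \<Rightarrow> 'x oper \<Rightarrow> bool" where
  "op_tendsto S As A \<longleftrightarrow> (\<forall>n. bounded_op S (As n)) \<and> bounded_op S A \<and>
     (\<exists>e. e \<longlonglongrightarrow> 0 \<and> (\<forall>n. 0 \<le> e n) \<and> (\<forall>n. \<forall>f\<in>ell2 S. ell2_norm (\<lambda>x. As n f x - A f x) \<le> e n * ell2_norm f))"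

lemma op_tendstoI:
  assumes "\<And>n. bounded_op S (As n)" "bounded_op S A" "e \<longlonglongrightarrow> 0" "\<And>n. 0 \<le> e n"
    and "\<And>n f. f \<in> ell2 S \<Longrightarrow> ell2_norm (\<lambda>x. As n f x - A f x) \<le> e n * ell2_norm f"
  shows "op_tendsto S As A"
  unfolding op_tendsto_def using assms(1,2) by (intro conjI allI exI[of _ e] ballI assms)

lemma op_norm_nonneg: "bounded_op S A \<Longrightarrow> 0 \<le> op_norm S A"
proof -
  assume A: "bounded_op S A"
  show ?thesis
  proof (cases "\<exists>f\<in>ell2 S. ell2_norm f \<noteq> 0")
    case True
    then obtain f where f: "f \<in> ell2 S" "ell2_norm f \<noteq> 0" by blast
    then have "0 < ell2_norm f" using ell2_norm_nonneg[of f] by (simp add: less_le)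
    moreover have "0 \<le> op_norm S A * ell2_norm f"
      using op_norm_bound[OF A f(1)] ell2_norm_nonneg[of "A f"] by linarith
    ultimately show ?thesis by (simp add: zero_le_mult_iff)
  next
    case False
    then have "ell2_norm (A f) = 0" if "f \<in> ell2 S" for f
      using that bounded_opD(1)[OF A] by blast
    then have "{ell2_norm (A f) | f. f \<in> ell2 S \<and> ell2_norm f \<le> 1} = {0}"
      by (auto intro!: exI[of _ "\<lambda>_. 0"])
    then show ?thesis unfolding op_norm_def by (simp only: cSup_singleton order_refl)
  qed
qed

lemma op_tendsto_op_norm:
  assumes "\<And>n. bounded_op S (As n)" "bounded_op S A"
    and "(\<lambda>n. op_norm S (\<lambda>f x. As n f x - A f x)) \<longlonglongrightarrow> 0"
  shows "op_tendsto S As A"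
  by (rule op_tendstoI[OF assms(1,2,3)])
    (use op_norm_bound[OF bounded_op_diff_op[OF assms(1,2)]] op_norm_nonneg[OF bounded_op_diff_op[OF assms(1,2)]] in auto)

lemma op_tendsto_bounded:
  assumes "op_tendsto S As A" shows "bounded_op S (As n)" "bounded_op S A"
  using assms by (auto simp: op_tendsto_def)

lemma op_tendsto_rate:
  assumes "op_tendsto S As A"
  shows "\<exists>e. e \<longlonglongrightarrow> 0 \<and> (\<forall>n. 0 \<le> e n) \<and> (\<forall>n. \<forall>f\<in>ell2 S. ell2_norm (\<lambda>x. As n f x - A f x) \<le> e n * ell2_norm f)"
  using assms unfolding op_tendsto_def by (elim conjE)

lemma op_tendsto_pointwise:
  assumes "op_tendsto S As A" "f \<in> ell2 S"
  shows "(\<lambda>n. ell2_norm (\<lambda>x. As n f x - A f x)) \<longlonglongrightarrow> 0"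
proof -
  obtain e where e: "e \<longlonglongrightarrow> 0" "\<forall>n. \<forall>f\<in>ell2 S. ell2_norm (\<lambda>x. As n f x - A f x) \<le> e n * ell2_norm f"
    using op_tendsto_rate[OF assms(1)] by auto
  show ?thesis
    by (rule squeeze_zero[OF _ _ tendsto_mult_left_zero[OF e(1), of "ell2_norm f"]]) (use e(2) assms(2) in auto)
qed

lemma op_tendsto_const: "bounded_op S A \<Longrightarrow> op_tendsto S (\<lambda>_. A) A"
  by (rule op_tendstoI[where e = "\<lambda>_. 0"]) auto

lemma op_tendsto_add:
  assumes "op_tendsto S As A" "op_tendsto S Bs B"
  shows "op_tendsto S (\<lambda>n f x. As n f x + Bs n f x) (\<lambda>f x. A f x + B f x)"
proof -
  note [simp] = op_tendsto_bounded[OF assms(1)] op_tendsto_bounded[OF assms(2)]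
  obtain e where e: "e \<longlonglongrightarrow> 0" "\<forall>n. 0 \<le> e n" "\<forall>n. \<forall>f\<in>ell2 S. ell2_norm (\<lambda>x. As n f x - A f x) \<le> e n * ell2_norm f"
    using op_tendsto_rate[OF assms(1)] by auto
  obtain d where d: "d \<longlonglongrightarrow> 0" "\<forall>n. 0 \<le> d n" "\<forall>n. \<forall>f\<in>ell2 S. ell2_norm (\<lambda>x. Bs n f x - B f x) \<le> d n * ell2_norm f"
    using op_tendsto_rate[OF assms(2)] by auto
  show ?thesis
  proof (rule op_tendstoI[where e = "\<lambda>n. e n + d n"])
    show "(\<lambda>n. e n + d n) \<longlonglongrightarrow> 0" using tendsto_add[OF e(1) d(1)] by simp
    fix n f assume f: "f \<in> ell2 S"
    have "ell2_norm (\<lambda>x. As n f x + Bs n f x - (A f x + B f x))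
        \<le> ell2_norm (\<lambda>x. As n f x - A f x) + ell2_norm (\<lambda>x. Bs n f x - B f x)"
      using ell2_add(2)[OF bounded_opD(1)[OF bounded_op_diff_op, of S "As n" A f] bounded_opD(1)[OF bounded_op_diff_op, of S "Bs n" B f]] f
      by (simp add: algebra_simps)
    also have "\<dots> \<le> e n * ell2_norm f + d n * ell2_norm f" using e(3) d(3) f by (intro add_mono) auto
    finally show "ell2_norm (\<lambda>x. As n f x + Bs n f x - (A f x + B f x)) \<le> (e n + d n) * ell2_norm f"
      by (simp add: algebra_simps)
  qed (use e d in \<open>auto intro: bounded_op_add\<close>)
qed

lemma op_tendsto_comp:
  assumes "op_tendsto S As A" "op_tendsto S Bs B"
  shows "op_tendsto S (\<lambda>n f. As n (Bs n f)) (\<lambda>f. A (B f))"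
proof -
  note b [simp] = op_tendsto_bounded[OF assms(1)] op_tendsto_bounded[OF assms(2)]
  obtain e where e: "e \<longlonglongrightarrow> 0" "\<forall>n. 0 \<le> e n" "\<forall>n. \<forall>f\<in>ell2 S. ell2_norm (\<lambda>x. As n f x - A f x) \<le> e n * ell2_norm f"
    using op_tendsto_rate[OF assms(1)] by auto
  obtain d where d: "d \<longlonglongrightarrow> 0" "\<forall>n. 0 \<le> d n" "\<forall>n. \<forall>f\<in>ell2 S. ell2_norm (\<lambda>x. Bs n f x - B f x) \<le> d n * ell2_norm f"
    using op_tendsto_rate[OF assms(2)] by auto
  obtain K where K: "0 \<le> K" "\<forall>f\<in>ell2 S. ell2_norm (A f) \<le> K * ell2_norm f"
    using bounded_op_bound[OF b(2)] by auto
  obtain L where L: "0 \<le> L" "\<forall>f\<in>ell2 S. ell2_norm (B f) \<le> L * ell2_norm f"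
    using bounded_op_bound[OF b(4)] by auto
  show ?thesis
  proof (rule op_tendstoI[where e = "\<lambda>n. e n * (L + d n) + K * d n"])
    show "(\<lambda>n. e n * (L + d n) + K * d n) \<longlonglongrightarrow> 0"
      using tendsto_add[OF tendsto_mult[OF e(1) tendsto_add[OF tendsto_const d(1), of L]] tendsto_mult[OF tendsto_const d(1), of K]] by simp
    fix n f assume f: "f \<in> ell2 S"
    have Bf: "Bs n f \<in> ell2 S" "B f \<in> ell2 S" "ell2_norm (\<lambda>x. Bs n f x - B f x) \<le> d n * ell2_norm f"
      using bounded_opD(1)[OF b(3) f] bounded_opD(1)[OF b(4) f] d(3) f by auto
    have n: "ell2_norm (Bs n f) \<le> (L + d n) * ell2_norm f"
      using ell2_norm_le_add_diff[OF Bf(1,2)] Bf(3) L(2)[rule_format, OF f] by (simp add: algebra_simps)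
    have "ell2_norm (\<lambda>x. As n (Bs n f) x - A (B f) x)
        \<le> ell2_norm (\<lambda>x. As n (Bs n f) x - A (Bs n f) x) + ell2_norm (\<lambda>x. A (Bs n f) x - A (B f) x)"
      by (rule ell2_norm_triangle_diff[OF bounded_opD(1) bounded_opD(1) bounded_opD(1)]) (use Bf b in auto)
    also have "\<dots> \<le> e n * ell2_norm (Bs n f) + K * ell2_norm (\<lambda>x. Bs n f x - B f x)"
      using e(3)[rule_format, OF Bf(1)] K(2)[rule_format, OF ell2_diff(1)[OF Bf(1,2)]]
        bounded_op_diff[OF b(2) Bf(1,2)] by (intro add_mono) auto
    also have "\<dots> \<le> e n * ((L + d n) * ell2_norm f) + K * (d n * ell2_norm f)"
      using n Bf(3) e(2) K(1) by (intro add_mono mult_left_mono) auto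
    finally show "ell2_norm (\<lambda>x. As n (Bs n f) x - A (B f) x) \<le> (e n * (L + d n) + K * d n) * ell2_norm f"
      by (simp add: algebra_simps)
  qed (use e d K L in \<open>auto intro: bounded_op_comp\<close>)
qed

lemma op_tendsto_funpow:
  "op_tendsto S As A \<Longrightarrow> op_tendsto S (\<lambda>n. As n ^^ k) (A ^^ k)"
proof (induction k)
  case (Suc k)
  then show ?case using op_tendsto_comp[OF Suc.prems Suc.IH[OF Suc.prems]] by (simp add: o_def)
qed (simp add: op_tendsto_const bounded_op_id)

lemma op_tendsto_monom:
  assumes "\<And>i. op_tendsto S (\<lambda>n. Ts n i) (T i)"
  shows "op_tendsto S (\<lambda>n. op_monom (Ts n) \<mu>) (op_monom T \<mu>)"
proof -
  have "op_tendsto S (\<lambda>n. foldr (\<lambda>i A. (Ts n i ^^ Poly_Mapping.lookup \<mu> i) \<circ> A) is id)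
      (foldr (\<lambda>i A. (T i ^^ Poly_Mapping.lookup \<mu> i) \<circ> A) is id)" for "is"
  proof (induction "is")
    case (Cons i "is")
    then show ?case
      using op_tendsto_comp[OF op_tendsto_funpow[OF assms] Cons.IH] by (simp add: o_def)
  qed (simp add: bounded_op_id op_tendsto_const)
  then show ?thesis by (simp add: op_monom_def)
qed

lemma op_tendsto_peval:
  assumes "\<And>i. op_tendsto S (\<lambda>n. Ts n i) (T i)"
  shows "op_tendsto S (\<lambda>n. op_peval p (Ts n)) (op_peval p T)"
proof -
  have "op_tendsto S (\<lambda>n f x. \<Sum>\<mu>\<in>M. Poly_Mapping.lookup p \<mu> * op_monom (Ts n) \<mu> f x)
     (\<lambda>f x. \<Sum>\<mu>\<in>M. Poly_Mapping.lookup p \<mu> * op_monom T \<mu> f x)" if "finite M" for M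
    using that
  proof induction
    case (insert \<mu> M)
    have "op_tendsto S (\<lambda>n f x. Poly_Mapping.lookup p \<mu> * op_monom (Ts n) \<mu> f x)
       (\<lambda>f x. Poly_Mapping.lookup p \<mu> * op_monom T \<mu> f x)"
      using op_tendsto_comp[OF op_tendsto_const[OF bounded_op_scale[OF bounded_op_id(2), where a = "Poly_Mapping.lookup p \<mu>"]] op_tendsto_monom[where Ts = Ts and T = T and \<mu> = \<mu>, OF assms]]
      by simp
    from op_tendsto_add[OF this insert.IH] insert.hyps show ?case by simp
  qed (simp add: op_tendsto_const bounded_op_const_zero)
  then show ?thesis by (simp add: op_peval_def)
qed

section \<open>Consequences of Taylor's functional calculus\<close>

text \<open>This is the Neumann series in iterative form: \<open>A f - \<zeta> f = g\<close> is the fixed point equation of a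
  map that contracts by the factor \<open>K / \<bar>\<zeta>\<bar>\<close>.\<close>

lemma bounded_op_resolvent:
  assumes A: "bounded_op S A" and K: "\<And>f. f \<in> ell2 S \<Longrightarrow> ell2_norm (A f) \<le> K * ell2_norm f"
    and lam: "K < cmod \<zeta>" and K0: "0 \<le> K"
  shows "f \<in> ell2 S \<Longrightarrow> (\<lambda>x. A f x - \<zeta> * f x) = (\<lambda>_. 0) \<Longrightarrow> f = (\<lambda>_. 0)"
    and "g \<in> ell2 S \<Longrightarrow> \<exists>f\<in>ell2 S. (\<lambda>x. A f x - \<zeta> * f x) = g"
proof -
  assume f: "f \<in> ell2 S" and eq: "(\<lambda>x. A f x - \<zeta> * f x) = (\<lambda>_. 0)"
  then have "A f = (\<lambda>x. \<zeta> * f x)" by (auto simp: fun_eq_iff)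
  then have "cmod \<zeta> * ell2_norm f \<le> K * ell2_norm f" using K[OF f] by (simp add: ell2_norm_scale)
  then have "(cmod \<zeta> - K) * ell2_norm f \<le> 0" by (simp add: algebra_simps)
  then have "ell2_norm f = 0" using lam ell2_norm_nonneg[of f] by (simp add: mult_le_0_iff)
  then show "f = (\<lambda>_. 0)" using ell2_norm_eq_zero_iff[OF f] by simp
next
  assume g: "g \<in> ell2 S"
  have l0: "\<zeta> \<noteq> 0" using lam K0 by auto
  define r where "r = K / cmod \<zeta>"
  have r: "0 \<le> r" "r < 1" using lam K0 l0 by (auto simp: r_def divide_less_eq)
  \<comment> \<open>The sum of the geometric series bounds all iterates that start from \<open>0\<close>.\<close>
  define D where "D = (ell2_norm g / cmod \<zeta>) / (1 - r)"
  have "r * (a / (1 - r)) + a = a / (1 - r)" for a :: real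
    using r by (simp add: field_simps)
  from this[of "ell2_norm g / cmod \<zeta>"] have D: "r * D + ell2_norm g / cmod \<zeta> = D" "0 \<le> D"
    using r unfolding D_def by simp_all
  define G where "G u = (\<lambda>x. inverse \<zeta> * (A u x - g x))" for u
  have G: "G u \<in> ell2 S" if "u \<in> ell2 S" for u
    unfolding G_def by (intro ell2_scale ell2_diff(1) bounded_opD(1)[OF A] that g)
  have contr: "ell2_norm (\<lambda>x. G u x - G v x) \<le> r * ell2_norm (\<lambda>x. u x - v x)"
    if "u \<in> ell2 S" "v \<in> ell2 S" for u v
  proof -
    have "(\<lambda>x. G u x - G v x) = (\<lambda>x. inverse \<zeta> * A (\<lambda>x. u x - v x) x)"
      by (simp only: bounded_op_diff[OF A that]) (simp add: G_def algebra_simps)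
    then have "ell2_norm (\<lambda>x. G u x - G v x) = inverse (cmod \<zeta>) * ell2_norm (A (\<lambda>x. u x - v x))"
      by (simp add: ell2_norm_scale norm_inverse)
    also have "\<dots> \<le> inverse (cmod \<zeta>) * (K * ell2_norm (\<lambda>x. u x - v x))"
      by (intro mult_left_mono K ell2_diff(1) that) simp
    finally show ?thesis by (simp add: r_def field_simps)
  qed
  define u where "u n = (G ^^ n) (\<lambda>_. 0)" for n
  have u: "u n \<in> ell2 S" for n
    by (induction n) (auto simp: u_def intro: G)
  have uSuc: "u (Suc n) = G (u n)" for n by (simp add: u_def)
  have norm_u: "ell2_norm (u k) \<le> D" for k
  proof (induction k)
    case (Suc k)
    have "G (\<lambda>_. 0) = (\<lambda>x. (- inverse \<zeta>) * g x)" using bounded_op_zero[OF A] by (simp add: G_def)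
    then have "ell2_norm (G (\<lambda>_. 0)) = ell2_norm g / cmod \<zeta>"
      by (simp only: ell2_norm_scale) (simp add: norm_inverse divide_inverse)
    then have "ell2_norm (u (Suc k)) \<le> ell2_norm g / cmod \<zeta> + r * ell2_norm (u k)"
      using ell2_norm_le_add_diff[OF G[OF u] G[OF ell2_zero], of k] contr[OF u ell2_zero, of k]
      by (simp add: uSuc)
    also have "\<dots> \<le> ell2_norm g / cmod \<zeta> + r * D" using mult_left_mono[OF Suc r(1)] by simp
    finally show ?case using D(1) by simp
  qed (use D(2) in \<open>simp add: u_def\<close>)
  have diff: "ell2_norm (\<lambda>x. u (n + k) x - u n x) \<le> r ^ n * D" for n k
  proof (induction n)
    case 0
    then show ?case using norm_u[of k] by (simp add: u_def[of 0])
  next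
    case (Suc n)
    have "ell2_norm (\<lambda>x. u (Suc n + k) x - u (Suc n) x) \<le> r * ell2_norm (\<lambda>x. u (n + k) x - u n x)"
      using contr[OF u u, of "n + k" n] by (simp add: uSuc)
    also have "\<dots> \<le> r * (r ^ n * D)" by (rule mult_left_mono[OF Suc r(1)])
    finally show ?case by simp
  qed
  have "\<exists>M. \<forall>m\<ge>M. \<forall>n\<ge>M. ell2_norm (\<lambda>x. u m x - u n x) \<le> e" if e: "0 < e" for e
  proof -
    have "(\<lambda>n. r ^ n * D) \<longlonglongrightarrow> 0" using r by (intro tendsto_mult_left_zero LIMSEQ_power_zero) auto
    then obtain M where "\<forall>n\<ge>M. norm (r ^ n * D - 0) < e / 2"
      using e by (meson LIMSEQ_D half_gt_zero)
    then have M: "r ^ M * D \<le> e / 2" by fastforce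
    have tail: "ell2_norm (\<lambda>x. u m x - u M x) \<le> e / 2" if "m \<ge> M" for m
      using diff[of M "m - M"] that M by simp
    have "ell2_norm (\<lambda>x. u m x - u n x) \<le> e" if "m \<ge> M" "n \<ge> M" for m n
      using ell2_norm_triangle_diff[OF u u u, of m n M] tail[OF that(1)] tail[OF that(2)]
        ell2_norm_diff_commute[of "u M" "u n"] by simp
    then show ?thesis by blast
  qed
  note c = ell2_complete[of u S, OF u this]
  obtain f where f: "f \<in> ell2 S" "(\<lambda>n. ell2_norm (\<lambda>x. u n x - f x)) \<longlonglongrightarrow> 0"
    by (rule bexE[OF c that])
  have "ell2_norm (\<lambda>x. G f x - f x) \<le> r * ell2_norm (\<lambda>x. u n x - f x) + ell2_norm (\<lambda>x. u (Suc n) x - f x)" for n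
    using ell2_norm_triangle_diff[OF G[OF f(1)] u f(1), of "Suc n"] contr[OF f(1) u, of n]
      ell2_norm_diff_commute[of f "u n"] by (simp add: uSuc)
  moreover have "(\<lambda>n. r * ell2_norm (\<lambda>x. u n x - f x) + ell2_norm (\<lambda>x. u (Suc n) x - f x)) \<longlonglongrightarrow> r * 0 + 0"
    using f(2) LIMSEQ_Suc[OF f(2)] by (intro tendsto_intros)
  ultimately have "ell2_norm (\<lambda>x. G f x - f x) \<le> r * 0 + 0"
    by (intro tendsto_lowerbound[where F = sequentially]) auto
  then have "ell2_norm (\<lambda>x. G f x - f x) = 0" using ell2_norm_nonneg[of "\<lambda>x. G f x - f x"] by simp
  then have "(\<lambda>x. G f x - f x) = (\<lambda>_. 0)" using ell2_norm_eq_zero_iff[OF ell2_diff(1)[OF G[OF f(1)] f(1)]] by simp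
  then have "A f x - \<zeta> * f x = g x" for x
    using l0 by (simp add: G_def fun_eq_iff field_simps)
  then show "\<exists>f\<in>ell2 S. (\<lambda>x. A f x - \<zeta> * f x) = g" using f(1) by (intro bexI[of _ f]) auto
qed

text \<open>The Koszul complex of the empty tuple consists of the space alone, with zero coboundary.\<close>

lemma koszul_exact_empty:
  assumes "koszul_exact S ({} :: nat set) A" "f \<in> ell2 S"
  shows "f = (\<lambda>_. 0)"
proof -
  define \<omega> :: "nat set \<Rightarrow> 'a \<Rightarrow> complex" where "\<omega> J = (if J = {} then f else (\<lambda>_. 0))" for J
  have d0: "koszul_d {} A \<eta> = (\<lambda>_ _. 0)" for \<eta> by (auto simp: koszul_d_def fun_eq_iff)
  have "\<omega> \<in> {\<omega> \<in> koszul_forms S {}. koszul_d {} A \<omega> = (\<lambda>_ _. 0)}"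
    using assms(2) by (simp add: koszul_forms_def d0 \<omega>_def)
  then have "\<omega> \<in> koszul_d {} A ` koszul_forms S {}" using assms(1) unfolding koszul_exact_def by (simp only:)
  then have "\<omega> = (\<lambda>_ _. 0)" using d0 by auto
  then have "\<omega> {} = (\<lambda>_. 0)" by simp
  then show ?thesis by (simp add: \<omega>_def)
qed

text \<open>The Koszul complex of a single operator \<open>A\<close> is \<open>0 \<rightarrow> H \<rightarrow> H \<rightarrow> 0\<close>, with \<open>A\<close> in the middle.\<close>

lemma koszul_exact_single:
  fixes A :: "nat \<Rightarrow> 'x oper"
  assumes zero: "A 0 (\<lambda>_. 0) = (\<lambda>_. 0)" and mem: "\<And>f. f \<in> ell2 S \<Longrightarrow> A 0 f \<in> ell2 S"
    and inj: "\<And>f. f \<in> ell2 S \<Longrightarrow> A 0 f = (\<lambda>_. 0) \<Longrightarrow> f = (\<lambda>_. 0)"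
    and surj: "\<And>g. g \<in> ell2 S \<Longrightarrow> \<exists>f\<in>ell2 S. A 0 f = g"
  shows "koszul_exact S {..<1} A"
proof -
  have I: "{..<1::nat} = {0}" by auto
  have sub: "J \<subseteq> {0} \<longleftrightarrow> J = {} \<or> J = {0}" for J :: "nat set" by auto
  have d: "koszul_d {0} A \<omega> = (\<lambda>J. if J = {0} then A 0 (\<omega> {}) else (\<lambda>_. 0))" for \<omega>
    by (auto simp: koszul_d_def sub fun_eq_iff)
  have forms: "\<omega> \<in> koszul_forms S {0} \<longleftrightarrow> \<omega> {} \<in> ell2 S \<and> \<omega> {0} \<in> ell2 S \<and> (\<forall>J. J \<noteq> {} \<and> J \<noteq> {0} \<longrightarrow> \<omega> J = (\<lambda>_. 0))"
    for \<omega> :: "nat set \<Rightarrow> 'x \<Rightarrow> complex"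
  proof -
    have "\<omega> \<in> koszul_forms S {0} \<longleftrightarrow> (\<forall>J. if J = {} \<or> J = {0} then \<omega> J \<in> ell2 S else \<omega> J = (\<lambda>_. 0))"
      unfolding koszul_forms_def mem_Collect_eq sub ..
    also have "\<dots> \<longleftrightarrow> \<omega> {} \<in> ell2 S \<and> \<omega> {0} \<in> ell2 S \<and> (\<forall>J. J \<noteq> {} \<and> J \<noteq> {0} \<longrightarrow> \<omega> J = (\<lambda>_. 0))"
      (is "?L \<longleftrightarrow> ?R")
    proof
      assume h: ?L
      show ?R using spec[OF h, of "{}"] spec[OF h, of "{0}"] h by simp
    next
      assume ?R
      then show ?L by simp
    qed
    finally show ?thesis .
  qed
  show ?thesis
    unfolding koszul_exact_def I
  proof (rule Set.set_eqI, rule iffI)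
    fix \<omega> assume "\<omega> \<in> {\<omega> \<in> koszul_forms S {0}. koszul_d {0} A \<omega> = (\<lambda>_ _. 0)}"
    then have f: "\<omega> \<in> koszul_forms S {0}" and "koszul_d {0} A \<omega> {0} = (\<lambda>_. 0)" by (auto simp: fun_eq_iff)
    then have z: "\<omega> {} = (\<lambda>_. 0)" using inj[of "\<omega> {}"] by (simp add: forms d)
    have w0: "\<omega> {0} \<in> ell2 S" using f by (simp add: forms)
    obtain g where g: "g \<in> ell2 S" "A 0 g = \<omega> {0}" by (rule bexE[OF surj[OF w0] that])
    define \<eta> where "\<eta> J = (if J = {} then g else (\<lambda>_. 0))" for J :: "nat set"
    have "\<eta> \<in> koszul_forms S {0}" using g by (simp add: forms \<eta>_def)
    moreover have "\<omega> = koszul_d {0} A \<eta>"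
    proof
      fix J show "\<omega> J = koszul_d {0} A \<eta> J"
        using f z g by (cases "J = {}"; cases "J = {0}") (simp_all add: forms d \<eta>_def)
    qed
    ultimately show "\<omega> \<in> koszul_d {0} A ` koszul_forms S {0}" by blast
  next
    fix \<omega> assume "\<omega> \<in> koszul_d {0} A ` koszul_forms S {0}"
    then obtain \<eta> where e: "\<eta> \<in> koszul_forms S {0}" "\<omega> = koszul_d {0} A \<eta>" by auto
    have "\<omega> \<in> koszul_forms S {0}" using e mem by (simp add: forms d)
    moreover have "koszul_d {0} A \<omega> = (\<lambda>_ _. 0)" unfolding e(2) d by (intro ext) (simp add: zero)
    ultimately show "\<omega> \<in> {\<omega> \<in> koszul_forms S {0}. koszul_d {0} A \<omega> = (\<lambda>_ _. 0)}" by simp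
  qed
qed

lemma taylor_calculusD:
  assumes "taylor_calculus S T \<Phi>"
  defines "\<sigma> \<equiv> joint_spectrum S T"
  shows "analytic_near \<sigma> f \<Longrightarrow> bounded_op S (\<Phi> f)"
    and "analytic_near \<sigma> f \<Longrightarrow> open U \<Longrightarrow> \<sigma> \<subseteq> U \<Longrightarrow> (\<And>z. z \<in> U \<Longrightarrow> f z = g z) \<Longrightarrow> h \<in> ell2 S \<Longrightarrow> \<Phi> f h = \<Phi> g h"
    and "h \<in> ell2 S \<Longrightarrow> \<Phi> (\<lambda>_. 1) h = h"
    and "h \<in> ell2 S \<Longrightarrow> \<Phi> (\<lambda>z. vec_nth z i) h = T i h"
    and "analytic_near \<sigma> f \<Longrightarrow> analytic_near \<sigma> g \<Longrightarrow> h \<in> ell2 S \<Longrightarrow> \<Phi> (\<lambda>z. f z + g z) h = (\<lambda>x. \<Phi> f h x + \<Phi> g h x)"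
    and "analytic_near \<sigma> f \<Longrightarrow> analytic_near \<sigma> g \<Longrightarrow> h \<in> ell2 S \<Longrightarrow> \<Phi> (\<lambda>z. f z * g z) h = \<Phi> f (\<Phi> g h)"
    and "analytic_near \<sigma> f \<Longrightarrow> h \<in> ell2 S \<Longrightarrow> \<Phi> (\<lambda>z. a * f z) h = (\<lambda>x. a * \<Phi> f h x)"
    and "(\<And>j. j < (N::nat) \<Longrightarrow> analytic_near \<sigma> (fs j)) \<Longrightarrow> taylor_spectrum S {..<N} (\<lambda>j. \<Phi> (fs j)) = (\<lambda>z j. if j < N then fs j z else 0) ` \<sigma>"
proof -
  note a = assms(1)[unfolded taylor_calculus_def Let_def, folded \<sigma>_def]
  show "analytic_near \<sigma> f \<Longrightarrow> bounded_op S (\<Phi> f)"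
    and "analytic_near \<sigma> f \<Longrightarrow> open U \<Longrightarrow> \<sigma> \<subseteq> U \<Longrightarrow> (\<And>z. z \<in> U \<Longrightarrow> f z = g z) \<Longrightarrow> h \<in> ell2 S \<Longrightarrow> \<Phi> f h = \<Phi> g h"
    and "h \<in> ell2 S \<Longrightarrow> \<Phi> (\<lambda>_. 1) h = h"
    and "h \<in> ell2 S \<Longrightarrow> \<Phi> (\<lambda>z. vec_nth z i) h = T i h"
    and "analytic_near \<sigma> f \<Longrightarrow> analytic_near \<sigma> g \<Longrightarrow> h \<in> ell2 S \<Longrightarrow> \<Phi> (\<lambda>z. f z + g z) h = (\<lambda>x. \<Phi> f h x + \<Phi> g h x)"
    and "analytic_near \<sigma> f \<Longrightarrow> analytic_near \<sigma> g \<Longrightarrow> h \<in> ell2 S \<Longrightarrow> \<Phi> (\<lambda>z. f z * g z) h = \<Phi> f (\<Phi> g h)"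
    and "analytic_near \<sigma> f \<Longrightarrow> h \<in> ell2 S \<Longrightarrow> \<Phi> (\<lambda>z. a * f z) h = (\<lambda>x. a * \<Phi> f h x)"
    subgoal using a by simp
    subgoal premises prems
    proof -
      have "\<forall>f g. analytic_near \<sigma> f \<and> (\<exists>U. open U \<and> \<sigma> \<subseteq> U \<and> (\<forall>z\<in>U. f z = g z)) \<longrightarrow> (\<forall>h\<in>ell2 S. \<Phi> f h = \<Phi> g h)"
        using a by simp
      then show ?thesis using prems by blast
    qed
    using a by simp_all
  show "(\<And>j. j < (N::nat) \<Longrightarrow> analytic_near \<sigma> (fs j)) \<Longrightarrow> taylor_spectrum S {..<N} (\<lambda>j. \<Phi> (fs j)) = (\<lambda>z j. if j < N then fs j z else 0) ` \<sigma>"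
    using a by blast
qed

text \<open>The spectral mapping property is applied to the empty tuple of functions: its spectrum, which is the
  image of the joint spectrum, is not empty as the space is not trivial.\<close>

lemma joint_spectrum_nonempty:
  assumes "taylor_calculus S T \<Phi>" "f \<in> ell2 S" "f \<noteq> (\<lambda>_. 0)"
  shows "joint_spectrum S T \<noteq> {}"
proof -
  have I: "{..<0::nat} = {}" by simp
  have "\<not> koszul_exact S ({} :: nat set) A" for A using koszul_exact_empty[of S A f] assms(2,3) by blast
  then have "(\<lambda>_. 0) \<in> taylor_spectrum S {..<0::nat} (\<lambda>j. \<Phi> undefined)"
    by (simp add: taylor_spectrum_def)
  then show ?thesis
    using taylor_calculusD(8)[OF assms(1), where N = 0 and fs = "\<lambda>_. undefined"] by auto
qed

text \<open>By spectral mapping \<open>f z\<close> is in the spectrum of \<open>\<Phi> f\<close>, and a spectrum is contained in every disk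
  around \<open>0\<close> whose radius bounds the operator.\<close>

lemma cmod_le_norm_on_spectrum:
  assumes \<Phi>: "taylor_calculus S T \<Phi>" and f: "analytic_near (joint_spectrum S T) f"
    and K: "\<And>h. h \<in> ell2 S \<Longrightarrow> ell2_norm (\<Phi> f h) \<le> K * ell2_norm h" "0 \<le> K"
    and z: "z \<in> joint_spectrum S T"
  shows "cmod (f z) \<le> K"
proof (rule ccontr)
  assume "\<not> cmod (f z) \<le> K"
  then have gt: "K < cmod (f z)" by simp
  have A: "bounded_op S (\<Phi> f)" by (rule taylor_calculusD(1)[OF \<Phi> f])
  note res = bounded_op_resolvent[OF A K(1) gt K(2)]
  have "koszul_exact S {..<1::nat} (\<lambda>i g x. \<Phi> f g x - f z * g x)"
  proof (rule koszul_exact_single)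
    show "(\<lambda>x. \<Phi> f (\<lambda>_. 0) x - f z * 0) = (\<lambda>_. 0)" by (simp add: bounded_op_zero[OF A])
    show "(\<lambda>x. \<Phi> f g x - f z * g x) \<in> ell2 S" if "g \<in> ell2 S" for g
      by (intro ell2_diff(1) ell2_scale bounded_opD(1)[OF A] that)
    show "g = (\<lambda>_. 0)" if "g \<in> ell2 S" "(\<lambda>x. \<Phi> f g x - f z * g x) = (\<lambda>_. 0)" for g
      by (rule res(1)[OF _ that]) simp
    show "\<exists>h\<in>ell2 S. (\<lambda>x. \<Phi> f h x - f z * h x) = g" if "g \<in> ell2 S" for g
      by (rule res(2)[OF _ that]) simp
  qed
  moreover have "(\<lambda>j::nat. if j < 1 then f z else 0) \<in> taylor_spectrum S {..<1} (\<lambda>j. \<Phi> f)"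
    using taylor_calculusD(8)[OF \<Phi>, where N = 1 and fs = "\<lambda>_. f"] f z by auto
  then have "\<not> koszul_exact S {..<1::nat} (\<lambda>i g x. \<Phi> f g x - (if i < 1 then f z else 0) * g x)"
    by (simp add: taylor_spectrum_def)
  moreover have "koszul_exact S {..<1::nat} (\<lambda>i g x. \<Phi> f g x - (if i < 1 then f z else 0) * g x)
      = koszul_exact S {..<1::nat} (\<lambda>i g x. \<Phi> f g x - f z * g x)"
  proof -
    have "koszul_d {..<1::nat} (\<lambda>i g x. \<Phi> f g x - (if i < 1 then f z else 0) * g x)
      = koszul_d {..<1::nat} (\<lambda>i g x. \<Phi> f g x - f z * g x)"
      by (intro ext) (auto simp: koszul_d_def subset_eq intro!: sum.cong)
    then show ?thesis by (simp add: koszul_exact_def)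
  qed
  ultimately show False by simp
qed

section \<open>Evaluation of polynomials\<close>

definition meval :: "('d::finite \<Rightarrow>\<^sub>0 nat) \<Rightarrow> complex ^ 'd \<Rightarrow> complex" where
  "meval \<mu> z = (\<Prod>i\<in>UNIV. vec_nth z i ^ Poly_Mapping.lookup \<mu> i)"

lemma meval_add: "meval (\<mu> + \<nu>) z = meval \<mu> z * meval \<nu> z"
  by (simp add: meval_def lookup_add power_add prod.distrib)

lemma meval_zero [simp]: "meval 0 z = 1"
  by (simp add: meval_def)

lemma peval_superset:
  assumes "finite M" "Poly_Mapping.keys p \<subseteq> M"
  shows "peval p z = (\<Sum>\<mu>\<in>M. Poly_Mapping.lookup p \<mu> * meval \<mu> z)"
  unfolding peval_def meval_def[symmetric]
  by (rule sum.mono_neutral_left) (use assms in \<open>auto simp: in_keys_iff\<close>)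

lemma peval_eq_sum: "peval p = (\<lambda>z. \<Sum>\<mu>\<in>Poly_Mapping.keys p. Poly_Mapping.lookup p \<mu> * meval \<mu> z)"
  by (intro ext peval_superset) auto

lemma peval_zero [simp]: "peval 0 z = 0"
  by (simp add: peval_def)

lemma peval_add: "peval (p + q) z = peval p z + peval q z"
proof -
  let ?M = "Poly_Mapping.keys p \<union> Poly_Mapping.keys q"
  show ?thesis
    using peval_superset[of ?M p z] peval_superset[of ?M q z] peval_superset[of ?M "p + q" z] Poly_Mapping.keys_add[of p q]
    by (simp add: lookup_add distrib_right sum.distrib)
qed

lemma peval_single: "peval (Poly_Mapping.single \<mu> a) z = a * meval \<mu> z"
  using peval_superset[of "{\<mu>}" "Poly_Mapping.single \<mu> a" z] by (simp add: Poly_Mapping.keys_single)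

lemma peval_one [simp]: "peval 1 z = 1"
  using peval_single[of 0 1 z] by simp

lemma peval_uminus: "peval (- p) z = - peval p z"
  using peval_add[of p "- p" z] by (simp add: eq_neg_iff_add_eq_0 add.commute)

lemma peval_diff: "peval (p - q) z = peval p z - peval q z"
  using peval_add[of p "- q" z] by (simp add: peval_uminus)

lemma peval_sum: "peval (\<Sum>i\<in>I. f i) z = (\<Sum>i\<in>I. peval (f i) z)"
  by (induction I rule: infinite_finite_induct) (auto simp: peval_add)

lemma sum_monomials: "(\<Sum>\<mu>\<in>Poly_Mapping.keys p. Poly_Mapping.single \<mu> (Poly_Mapping.lookup p \<mu>)) = p"
proof (rule poly_mapping_eqI)
  fix \<nu>
  have "(\<Sum>\<mu>\<in>Poly_Mapping.keys p. Poly_Mapping.lookup (Poly_Mapping.single \<mu> (Poly_Mapping.lookup p \<mu>)) \<nu>)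
      = (\<Sum>\<mu>\<in>Poly_Mapping.keys p. if \<mu> = \<nu> then Poly_Mapping.lookup p \<mu> else 0)"
    by (intro sum.cong) (auto simp: lookup_single when_def)
  then show "Poly_Mapping.lookup (\<Sum>\<mu>\<in>Poly_Mapping.keys p. Poly_Mapping.single \<mu> (Poly_Mapping.lookup p \<mu>)) \<nu> = Poly_Mapping.lookup p \<nu>"
    by (simp add: lookup_sum in_keys_iff)
qed

text \<open>Both factors are expanded into monomials, for which multiplicativity is the addition of exponents.\<close>

lemma peval_mult: "peval (p * q) z = peval p z * peval q z"
proof -
  let ?s = "\<lambda>p. (\<Sum>\<mu>\<in>Poly_Mapping.keys p. Poly_Mapping.single \<mu> (Poly_Mapping.lookup p \<mu>))"
  have "peval (?s p * ?s q) z = (\<Sum>\<mu>\<in>Poly_Mapping.keys p. \<Sum>\<nu>\<in>Poly_Mapping.keys q.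
      (Poly_Mapping.lookup p \<mu> * meval \<mu> z) * (Poly_Mapping.lookup q \<nu> * meval \<nu> z))"
    by (simp add: sum_product peval_sum mult_single peval_single meval_add mult_ac)
  also have "\<dots> = peval p z * peval q z"
    by (simp add: sum_product[symmetric] peval_eq_sum)
  finally show ?thesis by (simp only: sum_monomials)
qed

lemma peval_prod: "peval (\<Prod>i\<in>I. f i) z = (\<Prod>i\<in>I. peval (f i) z)"
  by (induction I rule: infinite_finite_induct) (auto simp: peval_mult)

lemma holomorphic_several_const: "holomorphic_several (\<lambda>_. c) U"
  unfolding holomorphic_several_def
  by (intro ballI exI[of _ "\<lambda>_. 0"]) (simp add: has_derivative_const)

lemma holomorphic_several_coord: "holomorphic_several (\<lambda>z. vec_nth z i) U"
  unfolding holomorphic_several_def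
proof
  fix z :: "complex ^ 'a"
  have "((\<lambda>z. vec_nth z i) has_derivative (\<lambda>h. vec_nth h i)) (at z)"
    by (intro bounded_linear_imp_has_derivative bounded_linear_vec_nth)
  moreover have "(\<lambda>h::complex ^ 'a. vec_nth h i) = (\<lambda>h. \<Sum>j\<in>UNIV. (if j = i then 1 else 0) * vec_nth h j)"
    by (simp add: if_distrib[of "\<lambda>x. x * _"] cong: if_cong)
  ultimately show "\<exists>a. ((\<lambda>z. vec_nth z i) has_derivative (\<lambda>h. \<Sum>i\<in>UNIV. a i * vec_nth h i)) (at z)"
    by (metis (no_types))
qed

lemma holomorphic_several_add:
  assumes "holomorphic_several f U" "holomorphic_several g U"
  shows "holomorphic_several (\<lambda>z. f z + g z) U"
  unfolding holomorphic_several_def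
proof
  fix z assume "z \<in> U"
  then obtain a b where "(f has_derivative (\<lambda>h. \<Sum>i\<in>UNIV. a i * vec_nth h i)) (at z)"
    "(g has_derivative (\<lambda>h. \<Sum>i\<in>UNIV. b i * vec_nth h i)) (at z)"
    using assms unfolding holomorphic_several_def by blast
  from has_derivative_add[OF this]
  show "\<exists>a. ((\<lambda>z. f z + g z) has_derivative (\<lambda>h. \<Sum>i\<in>UNIV. a i * vec_nth h i)) (at z)"
    by (intro exI[of _ "\<lambda>i. a i + b i"]) (simp add: distrib_right sum.distrib)
qed

lemma holomorphic_several_mult:
  assumes "holomorphic_several f U" "holomorphic_several g U"
  shows "holomorphic_several (\<lambda>z. f z * g z) U"
  unfolding holomorphic_several_def
proof
  fix z assume "z \<in> U"
  then obtain a b where "(f has_derivative (\<lambda>h. \<Sum>i\<in>UNIV. a i * vec_nth h i)) (at z)"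
    "(g has_derivative (\<lambda>h. \<Sum>i\<in>UNIV. b i * vec_nth h i)) (at z)"
    using assms unfolding holomorphic_several_def by blast
  from has_derivative_mult[OF this]
  have "((\<lambda>z. f z * g z) has_derivative (\<lambda>h. f z * (\<Sum>i\<in>UNIV. b i * vec_nth h i) + (\<Sum>i\<in>UNIV. a i * vec_nth h i) * g z)) (at z)" .
  moreover have "(\<lambda>h. f z * (\<Sum>i\<in>UNIV. b i * vec_nth h i) + (\<Sum>i\<in>UNIV. a i * vec_nth h i) * g z)
      = (\<lambda>h. \<Sum>i\<in>UNIV. (f z * b i + a i * g z) * vec_nth h i)"
    by (simp add: sum_distrib_left sum_distrib_right sum.distrib[symmetric] algebra_simps)
  ultimately show "\<exists>a. ((\<lambda>z. f z * g z) has_derivative (\<lambda>h. \<Sum>i\<in>UNIV. a i * vec_nth h i)) (at z)"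
    by (intro exI[of _ "\<lambda>i. f z * b i + a i * g z"]) simp
qed

lemma holomorphic_several_inverse:
  assumes "holomorphic_several f U" "\<And>z. z \<in> U \<Longrightarrow> f z \<noteq> 0"
  shows "holomorphic_several (\<lambda>z. inverse (f z)) U"
  unfolding holomorphic_several_def
proof
  fix z assume z: "z \<in> U"
  then obtain a where "(f has_derivative (\<lambda>h. \<Sum>i\<in>UNIV. a i * vec_nth h i)) (at z)"
    using assms(1) unfolding holomorphic_several_def by blast
  from Deriv.has_derivative_inverse[OF assms(2)[OF z] this]
  show "\<exists>a. ((\<lambda>z. inverse (f z)) has_derivative (\<lambda>h. \<Sum>i\<in>UNIV. a i * vec_nth h i)) (at z)"
    by (intro exI[of _ "\<lambda>i. - (inverse (f z) * a i * inverse (f z))"])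
      (simp add: sum_negf sum_distrib_left sum_distrib_right mult_ac)
qed

lemma holomorphic_several_cong:
  assumes "holomorphic_several f U" "open U" "\<And>z. z \<in> U \<Longrightarrow> f z = g z"
  shows "holomorphic_several g U"
  unfolding holomorphic_several_def
proof
  fix z assume z: "z \<in> U"
  then obtain a where "(f has_derivative (\<lambda>h. \<Sum>i\<in>UNIV. a i * vec_nth h i)) (at z)"
    using assms(1) unfolding holomorphic_several_def by blast
  from has_derivative_transform_within_open[OF this assms(2) z assms(3)]
  show "\<exists>a. (g has_derivative (\<lambda>h. \<Sum>i\<in>UNIV. a i * vec_nth h i)) (at z)" by blast
qed

lemma holomorphic_several_power: "holomorphic_several f U \<Longrightarrow> holomorphic_several (\<lambda>z. f z ^ n) U"
  by (induction n) (auto intro: holomorphic_several_const holomorphic_several_mult)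

lemma holomorphic_several_prod:
  "(\<And>i. i \<in> I \<Longrightarrow> holomorphic_several (f i) U) \<Longrightarrow> holomorphic_several (\<lambda>z. \<Prod>i\<in>I. f i z) U"
  by (induction I rule: infinite_finite_induct) (auto intro: holomorphic_several_const holomorphic_several_mult)

lemma holomorphic_several_sum:
  "(\<And>i. i \<in> I \<Longrightarrow> holomorphic_several (f i) U) \<Longrightarrow> holomorphic_several (\<lambda>z. \<Sum>i\<in>I. f i z) U"
  by (induction I rule: infinite_finite_induct) (auto intro: holomorphic_several_const holomorphic_several_add)

lemma holomorphic_several_meval: "holomorphic_several (meval \<mu>) U"
  unfolding meval_def[abs_def]
  by (intro holomorphic_several_prod holomorphic_several_power holomorphic_several_coord)

lemma holomorphic_several_peval: "holomorphic_several (peval p) U"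
proof -
  have "holomorphic_several (\<lambda>z. \<Sum>\<mu>\<in>Poly_Mapping.keys p. Poly_Mapping.lookup p \<mu> * meval \<mu> z) U"
    by (intro holomorphic_several_sum holomorphic_several_mult holomorphic_several_const holomorphic_several_meval)
  then show ?thesis by (simp add: peval_eq_sum)
qed

lemma continuous_on_peval: "continuous_on U (peval p)"
proof (rule continuous_at_imp_continuous_on, rule ballI)
  fix z show "isCont (peval p) z"
    using holomorphic_several_peval[of p UNIV] has_derivative_continuous
    unfolding holomorphic_several_def by blast
qed

lemma analytic_near_entire: "holomorphic_several f UNIV \<Longrightarrow> analytic_near K f"
  unfolding analytic_near_def by blast

lemmas analytic_near_peval = analytic_near_entire[OF holomorphic_several_peval]

section \<open>The functional calculus on polynomials\<close>

text \<open>A homomorphism is determined on polynomials by the coordinates. The product over the variables is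
  taken along the increasing list of variables, since this is the order in the definition of \<open>T\<^sup>\<mu>\<close>.\<close>

lemma taylor_calculus_peval:
  assumes \<Phi>: "taylor_calculus S T \<Phi>" and T: "\<And>i. bounded_op S (T i)" and h: "h \<in> ell2 S"
  shows "\<Phi> (peval p) h = op_peval p T h"
proof -
  note D = taylor_calculusD[OF \<Phi>]
  have pow: "\<Phi> (\<lambda>z. vec_nth z i ^ n) h = (T i ^^ n) h" if h: "h \<in> ell2 S" for h i n
  proof (induction n)
    case 0 then show ?case using D(3)[OF h] by simp
  next
    case (Suc n)
    have "\<Phi> (\<lambda>z. vec_nth z i * vec_nth z i ^ n) h = \<Phi> (\<lambda>z. vec_nth z i) (\<Phi> (\<lambda>z. vec_nth z i ^ n) h)"
      by (intro D(6) analytic_near_entire holomorphic_several_coord holomorphic_several_power h)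
    also have "\<dots> = T i ((T i ^^ n) h)"
      unfolding Suc by (intro D(4) bounded_opD(1)[OF bounded_op_funpow[OF T]] h)
    finally show ?case by simp
  qed
  define F where "F \<mu> i A = (T i ^^ Poly_Mapping.lookup \<mu> i) \<circ> A" for \<mu> i and A :: "('a \<Rightarrow> complex) \<Rightarrow> 'a \<Rightarrow> complex"
  have F: "F \<mu> i A h = (T i ^^ Poly_Mapping.lookup \<mu> i) (A h)" for \<mu> i A h by (simp add: F_def)
  have monl: "\<Phi> (\<lambda>z. \<Prod>i\<leftarrow>is. vec_nth z i ^ Poly_Mapping.lookup \<mu> i) h
      = foldr (F \<mu>) is id h
      \<and> holomorphic_several (\<lambda>z. \<Prod>i\<leftarrow>is. vec_nth z i ^ Poly_Mapping.lookup \<mu> i) UNIV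
      \<and> foldr (F \<mu>) is id h \<in> ell2 S" for "is" \<mu>
  proof (induction "is")
    case Nil then show ?case using D(3)[OF h] h by (simp add: holomorphic_several_const)
  next
    case (Cons i "is")
    let ?f = "\<lambda>z. \<Prod>i\<leftarrow>is. vec_nth z i ^ Poly_Mapping.lookup \<mu> i"
    let ?A = "foldr (F \<mu>) is id"
    have "\<Phi> (\<lambda>z. vec_nth z i ^ Poly_Mapping.lookup \<mu> i * ?f z) h = \<Phi> (\<lambda>z. vec_nth z i ^ Poly_Mapping.lookup \<mu> i) (\<Phi> ?f h)"
      using Cons.IH by (intro D(6) analytic_near_entire holomorphic_several_coord holomorphic_several_power h) simp
    also have "\<dots> = (T i ^^ Poly_Mapping.lookup \<mu> i) (?A h)"
      unfolding conjunct1[OF Cons.IH] by (rule pow[OF conjunct2[OF conjunct2[OF Cons.IH]]])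
    finally have 1: "\<Phi> (\<lambda>z. vec_nth z i ^ Poly_Mapping.lookup \<mu> i * ?f z) h = (T i ^^ Poly_Mapping.lookup \<mu> i) (?A h)" .
    moreover have "holomorphic_several (\<lambda>z. vec_nth z i ^ Poly_Mapping.lookup \<mu> i * ?f z) UNIV"
      using Cons.IH by (intro holomorphic_several_mult holomorphic_several_power holomorphic_several_coord) simp
    moreover have "(T i ^^ Poly_Mapping.lookup \<mu> i) (?A h) \<in> ell2 S"
      by (rule bounded_opD(1)[OF bounded_op_funpow[OF T] conjunct2[OF conjunct2[OF Cons.IH]]])
    moreover have "foldr (F \<mu>) (i # is) id h = (T i ^^ Poly_Mapping.lookup \<mu> i) (?A h)"
      by (simp only: foldr.simps comp_apply F[of \<mu> i "foldr (F \<mu>) is id" h])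
    ultimately show ?case by (simp only: list.map prod_list.Cons simp_thms)
  qed
  have mon: "\<Phi> (meval \<mu>) h = op_monom T \<mu> h" for \<mu>
  proof -
    have "meval \<mu> = (\<lambda>z. \<Prod>i\<leftarrow>sorted_list_of_set UNIV. vec_nth z i ^ Poly_Mapping.lookup \<mu> i)"
      by (auto simp: fun_eq_iff meval_def prod.distinct_set_conv_list[symmetric])
    then show ?thesis using monl[of \<mu> "sorted_list_of_set UNIV"] by (simp add: op_monom_def F_def[abs_def])
  qed
  have "\<Phi> (\<lambda>z. \<Sum>\<mu>\<in>M. Poly_Mapping.lookup p \<mu> * meval \<mu> z) h = (\<lambda>x. \<Sum>\<mu>\<in>M. Poly_Mapping.lookup p \<mu> * op_monom T \<mu> h x)"
    if "finite M" for M
    using that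
  proof induction
    case empty
    show ?case using D(7)[OF analytic_near_entire[OF holomorphic_several_const[of 1]] h, of 0] by simp
  next
    case (insert \<mu> M)
    have "\<Phi> (\<lambda>z. Poly_Mapping.lookup p \<mu> * meval \<mu> z + (\<Sum>\<mu>\<in>M. Poly_Mapping.lookup p \<mu> * meval \<mu> z)) h
      = (\<lambda>x. \<Phi> (\<lambda>z. Poly_Mapping.lookup p \<mu> * meval \<mu> z) h x + \<Phi> (\<lambda>z. \<Sum>\<mu>\<in>M. Poly_Mapping.lookup p \<mu> * meval \<mu> z) h x)"
      by (intro D(5) h analytic_near_entire holomorphic_several_sum holomorphic_several_mult holomorphic_several_const holomorphic_several_meval)
    moreover have "\<Phi> (\<lambda>z. Poly_Mapping.lookup p \<mu> * meval \<mu> z) h = (\<lambda>x. Poly_Mapping.lookup p \<mu> * op_monom T \<mu> h x)"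
      using D(7)[OF analytic_near_entire[OF holomorphic_several_meval] h, of "Poly_Mapping.lookup p \<mu>" \<mu>] mon by simp
    ultimately show ?case using insert by simp
  qed
  from this[OF finite_keys] show ?thesis
    by (simp add: op_peval_def peval_eq_sum)
qed

section \<open>The spectral norm and the domain\<close>

lemma vec_l2norm_L2_set: "vec_l2norm v = L2_set (\<lambda>i. cmod (vec_index v i)) {..<dim_vec v}"
  by (simp add: vec_l2norm_def L2_set_def)

lemma vec_l2norm_nonneg [simp]: "0 \<le> vec_l2norm v"
  by (simp add: vec_l2norm_L2_set)

lemma cmod_le_vec_l2norm: "i < dim_vec v \<Longrightarrow> cmod (vec_index v i) \<le> vec_l2norm v"
  unfolding vec_l2norm_L2_set by (rule member_le_L2_set) auto

lemma mult_mat_vec_index_sum: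
  "r < dim_row A \<Longrightarrow> v \<in> carrier_vec (dim_col A) \<Longrightarrow>
    vec_index (A *\<^sub>v v) r = (\<Sum>c<dim_col A. A $$ (r, c) * vec_index v c)"
  by (auto simp: scalar_prod_def atLeast0LessThan intro!: sum.cong)

text \<open>This crude bound makes the spectral norm a finite supremum and a Lipschitz function of the entries.\<close>

lemma vec_l2norm_mult_le_sum:
  assumes "v \<in> carrier_vec (dim_col A)"
  shows "vec_l2norm (A *\<^sub>v v) \<le> (\<Sum>r<dim_row A. \<Sum>c<dim_col A. cmod (A $$ (r, c))) * vec_l2norm v"
proof -
  have "vec_l2norm (A *\<^sub>v v) \<le> (\<Sum>r<dim_row A. cmod (vec_index (A *\<^sub>v v) r))"
    unfolding vec_l2norm_L2_set dim_mult_mat_vec by (rule L2_set_le_sum) simp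
  also have "\<dots> \<le> (\<Sum>r<dim_row A. \<Sum>c<dim_col A. cmod (A $$ (r, c)) * vec_l2norm v)"
  proof (rule sum_mono)
    fix r assume "r \<in> {..<dim_row A}"
    then have "vec_index (A *\<^sub>v v) r = (\<Sum>c<dim_col A. A $$ (r, c) * vec_index v c)"
      using mult_mat_vec_index_sum[OF _ assms] by simp
    then have "cmod (vec_index (A *\<^sub>v v) r) \<le> (\<Sum>c<dim_col A. cmod (A $$ (r, c) * vec_index v c))"
      by (simp add: norm_sum)
    also have "\<dots> \<le> (\<Sum>c<dim_col A. cmod (A $$ (r, c)) * vec_l2norm v)"
      using assms by (intro sum_mono) (auto simp: norm_mult intro!: mult_left_mono cmod_le_vec_l2norm)
    finally show "cmod (vec_index (A *\<^sub>v v) r) \<le> (\<Sum>c<dim_col A. cmod (A $$ (r, c)) * vec_l2norm v)" .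
  qed
  finally show ?thesis by (simp add: sum_distrib_right)
qed

lemma vec_l2norm_smult: "vec_l2norm (a \<cdot>\<^sub>v v) = cmod a * vec_l2norm v"
proof -
  have "L2_set (\<lambda>i. cmod (vec_index (a \<cdot>\<^sub>v v) i)) {..<dim_vec v} = L2_set (\<lambda>i. cmod a * cmod (vec_index v i)) {..<dim_vec v}"
    by (rule L2_set_cong) (auto simp: norm_mult)
  then show ?thesis by (simp add: vec_l2norm_L2_set L2_set_right_distrib)
qed

lemma spectral_norm_bound:
  assumes v: "v \<in> carrier_vec (dim_col A)"
  shows "vec_l2norm (A *\<^sub>v v) \<le> spectral_norm A * vec_l2norm v"
proof (cases "vec_l2norm v = 0")
  case True
  then show ?thesis using vec_l2norm_mult_le_sum[OF v] by simp
next
  case False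
  then have pos: "0 < vec_l2norm v" using vec_l2norm_nonneg[of v] by (simp add: less_le)
  define a where "a = complex_of_real (inverse (vec_l2norm v))"
  have a: "cmod a = inverse (vec_l2norm v)" using pos by (simp add: a_def norm_inverse)
  have av: "a \<cdot>\<^sub>v v \<in> carrier_vec (dim_col A)" "vec_l2norm (a \<cdot>\<^sub>v v) \<le> 1"
    using v pos by (auto simp: vec_l2norm_smult a)
  have "bdd_above {vec_l2norm (A *\<^sub>v v) | v. v \<in> carrier_vec (dim_col A) \<and> vec_l2norm v \<le> 1}"
  proof (rule bdd_aboveI[where M = "\<Sum>r<dim_row A. \<Sum>c<dim_col A. cmod (A $$ (r, c))"])
    fix y assume "y \<in> {vec_l2norm (A *\<^sub>v v) | v. v \<in> carrier_vec (dim_col A) \<and> vec_l2norm v \<le> 1}"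
    then obtain v where v: "y = vec_l2norm (A *\<^sub>v v)" "v \<in> carrier_vec (dim_col A)" "vec_l2norm v \<le> 1"
      by auto
    show "y \<le> (\<Sum>r<dim_row A. \<Sum>c<dim_col A. cmod (A $$ (r, c)))"
      using vec_l2norm_mult_le_sum[OF v(2)] v(1)
        mult_left_mono[OF v(3), of "\<Sum>r<dim_row A. \<Sum>c<dim_col A. cmod (A $$ (r, c))"]
      by (simp add: sum_nonneg)
  qed
  then have "vec_l2norm (A *\<^sub>v (a \<cdot>\<^sub>v v)) \<le> spectral_norm A"
    unfolding spectral_norm_def using av by (intro cSup_upper) auto
  moreover have "A *\<^sub>v (a \<cdot>\<^sub>v v) = a \<cdot>\<^sub>v (A *\<^sub>v v)"
    using mult_mat_vec[of A "dim_row A" "dim_col A" v a] v by simp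
  ultimately show ?thesis using pos by (simp add: vec_l2norm_smult a field_simps)
qed

lemma spectral_norm_set_nonempty:
  "{vec_l2norm (A *\<^sub>v v) | v. v \<in> carrier_vec (dim_col A) \<and> vec_l2norm v \<le> 1} \<noteq> {}"
proof -
  have "vec_l2norm (0\<^sub>v (dim_col A)) \<le> 1" by (simp add: vec_l2norm_L2_set L2_set_def)
  then show ?thesis by (auto intro!: exI[of _ "0\<^sub>v (dim_col A)"])
qed

lemma spectral_norm_le:
  assumes "\<And>v. v \<in> carrier_vec (dim_col A) \<Longrightarrow> vec_l2norm (A *\<^sub>v v) \<le> K * vec_l2norm v" "0 \<le> K"
  shows "spectral_norm A \<le> K"
  unfolding spectral_norm_def
proof (rule cSup_least[OF spectral_norm_set_nonempty])
  fix y assume "y \<in> {vec_l2norm (A *\<^sub>v v) | v. v \<in> carrier_vec (dim_col A) \<and> vec_l2norm v \<le> 1}"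
  then obtain v where v: "y = vec_l2norm (A *\<^sub>v v)" "v \<in> carrier_vec (dim_col A)" "vec_l2norm v \<le> 1"
    by auto
  then show "y \<le> K" using assms(1)[OF v(2)] mult_left_mono[OF v(3) assms(2)] by simp
qed

lemma less_spectral_normD:
  assumes "s < spectral_norm A"
  shows "\<exists>v\<in>carrier_vec (dim_col A). vec_l2norm v \<le> 1 \<and> s < vec_l2norm (A *\<^sub>v v)"
  using less_cSupD[OF spectral_norm_set_nonempty assms[unfolded spectral_norm_def]] by auto

lemma spectral_norm_nonneg: "0 \<le> spectral_norm A"
proof (rule ccontr)
  assume "\<not> 0 \<le> spectral_norm A"
  then have "spectral_norm A * vec_l2norm v \<le> 0" for v by (simp add: mult_nonpos_nonneg)
  then have "vec_l2norm (A *\<^sub>v v) = 0" if "v \<in> carrier_vec (dim_col A)" for v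
    using spectral_norm_bound[OF that] vec_l2norm_nonneg[of "A *\<^sub>v v"] by (meson order_antisym order_trans)
  moreover define X where "X = {vec_l2norm (A *\<^sub>v v) | v. v \<in> carrier_vec (dim_col A) \<and> vec_l2norm v \<le> 1}"
  ultimately have "X \<subseteq> {0}" by auto
  moreover have "X \<noteq> {}" unfolding X_def by (rule spectral_norm_set_nonempty)
  ultimately have "X = {0}" by blast
  then have "spectral_norm A = 0" unfolding spectral_norm_def X_def[symmetric] by simp
  then show False using \<open>\<not> 0 \<le> spectral_norm A\<close> by simp
qed

lemma spectral_norm_perturbation:
  assumes "dim_row A = dim_row B" "dim_col A = dim_col B"
  shows "spectral_norm A \<le> spectral_norm B + (\<Sum>r<dim_row B. \<Sum>c<dim_col B. cmod (A $$ (r, c) - B $$ (r, c)))"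
proof (rule spectral_norm_le)
  fix v :: "complex Matrix.vec" assume "v \<in> carrier_vec (dim_col A)"
  then have v: "v \<in> carrier_vec (dim_col B)" using assms by simp
  have v': "v \<in> carrier_vec (dim_col (A - B))" using v by simp
  have "A = B + (A - B)" using assms by (intro eq_matI) auto
  moreover have "A - B \<in> carrier_mat (dim_row B) (dim_col B)" by (rule minus_carrier_mat) simp
  ultimately have eq: "A *\<^sub>v v = B *\<^sub>v v + (A - B) *\<^sub>v v"
    using add_mult_distrib_mat_vec[of B "dim_row B" "dim_col B" "A - B" v] v assms by simp
  have "vec_l2norm (A *\<^sub>v v) \<le> vec_l2norm (B *\<^sub>v v) + vec_l2norm ((A - B) *\<^sub>v v)"
  proof -
    have "vec_l2norm (A *\<^sub>v v) \<le> L2_set (\<lambda>i. cmod (vec_index (B *\<^sub>v v) i) + cmod (vec_index ((A - B) *\<^sub>v v) i)) {..<dim_row B}"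
      unfolding eq vec_l2norm_L2_set using assms
      by (auto intro!: L2_set_mono norm_triangle_ineq)
    also have "\<dots> \<le> vec_l2norm (B *\<^sub>v v) + vec_l2norm ((A - B) *\<^sub>v v)"
      using L2_set_triangle_ineq assms by (simp add: vec_l2norm_L2_set)
    finally show ?thesis .
  qed
  also have "\<dots> \<le> spectral_norm B * vec_l2norm v
      + (\<Sum>r<dim_row (A - B). \<Sum>c<dim_col (A - B). cmod ((A - B) $$ (r, c))) * vec_l2norm v"
    by (intro add_mono spectral_norm_bound vec_l2norm_mult_le_sum v v')
  also have "(\<Sum>r<dim_row (A - B). \<Sum>c<dim_col (A - B). cmod ((A - B) $$ (r, c)))
      = (\<Sum>r<dim_row B. \<Sum>c<dim_col B. cmod (A $$ (r, c) - B $$ (r, c)))"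
    using assms by (intro sum.cong) auto
  finally show "vec_l2norm (A *\<^sub>v v)
      \<le> (spectral_norm B + (\<Sum>r<dim_row B. \<Sum>c<dim_col B. cmod (A $$ (r, c) - B $$ (r, c)))) * vec_l2norm v"
    by (simp add: distrib_right)
qed (simp add: spectral_norm_nonneg sum_nonneg)

lemma mat_peval_simps [simp]:
  "dim_row (mat_peval P z) = dim_row P" "dim_col (mat_peval P z) = dim_col P"
  "r < dim_row P \<Longrightarrow> c < dim_col P \<Longrightarrow> mat_peval P z $$ (r, c) = peval (P $$ (r, c)) z"
  by (simp_all add: mat_peval_def)

text \<open>The entries of \<open>P(z)\<close> are continuous, and the spectral norm is Lipschitz in the entries.\<close>

lemma open_dom_P: "open (dom_P P)"
proof (rule openI)
  fix z0 assume "z0 \<in> dom_P P"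
  then have z0: "spectral_norm (mat_peval P z0) < 1" by (simp add: dom_P_def)
  let ?U = "{z. spectral_norm (mat_peval P z0) +
    (\<Sum>r<dim_row P. \<Sum>c<dim_col P. cmod (peval (P $$ (r, c)) z - peval (P $$ (r, c)) z0)) < 1}"
  have "open ?U" by (intro open_Collect_less continuous_intros continuous_on_peval)
  moreover have "z0 \<in> ?U" using z0 by simp
  moreover have "?U \<subseteq> dom_P P"
  proof
    fix z assume "z \<in> ?U"
    then show "z \<in> dom_P P"
      using spectral_norm_perturbation[of "mat_peval P z" "mat_peval P z0"] by (simp add: dom_P_def)
  qed
  ultimately show "\<exists>e>0. ball z0 e \<subseteq> dom_P P" by (meson open_contains_ball subset_trans)
qed

section \<open>Estimates on the class of operator tuples\<close>

lemma opmat_peval_simps [simp]: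
  "dim_row (opmat_peval P T) = dim_row P" "dim_col (opmat_peval P T) = dim_col P"
  "r < dim_row P \<Longrightarrow> c < dim_col P \<Longrightarrow> opmat_peval P T $$ (r, c) = op_peval (P $$ (r, c)) T"
  by (simp_all add: opmat_peval_def)

lemma opmat_peval_bound:
  assumes "\<And>i. bounded_op S (T i)" "\<And>c. c < dim_col P \<Longrightarrow> v c \<in> ell2 S"
  shows "block_norm (dim_row P) (\<lambda>r x. \<Sum>c<dim_col P. op_peval (P $$ (r, c)) T (v c) x)
    \<le> opmat_norm S (opmat_peval P T) * block_norm (dim_col P) v"
proof -
  have "block_norm (dim_row P) (\<lambda>r x. \<Sum>c<dim_col P. op_peval (P $$ (r, c)) T (v c) x)
    = block_norm (dim_row P) (opmat_apply (opmat_peval P T) v)"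
    unfolding block_norm_def by (simp add: opmat_apply_def)
  also have "\<dots> \<le> opmat_norm S (opmat_peval P T) * block_norm (dim_col P) v"
    using opmat_norm_bound[of "opmat_peval P T" S v] assms by (simp add: bounded_op_peval)
  finally show ?thesis .
qed

lemma class_TD:
  assumes "T \<in> class_T P S"
  shows "commuting_tuple S T" "bounded_op S (T i)" "opmat_norm S (opmat_peval P T) < 1"
  using assms by (auto simp: class_T_def commuting_tuple_def)

lemma peval_le_on_spectrum:
  assumes \<Phi>: "taylor_calculus S T \<Phi>" and T: "\<And>i. bounded_op S (T i)"
    and K: "\<And>h. h \<in> ell2 S \<Longrightarrow> ell2_norm (op_peval q T h) \<le> K * ell2_norm h" "0 \<le> K"
    and z: "z \<in> joint_spectrum S T"
  shows "cmod (peval q z) \<le> K"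
  by (rule cmod_le_norm_on_spectrum[OF \<Phi> analytic_near_peval _ K(2) z])
    (simp add: taylor_calculus_peval[OF \<Phi> T] K(1))

lemma taylor_calculus_linear_combination:
  assumes T: "\<And>i. bounded_op S (T i)" and h: "h \<in> ell2 S" and \<Phi>: "taylor_calculus S T \<Phi>"
  shows "\<Phi> (\<lambda>z. \<Sum>i\<in>I. a i * peval (p i) z) h = (\<lambda>x. \<Sum>i\<in>I. a i * op_peval (p i) T h x)"
    and "analytic_near (joint_spectrum S T) (\<lambda>z. \<Sum>i\<in>I. a i * peval (p i) z)"
proof -
  note D = taylor_calculusD[OF \<Phi>]
  have hol: "holomorphic_several (\<lambda>z. a i * peval (p i) z) UNIV" "holomorphic_several (\<lambda>z. \<Sum>i\<in>J. a i * peval (p i) z) UNIV" for i J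
    by (intro holomorphic_several_sum holomorphic_several_mult holomorphic_several_const holomorphic_several_peval)+
  show "analytic_near (joint_spectrum S T) (\<lambda>z. \<Sum>i\<in>I. a i * peval (p i) z)"
    by (rule analytic_near_entire[OF hol(2)])
  have zero: "\<Phi> (\<lambda>z. 0) h = (\<lambda>x. 0)"
    using D(7)[OF analytic_near_entire[OF holomorphic_several_const[of 1]] h, of 0] by simp
  show "\<Phi> (\<lambda>z. \<Sum>i\<in>I. a i * peval (p i) z) h = (\<lambda>x. \<Sum>i\<in>I. a i * op_peval (p i) T h x)"
  proof (induction I rule: infinite_finite_induct)
    case (insert i I)
    have "\<Phi> (\<lambda>z. a i * peval (p i) z + (\<Sum>i\<in>I. a i * peval (p i) z)) h
      = (\<lambda>x. \<Phi> (\<lambda>z. a i * peval (p i) z) h x + \<Phi> (\<lambda>z. \<Sum>i\<in>I. a i * peval (p i) z) h x)"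
      by (intro D(5) h analytic_near_entire hol)
    also have "\<Phi> (\<lambda>z. a i * peval (p i) z) h = (\<lambda>x. a i * op_peval (p i) T h x)"
      using D(7)[OF analytic_near_peval h, of "a i" "p i"] taylor_calculus_peval[OF \<Phi> T h] by simp
    finally show ?case using insert by simp
  qed (simp_all add: zero)
qed

text \<open>Let \<open>s = \<parallel>P(T)\<parallel> < 1\<close> and suppose \<open>\<parallel>P(z)\<parallel> > s\<close>. There is a vector \<open>v\<close> in the unit ball for which
  \<open>w = P(z) v\<close> is longer than \<open>s\<close>. The polynomial \<open>f = w\<^sup>* P v\<close> takes the value \<open>\<parallel>w\<parallel>\<^sup>2\<close> at \<open>z\<close>, whereas
  \<open>\<parallel>f(T)\<parallel> \<le> \<parallel>w\<parallel> s\<close>; so \<open>z\<close> is not in the joint spectrum.\<close>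

lemma joint_spectrum_subset_dom_P:
  assumes \<Phi>: "taylor_calculus S T \<Phi>" and T: "T \<in> class_T P S"
  shows "joint_spectrum S T \<subseteq> dom_P P"
proof
  fix z assume z: "z \<in> joint_spectrum S T"
  note bT = class_TD(2)[OF T]
  define s where "s = max 0 (opmat_norm S (opmat_peval P T))"
  have s: "0 \<le> s" "s < 1" using class_TD(3)[OF T] by (auto simp: s_def)
  show "z \<in> dom_P P"
  proof (rule ccontr)
    assume "z \<notin> dom_P P"
    then have "s < spectral_norm (mat_peval P z)" using s by (simp add: dom_P_def)
    from less_spectral_normD[OF this] obtain v where v: "v \<in> carrier_vec (dim_col P)" "vec_l2norm v \<le> 1"
      and big: "s < vec_l2norm (mat_peval P z *\<^sub>v v)" by auto
    define w where "w r = (\<Sum>c<dim_col P. peval (P $$ (r, c)) z * vec_index v c)" for r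
    have w: "vec_l2norm (mat_peval P z *\<^sub>v v) = L2_set (\<lambda>r. cmod (w r)) {..<dim_row P}"
      unfolding vec_l2norm_L2_set w_def
    proof (rule L2_set_cong)
      fix r assume "r \<in> {..<dim_row P}"
      then have "vec_index (mat_peval P z *\<^sub>v v) r = (\<Sum>c<dim_col P. mat_peval P z $$ (r, c) * vec_index v c)"
        using mult_mat_vec_index_sum[of r "mat_peval P z" v] v(1) by simp
      also have "\<dots> = (\<Sum>c<dim_col P. peval (P $$ (r, c)) z * vec_index v c)"
        using \<open>r \<in> {..<dim_row P}\<close> by (intro sum.cong) auto
      finally show "cmod (vec_index (mat_peval P z *\<^sub>v v) r) = cmod (\<Sum>c<dim_col P. peval (P $$ (r, c)) z * vec_index v c)"
        by simp
    qed simp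
    define W where "W = L2_set (\<lambda>r. cmod (w r)) {..<dim_row P}"
    have W: "s < W" using big w by (simp add: W_def)
    define f where "f z' = (\<Sum>(r, c)\<in>{..<dim_row P} \<times> {..<dim_col P}. (cnj (w r) * vec_index v c) * peval (P $$ (r, c)) z')" for z'
    have fz: "f z = of_real (W\<^sup>2)"
    proof -
      have "f z = (\<Sum>r<dim_row P. \<Sum>c<dim_col P. cnj (w r) * (peval (P $$ (r, c)) z * vec_index v c))"
        by (simp add: f_def sum.cartesian_product[symmetric] mult_ac)
      also have "\<dots> = (\<Sum>r<dim_row P. cnj (w r) * w r)"
        by (simp only: sum_distrib_left[symmetric] w_def[symmetric])
      also have "\<dots> = (\<Sum>r<dim_row P. of_real ((cmod (w r))\<^sup>2))"
        by (intro sum.cong refl) (simp only: complex_norm_square mult.commute)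
      finally show ?thesis by (simp add: W_def L2_set_def sum_nonneg)
    qed
    have "cmod (f z) \<le> W * s"
    proof (rule cmod_le_norm_on_spectrum[OF \<Phi> _ _ _ z])
      show "analytic_near (joint_spectrum S T) f"
        using taylor_calculus_linear_combination(2)[OF bT ell2_zero \<Phi>, where I = "{..<dim_row P} \<times> {..<dim_col P}" and a = "\<lambda>(r, c). cnj (w r) * vec_index v c" and p = "\<lambda>(r, c). P $$ (r, c)"]
        by (simp add: f_def[abs_def] case_prod_beta)
      show "0 \<le> W * s" using W s by simp
      fix h assume h: "h \<in> ell2 S"
      let ?g = "\<lambda>r x. \<Sum>c<dim_col P. op_peval (P $$ (r, c)) T (\<lambda>x. vec_index v c * h x) x"
      have g: "?g r \<in> ell2 S" for r
        by (intro ell2_sum bounded_opD(1)[OF bounded_op_peval[OF bT]] ell2_scale h)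
      have "\<Phi> f h = (\<lambda>x. \<Sum>(r, c)\<in>{..<dim_row P} \<times> {..<dim_col P}. (cnj (w r) * vec_index v c) * op_peval (P $$ (r, c)) T h x)"
        using taylor_calculus_linear_combination(1)[OF bT h \<Phi>, where I = "{..<dim_row P} \<times> {..<dim_col P}" and a = "\<lambda>(r, c). cnj (w r) * vec_index v c" and p = "\<lambda>(r, c). P $$ (r, c)"]
        by (simp add: f_def[abs_def] case_prod_beta)
      also have "\<dots> = (\<lambda>x. \<Sum>r<dim_row P. cnj (w r) * ?g r x)"
        by (simp only: bounded_opD(3)[OF bounded_op_peval[OF bT] h])
          (simp add: sum.cartesian_product[symmetric] sum_distrib_left mult_ac)
      finally have "ell2_norm (\<Phi> f h) = ell2_norm (\<lambda>x. \<Sum>r<dim_row P. cnj (w r) * ?g r x)" by simp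
      also have "\<dots> \<le> (\<Sum>r<dim_row P. ell2_norm (\<lambda>x. cnj (w r) * ?g r x))"
        by (rule ell2_norm_sum_le[where S = S]) (intro ell2_scale g)
      also have "\<dots> = (\<Sum>r<dim_row P. \<bar>cmod (w r)\<bar> * \<bar>ell2_norm (?g r)\<bar>)"
        by (simp add: ell2_norm_scale)
      also have "\<dots> \<le> W * block_norm (dim_row P) ?g"
        unfolding W_def block_norm_L2_set by (rule L2_set_mult_ineq)
      also have "\<dots> \<le> W * (s * block_norm (dim_col P) (\<lambda>c x. vec_index v c * h x))"
      proof (rule mult_left_mono)
        have "block_norm (dim_row P) ?g \<le> opmat_norm S (opmat_peval P T) * block_norm (dim_col P) (\<lambda>c x. vec_index v c * h x)"
          by (intro opmat_peval_bound bT ell2_scale h)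
        also have "\<dots> \<le> s * block_norm (dim_col P) (\<lambda>c x. vec_index v c * h x)"
          by (intro mult_right_mono) (auto simp: s_def)
        finally show "block_norm (dim_row P) ?g \<le> s * block_norm (dim_col P) (\<lambda>c x. vec_index v c * h x)" .
      qed (use W s in simp)
      also have "block_norm (dim_col P) (\<lambda>c x. vec_index v c * h x) = vec_l2norm v * ell2_norm h"
        using v(1) by (simp add: block_norm_L2_set ell2_norm_scale vec_l2norm_L2_set L2_set_left_distrib)
      also have "W * (s * (vec_l2norm v * ell2_norm h)) \<le> W * s * ell2_norm h"
        using v(2) W s by (simp add: mult_left_mono mult_right_le_one_le mult_left_le_one_le)
      finally show "ell2_norm (\<Phi> f h) \<le> W * s * ell2_norm h" .
    qed
    then have "W * W \<le> W * s" by (simp add: fz power2_eq_square norm_mult)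
    then show False using W s by (simp add: mult_le_cancel_left)
  qed
qed

text \<open>The infimum over an empty set of calculi is infinite. A finite Agler norm thus also provides the
  existence of a Taylor calculus for every tuple of the class.\<close>

lemma agler_norm_lessD:
  fixes S :: "'x set"
  assumes "agler_norm TYPE('x) P \<alpha> \<beta> F < ereal c" "T \<in> class_T P S"
  shows "\<exists>\<Phi>. taylor_calculus S T \<Phi> \<and> opmat_norm S (calculus_mat \<alpha> \<beta> \<Phi> F) \<le> c"
proof -
  let ?N = "\<lambda>S T. INF \<Phi>\<in>{\<Phi>. taylor_calculus S T \<Phi>}. ereal (opmat_norm S (calculus_mat \<alpha> \<beta> \<Phi> F))"
  have "?N S T \<le> (SUP T\<in>class_T P S. ?N S T)" by (rule SUP_upper[OF assms(2)])
  also have "\<dots> \<le> (SUP S\<in>(UNIV :: 'x set set). SUP T\<in>class_T P S. ?N S T)" by (rule SUP_upper2[of S]) auto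
  finally have "?N S T < ereal c" using assms(1) unfolding agler_norm_def by (rule le_less_trans)
  then show ?thesis by (auto simp: INF_less_iff intro: less_imp_le)
qed

text \<open>Near the joint spectrum \<open>F q = Q\<close>, so \<open>F(T) q(T) = Q(T)\<close> by multiplicativity of the calculus.\<close>

lemma rational_function_estimate:
  assumes \<Phi>: "taylor_calculus S T \<Phi>" and T: "T \<in> class_T P S"
    and c: "opmat_norm S (calculus_mat \<alpha> \<beta> \<Phi> F) \<le> c"
    and q: "\<And>z. z \<in> dom_P P \<Longrightarrow> peval q z \<noteq> 0"
    and F: "\<And>z r b. z \<in> dom_P P \<Longrightarrow> r < \<alpha> \<Longrightarrow> b < \<beta> \<Longrightarrow> F z $$ (r, b) = peval (Q r b) z / peval q z"
    and h: "\<And>b. b < \<beta> \<Longrightarrow> h b \<in> ell2 S"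
  shows "block_norm \<alpha> (\<lambda>r x. \<Sum>b<\<beta>. op_peval (Q r b) T (h b) x) \<le> c * block_norm \<beta> (\<lambda>b. op_peval q T (h b))"
proof -
  note D = taylor_calculusD[OF \<Phi>] and bT = class_TD(2)[OF T]
  note sp = joint_spectrum_subset_dom_P[OF \<Phi> T]
  have an: "analytic_near (joint_spectrum S T) (\<lambda>z. F z $$ (r, b))" if "r < \<alpha>" "b < \<beta>" for r b
  proof -
    have "holomorphic_several (\<lambda>z. peval (Q r b) z * inverse (peval q z)) (dom_P P)"
      by (intro holomorphic_several_mult holomorphic_several_inverse holomorphic_several_peval q)
    then have "holomorphic_several (\<lambda>z. F z $$ (r, b)) (dom_P P)"
      by (rule holomorphic_several_cong[OF _ open_dom_P]) (simp add: F that divide_inverse)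
    then show ?thesis using open_dom_P sp unfolding analytic_near_def by blast
  qed
  let ?X = "calculus_mat \<alpha> \<beta> \<Phi> F"
  have X: "dim_row ?X = \<alpha>" "dim_col ?X = \<beta>" "\<And>r b. r < \<alpha> \<Longrightarrow> b < \<beta> \<Longrightarrow> ?X $$ (r, b) = \<Phi> (\<lambda>z. F z $$ (r, b))"
    by (simp_all add: calculus_mat_def)
  have qh: "op_peval q T (h b) \<in> ell2 S" if "b < \<beta>" for b
    by (intro bounded_opD(1)[OF bounded_op_peval[OF bT]] h that)
  have "\<Phi> (\<lambda>z. F z $$ (r, b)) (op_peval q T (h b)) = op_peval (Q r b) T (h b)" if rb: "r < \<alpha>" "b < \<beta>" for r b
  proof -
    have "\<Phi> (\<lambda>z. F z $$ (r, b)) (op_peval q T (h b)) = \<Phi> (\<lambda>z. F z $$ (r, b)) (\<Phi> (peval q) (h b))"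
      by (simp add: taylor_calculus_peval[OF \<Phi> bT h[OF rb(2)]])
    also have "\<dots> = \<Phi> (\<lambda>z. F z $$ (r, b) * peval q z) (h b)"
      by (rule D(6)[OF an[OF rb] analytic_near_peval h[OF rb(2)], symmetric])
    also have "\<dots> = \<Phi> (peval (Q r b)) (h b)"
      by (rule D(2)[OF analytic_near_peval open_dom_P sp _ h[OF rb(2)], symmetric]) (simp add: F rb q)
    also have "\<dots> = op_peval (Q r b) T (h b)" by (rule taylor_calculus_peval[OF \<Phi> bT h[OF rb(2)]])
    finally show ?thesis .
  qed
  then have "block_norm \<alpha> (\<lambda>r x. \<Sum>b<\<beta>. op_peval (Q r b) T (h b) x)
      = block_norm (dim_row ?X) (opmat_apply ?X (\<lambda>b. op_peval q T (h b)))"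
    unfolding block_norm_def by (simp add: opmat_apply_def X)
  also have "\<dots> \<le> opmat_norm S ?X * block_norm (dim_col ?X) (\<lambda>b. op_peval q T (h b))"
    by (rule opmat_norm_bound) (simp_all add: X D(1) an qh)
  also have "\<dots> \<le> c * block_norm \<beta> (\<lambda>b. op_peval q T (h b))"
    unfolding X by (intro mult_right_mono c) simp
  finally show ?thesis .
qed

section \<open>The Archimedean condition as an identity between functions\<close>

text \<open>In a Kronecker product with an identity matrix of size \<open>n\<close>, the index \<open>t\<close> encodes the pair of
  \<open>t div n\<close> and \<open>t mod n\<close>.\<close>

lemma sum_div_mod:
  fixes f :: "nat \<Rightarrow> nat \<Rightarrow> 'a::comm_monoid_add"
  shows "(\<Sum>t<m * n. f (t div n) (t mod n)) = (\<Sum>s<m. \<Sum>b<n. f s b)"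
proof (cases "n = 0")
  case False
  have "(\<Sum>t<m * n. f (t div n) (t mod n)) = (\<Sum>s<m. \<Sum>t=s * n..<s * n + n. f (t div n) (t mod n))"
    by (rule sum.nat_group[symmetric])
  also have "\<dots> = (\<Sum>s<m. \<Sum>b<n. f s b)"
  proof (rule sum.cong[OF refl])
    fix s
    have "(\<Sum>t=s * n..<s * n + n. f (t div n) (t mod n)) = (\<Sum>b=0..<n. f ((b + s * n) div n) ((b + s * n) mod n))"
      using sum.shift_bounds_nat_ivl[of "\<lambda>t. f (t div n) (t mod n)" 0 "s * n" n] by (simp add: add.commute)
    also have "\<dots> = (\<Sum>b<n. f s b)"
      using False by (intro sum.cong) auto
    finally show "(\<Sum>t=s * n..<s * n + n. f (t div n) (t mod n)) = (\<Sum>b<n. f s b)" .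
  qed
  finally show ?thesis .
qed simp

lemma sum_mod_div:
  fixes f :: "nat \<Rightarrow> nat \<Rightarrow> 'a::comm_monoid_add"
  shows "(\<Sum>t<n * m. f (t div n) (t mod n)) = (\<Sum>s<m. \<Sum>b<n. f s b)"
  using sum_div_mod[of f n m] by (simp only: mult.commute)

lemma mat_mult_entry:
  "i < dim_row A \<Longrightarrow> j < dim_col B \<Longrightarrow> dim_col A = dim_row B \<Longrightarrow>
    (A * B) $$ (i, j) = (\<Sum>t<dim_row B. A $$ (i, t) * B $$ (t, j))"
  by (auto simp: scalar_prod_def atLeast0LessThan intro!: sum.cong)

lemma mat_mult_entry_carrier:
  "A \<in> carrier_mat nr n \<Longrightarrow> B \<in> carrier_mat n nc \<Longrightarrow> i < nr \<Longrightarrow> j < nc \<Longrightarrow>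
    (A * B) $$ (i, j) = (\<Sum>t<n. A $$ (i, t) * B $$ (t, j))"
  using mat_mult_entry[of i A j B] by auto

lemma meval_sum: "meval (\<Sum>i\<in>I. f i) z = (\<Prod>i\<in>I. meval (f i) z)"
  by (induction I rule: infinite_finite_induct) (auto simp: meval_add)

lemma meval_single: "meval (Poly_Mapping.single i n) z = vec_nth z i ^ n"
proof -
  have "meval (Poly_Mapping.single i n) z = (\<Prod>j\<in>UNIV. if j = i then vec_nth z i ^ n else 1)"
    unfolding meval_def by (intro prod.cong) (auto simp: lookup_single when_def)
  then show ?thesis by simp
qed

text \<open>Evaluation at this point replaces the indeterminates \<open>w\<close> by the conjugates of the coordinates of
  \<open>w\<close>, so that an adjoint polynomial takes the conjugates of the values of the polynomial.\<close>

definition dbl :: "complex ^ 'd \<Rightarrow> complex ^ 'd \<Rightarrow> complex ^ ('d::finite + 'd)" where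
  "dbl w z = (\<chi> i. case i of Inl i \<Rightarrow> cnj (vec_nth w i) | Inr i \<Rightarrow> vec_nth z i)"

lemma meval_keys: "meval \<mu> z = (\<Prod>i\<in>Poly_Mapping.keys \<mu>. vec_nth z i ^ Poly_Mapping.lookup \<mu> i)"
  unfolding meval_def by (rule prod.mono_neutral_right) (auto simp: in_keys_iff)

lemma peval_var_z: "peval (var_z p) (dbl w z) = peval p z"
proof -
  have "meval (\<Sum>i\<in>Poly_Mapping.keys \<mu>. Poly_Mapping.single (Inr i) (Poly_Mapping.lookup \<mu> i)) (dbl w z) = meval \<mu> z" for \<mu>
    unfolding meval_sum meval_single by (simp add: meval_keys dbl_def)
  then show ?thesis by (simp add: var_z_def peval_sum peval_single peval_eq_sum[of p])
qed

lemma peval_cnj_var_w: "peval (cnj_var_w p) (dbl w z) = cnj (peval p w)"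
proof -
  have "meval (\<Sum>i\<in>Poly_Mapping.keys \<mu>. Poly_Mapping.single (Inl i) (Poly_Mapping.lookup \<mu> i)) (dbl w z) = cnj (meval \<mu> w)" for \<mu>
    unfolding meval_sum meval_single by (simp add: meval_keys dbl_def)
  then show ?thesis by (simp add: cnj_var_w_def peval_sum peval_single peval_eq_sum[of p])
qed

lemma in_z_simps [simp]:
  "dim_row (in_z Q) = dim_row Q" "dim_col (in_z Q) = dim_col Q"
  "r < dim_row Q \<Longrightarrow> c < dim_col Q \<Longrightarrow> in_z Q $$ (r, c) = var_z (Q $$ (r, c))"
  by (simp_all add: in_z_def)

lemma adj_w_simps [simp]:
  "dim_row (adj_w Q) = dim_col Q" "dim_col (adj_w Q) = dim_row Q"
  "r < dim_col Q \<Longrightarrow> c < dim_row Q \<Longrightarrow> adj_w Q $$ (r, c) = cnj_var_w (Q $$ (c, r))"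
  by (simp_all add: adj_w_def)

lemma kron_simps [simp]:
  "dim_row (kron A B) = dim_row A * dim_row B" "dim_col (kron A B) = dim_col A * dim_col B"
  "r < dim_row A * dim_row B \<Longrightarrow> c < dim_col A * dim_col B \<Longrightarrow>
    kron A B $$ (r, c) = A $$ (r div dim_row B, c div dim_col B) * B $$ (r mod dim_row B, c mod dim_col B)"
  by (simp_all add: kron_def)

lemma peval_square_term:
  assumes "H \<in> carrier_mat n 1"
  shows "peval ((adj_w H * in_z H) $$ (0, 0)) (dbl w z)
    = (\<Sum>t<n. cnj (peval (H $$ (t, 0)) w) * peval (H $$ (t, 0)) z)"
proof -
  have "(adj_w H * in_z H) $$ (0, 0) = (\<Sum>t<n. cnj_var_w (H $$ (t, 0)) * var_z (H $$ (t, 0)))"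
    using assms mat_mult_entry[of 0 "adj_w H" 0 "in_z H"] by (auto intro!: sum.cong)
  then show ?thesis by (simp add: peval_sum peval_mult peval_var_z peval_cnj_var_w)
qed

lemma weighted_square_sum:
  fixes f :: "nat \<Rightarrow> complex"
  shows "(\<Sum>s<m. \<Sum>s'<m. f s * ((if s = s' then 1 else 0) - (\<Sum>r<l. cnj (p r s) * q r s')) * g s')
    = (\<Sum>s<m. f s * g s) - (\<Sum>r<l. (\<Sum>s<m. f s * cnj (p r s)) * (\<Sum>s<m. q r s * g s))"
proof -
  have "(\<Sum>s<m. \<Sum>s'<m. f s * ((if s = s' then 1 else 0) - (\<Sum>r<l. cnj (p r s) * q r s')) * g s')
    = (\<Sum>s<m. \<Sum>s'<m. (if s = s' then f s * g s' else 0)) - (\<Sum>s<m. \<Sum>s'<m. \<Sum>r<l. f s * cnj (p r s) * (q r s' * g s'))"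
    unfolding sum_subtractf[symmetric]
    by (intro sum.cong refl) (auto simp: algebra_simps sum_distrib_left sum_distrib_right)
  also have "(\<Sum>s<m. \<Sum>s'<m. (if s = s' then f s * g s' else 0)) = (\<Sum>s<m. f s * g s)"
    by simp
  also have "(\<Sum>s<m. \<Sum>s'<m. \<Sum>r<l. f s * cnj (p r s) * (q r s' * g s'))
    = (\<Sum>s<m. \<Sum>r<l. \<Sum>s'<m. f s * cnj (p r s) * (q r s' * g s'))"
    by (intro sum.cong refl sum.swap)
  also have "\<dots> = (\<Sum>r<l. \<Sum>s<m. \<Sum>s'<m. f s * cnj (p r s) * (q r s' * g s'))"
    by (rule sum.swap)
  finally show ?thesis by (simp add: sum_product)
qed

text \<open>In matrix notation this is \<open>h(w)\<^sup>* (I - p(w)\<^sup>* p(z)) h(z)\<close> for the \<open>l \<times> m\<close> matrix function \<open>p\<close> and the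
  column \<open>h\<close>.\<close>

definition defect :: "nat \<Rightarrow> nat \<Rightarrow> (nat \<Rightarrow> nat \<Rightarrow> 'p \<Rightarrow> complex) \<Rightarrow> (nat \<Rightarrow> 'p \<Rightarrow> complex) \<Rightarrow> 'p \<Rightarrow> 'p \<Rightarrow> complex" where
  "defect l m p h w z = (\<Sum>s<m. cnj (h s w) * h s z)
    - (\<Sum>r<l. cnj (\<Sum>s<m. p r s w * h s w) * (\<Sum>s<m. p r s z * h s z))"

text \<open>The factor \<open>I\<^sub>n\<close> of the Kronecker product decouples the entries of \<open>H\<close> with different index
  \<open>b < n\<close>, and the term splits into \<open>n\<close> separate defects.\<close>

lemma peval_weighted_term:
  fixes P H :: "'d::finite mpoly mat"
  assumes P: "P \<in> carrier_mat l m" and H: "H \<in> carrier_mat (m * n) 1"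
  shows "peval ((adj_w H * kron (1\<^sub>m m - adj_w P * in_z P) (1\<^sub>m n) * in_z H) $$ (0, 0)) (dbl w z)
    = (\<Sum>b<n. defect l m (\<lambda>r s. peval (P $$ (r, s))) (\<lambda>s. peval (H $$ (s * n + b, 0))) w z)"
proof -
  let ?e = "\<lambda>p. peval p (dbl w z)"
  let ?M = "1\<^sub>m m - adj_w P * in_z P"
  let ?K = "kron ?M (1\<^sub>m n)"
  let ?h = "\<lambda>t x. peval (H $$ (t, 0)) x"
  let ?D = "\<lambda>s s'. (if s = s' then 1 else 0) - (\<Sum>r<l. cnj (peval (P $$ (r, s)) w) * peval (P $$ (r, s')) z)"
  have dimK: "dim_row ?K = m * n" "dim_col ?K = m * n" using P by auto
  have M: "?e (?M $$ (s, s')) = ?D s s'" if "s < m" "s' < m" for s s'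
  proof -
    have "(adj_w P * in_z P) $$ (s, s') = (\<Sum>r<l. cnj_var_w (P $$ (r, s)) * var_z (P $$ (r, s')))"
      using P that mat_mult_entry[of s "adj_w P" s' "in_z P"] by (auto intro!: sum.cong)
    then show ?thesis using P that
      by (simp add: peval_diff peval_sum peval_mult peval_var_z peval_cnj_var_w)
  qed
  have K: "?e (?K $$ (t, u)) = ?D (t div n) (u div n) * (if t mod n = u mod n then 1 else 0)"
    if "t < m * n" "u < m * n" for t u
  proof -
    have n: "0 < n" using that by (cases n) auto
    have d: "t div n < m" "u div n < m" using that by (auto simp: less_mult_imp_div_less)
    have "?K $$ (t, u) = ?M $$ (t div n, u div n) * 1\<^sub>m n $$ (t mod n, u mod n)"
      using that P by simp
    then show ?thesis using M[OF d] n by (simp add: peval_mult)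
  qed
  have "(adj_w H * ?K * in_z H) $$ (0, 0) = (\<Sum>u<m * n. (adj_w H * ?K) $$ (0, u) * var_z (H $$ (u, 0)))"
    using H dimK mat_mult_entry[of 0 "adj_w H * ?K" 0 "in_z H"] by (auto intro!: sum.cong)
  also have "\<dots> = (\<Sum>u<m * n. (\<Sum>t<m * n. cnj_var_w (H $$ (t, 0)) * ?K $$ (t, u)) * var_z (H $$ (u, 0)))"
  proof (intro sum.cong refl arg_cong[where f = "\<lambda>x. x * _"])
    fix u assume "u \<in> {..<m * n}"
    then show "(adj_w H * ?K) $$ (0, u) = (\<Sum>t<m * n. cnj_var_w (H $$ (t, 0)) * ?K $$ (t, u))"
      using H dimK mat_mult_entry[of 0 "adj_w H" u ?K] by (auto intro!: sum.cong)
  qed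
  finally have "?e ((adj_w H * ?K * in_z H) $$ (0, 0))
      = (\<Sum>u<m * n. (\<Sum>t<m * n. cnj (?h t w) * ?e (?K $$ (t, u))) * ?h u z)"
    by (simp add: peval_sum peval_mult peval_var_z peval_cnj_var_w)
  also have "\<dots> = (\<Sum>u<m * n. \<Sum>t<m * n. cnj (?h (t div n * n + t mod n) w) *
      (?D (t div n) (u div n) * (if t mod n = u mod n then 1 else 0)) * ?h (u div n * n + u mod n) z)"
    by (simp add: sum_distrib_right K)
  also have "\<dots> = (\<Sum>s'<m. \<Sum>b'<n. \<Sum>s<m. \<Sum>b<n. cnj (?h (s * n + b) w) *
      (?D s s' * (if b = b' then 1 else 0)) * ?h (s' * n + b') z)"
    unfolding sum_div_mod[where f = "\<lambda>s' b'. \<Sum>t<m * n. cnj (?h (t div n * n + t mod n) w) *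
      (?D (t div n) s' * (if t mod n = b' then 1 else 0)) * ?h (s' * n + b') z"]
    by (intro sum.cong refl sum_div_mod[where f = "\<lambda>s b. cnj (?h (s * n + b) w) *
      (?D s _ * (if b = _ then 1 else 0)) * ?h (_ * n + _) z"])
  also have "\<dots> = (\<Sum>s'<m. \<Sum>b'<n. \<Sum>s<m. cnj (?h (s * n + b') w) * ?D s s' * ?h (s' * n + b') z)"
    by (simp add: if_distrib[of "\<lambda>x. _ * x"] if_distrib[of "\<lambda>x. x * _"] mult.assoc cong: if_cong)
  also have "\<dots> = (\<Sum>b<n. \<Sum>s'<m. \<Sum>s<m. cnj (?h (s * n + b) w) * ?D s s' * ?h (s' * n + b) z)"
    by (rule sum.swap)
  also have "\<dots> = (\<Sum>b<n. \<Sum>s<m. \<Sum>s'<m. cnj (?h (s * n + b) w) * ?D s s' * ?h (s' * n + b) z)"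
    by (intro sum.cong refl sum.swap)
  finally show ?thesis
    unfolding weighted_square_sum defect_def by (simp add: mult.commute)
qed

lemma archimedean_identity:
  fixes P :: "nat \<Rightarrow> 'd::finite mpoly mat"
  assumes arch: "archimedean_condition k m P" and P: "\<And>j. j < k \<Longrightarrow> P j \<in> carrier_mat (l j) (m j)"
  obtains c :: real where "\<And>i. \<exists>(n0::nat) (n::nat \<Rightarrow> nat) h0 h. \<forall>w z.
    complex_of_real (c\<^sup>2) - cnj (vec_nth w i) * vec_nth z i =
      (\<Sum>t<n0. cnj (peval (h0 t) w) * peval (h0 t) z) +
      (\<Sum>j<k. \<Sum>b<n j. defect (l j) (m j) (\<lambda>r s. peval (P j $$ (r, s))) (\<lambda>s. peval (h j b s)) w z)"
proof -
  let ?T = "\<lambda>n H j. (adj_w (H j) * kron (1\<^sub>m (m j) - adj_w (P j) * in_z (P j)) (1\<^sub>m (n j)) * in_z (H j)) $$ (0, 0)"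
  let ?lhs = "\<lambda>(c::real) i. Poly_Mapping.single 0 (complex_of_real (c\<^sup>2))
       - Poly_Mapping.single (Poly_Mapping.single (Inl i) 1 + Poly_Mapping.single (Inr i) 1) 1"
  obtain c where c: "\<forall>i. \<exists>n0 n H0 H. H0 \<in> carrier_mat n0 1 \<and> (\<forall>j<k. H j \<in> carrier_mat (m j * n j) 1) \<and>
     ?lhs c i = (adj_w H0 * in_z H0) $$ (0, 0) + (\<Sum>j<k. ?T n H j)"
    using arch unfolding archimedean_condition_def by auto
  show ?thesis
  proof
    fix i
    obtain n0 n H0 H where H0: "H0 \<in> carrier_mat n0 1" and H: "\<forall>j<k. H j \<in> carrier_mat (m j * n j) 1"
      and eq: "?lhs c i = (adj_w H0 * in_z H0) $$ (0, 0) + (\<Sum>j<k. ?T n H j)"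
      using spec[OF c, of i] by (elim exE conjE) blast
    let ?h = "\<lambda>j b s. H j $$ (s * n j + b, 0)"
    let ?d = "\<lambda>j b. defect (l j) (m j) (\<lambda>r s. peval (P j $$ (r, s))) (\<lambda>s. peval (?h j b s))"
    have id: "complex_of_real (c\<^sup>2) - cnj (vec_nth w i) * vec_nth z i =
      (\<Sum>t<n0. cnj (peval (H0 $$ (t, 0)) w) * peval (H0 $$ (t, 0)) z) + (\<Sum>j<k. \<Sum>b<n j. ?d j b w z)"
      for w z :: "complex ^ 'd"
    proof -
      have "complex_of_real (c\<^sup>2) - cnj (vec_nth w i) * vec_nth z i = peval (?lhs c i) (dbl w z)"
        by (simp add: peval_diff peval_single meval_add meval_single dbl_def)
      also have "\<dots> = (\<Sum>t<n0. cnj (peval (H0 $$ (t, 0)) w) * peval (H0 $$ (t, 0)) z)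
          + (\<Sum>j<k. peval (?T n H j) (dbl w z))"
        unfolding eq by (simp only: peval_add peval_sum peval_square_term[OF H0])
      also have "(\<Sum>j<k. peval (?T n H j) (dbl w z)) = (\<Sum>j<k. \<Sum>b<n j. ?d j b w z)"
      proof (rule sum.cong[OF refl])
        fix j assume "j \<in> {..<k}"
        then have "P j \<in> carrier_mat (l j) (m j)" "H j \<in> carrier_mat (m j * n j) 1" using P H by auto
        then show "peval (?T n H j) (dbl w z) = (\<Sum>b<n j. ?d j b w z)"
          by (rule peval_weighted_term)
      qed
      finally show ?thesis .
    qed
    show "\<exists>(n0::nat) (n::nat \<Rightarrow> nat) h0 h. \<forall>w z.
      complex_of_real (c\<^sup>2) - cnj (vec_nth w i) * vec_nth z i =
      (\<Sum>t<n0. cnj (peval (h0 t) w) * peval (h0 t) z) +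
      (\<Sum>j<k. \<Sum>b<n j. defect (l j) (m j) (\<lambda>r s. peval (P j $$ (r, s))) (\<lambda>s. peval (h j b s)) w z)"
      by (rule exI[of _ n0], rule exI[of _ n], rule exI[of _ "\<lambda>t. H0 $$ (t, 0)"], rule exI[of _ ?h])
        (intro allI id)
  qed
qed

section \<open>Separation of a point from a cone with an order unit\<close>

text \<open>Zorn's lemma provides a maximal cone \<open>M\<close> containing \<open>C\<close> and \<open>- f\<close> but not \<open>- e\<close>. Maximality
  makes \<open>M\<close> total: it contains \<open>v\<close> or \<open>- v\<close> for every \<open>v\<close>. Modulo arbitrarily small multiples of
  \<open>e\<close>, every vector is thus congruent to a multiple of \<open>e\<close>, and this multiple is the functional.\<close>

lemma cone_separation:
  fixes C V :: "'v::real_vector set" and e f :: 'v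
  assumes C0: "0 \<in> C" and Cadd: "\<And>x y. x \<in> C \<Longrightarrow> y \<in> C \<Longrightarrow> x + y \<in> C"
    and Cscale: "\<And>t x. 0 \<le> t \<Longrightarrow> x \<in> C \<Longrightarrow> t *\<^sub>R x \<in> C"
    and V: "subspace V" "C \<subseteq> V" "f \<in> V" and e: "e \<in> C"
    and unit: "\<And>v. v \<in> V \<Longrightarrow> \<exists>t. t *\<^sub>R e - v \<in> C"
    and f: "f \<notin> C"
  obtains L :: "'v \<Rightarrow> real"
  where "\<And>x y. x \<in> V \<Longrightarrow> y \<in> V \<Longrightarrow> L (x + y) = L x + L y"
    and "\<And>t x. x \<in> V \<Longrightarrow> L (t *\<^sub>R x) = t * L x"
    and "\<And>x. x \<in> C \<Longrightarrow> 0 \<le> L x" and "L f \<le> 0" and "L e = 1"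
proof -
  define \<M> where "\<M> = {M. M \<subseteq> V \<and> C \<subseteq> M \<and> - f \<in> M \<and> (\<forall>x\<in>M. \<forall>y\<in>M. x + y \<in> M)
      \<and> (\<forall>t\<ge>0. \<forall>x\<in>M. t *\<^sub>R x \<in> M) \<and> - e \<notin> M}"
  have \<M>I: "X \<in> \<M>" if "X \<subseteq> V" "C \<subseteq> X" "- f \<in> X" "\<And>x y. x \<in> X \<Longrightarrow> y \<in> X \<Longrightarrow> x + y \<in> X"
      "\<And>t x. 0 \<le> t \<Longrightarrow> x \<in> X \<Longrightarrow> t *\<^sub>R x \<in> X" "- e \<notin> X" for X
    using that by (simp add: \<M>_def)
  have \<M>D: "X \<subseteq> V" "C \<subseteq> X" "- f \<in> X" "\<And>x y. x \<in> X \<Longrightarrow> y \<in> X \<Longrightarrow> x + y \<in> X"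
      "\<And>t x. 0 \<le> t \<Longrightarrow> x \<in> X \<Longrightarrow> t *\<^sub>R x \<in> X" "- e \<notin> X" if "X \<in> \<M>" for X
    using that by (simp_all add: \<M>_def)
  have ne: "\<M> \<noteq> {}"
  proof -
    \<comment> \<open>The cone generated by \<open>C\<close> and \<open>- f\<close>; were \<open>- e\<close> in it, then \<open>f\<close> would be in \<open>C\<close>.\<close>
    let ?M = "{c - t *\<^sub>R f | c t. c \<in> C \<and> 0 \<le> t}"
    have m6: "- e \<notin> ?M"
    proof
      assume "- e \<in> ?M"
      then obtain c t where ct: "- e = c - t *\<^sub>R f" "c \<in> C" "0 \<le> t" by auto
      have tf: "t *\<^sub>R f \<in> C" using Cadd[OF ct(2) e] ct(1) by (metis add_diff_cancel_left' diff_add_cancel diff_minus_eq_add minus_diff_eq add.commute)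
      show False
      proof (cases "t = 0")
        case True
        then have me: "- e \<in> C" using ct by simp
        obtain s where s: "s *\<^sub>R e - (- f) \<in> C" using unit[of "- f"] V subspace_neg by blast
        have "(s *\<^sub>R e - (- f)) + \<bar>s\<bar> *\<^sub>R e \<in> C" by (intro Cadd s Cscale e) simp
        moreover have "(s + \<bar>s\<bar>) *\<^sub>R (- e) \<in> C" by (intro Cscale me) simp
        ultimately have "((s *\<^sub>R e - (- f)) + \<bar>s\<bar> *\<^sub>R e) + (s + \<bar>s\<bar>) *\<^sub>R (- e) \<in> C" by (rule Cadd)
        then show False using f by (simp add: algebra_simps)
      next
        case False
        then have "f = (1 / t) *\<^sub>R (t *\<^sub>R f)" by simp
        then show False using Cscale[OF _ tf, of "1 / t"] ct(3) f by simp
      qed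
    qed
    have m1: "?M \<subseteq> V"
      using V by (auto intro!: subspace_diff subspace_scale)
    have m2: "C \<subseteq> ?M"
    proof
      fix x assume "x \<in> C"
      then have "x = x - 0 *\<^sub>R f \<and> x \<in> C \<and> (0::real) \<le> 0" by simp
      then show "x \<in> ?M" by blast
    qed
    have "- f = 0 - 1 *\<^sub>R f \<and> 0 \<in> C \<and> (0::real) \<le> 1" using C0 by simp
    then have m3: "- f \<in> ?M" by blast
    have m4: "x + y \<in> ?M" if xy: "x \<in> ?M" "y \<in> ?M" for x y
    proof -
      obtain c t where x: "x = c - t *\<^sub>R f" "c \<in> C" "0 \<le> t" using xy(1) by auto
      obtain c' t' where y: "y = c' - t' *\<^sub>R f" "c' \<in> C" "0 \<le> t'" using xy(2) by auto
      have "x + y = (c + c') - (t + t') *\<^sub>R f \<and> c + c' \<in> C \<and> 0 \<le> t + t'"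
        using x y Cadd[of c c'] by (simp add: scaleR_add_left)
      then show ?thesis by blast
    qed
    have m5: "s *\<^sub>R x \<in> ?M" if x: "0 \<le> s" "x \<in> ?M" for x s
    proof -
      obtain c t where ct: "x = c - t *\<^sub>R f" "c \<in> C" "0 \<le> t" using x(2) by auto
      have "s *\<^sub>R x = s *\<^sub>R c - (s * t) *\<^sub>R f \<and> s *\<^sub>R c \<in> C \<and> 0 \<le> s * t"
        using ct Cscale[OF x(1), of c] x(1) by (simp add: scaleR_diff_right)
      then show ?thesis by blast
    qed
    have "?M \<in> \<M>" by (rule \<M>I[OF m1 m2 m3 m4 m5 m6])
    then show ?thesis by blast
  qed
  have "\<exists>M\<in>\<M>. \<forall>X\<in>\<M>. M \<subseteq> X \<longrightarrow> X = M"
  proof (rule subset_Zorn_nonempty[OF ne])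
    fix \<C> assume \<C>: "\<C> \<noteq> {}" "subset.chain \<M> \<C>"
    then have mem: "X \<in> \<M>" if "X \<in> \<C>" for X using that by (auto simp: subset_chain_def)
    have lin: "X \<subseteq> Y \<or> Y \<subseteq> X" if "X \<in> \<C>" "Y \<in> \<C>" for X Y
      using \<C>(2) that by (auto simp: subset_chain_def)
    have m4: "x + y \<in> \<Union>\<C>" if xy: "x \<in> \<Union>\<C>" "y \<in> \<Union>\<C>" for x y
    proof -
      obtain X Y where XY: "x \<in> X" "X \<in> \<C>" "y \<in> Y" "Y \<in> \<C>" using xy by auto
      then obtain Z where "Z \<in> \<C>" "x \<in> Z" "y \<in> Z" using lin[of X Y] by blast
      then show ?thesis using \<M>D(4)[OF mem[of Z], of x y] by blast
    qed
    have m5: "t *\<^sub>R x \<in> \<Union>\<C>" if "0 \<le> t" "x \<in> \<Union>\<C>" for x t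
      using that \<M>D(5)[OF mem] by blast
    obtain X where X: "X \<in> \<C>" using \<C>(1) by blast
    have "\<Union>\<C> \<subseteq> V" using \<M>D(1)[OF mem] by blast
    moreover have "C \<subseteq> \<Union>\<C>" "- f \<in> \<Union>\<C>" using \<M>D(2,3)[OF mem[OF X]] X by blast+
    moreover have "- e \<notin> \<Union>\<C>" using \<M>D(6)[OF mem] by blast
    ultimately show "\<Union>\<C> \<in> \<M>" using m4 m5 by (intro \<M>I)
  qed
  then obtain M where M\<M>: "M \<in> \<M>" and max: "\<And>X. X \<in> \<M> \<Longrightarrow> M \<subseteq> X \<Longrightarrow> X = M" by blast
  have M: "M \<subseteq> V" "C \<subseteq> M" "- f \<in> M" "- e \<notin> M"
    and Madd: "\<And>x y. x \<in> M \<Longrightarrow> y \<in> M \<Longrightarrow> x + y \<in> M"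
    and Mscale: "\<And>t x. 0 \<le> t \<Longrightarrow> x \<in> M \<Longrightarrow> t *\<^sub>R x \<in> M"
    using \<M>D[OF M\<M>] by simp_all
  have eM: "e \<in> M" using e M(2) by blast
  have eV: "e \<in> V" using e V(2) by blast
  \<comment> \<open>Multiples of the order unit in \<open>M\<close> are nonnegative, and \<open>M\<close> is total.\<close>
  have pos: "0 \<le> t" if "t *\<^sub>R e \<in> M" for t
  proof (rule ccontr)
    assume "\<not> 0 \<le> t"
    then have "(1 / - t) *\<^sub>R (t *\<^sub>R e) \<in> M" by (intro Mscale that) simp
    then show False using \<open>\<not> 0 \<le> t\<close> M(4) by simp
  qed
  have total: "- v \<in> M" if v: "v \<in> V" "v \<notin> M" for v
  proof -
    let ?M = "{x + t *\<^sub>R v | x t. x \<in> M \<and> 0 \<le> t}"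
    have MM: "M \<subseteq> ?M"
    proof
      fix x assume "x \<in> M"
      then have "x = x + 0 *\<^sub>R v \<and> x \<in> M \<and> (0::real) \<le> 0" by simp
      then show "x \<in> ?M" by blast
    qed
    have "v = 0 + 1 *\<^sub>R v \<and> 0 \<in> M \<and> (0::real) \<le> 1" using C0 M(2) by auto
    then have "v \<in> ?M" by blast
    then have notin: "?M \<notin> \<M>" using max[OF _ MM] v(2) by auto
    have m1: "?M \<subseteq> V" using M(1) V(1) v(1) by (auto intro!: subspace_add subspace_scale)
    have m2: "C \<subseteq> ?M" and m3: "- f \<in> ?M" using M(2,3) MM by blast+
    have m4: "x + y \<in> ?M" if xy: "x \<in> ?M" "y \<in> ?M" for x y
    proof -
      obtain c t where x: "x = c + t *\<^sub>R v" "c \<in> M" "0 \<le> t" using xy(1) by auto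
      obtain c' t' where y: "y = c' + t' *\<^sub>R v" "c' \<in> M" "0 \<le> t'" using xy(2) by auto
      have "x + y = (c + c') + (t + t') *\<^sub>R v \<and> c + c' \<in> M \<and> 0 \<le> t + t'"
        using x y Madd[of c c'] by (simp add: scaleR_add_left)
      then show ?thesis by blast
    qed
    have m5: "s *\<^sub>R x \<in> ?M" if x: "0 \<le> s" "x \<in> ?M" for x s
    proof -
      obtain c t where ct: "x = c + t *\<^sub>R v" "c \<in> M" "0 \<le> t" using x(2) by auto
      have "s *\<^sub>R x = s *\<^sub>R c + (s * t) *\<^sub>R v \<and> s *\<^sub>R c \<in> M \<and> 0 \<le> s * t"
        using ct Mscale[OF x(1), of c] x(1) by (simp add: scaleR_add_right)
      then show ?thesis by blast
    qed
    have "- e \<in> ?M" using \<M>I[OF m1 m2 m3 m4 m5] notin by blast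
    then obtain x t where xt: "- e = x + t *\<^sub>R v" "x \<in> M" "0 \<le> t" by auto
    then have t: "t > 0" using M(4) by (cases "t = 0") auto
    have "x = - e - t *\<^sub>R v" using xt(1) by (simp add: eq_diff_eq)
    then have "t *\<^sub>R (- v) = x + e" by simp
    then have "(1 / t) *\<^sub>R (x + e) = - v" using t by (metis divide_self_if less_irrefl scaleR_one scaleR_scaleR times_divide_eq_left mult_1)
    then show ?thesis using Mscale[OF _ Madd[OF xt(2) eM], of "1 / t"] t by simp
  qed
  define A where "A v = {t. t *\<^sub>R e - v \<in> M}" for v
  have A_up: "t' \<in> A v" if "t \<in> A v" "t \<le> t'" for t t' v
  proof -
    have "(t *\<^sub>R e - v) + (t' - t) *\<^sub>R e \<in> M" using that unfolding A_def by (intro Madd Mscale eM) auto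
    then show ?thesis by (simp add: A_def algebra_simps)
  qed
  have A_ne: "A v \<noteq> {}" if "v \<in> V" for v
    using unit[OF that] M(2) unfolding A_def by blast
  have A_bdd: "bdd_below (A v)" if v: "v \<in> V" for v
  proof -
    obtain s where "s *\<^sub>R e - (- v) \<in> M" using unit[of "- v"] v V(1) M(2) subspace_neg by blast
    then have "- s \<le> t" if "t \<in> A v" for t
      using pos[of "t + s"] Madd[of "t *\<^sub>R e - v" "s *\<^sub>R e - (- v)"] that
      by (simp add: A_def algebra_simps)
    then show ?thesis by (intro bdd_belowI)
  qed
  define L where "L v = Inf (A v)" for v
  have L1: "(L v + d) *\<^sub>R e - v \<in> M" if v: "v \<in> V" and d: "0 < d" for v d
  proof -
    have "Inf (A v) < L v + d" using d by (simp add: L_def)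
    then obtain t where "t \<in> A v" "t < L v + d" using cInf_lessD[OF A_ne[OF v]] by blast
    then have "L v + d \<in> A v" using A_up[of t v "L v + d"] by simp
    then show ?thesis by (simp add: A_def)
  qed
  have L2: "v - (L v - d) *\<^sub>R e \<in> M" if v: "v \<in> V" and d: "0 < d" for v d
  proof -
    have "L v - d \<notin> A v"
      using cInf_lower[OF _ A_bdd[OF v], of "L v - d"] d by (auto simp: L_def)
    then have "(L v - d) *\<^sub>R e - v \<notin> M" by (simp add: A_def)
    then have "- ((L v - d) *\<^sub>R e - v) \<in> M"
      using v eV V(1) by (intro total subspace_diff subspace_scale)
    then show ?thesis by simp
  qed
  have L_eq: "L v = a" if v: "v \<in> V"
    and up: "\<And>d. 0 < d \<Longrightarrow> (a + d) *\<^sub>R e - v \<in> M" and lo: "\<And>d. 0 < d \<Longrightarrow> v - (a - d) *\<^sub>R e \<in> M" for v a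
  proof (rule antisym)
    show "L v \<le> a"
    proof (rule field_le_epsilon)
      fix d :: real assume "0 < d"
      then show "L v \<le> a + d"
        using up[of d] cInf_lower[OF _ A_bdd[OF v], of "a + d"] by (simp add: L_def A_def)
    qed
    show "a \<le> L v"
      unfolding L_def
    proof (rule cInf_greatest[OF A_ne[OF v]])
      fix t assume t: "t \<in> A v"
      show "a \<le> t"
      proof (rule field_le_epsilon)
        fix d :: real assume "0 < d"
        then have "(t *\<^sub>R e - v) + (v - (a - d) *\<^sub>R e) \<in> M"
          using t lo[of d] by (intro Madd) (auto simp: A_def)
        then show "a \<le> t + d" using pos[of "t - a + d"] by (simp add: algebra_simps)
      qed
    qed
  qed
  show ?thesis
  proof
    show "L (x + y) = L x + L y" if x: "x \<in> V" and y: "y \<in> V" for x y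
    proof (rule L_eq)
      show "x + y \<in> V" by (rule subspace_add[OF V(1) x y])
      fix d :: real assume "0 < d"
      then have d: "0 < d / 2" by simp
      show "(L x + L y + d) *\<^sub>R e - (x + y) \<in> M"
        using Madd[OF L1[OF x d] L1[OF y d]] by (simp add: algebra_simps flip: scaleR_add_left)
      show "x + y - (L x + L y - d) *\<^sub>R e \<in> M"
        using Madd[OF L2[OF x d] L2[OF y d]] by (simp add: algebra_simps flip: scaleR_add_left)
    qed
    have Lscale: "L (t *\<^sub>R x) = t * L x" if x: "x \<in> V" and t: "0 < t" for t x
    proof (rule L_eq)
      show "t *\<^sub>R x \<in> V" by (rule subspace_scale[OF V(1) x])
      fix d :: real assume "0 < d"
      then have d: "0 < d / t" using t by simp
      show "(t * L x + d) *\<^sub>R e - t *\<^sub>R x \<in> M"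
        using Mscale[OF less_imp_le[OF t] L1[OF x d]] t by (simp add: algebra_simps)
      show "t *\<^sub>R x - (t * L x - d) *\<^sub>R e \<in> M"
        using Mscale[OF less_imp_le[OF t] L2[OF x d]] t by (simp add: algebra_simps)
    qed
    have Lneg: "L (- x) = - L x" if x: "x \<in> V" for x
    proof (rule L_eq)
      show "- x \<in> V" by (rule subspace_neg[OF V(1) x])
      fix d :: real assume d: "0 < d"
      have "(- L x + d) *\<^sub>R e - (- x) = x - (L x - d) *\<^sub>R e"
        by (simp add: scaleR_left_diff_distrib scaleR_add_left)
      then show "(- L x + d) *\<^sub>R e - (- x) \<in> M" using L2[OF x d] by (simp only:)
      have "- x - (- L x - d) *\<^sub>R e = (L x + d) *\<^sub>R e - x"
        by (simp add: scaleR_left_diff_distrib scaleR_add_left)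
      then show "- x - (- L x - d) *\<^sub>R e \<in> M" using L1[OF x d] by (simp only:)
    qed
    have L0: "L 0 = 0" using Lneg[of 0] subspace_0[OF V(1)] by simp
    show "L (t *\<^sub>R x) = t * L x" if x: "x \<in> V" for t x
    proof -
      consider "t = 0" | "0 < t" | "0 < - t" by linarith
      then show ?thesis
      proof cases
        case 3
        then show ?thesis using Lscale[OF subspace_neg[OF V(1) x] 3] Lneg[OF x] by simp
      qed (use L0 Lscale[OF x] in auto)
    qed
    show "0 \<le> L x" if "x \<in> C" for x
      unfolding L_def
    proof (rule cInf_greatest[OF A_ne])
      show "x \<in> V" using that V(2) by blast
      fix t assume "t \<in> A x"
      then show "0 \<le> t" using pos[of t] Madd[of "t *\<^sub>R e - x" x] that M(2) by (auto simp: A_def)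
    qed
    show "L f \<le> 0"
      using cInf_lower[OF _ A_bdd[OF V(3)], of 0] M(3) by (simp add: L_def A_def)
    show "L e = 1"
    proof (rule L_eq[OF eV])
      fix d :: real assume d: "0 < d"
      show "(1 + d) *\<^sub>R e - e \<in> M" using Mscale[OF _ eM, of d] d by (simp add: algebra_simps)
      show "e - (1 - d) *\<^sub>R e \<in> M" using Mscale[OF _ eM, of d] d by (simp add: algebra_simps)
    qed
  qed
qed

text \<open>Kernels, as curried functions, form a real vector space under pointwise operations.\<close>

instantiation "fun" :: (type, real_vector) real_vector
begin

definition scaleR_fun :: "real \<Rightarrow> ('a \<Rightarrow> 'b) \<Rightarrow> 'a \<Rightarrow> 'b" where
  "scaleR_fun t f = (\<lambda>x. t *\<^sub>R f x)"

instance
  by standard (auto simp: scaleR_fun_def fun_eq_iff scaleR_add_right scaleR_add_left)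

end

section \<open>Semi-inner products and their square summable models\<close>

locale semi_inner_product =
  fixes G :: "('a \<Rightarrow> complex) set" and ip :: "('a \<Rightarrow> complex) \<Rightarrow> ('a \<Rightarrow> complex) \<Rightarrow> complex"
  assumes zero_closed: "(\<lambda>_. 0) \<in> G"
    and add_closed: "g \<in> G \<Longrightarrow> h \<in> G \<Longrightarrow> (\<lambda>x. g x + h x) \<in> G"
    and scale_closed: "g \<in> G \<Longrightarrow> (\<lambda>x. a * g x) \<in> G"
    and ip_add: "f \<in> G \<Longrightarrow> g \<in> G \<Longrightarrow> h \<in> G \<Longrightarrow> ip f (\<lambda>x. g x + h x) = ip f g + ip f h"
    and ip_scale: "f \<in> G \<Longrightarrow> g \<in> G \<Longrightarrow> ip f (\<lambda>x. a * g x) = a * ip f g"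
    and ip_cnj: "f \<in> G \<Longrightarrow> g \<in> G \<Longrightarrow> ip g f = cnj (ip f g)"
    and ip_nonneg: "g \<in> G \<Longrightarrow> 0 \<le> Re (ip g g)"
begin

definition "nrm2 g = Re (ip g g)"

lemma nrm2_nonneg: "g \<in> G \<Longrightarrow> 0 \<le> nrm2 g"
  by (simp add: nrm2_def ip_nonneg)

lemma ip_self: "g \<in> G \<Longrightarrow> ip g g = of_real (nrm2 g)"
  using ip_cnj[of g g] by (simp add: nrm2_def complex_eq_iff)

lemma diff_closed: "g \<in> G \<Longrightarrow> h \<in> G \<Longrightarrow> (\<lambda>x. g x - h x) \<in> G"
  using add_closed[of g "\<lambda>x. (- 1) * h x"] scale_closed[of h "- 1"] by simp

lemma sum_closed:
  assumes "\<And>i. i \<in> I \<Longrightarrow> g i \<in> G" shows "(\<lambda>x. \<Sum>i\<in>I. a i * g i x) \<in> G"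
  using assms
proof (induction I rule: infinite_finite_induct)
  case (insert i I)
  then show ?case using add_closed[OF scale_closed[of "g i" "a i"], of "\<lambda>x. \<Sum>i\<in>I. a i * g i x"] by simp
qed (simp_all add: zero_closed)

lemma ip_zero: "f \<in> G \<Longrightarrow> ip f (\<lambda>_. 0) = 0"
  using ip_scale[of f "\<lambda>_. 0" 0] zero_closed by simp

lemma ip_diff: "f \<in> G \<Longrightarrow> g \<in> G \<Longrightarrow> h \<in> G \<Longrightarrow> ip f (\<lambda>x. g x - h x) = ip f g - ip f h"
  using ip_add[of f g "\<lambda>x. (- 1) * h x"] ip_scale[of f h "- 1"] scale_closed[of h "- 1"] by simp

lemma ip_sum:
  assumes "f \<in> G" "\<And>i. i \<in> I \<Longrightarrow> g i \<in> G"
  shows "ip f (\<lambda>x. \<Sum>i\<in>I. a i * g i x) = (\<Sum>i\<in>I. a i * ip f (g i))"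
  using assms(2)
proof (induction I rule: infinite_finite_induct)
  case (insert i I)
  then show ?case
    using ip_add[OF assms(1) scale_closed[of "g i" "a i"] sum_closed[of I g a]] ip_scale[OF assms(1), of "g i" "a i"] by simp
qed (simp_all add: ip_zero assms(1))

lemma ip_add_left: "f \<in> G \<Longrightarrow> g \<in> G \<Longrightarrow> h \<in> G \<Longrightarrow> ip (\<lambda>x. g x + h x) f = ip g f + ip h f"
  using ip_add[of f g h] ip_cnj[of f "\<lambda>x. g x + h x"] ip_cnj[of f g] ip_cnj[of f h] add_closed[of g h] by simp

lemma ip_scale_left: "f \<in> G \<Longrightarrow> g \<in> G \<Longrightarrow> ip (\<lambda>x. a * g x) f = cnj a * ip g f"
  using ip_scale[of f g a] ip_cnj[of f "\<lambda>x. a * g x"] ip_cnj[of f g] scale_closed[of g a] by simp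

lemma ip_diff_left: "f \<in> G \<Longrightarrow> g \<in> G \<Longrightarrow> h \<in> G \<Longrightarrow> ip (\<lambda>x. g x - h x) f = ip g f - ip h f"
  using ip_diff[of f g h] ip_cnj[of f "\<lambda>x. g x - h x"] ip_cnj[of f g] ip_cnj[of f h] diff_closed[of g h] by simp

text \<open>The degenerate case of the Cauchy-Schwarz inequality: with \<open>s = - t \<langle>g, h\<rangle>\<close>, the square norm of
  \<open>h + s g\<close> is \<open>\<parallel>h\<parallel>\<^sup>2 - 2 t \<bar>\<langle>g, h\<rangle>\<bar>\<^sup>2\<close>, which would be negative for large \<open>t\<close>.\<close>

lemma null_ip:
  assumes g: "g \<in> G" "nrm2 g = 0" and h: "h \<in> G"
  shows "ip g h = 0" "ip h g = 0"
proof -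
  define c where "c = ip g h"
  have hg: "ip h g = cnj c" using ip_cnj[OF g(1) h] by (simp add: c_def)
  have gg: "ip g g = 0" using ip_self[OF g(1)] g(2) by simp
  have *: "0 \<le> nrm2 h - 2 * t * (cmod c)\<^sup>2" for t :: real
  proof -
    define s where "s = - of_real t * c"
    have sg: "(\<lambda>x. s * g x) \<in> G" by (rule scale_closed[OF g(1)])
    have u: "(\<lambda>x. h x + s * g x) \<in> G" by (rule add_closed[OF h sg])
    have "ip (\<lambda>x. h x + s * g x) (\<lambda>x. h x + s * g x) = ip (\<lambda>x. h x + s * g x) h + s * ip (\<lambda>x. h x + s * g x) g"
      using ip_add[OF u h sg] ip_scale[OF u g(1)] by simp
    also have "ip (\<lambda>x. h x + s * g x) h = ip h h + cnj s * c"
      using ip_add_left[OF h h sg] ip_scale_left[OF h g(1)] by (simp add: c_def)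
    also have "ip (\<lambda>x. h x + s * g x) g = cnj c"
      using ip_add_left[OF g(1) h sg] ip_scale_left[OF g(1) g(1)] by (simp add: hg gg)
    finally have "ip (\<lambda>x. h x + s * g x) (\<lambda>x. h x + s * g x) = ip h h + (cnj s * c + s * cnj c)" by simp
    also have "cnj s * c + s * cnj c = of_real (- 2 * t * (cmod c)\<^sup>2)"
      by (simp add: s_def complex_norm_square mult_ac del: of_real_power) 
    finally have "Re (ip (\<lambda>x. h x + s * g x) (\<lambda>x. h x + s * g x)) = nrm2 h - 2 * t * (cmod c)\<^sup>2"
      by (simp add: nrm2_def)
    then show ?thesis using ip_nonneg[OF u] by simp
  qed
  have "c = 0"
  proof (rule ccontr)
    assume "c \<noteq> 0"
    then have "0 < (cmod c)\<^sup>2" by simp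
    moreover have "2 * ((nrm2 h + 1) / (2 * (cmod c)\<^sup>2)) * (cmod c)\<^sup>2 = nrm2 h + 1"
      using \<open>c \<noteq> 0\<close> by (simp add: field_simps)
    ultimately show False using *[of "(nrm2 h + 1) / (2 * (cmod c)\<^sup>2)"] by simp
  qed
  then show "ip g h = 0" "ip h g = 0" using hg by (simp_all add: c_def)
qed

text \<open>A family whose members are pairwise orthogonal and are unit vectors or null vectors. Null
  vectors are admitted so that the orthonormalisation of a sequence keeps its indices.\<close>

definition orthosystem :: "(nat \<Rightarrow> 'a \<Rightarrow> complex) \<Rightarrow> nat \<Rightarrow> bool" where
  "orthosystem e n \<longleftrightarrow> (\<forall>j<n. e j \<in> G \<and> (ip (e j) (e j) = 0 \<or> ip (e j) (e j) = 1) \<and>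
     (\<forall>i<n. i \<noteq> j \<longrightarrow> ip (e i) (e j) = 0))"

definition proj :: "(nat \<Rightarrow> 'a \<Rightarrow> complex) \<Rightarrow> nat \<Rightarrow> ('a \<Rightarrow> complex) \<Rightarrow> 'a \<Rightarrow> complex" where
  "proj e n g = (\<lambda>x. \<Sum>k<n. ip (e k) g * e k x)"

lemma orthosystemD:
  assumes "orthosystem e n"
  shows "j < n \<Longrightarrow> e j \<in> G" "j < n \<Longrightarrow> ip (e j) (e j) = 0 \<or> ip (e j) (e j) = 1"
    "i < n \<Longrightarrow> j < n \<Longrightarrow> i \<noteq> j \<Longrightarrow> ip (e i) (e j) = 0"
  using assms by (auto simp: orthosystem_def)

lemma proj_closed: "orthosystem e n \<Longrightarrow> proj e n g \<in> G"
  unfolding proj_def by (rule sum_closed) (auto dest: orthosystemD)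

lemma ip_orthosystem_sum:
  assumes e: "orthosystem e n" and j: "j < n"
  shows "ip (e j) (\<lambda>x. \<Sum>k<n. a k * e k x) = a j * ip (e j) (e j)"
proof -
  have "ip (e j) (\<lambda>x. \<Sum>k<n. a k * e k x) = (\<Sum>k<n. a k * ip (e j) (e k))"
    by (rule ip_sum) (use orthosystemD(1)[OF e] j in auto)
  also have "\<dots> = (\<Sum>k<n. if k = j then a j * ip (e j) (e j) else 0)"
    using orthosystemD(3)[OF e j] by (intro sum.cong) auto
  finally show ?thesis using j by simp
qed

lemma ip_unit_or_null:
  assumes "e \<in> G" "ip e e = 0 \<or> ip e e = 1" "g \<in> G"
  shows "ip e g * ip e e = ip e g"
  using assms null_ip(1)[of e g] by (auto simp: nrm2_def)

lemma residual_orthogonal: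
  assumes e: "orthosystem e n" and g: "g \<in> G" and j: "j < n"
  shows "ip (e j) (\<lambda>x. g x - proj e n g x) = 0"
proof -
  have ej: "e j \<in> G" using orthosystemD(1)[OF e j] .
  have "ip (e j) (\<lambda>x. g x - proj e n g x) = ip (e j) g - ip (e j) (proj e n g)"
    by (rule ip_diff[OF ej g proj_closed[OF e]])
  also have "ip (e j) (proj e n g) = ip (e j) g * ip (e j) (e j)"
    unfolding proj_def by (rule ip_orthosystem_sum[OF e j])
  finally show ?thesis using ip_unit_or_null[OF ej orthosystemD(2)[OF e j] g] by simp
qed

text \<open>One orthonormalisation step.\<close>

text \<open>One orthonormalisation step. If the residual \<open>r\<close> is a null vector, the convention \<open>1 / 0 = 0\<close> makes
  the new member the zero vector, as it should be.\<close>

lemma orthosystem_extend: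
  assumes e: "orthosystem e n" and g: "g \<in> G"
  defines "r \<equiv> (\<lambda>x. g x - proj e n g x)"
  defines "e' \<equiv> e(n := (\<lambda>x. of_real (1 / sqrt (nrm2 r)) * r x))"
  shows "orthosystem e' (Suc n)" and "nrm2 (\<lambda>x. g x - proj e' (Suc n) g x) = 0"
    and "nrm2 r \<noteq> 0 \<Longrightarrow> ip (e' n) (e' n) = 1"
proof -
  have r: "r \<in> G" unfolding r_def by (intro diff_closed g proj_closed e)
  define a where "a = complex_of_real (1 / sqrt (nrm2 r))"
  have e'n: "e' n = (\<lambda>x. a * r x)" and e'k: "\<And>k. k < n \<Longrightarrow> e' k = e k"
    by (auto simp: e'_def a_def)
  have en: "e' n \<in> G" unfolding e'n by (rule scale_closed[OF r])
  have sq: "a * cnj a * of_real (nrm2 r) = (if nrm2 r = 0 then 0 else 1)"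
  proof -
    have "sqrt (nrm2 r) * sqrt (nrm2 r) = nrm2 r" using nrm2_nonneg[OF r] by simp
    then have "1 / sqrt (nrm2 r) * (1 / sqrt (nrm2 r)) * nrm2 r = (if nrm2 r = 0 then 0 else 1)"
      by (simp add: field_simps)
    then have "complex_of_real (1 / sqrt (nrm2 r) * (1 / sqrt (nrm2 r)) * nrm2 r) = (if nrm2 r = 0 then 0 else 1)"
      by simp
    then show ?thesis by (simp only: a_def complex_cnj_complex_of_real of_real_mult)
  qed
  have "ip (e' n) (e' n) = a * cnj a * of_real (nrm2 r)"
    using ip_scale[OF en r, of a] ip_scale_left[OF r r, of a] ip_self[OF r] by (simp add: e'n)
  then have self: "ip (e' n) (e' n) = (if nrm2 r = 0 then 0 else 1)" using sq by simp
  show "nrm2 r \<noteq> 0 \<Longrightarrow> ip (e' n) (e' n) = 1" using self by simp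
  have orth: "ip (e j) (e' n) = 0 \<and> ip (e' n) (e j) = 0" if j: "j < n" for j
  proof -
    have "ip (e j) (e' n) = 0"
      using residual_orthogonal[OF e g j] ip_scale[OF orthosystemD(1)[OF e j] r, of a] by (simp add: e'n r_def)
    then show ?thesis using ip_cnj[OF orthosystemD(1)[OF e j] en] by simp
  qed
  show os: "orthosystem e' (Suc n)"
    unfolding orthosystem_def
  proof (intro allI impI conjI)
    fix j assume j: "j < Suc n"
    show "e' j \<in> G" using j en e'k orthosystemD(1)[OF e] by (cases "j = n") auto
    show "ip (e' j) (e' j) = 0 \<or> ip (e' j) (e' j) = 1"
      using j self e'k orthosystemD(2)[OF e] by (cases "j = n") auto
    fix i assume "i < Suc n" "i \<noteq> j"
    then show "ip (e' i) (e' j) = 0"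
      using j orth e'k orthosystemD(3)[OF e] by (cases "j = n"; cases "i = n") auto
  qed
  have "proj e' (Suc n) g = (\<lambda>x. proj e n g x + ip (e' n) g * e' n x)"
    by (simp add: proj_def e'k)
  then have res: "(\<lambda>x. g x - proj e' (Suc n) g x) = (\<lambda>x. r x - ip (e' n) g * e' n x)"
    by (simp add: r_def fun_eq_iff)
  have "ip (e' n) (proj e n g) = (\<Sum>k<n. ip (e k) g * ip (e' n) (e k))"
    unfolding proj_def by (rule ip_sum[OF en]) (use orthosystemD(1)[OF e] in auto)
  also have "\<dots> = 0" using orth by (intro sum.neutral) auto
  finally have "ip (e' n) g = ip (e' n) r"
    using ip_diff[OF en g proj_closed[OF e], of g] by (simp add: r_def)
  also have "\<dots> = cnj a * of_real (nrm2 r)"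
    using ip_scale_left[OF r r, of a] ip_self[OF r] by (simp add: e'n)
  finally have ig: "ip (e' n) g = cnj a * of_real (nrm2 r)" .
  show "nrm2 (\<lambda>x. g x - proj e' (Suc n) g x) = 0"
  proof (cases "nrm2 r = 0")
    case True
    then show ?thesis unfolding res ig by simp
  next
    case False
    have "ip (e' n) g * e' n x = (a * cnj a * of_real (nrm2 r)) * r x" for x
      by (simp only: ig) (simp add: e'n mult_ac)
    then have "(\<lambda>x. r x - ip (e' n) g * e' n x) = (\<lambda>_. 0)"
      using sq False by simp
    then show ?thesis unfolding res using ip_zero[OF zero_closed] by (simp add: nrm2_def)
  qed
qed

lemma proj_cong: "(\<And>k. k < n \<Longrightarrow> e k = e' k) \<Longrightarrow> proj e n g = proj e' n g"
  by (simp add: proj_def)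

lemma orthosystem_cong:
  assumes eq: "\<And>k. k < n \<Longrightarrow> e k = e' k" and e: "orthosystem e n"
  shows "orthosystem e' n"
  unfolding orthosystem_def
proof (intro allI impI conjI)
  fix j assume j: "j < n"
  show "e' j \<in> G" using orthosystemD(1)[OF e j] eq[OF j] by simp
  show "ip (e' j) (e' j) = 0 \<or> ip (e' j) (e' j) = 1" using orthosystemD(2)[OF e j] eq[OF j] by simp
  fix i assume "i < n" "i \<noteq> j"
  then show "ip (e' i) (e' j) = 0" using orthosystemD(3)[OF e, of i j] eq[of i] eq[OF j] j by simp
qed

lemma orthonormalisation:
  assumes v: "\<And>n. v n \<in> G"
  shows "\<exists>e. \<forall>n. orthosystem e n \<and> nrm2 (\<lambda>x. v n x - proj e (Suc n) (v n) x) = 0"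
proof -
  define step where "step n e = e(n := (\<lambda>x. of_real (1 / sqrt (nrm2 (\<lambda>x. v n x - proj e n (v n) x)))
      * (v n x - proj e n (v n) x)))" for n and e :: "nat \<Rightarrow> 'a \<Rightarrow> complex"
  define E where "E = rec_nat (\<lambda>_ _. 0) step"
  have E_Suc: "E (Suc n) = step n (E n)" for n by (simp add: E_def)
  have E_os: "orthosystem (E n) n" for n
  proof (induction n)
    case (Suc n)
    then show ?case unfolding E_Suc step_def by (rule orthosystem_extend(1)[OF _ v])
  qed (simp add: orthosystem_def)
  have E_res: "nrm2 (\<lambda>x. v n x - proj (E (Suc n)) (Suc n) (v n) x) = 0" for n
    unfolding E_Suc step_def by (rule orthosystem_extend(2)[OF E_os v])
  have E_stable: "k < n \<Longrightarrow> E n k = E (Suc k) k" for n k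
  proof (induction n)
    case (Suc n)
    show ?case
    proof (cases "k = n")
      case False
      then have "E (Suc n) k = E n k" using E_Suc[of n] by (simp add: step_def)
      then show ?thesis using Suc False by simp
    qed simp
  qed simp
  define e where "e k = E (Suc k) k" for k
  have eE: "k < n \<Longrightarrow> E n k = e k" for k n unfolding e_def by (rule E_stable)
  have "orthosystem e n" for n
    by (rule orthosystem_cong[OF eE E_os])
  moreover have "nrm2 (\<lambda>x. v n x - proj e (Suc n) (v n) x) = 0" for n
    using E_res[of n] proj_cong[of "Suc n" "E (Suc n)" e "v n", OF eE] by simp
  ultimately show ?thesis by blast
qed

lemma null_sum:
  assumes "\<And>i. i \<in> I \<Longrightarrow> z i \<in> G" "\<And>i. i \<in> I \<Longrightarrow> nrm2 (z i) = 0"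
  shows "nrm2 (\<lambda>x. \<Sum>i\<in>I. a i * z i x) = 0"
proof -
  have s: "(\<lambda>x. \<Sum>i\<in>I. a i * z i x) \<in> G" by (rule sum_closed[OF assms(1)])
  have "ip (\<lambda>x. \<Sum>i\<in>I. a i * z i x) (\<lambda>x. \<Sum>i\<in>I. a i * z i x) = (\<Sum>i\<in>I. a i * ip (\<lambda>x. \<Sum>i\<in>I. a i * z i x) (z i))"
    by (rule ip_sum[OF s assms(1)])
  also have "\<dots> = 0" using null_ip(2)[OF assms s] by (intro sum.neutral) simp
  finally show ?thesis by (simp add: nrm2_def)
qed

end

text \<open>The completion of a semi-inner product space, realised on the square summable functions on a
  subset \<open>S\<close> of the range of an injection of the naturals. The linear isometry \<open>U\<close> maps onto the
  finitely supported functions, and \<open>R\<close> is a right inverse of it.\<close>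

locale l2_representation = semi_inner_product G ip
  for G :: "('a \<Rightarrow> complex) set" and ip +
  fixes \<iota> :: "nat \<Rightarrow> 'x" and S :: "'x set" and U R
  assumes inj: "inj \<iota>" and S: "S \<subseteq> range \<iota>"
    and U_finsupp: "g \<in> G \<Longrightarrow> U g \<in> finsupp S"
    and U_add: "g \<in> G \<Longrightarrow> h \<in> G \<Longrightarrow> U (\<lambda>x. g x + h x) = (\<lambda>y. U g y + U h y)"
    and U_scale: "g \<in> G \<Longrightarrow> U (\<lambda>x. a * g x) = (\<lambda>y. a * U g y)"
    and U_norm: "g \<in> G \<Longrightarrow> (ell2_norm (U g))\<^sup>2 = nrm2 g"
    and R_closed: "\<phi> \<in> finsupp S \<Longrightarrow> R \<phi> \<in> G"
    and U_R: "\<phi> \<in> finsupp S \<Longrightarrow> U (R \<phi>) = \<phi>"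

text \<open>The coordinates are the Fourier coefficients with respect to an orthonormalisation \<open>e\<close> of the
  spanning sequence; the members of \<open>e\<close> that are null vectors are left out of \<open>S\<close>. A vector in the span
  of the first \<open>N\<close> members of the sequence differs from its projection to the first \<open>N\<close> members of
  \<open>e\<close> by a null vector, so it has finitely many coordinates and satisfies Parseval's identity.\<close>

lemma (in semi_inner_product) l2_representation_exists:
  fixes \<iota> :: "nat \<Rightarrow> 'x"
  assumes v: "\<And>n. v n \<in> G" and span: "\<And>g. g \<in> G \<Longrightarrow> \<exists>N a. g = (\<lambda>x. \<Sum>n<(N::nat). a n * v n x)"
    and inj: "inj \<iota>"
  shows "\<exists>S U R. l2_representation G ip \<iota> S U R"
proof -
  have "\<exists>e. \<forall>n. orthosystem e n \<and> nrm2 (\<lambda>x. v n x - proj e (Suc n) (v n) x) = 0"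
    by (rule orthonormalisation[OF v])
  then obtain e where e: "\<forall>n. orthosystem e n \<and> nrm2 (\<lambda>x. v n x - proj e (Suc n) (v n) x) = 0"
    by (rule exE)
  have os: "orthosystem e n" and res: "nrm2 (\<lambda>x. v n x - proj e (Suc n) (v n) x) = 0" for n
    using e by simp_all
  have eG: "e k \<in> G" for k using orthosystemD(1)[OF os, of k "Suc k"] by simp
  have e01: "ip (e k) (e k) = 0 \<or> ip (e k) (e k) = 1" for k using orthosystemD(2)[OF os, of k "Suc k"] by simp
  have eo: "i \<noteq> j \<Longrightarrow> ip (e i) (e j) = 0" for i j
    using orthosystemD(3)[OF os, of i "Suc (max i j)" j] by simp
  define null where "null M g \<longleftrightarrow> nrm2 (\<lambda>x. g x - proj e M g x) = 0" for M g
  have coord0: "ip (e j) g = 0" if "null M g" "g \<in> G" "M \<le> j" for M g j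
  proof -
    have "ip (e j) (\<lambda>x. g x - proj e M g x) = 0"
      using null_ip(2)[OF diff_closed[OF that(2) proj_closed[OF os]] _ eG] that(1) by (simp add: null_def)
    moreover have "ip (e j) (proj e M g) = (\<Sum>k<M. ip (e k) g * ip (e j) (e k))"
      unfolding proj_def by (rule ip_sum[OF eG eG])
    moreover have "\<dots> = 0" using that(3) by (intro sum.neutral) (auto simp: eo)
    ultimately show ?thesis using ip_diff[OF eG that(2) proj_closed[OF os], of j] by simp
  qed
  have null_mono: "null N g" if "null M g" "g \<in> G" "M \<le> N" for M N g
  proof -
    have "proj e N g = proj e M g"
      unfolding proj_def using that coord0[OF that(1,2)]
      by (intro ext sum.mono_neutral_right) auto
    then show ?thesis using that(1) by (simp add: null_def)
  qed
  have ex_null: "\<exists>M. null M g" if g: "g \<in> G" for g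
  proof -
    obtain N a where gs: "g = (\<lambda>x. \<Sum>n<N. a n * v n x)" using span[OF g] by (elim exE)
    have nv: "nrm2 (\<lambda>x. v n x - proj e N (v n) x) = 0" if "n < N" for n
      using null_mono[of "Suc n" "v n" N] res[of n] v that by (simp add: null_def)
    have "proj e N g x = (\<Sum>n<N. a n * proj e N (v n) x)" for x
    proof -
      have "ip (e k) g = (\<Sum>n<N. a n * ip (e k) (v n))" for k
        unfolding gs by (rule ip_sum[OF eG v])
      then have "proj e N g x = (\<Sum>k<N. \<Sum>n<N. a n * ip (e k) (v n) * e k x)"
        by (simp add: proj_def sum_distrib_right)
      also have "\<dots> = (\<Sum>n<N. \<Sum>k<N. a n * ip (e k) (v n) * e k x)" by (rule sum.swap)
      finally show ?thesis by (simp add: proj_def sum_distrib_left mult.assoc)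
    qed
    then have "(\<lambda>x. g x - proj e N g x) = (\<lambda>x. \<Sum>n<N. a n * (v n x - proj e N (v n) x))"
      by (simp add: gs sum_subtractf right_diff_distrib)
    then have "null N g" unfolding null_def
      using null_sum[of "{..<N}" "\<lambda>n x. v n x - proj e N (v n) x" a] nv diff_closed[OF v proj_closed[OF os]] by simp
    then show ?thesis by blast
  qed
  define A where "A = {n. ip (e n) (e n) = 1}"
  define U where "U g x = (if x \<in> range \<iota> then ip (e (inv_into UNIV \<iota> x)) g else 0)" for g x
  have U\<iota>: "U g (\<iota> n) = ip (e n) g" for g n using inj by (simp add: U_def)
  have Uout: "U g x = 0" if "x \<notin> \<iota> ` A" "g \<in> G" for g x
  proof (cases "x \<in> range \<iota>")
    case True
    then obtain n where n: "x = \<iota> n" by blast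
    then have "ip (e n) (e n) = 0" using that(1) e01[of n] by (auto simp: A_def)
    then show ?thesis using null_ip(1)[OF eG _ that(2), of n] by (simp add: n U\<iota> nrm2_def)
  qed (simp add: U_def)
  have Usupp: "U g x = 0" if "null M g" "g \<in> G" "x \<notin> \<iota> ` {..<M}" for M g x
  proof (cases "x \<in> range \<iota>")
    case True
    then obtain n where n: "x = \<iota> n" by blast
    then have "M \<le> n" using that(3) by (auto simp: not_less[symmetric])
    then show ?thesis using coord0[OF that(1,2)] by (simp add: n U\<iota>)
  qed (simp add: U_def)
  define R where "R \<phi> = (\<lambda>x. \<Sum>n\<in>{n. \<phi> (\<iota> n) \<noteq> 0}. \<phi> (\<iota> n) * e n x)" for \<phi>
  have "l2_representation G ip \<iota> (\<iota> ` A) U R"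
  proof
    show "inj \<iota>" by (rule inj)
    show "\<iota> ` A \<subseteq> range \<iota>" by blast
    show "U g \<in> finsupp (\<iota> ` A)" if g: "g \<in> G" for g
    proof -
      obtain M where M: "null M g" using ex_null[OF g] by blast
      show ?thesis
        by (rule finsuppI[of "\<iota> ` {..<M}"]) (use Usupp[OF M g] Uout[OF _ g] in auto)
    qed
    show "U (\<lambda>x. g x + h x) = (\<lambda>y. U g y + U h y)" if "g \<in> G" "h \<in> G" for g h
      by (rule ext) (simp add: U_def ip_add[OF eG that])
    show "U (\<lambda>x. a * g x) = (\<lambda>y. a * U g y)" if "g \<in> G" for a g
      by (rule ext) (simp add: U_def ip_scale[OF eG that])
    show "(ell2_norm (U g))\<^sup>2 = nrm2 g" if g: "g \<in> G" for g
    proof -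
      obtain M where M: "null M g" using ex_null[OF g] by blast
      let ?p = "proj e M g" and ?z = "\<lambda>x. g x - proj e M g x"
      have p: "?p \<in> G" by (rule proj_closed[OF os])
      have z: "?z \<in> G" "nrm2 ?z = 0" using diff_closed[OF g p] M by (auto simp: null_def)
      have "ell2_norm (U g) = L2_set (\<lambda>x. cmod (U g x)) (\<iota> ` {..<M})"
        by (rule ell2_norm_finite_support(1)) (use Usupp[OF M g] in auto)
      then have "(ell2_norm (U g))\<^sup>2 = (\<Sum>x\<in>\<iota> ` {..<M}. (cmod (U g x))\<^sup>2)"
        by (simp add: L2_set_def sum_nonneg)
      also have "\<dots> = (\<Sum>k<M. (cmod (ip (e k) g))\<^sup>2)"
        using inj by (subst sum.reindex) (auto simp: U\<iota> inj_on_def)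
      finally have 1: "(ell2_norm (U g))\<^sup>2 = (\<Sum>k<M. (cmod (ip (e k) g))\<^sup>2)" .
      have zero: "ip ?z g = 0" by (rule null_ip(1)[OF z g])
      have "ip g ?p = (\<Sum>k<M. ip (e k) g * ip g (e k))"
        unfolding proj_def by (rule ip_sum[OF g eG])
      also have "\<dots> = (\<Sum>k<M. of_real ((cmod (ip (e k) g))\<^sup>2))"
        by (intro sum.cong refl) (simp only: complex_norm_square ip_cnj[OF eG g])
      finally have 2: "ip g ?p = of_real (\<Sum>k<M. (cmod (ip (e k) g))\<^sup>2)" by simp
      have "ip g g = ip ?p g" using ip_diff_left[OF g g p] zero by simp
      also have "\<dots> = cnj (ip g ?p)" by (rule ip_cnj[OF g p])
      finally show ?thesis using 1 2 by (simp add: nrm2_def)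
    qed
    have fin: "finite {n. \<phi> (\<iota> n) \<noteq> 0}" if "\<phi> \<in> finsupp (\<iota> ` A)" for \<phi>
    proof -
      have "finite (\<iota> -` {x. \<phi> x \<noteq> 0})"
        by (rule finite_vimageI[OF finsuppD(1)[OF that] inj])
      then show ?thesis by (simp add: vimage_def)
    qed
    show "R \<phi> \<in> G" if "\<phi> \<in> finsupp (\<iota> ` A)" for \<phi>
      unfolding R_def by (rule sum_closed[OF eG])
    show "U (R \<phi>) = \<phi>" if \<phi>: "\<phi> \<in> finsupp (\<iota> ` A)" for \<phi>
    proof
      fix x
      show "U (R \<phi>) x = \<phi> x"
      proof (cases "x \<in> \<iota> ` A")
        case True
        then obtain j where j: "x = \<iota> j" "ip (e j) (e j) = 1" by (auto simp: A_def)
        have "U (R \<phi>) x = (\<Sum>n\<in>{n. \<phi> (\<iota> n) \<noteq> 0}. \<phi> (\<iota> n) * ip (e j) (e n))"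
          unfolding j(1) U\<iota> R_def by (rule ip_sum[OF eG eG])
        also have "\<dots> = (\<Sum>n\<in>{n. \<phi> (\<iota> n) \<noteq> 0}. if n = j then \<phi> (\<iota> j) else 0)"
          using j(2) eo[of j] by (intro sum.cong) auto
        also have "\<dots> = \<phi> (\<iota> j)" using fin[OF \<phi>] by simp
        finally show ?thesis by (simp add: j)
      next
        case False
        have "R \<phi> \<in> G" unfolding R_def by (rule sum_closed[OF eG])
        then show ?thesis using finsuppD(2)[OF \<phi> False] Uout[OF False] by simp
      qed
    qed
  qed
  then show ?thesis by (intro exI)
qed

context l2_representation
begin

lemma U_ell2: "g \<in> G \<Longrightarrow> U g \<in> ell2 S"
  by (rule finsupp_ell2[OF U_finsupp])

lemma U_diff: "g \<in> G \<Longrightarrow> h \<in> G \<Longrightarrow> U (\<lambda>x. g x - h x) = (\<lambda>y. U g y - U h y)"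
  using U_add[of g "\<lambda>x. (- 1) * h x"] U_scale[of h "- 1"] scale_closed[of h "- 1"] by simp

lemma U_sum:
  assumes "\<And>i. i \<in> I \<Longrightarrow> g i \<in> G"
  shows "U (\<lambda>x. \<Sum>i\<in>I. a i * g i x) = (\<lambda>y. \<Sum>i\<in>I. a i * U (g i) y)"
  using assms
proof (induction I rule: infinite_finite_induct)
  case (insert i I)
  then show ?case
    using U_add[OF scale_closed[of "g i" "a i"] sum_closed[of I g a]] U_scale[of "g i" "a i"] by simp
qed (use U_scale[OF zero_closed, of 0] in simp_all)

lemma ell2_norm_U: "g \<in> G \<Longrightarrow> ell2_norm (U g) = sqrt (nrm2 g)"
  using U_norm[of g] ell2_norm_nonneg[of "U g"] by (metis real_sqrt_unique)

lemma U_eqI: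
  assumes "g \<in> G" "h \<in> G" "nrm2 (\<lambda>x. g x - h x) = 0" shows "U g = U h"
proof -
  have "ell2_norm (U (\<lambda>x. g x - h x)) = 0"
    using ell2_norm_U[OF diff_closed[OF assms(1,2)]] assms(3) by simp
  then have "U (\<lambda>x. g x - h x) = (\<lambda>_. 0)"
    using ell2_norm_eq_zero_iff[OF U_ell2[OF diff_closed[OF assms(1,2)]]] by simp
  then show ?thesis using U_diff[OF assms(1,2)] by (simp add: fun_eq_iff)
qed

lemma R_U_null: "g \<in> G \<Longrightarrow> nrm2 (\<lambda>x. R (U g) x - g x) = 0"
proof -
  assume g: "g \<in> G"
  have R: "R (U g) \<in> G" by (rule R_closed[OF U_finsupp[OF g]])
  have "U (\<lambda>x. R (U g) x - g x) = (\<lambda>_. 0)" by (simp only: U_diff[OF R g] U_R[OF U_finsupp[OF g]]) simp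
  then show ?thesis using U_norm[OF diff_closed[OF R g]] by simp
qed

text \<open>A bounded map preserves null vectors, hence it descends to the finitely supported functions and
  extends by continuity.\<close>

lemma transported_operator:
  assumes closed: "\<And>g. g \<in> G \<Longrightarrow> A g \<in> G"
    and add: "\<And>g h. g \<in> G \<Longrightarrow> h \<in> G \<Longrightarrow> A (\<lambda>x. g x + h x) = (\<lambda>x. A g x + A h x)"
    and scale: "\<And>a g. g \<in> G \<Longrightarrow> A (\<lambda>x. a * g x) = (\<lambda>x. a * A g x)"
    and bound: "\<And>g. g \<in> G \<Longrightarrow> nrm2 (A g) \<le> K\<^sup>2 * nrm2 g" and K: "0 \<le> K"
  shows "\<exists>T. bounded_op S T \<and> (\<forall>g\<in>G. T (U g) = U (A g))"
proof -
  have diff: "A (\<lambda>x. g x - h x) = (\<lambda>x. A g x - A h x)" if "g \<in> G" "h \<in> G" for g h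
    using add[OF that(1) scale_closed[OF that(2), of "- 1"]] scale[OF that(2), of "- 1"] by simp
  have cong: "U (A g) = U (A h)" if gh: "g \<in> G" "h \<in> G" "nrm2 (\<lambda>x. g x - h x) = 0" for g h
  proof (rule U_eqI)
    show "nrm2 (\<lambda>x. A g x - A h x) = 0"
      using bound[OF diff_closed[OF gh(1,2)]] nrm2_nonneg[OF closed[OF diff_closed[OF gh(1,2)]]] gh(3)
      by (simp add: diff[OF gh(1,2)])
  qed (simp_all add: closed gh)
  define T0 where "T0 \<phi> = U (A (R \<phi>))" for \<phi>
  have T0U: "T0 (U g) = U (A g)" if "g \<in> G" for g
    unfolding T0_def by (rule cong[OF R_closed[OF U_finsupp[OF that]] that R_U_null[OF that]])
  show ?thesis
  proof (rule bounded_op_extension[OF S inj, where ?T0.0 = T0 and S' = S and K = K])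
    show "T0 \<phi> \<in> ell2 S" if "\<phi> \<in> finsupp S" for \<phi>
      unfolding T0_def by (rule U_ell2[OF closed[OF R_closed[OF that]]])
    show "T0 (\<lambda>x. \<phi> x + \<psi> x) = (\<lambda>y. T0 \<phi> y + T0 \<psi> y)" if "\<phi> \<in> finsupp S" "\<psi> \<in> finsupp S" for \<phi> \<psi>
      using T0U[OF add_closed[OF R_closed[OF that(1)] R_closed[OF that(2)]]]
      by (simp only: U_add[OF R_closed[OF that(1)] R_closed[OF that(2)]] U_R[OF that(1)] U_R[OF that(2)]
          add[OF R_closed[OF that(1)] R_closed[OF that(2)]]
          U_add[OF closed[OF R_closed[OF that(1)]] closed[OF R_closed[OF that(2)]]] T0_def)
    show "T0 (\<lambda>x. a * \<phi> x) = (\<lambda>y. a * T0 \<phi> y)" if "\<phi> \<in> finsupp S" for a \<phi>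
      using T0U[OF scale_closed[OF R_closed[OF that]], of a]
      by (simp only: U_scale[OF R_closed[OF that]] U_R[OF that] scale[OF R_closed[OF that]]
          U_scale[OF closed[OF R_closed[OF that]]] T0_def)
    show "ell2_norm (T0 \<phi>) \<le> K * ell2_norm \<phi>" if \<phi>: "\<phi> \<in> finsupp S" for \<phi>
    proof -
      have "ell2_norm (T0 \<phi>) \<le> sqrt (K\<^sup>2 * nrm2 (R \<phi>))"
        unfolding T0_def using ell2_norm_U[OF closed[OF R_closed[OF \<phi>]]] bound[OF R_closed[OF \<phi>]] by simp
      also have "\<dots> = K * ell2_norm (U (R \<phi>))"
        using ell2_norm_U[OF R_closed[OF \<phi>]] K by (simp add: real_sqrt_mult)
      finally show ?thesis using U_R[OF \<phi>] by simp
    qed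
  next
    fix T assume T: "\<And>f. f \<in> ell2 S \<Longrightarrow> T f \<in> ell2 S"
      "\<And>f g. f \<in> ell2 S \<Longrightarrow> g \<in> ell2 S \<Longrightarrow> T (\<lambda>x. f x + g x) = (\<lambda>y. T f y + T g y)"
      "\<And>a f. f \<in> ell2 S \<Longrightarrow> T (\<lambda>x. a * f x) = (\<lambda>y. a * T f y)"
      "\<And>f. f \<in> ell2 S \<Longrightarrow> ell2_norm (T f) \<le> K * ell2_norm f"
      "\<And>f. f \<in> finsupp S \<Longrightarrow> T f = T0 f"
    have "bounded_op S T" by (rule bounded_opI[OF T(1-4)])
    moreover have "\<forall>g\<in>G. T (U g) = U (A g)" using T(5)[OF U_finsupp] T0U by simp
    ultimately show ?thesis by (intro exI[of _ T] conjI)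
  qed
qed

text \<open>The image of \<open>U\<close> contains all truncations and is therefore dense.\<close>

lemma bounded_op_eqI:
  assumes A: "bounded_op S A" and B: "bounded_op S B"
    and eq: "\<And>g. g \<in> G \<Longrightarrow> A (U g) = B (U g)" and f: "f \<in> ell2 S"
  shows "A f = B f"
proof -
  define cut where "cut n = (\<lambda>x. if x \<in> \<iota> ` {..<n} then f x else 0)" for n
  have cut: "cut n \<in> finsupp S" for n unfolding cut_def by (rule truncation_finsupp[OF f]) simp
  note cl = finsupp_ell2[OF cut]
  have lim: "(\<lambda>n. ell2_norm (\<lambda>x. cut n x - f x)) \<longlonglongrightarrow> 0"
    unfolding cut_def by (rule ell2_truncations_converge[OF f S inj])
  have D: "bounded_op S (\<lambda>f x. A f x - B f x)" by (rule bounded_op_diff_op[OF A B])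
  have "(\<lambda>n. ell2_norm (\<lambda>x. (A (cut n) x - B (cut n) x))) \<longlonglongrightarrow> ell2_norm (\<lambda>x. A f x - B f x)"
    by (rule ell2_norm_tendsto[OF bounded_opD(1)[OF D cl] bounded_opD(1)[OF D f] bounded_op_continuous[OF D cl f lim]])
  moreover have "A (cut n) = B (cut n)" for n using eq[OF R_closed[OF cut]] by (simp only: U_R[OF cut])
  ultimately have "(\<lambda>n. 0) \<longlonglongrightarrow> ell2_norm (\<lambda>x. A f x - B f x)" by simp
  then have "ell2_norm (\<lambda>x. A f x - B f x) = 0" by (simp add: LIMSEQ_const_iff)
  then have "(\<lambda>x. A f x - B f x) = (\<lambda>_. 0)" using ell2_norm_eq_zero_iff[OF bounded_opD(1)[OF D f]] by simp
  then show ?thesis by (simp add: fun_eq_iff)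
qed

end

section \<open>The cone of hermitian kernels generated by the constraints\<close>

text \<open>A row of \<open>\<beta>\<close> polynomials is treated as a scalar function of a point and a column index \<open>b < \<beta>\<close>. The
  basic rows have a product of coordinates in one column; products are indexed by words, which are
  easier to extend by a coordinate than exponent vectors.\<close>

definition word :: "'d list \<Rightarrow> nat \<Rightarrow> (complex ^ 'd::finite) \<times> nat \<Rightarrow> complex" where
  "word w b x = (if snd x = b then (\<Prod>i\<leftarrow>w. vec_nth (fst x) i) else 0)"

inductive_set polys :: "nat \<Rightarrow> ((complex ^ 'd::finite) \<times> nat \<Rightarrow> complex) set" for \<beta> where
  polys_zero: "(\<lambda>_. 0) \<in> polys \<beta>"
| polys_step: "g \<in> polys \<beta> \<Longrightarrow> b < \<beta> \<Longrightarrow> (\<lambda>x. g x + a * word w b x) \<in> polys \<beta>"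

lemma polys_add:
  assumes "g \<in> polys \<beta>" "h \<in> polys \<beta>" shows "(\<lambda>x. g x + h x) \<in> polys \<beta>"
  using assms(2)
proof induction
  case (polys_step h b a w)
  then show ?case using polys.polys_step[of "\<lambda>x. g x + h x" \<beta> b a w] by (simp add: add.assoc)
qed (simp add: assms(1))

lemma polys_scale:
  assumes "g \<in> polys \<beta>" shows "(\<lambda>x. a * g x) \<in> polys \<beta>"
  using assms
proof induction
  case (polys_step h b a' w)
  then show ?case using polys.polys_step[of "\<lambda>x. a * h x" \<beta> b "a * a'" w]
    by (simp add: distrib_left mult.assoc)
qed (simp add: polys_zero)

lemma polys_word: "b < \<beta> \<Longrightarrow> word w b \<in> polys \<beta>"
  using polys_step[OF polys_zero, of b \<beta> 1 w] by simp

lemma word_Cons: "word (i # w) b = (\<lambda>x. vec_nth (fst x) i * word w b x)"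
  by (auto simp: word_def fun_eq_iff)

lemma polys_coord:
  assumes "g \<in> polys \<beta>" shows "(\<lambda>x. vec_nth (fst x) i * g x) \<in> polys \<beta>"
  using assms
proof induction
  case (polys_step h b a w)
  then show ?case
    using polys.polys_step[of "\<lambda>x. vec_nth (fst x) i * h x" \<beta> b a "i # w"]
    by (simp add: distrib_left mult.left_commute word_Cons)
qed (simp add: polys_zero)

lemma polys_sum:
  assumes "\<And>i. i \<in> I \<Longrightarrow> g i \<in> polys \<beta>" shows "(\<lambda>x. \<Sum>i\<in>I. g i x) \<in> polys \<beta>"
  using assms
proof (induction I rule: infinite_finite_induct)
  case (insert i I)
  then show ?case using polys_add[of "g i" \<beta> "\<lambda>x. \<Sum>i\<in>I. g i x"] by simp
qed (simp_all add: polys_zero)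

lemma polys_peval:
  assumes g: "g \<in> polys \<beta>" shows "(\<lambda>x. peval p (fst x) * g x) \<in> polys \<beta>"
proof -
  have pow: "(\<lambda>x. vec_nth (fst x) i ^ n * g x) \<in> polys \<beta>" if "g \<in> polys \<beta>" for i n and g :: "(complex ^ 'a) \<times> nat \<Rightarrow> complex"
  proof (induction n)
    case (Suc n)
    then show ?case using polys_coord[OF Suc, of i] by (simp add: mult.assoc)
  qed (simp add: that)
  have "(\<lambda>x. (\<Prod>i\<in>I. vec_nth (fst x) i ^ e i) * g x) \<in> polys \<beta>" for I and e :: "'a \<Rightarrow> nat"
  proof (induction I rule: infinite_finite_induct)
    case (insert i I)
    then show ?case using pow[OF insert.IH, of i "e i"] by (simp add: mult.assoc)
  qed (simp_all add: g)
  then have "(\<lambda>x. meval \<mu> (fst x) * g x) \<in> polys \<beta>" for \<mu> by (simp add: meval_def)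
  then have "(\<lambda>x. \<Sum>\<mu>\<in>Poly_Mapping.keys p. Poly_Mapping.lookup p \<mu> * (meval \<mu> (fst x) * g x)) \<in> polys \<beta>"
    by (intro polys_sum polys_scale)
  then show ?thesis by (simp add: peval_eq_sum sum_distrib_right mult.assoc)
qed

definition dyad :: "('p \<Rightarrow> complex) \<Rightarrow> 'p \<Rightarrow> 'p \<Rightarrow> complex" where
  "dyad g = (\<lambda>x y. cnj (g x) * g y)"

lemma dyad_scale: "dyad (\<lambda>x. a * g x) = (\<lambda>x y. of_real ((cmod a)\<^sup>2) * dyad g x y)"
  by (simp only: dyad_def complex_norm_square complex_cnj_mult) (simp add: mult_ac)

locale hermitian_kernels =
  fixes k \<beta> :: nat and l m :: "nat \<Rightarrow> nat" and P :: "nat \<Rightarrow> 'd::finite mpoly mat" and c :: real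
  assumes arch: "\<exists>(n0::nat) (n::nat \<Rightarrow> nat) h0 h. \<forall>w z.
    complex_of_real (c\<^sup>2) - cnj (vec_nth w i) * vec_nth z i =
      (\<Sum>t<n0. cnj (peval (h0 t) w) * peval (h0 t) z) +
      (\<Sum>j<k. \<Sum>b<n j. defect (l j) (m j) (\<lambda>r s. peval (P j $$ (r, s))) (\<lambda>s. peval (h j b s)) w z)"
begin

definition Pmult :: "nat \<Rightarrow> (nat \<Rightarrow> (complex ^ 'd) \<times> nat \<Rightarrow> complex) \<Rightarrow> nat \<Rightarrow> (complex ^ 'd) \<times> nat \<Rightarrow> complex" where
  "Pmult j h r = (\<lambda>x. \<Sum>s<m j. peval (P j $$ (r, s)) (fst x) * h s x)"

text \<open>The kernel \<open>h(x)\<^sup>* (I - P\<^sub>j(x)\<^sup>* P\<^sub>j(y)) h(y)\<close>, where \<open>h\<close> is a matrix polynomial with \<open>m\<^sub>j\<close> rows; the sum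
  form separates the squares \<open>dyad\<close> of either sign.\<close>

definition gen :: "nat \<Rightarrow> (nat \<Rightarrow> (complex ^ 'd) \<times> nat \<Rightarrow> complex) \<Rightarrow> (complex ^ 'd) \<times> nat \<Rightarrow> (complex ^ 'd) \<times> nat \<Rightarrow> complex" where
  "gen j h = (\<lambda>x y. (\<Sum>s<m j. dyad (h s) x y) - (\<Sum>r<l j. dyad (Pmult j h r) x y))"

inductive_set cone :: "((complex ^ 'd) \<times> nat \<Rightarrow> (complex ^ 'd) \<times> nat \<Rightarrow> complex) set" where
  cone_zero: "(\<lambda>_ _. 0) \<in> cone"
| cone_dyad: "K \<in> cone \<Longrightarrow> g \<in> polys \<beta> \<Longrightarrow> (\<lambda>x y. K x y + dyad g x y) \<in> cone"
| cone_gen: "K \<in> cone \<Longrightarrow> j < k \<Longrightarrow> (\<And>s. s < m j \<Longrightarrow> h s \<in> polys \<beta>) \<Longrightarrow> (\<lambda>x y. K x y + gen j h x y) \<in> cone"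

lemma Pmult_closed: "(\<And>s. s < m j \<Longrightarrow> h s \<in> polys \<beta>) \<Longrightarrow> Pmult j h r \<in> polys \<beta>"
  unfolding Pmult_def by (intro polys_sum polys_peval) auto

lemma cone_add:
  assumes "K \<in> cone" "K' \<in> cone" shows "(\<lambda>x y. K x y + K' x y) \<in> cone"
  using assms(2)
proof induction
  case (cone_dyad K' g)
  then show ?case using cone.cone_dyad[of "\<lambda>x y. K x y + K' x y" g] by (simp add: add.assoc)
next
  case (cone_gen K' j h)
  then show ?case using cone.cone_gen[of "\<lambda>x y. K x y + K' x y" j h] by (simp add: add.assoc)
qed (simp add: assms(1))

lemma dyad_in_cone: "g \<in> polys \<beta> \<Longrightarrow> dyad g \<in> cone"
  using cone_dyad[OF cone_zero, of g] by simp

lemma gen_in_cone: "j < k \<Longrightarrow> (\<And>s. s < m j \<Longrightarrow> h s \<in> polys \<beta>) \<Longrightarrow> gen j h \<in> cone"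
  using cone_gen[OF cone_zero, of j h] by simp

lemma cone_sum:
  assumes "\<And>i. i \<in> I \<Longrightarrow> K i \<in> cone" shows "(\<lambda>x y. \<Sum>i\<in>I. K i x y) \<in> cone"
  using assms
proof (induction I rule: infinite_finite_induct)
  case (insert i I)
  then show ?case using cone_add[of "K i" "\<lambda>x y. \<Sum>i\<in>I. K i x y"] by simp
qed (simp_all add: cone_zero)

lemma Pmult_scale: "Pmult j (\<lambda>s x. a * h s x) r = (\<lambda>x. a * Pmult j h r x)"
  by (simp add: Pmult_def sum_distrib_left mult.left_commute)

lemma gen_scale: "gen j (\<lambda>s x. a * h s x) = (\<lambda>x y. of_real ((cmod a)\<^sup>2) * gen j h x y)"
  by (simp only: gen_def Pmult_scale dyad_scale sum_distrib_left right_diff_distrib)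

lemma cone_scale:
  assumes "K \<in> cone" "0 \<le> t" shows "(\<lambda>x y. of_real t * K x y) \<in> cone"
proof -
  have t: "t = (cmod (of_real (sqrt t)))\<^sup>2" using assms(2) by simp
  show ?thesis
    using assms(1)
  proof induction
    case (cone_dyad K g)
    have "(\<lambda>x y. of_real t * K x y + dyad (\<lambda>x. of_real (sqrt t) * g x) x y) \<in> cone"
      by (rule cone.cone_dyad[OF cone_dyad.IH polys_scale[OF cone_dyad.hyps(2)]])
    then show ?case by (simp only: dyad_scale t[symmetric] distrib_left)
  next
    case (cone_gen K j h)
    have "(\<lambda>x y. of_real t * K x y + gen j (\<lambda>s x. of_real (sqrt t) * h s x) x y) \<in> cone"
      by (rule cone.cone_gen[OF cone_gen.IH cone_gen.hyps(2) polys_scale[OF cone_gen.hyps(3)]])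
    then show ?case by (simp only: gen_scale t[symmetric] distrib_left)
  qed (simp add: cone_zero)
qed

text \<open>The Archimedean identity is multiplied by \<open>dyad g\<close>, which multiplies each polynomial \<open>h\<close> in it by \<open>g\<close>.\<close>

lemma coordinate_bound:
  assumes g: "g \<in> polys \<beta>"
  shows "(\<lambda>x y. of_real (c\<^sup>2) * dyad g x y - dyad (\<lambda>x. vec_nth (fst x) i * g x) x y) \<in> cone"
proof -
  obtain n0 :: nat and n :: "nat \<Rightarrow> nat" and h0 h where id: "\<forall>w z.
    complex_of_real (c\<^sup>2) - cnj (vec_nth w i) * vec_nth z i =
      (\<Sum>t<n0. cnj (peval (h0 t) w) * peval (h0 t) z) +
      (\<Sum>j<k. \<Sum>b<n j. defect (l j) (m j) (\<lambda>r s. peval (P j $$ (r, s))) (\<lambda>s. peval (h j b s)) w z)"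
    using arch[of i] by (elim exE)
  let ?g0 = "\<lambda>t x. peval (h0 t) (fst x) * g x"
  let ?h = "\<lambda>j b s x. peval (h j b s) (fst x) * g x"
  have "(\<lambda>x y. (\<Sum>t<n0. dyad (?g0 t) x y) + (\<Sum>j<k. \<Sum>b<n j. gen j (?h j b) x y)) \<in> cone"
    by (intro cone_add cone_sum dyad_in_cone gen_in_cone polys_peval g) auto
  moreover have "of_real (c\<^sup>2) * dyad g x y - dyad (\<lambda>x. vec_nth (fst x) i * g x) x y
    = (\<Sum>t<n0. dyad (?g0 t) x y) + (\<Sum>j<k. \<Sum>b<n j. gen j (?h j b) x y)" for x y
  proof -
    have d0: "dyad (?g0 t) x y = (cnj (peval (h0 t) (fst x)) * peval (h0 t) (fst y)) * dyad g x y" for t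
      by (simp add: dyad_def mult_ac)
    have Ph: "Pmult j (?h j b) r = (\<lambda>x. (\<Sum>s<m j. peval (P j $$ (r, s)) (fst x) * peval (h j b s) (fst x)) * g x)" for j b r
      by (simp add: Pmult_def sum_distrib_right mult.assoc)
    have dg: "gen j (?h j b) x y = defect (l j) (m j) (\<lambda>r s. peval (P j $$ (r, s))) (\<lambda>s. peval (h j b s)) (fst x) (fst y)
        * dyad g x y" for j b
      unfolding gen_def defect_def Ph left_diff_distrib sum_distrib_right[of _ _ "dyad g x y"]
      by (intro arg_cong2[where f = minus] sum.cong refl) (simp_all add: dyad_def mult_ac)
    have "of_real (c\<^sup>2) * dyad g x y - dyad (\<lambda>x. vec_nth (fst x) i * g x) x y
      = (complex_of_real (c\<^sup>2) - cnj (vec_nth (fst x) i) * vec_nth (fst y) i) * dyad g x y"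
      by (simp add: dyad_def algebra_simps)
    also have "\<dots> = (\<Sum>t<n0. dyad (?g0 t) x y) + (\<Sum>j<k. \<Sum>b<n j. gen j (?h j b) x y)"
      unfolding id[rule_format, of "fst x" "fst y"] d0 dg
      by (simp only: distrib_right sum_distrib_right)
    finally show ?thesis .
  qed
  ultimately show ?thesis by simp
qed

definition unit_kernel :: "(complex ^ 'd) \<times> nat \<Rightarrow> (complex ^ 'd) \<times> nat \<Rightarrow> complex" where
  "unit_kernel = (\<lambda>x y. \<Sum>b<\<beta>. dyad (word [] b) x y)"

lemma unit_in_cone: "unit_kernel \<in> cone"
  unfolding unit_kernel_def by (intro cone_sum dyad_in_cone polys_word) auto

text \<open>Each further letter of the word costs a factor \<open>c\<^sup>2\<close>.\<close>

lemma word_bounded: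
  assumes b: "b < \<beta>"
  shows "\<exists>t. (\<lambda>x y. of_real t * unit_kernel x y - dyad (word w b) x y) \<in> cone"
proof (induction w)
  case Nil
  have "(\<lambda>x y. \<Sum>b'\<in>{..<\<beta>} - {b}. dyad (word [] b') x y) \<in> cone"
    by (intro cone_sum dyad_in_cone polys_word) auto
  moreover have "(\<Sum>b'\<in>{..<\<beta>} - {b}. dyad (word [] b') x y) = of_real 1 * unit_kernel x y - dyad (word [] b) x y" for x y
    using b by (simp add: unit_kernel_def sum_diff1)
  ultimately show ?case by (intro exI[of _ 1]) simp
next
  case (Cons i w)
  then obtain t where t: "(\<lambda>x y. of_real t * unit_kernel x y - dyad (word w b) x y) \<in> cone" by blast
  have "(\<lambda>x y. of_real (c\<^sup>2) * (of_real t * unit_kernel x y - dyad (word w b) x y)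
      + (of_real (c\<^sup>2) * dyad (word w b) x y - dyad (word (i # w) b) x y)) \<in> cone"
    unfolding word_Cons by (intro cone_add cone_scale[OF t] coordinate_bound polys_word b) simp
  then show ?case by (intro exI[of _ "c\<^sup>2 * t"]) (simp add: algebra_simps)
qed

text \<open>A sum is treated by the parallelogram law, which implies that \<open>dyad (g + h)\<close> is below
  \<open>2 dyad g + 2 dyad h\<close>.\<close>

lemma polys_bounded:
  assumes "g \<in> polys \<beta>"
  shows "\<exists>t. (\<lambda>x y. of_real t * unit_kernel x y - dyad g x y) \<in> cone"
  using assms
proof induction
  case polys_zero
  show ?case using cone_zero by (intro exI[of _ 0]) (simp add: dyad_def)
next
  case (polys_step g b a w)
  obtain t where t: "(\<lambda>x y. of_real t * unit_kernel x y - dyad g x y) \<in> cone" using polys_step.IH by blast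
  obtain u where u: "(\<lambda>x y. of_real u * unit_kernel x y - dyad (word w b) x y) \<in> cone"
    using word_bounded[OF polys_step.hyps(2)] by blast
  let ?h = "\<lambda>x. a * word w b x"
  have gh: "(\<lambda>x. g x + (- 1) * ?h x) \<in> polys \<beta>"
    by (rule polys_add[OF polys_step.hyps(1) polys_scale[OF polys_scale[OF polys_word[OF polys_step.hyps(2)]]]])
  have "(\<lambda>x y. (of_real 2 * (of_real t * unit_kernel x y - dyad g x y)
      + of_real (2 * (cmod a)\<^sup>2) * (of_real u * unit_kernel x y - dyad (word w b) x y))
      + dyad (\<lambda>x. g x + (- 1) * ?h x) x y) \<in> cone"
    by (intro cone_add cone_scale[OF t] cone_scale[OF u] dyad_in_cone[OF gh]) auto
  moreover have "(of_real 2 * (of_real t * unit_kernel x y - dyad g x y)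
      + of_real (2 * (cmod a)\<^sup>2) * (of_real u * unit_kernel x y - dyad (word w b) x y))
      + dyad (\<lambda>x. g x + (- 1) * ?h x) x y
      = of_real (2 * t + 2 * (cmod a)\<^sup>2 * u) * unit_kernel x y - dyad (\<lambda>x. g x + ?h x) x y" for x y
  proof -
    have h: "of_real ((cmod a)\<^sup>2) * dyad (word w b) x y = dyad ?h x y" by (simp add: dyad_scale)
    have par: "dyad (\<lambda>x. g x + (- 1) * ?h x) x y = 2 * dyad g x y + 2 * dyad ?h x y - dyad (\<lambda>x. g x + ?h x) x y"
      by (simp add: dyad_def algebra_simps)
    show ?thesis unfolding par h[symmetric] by (simp add: algebra_simps)
  qed
  ultimately show ?case by (intro exI[of _ "2 * t + 2 * (cmod a)\<^sup>2 * u"]) simp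
qed

lemma cone_representation:
  assumes "K \<in> cone"
  shows "\<exists>(n0::nat) g (n::nat \<Rightarrow> nat) h. (\<forall>t<n0. g t \<in> polys \<beta>)
    \<and> K = (\<lambda>x y. (\<Sum>t<n0. dyad (g t) x y) + (\<Sum>j<k. \<Sum>b<n j. gen j (h j b) x y))"
  using assms
proof induction
  case cone_zero
  show ?case by (intro exI[of _ 0] exI[of _ "\<lambda>_. 0"]) simp
next
  case (cone_dyad K g')
  then obtain n0 :: nat and g and n :: "nat \<Rightarrow> nat" and h where g: "\<forall>t<n0. g t \<in> polys \<beta>"
    and K: "K = (\<lambda>x y. (\<Sum>t<n0. dyad (g t) x y) + (\<Sum>j<k. \<Sum>b<n j. gen j (h j b) x y))" by (elim exE conjE)
  let ?g = "g(n0 := g')"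
  have "(\<Sum>t<Suc n0. dyad (?g t) x y) = (\<Sum>t<n0. dyad (g t) x y) + dyad g' x y" for x y by simp
  then have "(\<lambda>x y. K x y + dyad g' x y) = (\<lambda>x y. (\<Sum>t<Suc n0. dyad (?g t) x y) + (\<Sum>j<k. \<Sum>b<n j. gen j (h j b) x y))"
    unfolding K by (simp add: add_ac)
  moreover have "\<forall>t<Suc n0. ?g t \<in> polys \<beta>" using g cone_dyad.hyps(2) by (simp add: less_Suc_eq)
  ultimately have "(\<forall>t<Suc n0. ?g t \<in> polys \<beta>) \<and> (\<lambda>x y. K x y + dyad g' x y) = (\<lambda>x y. (\<Sum>t<Suc n0. dyad (?g t) x y) + (\<Sum>j<k. \<Sum>b<n j. gen j (h j b) x y))"
    by simp
  then show ?case by (rule exI[of _ "Suc n0", OF exI[of _ ?g, OF exI[of _ n, OF exI[of _ h]]]])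
next
  case (cone_gen K j' h')
  then obtain n0 :: nat and g and n :: "nat \<Rightarrow> nat" and h where g: "\<forall>t<n0. g t \<in> polys \<beta>"
    and K: "K = (\<lambda>x y. (\<Sum>t<n0. dyad (g t) x y) + (\<Sum>j<k. \<Sum>b<n j. gen j (h j b) x y))" by (elim exE conjE)
  let ?n = "n(j' := Suc (n j'))" and ?h = "h(j' := (h j')(n j' := h'))"
  have "(\<Sum>j<k. \<Sum>b<?n j. gen j (?h j b) x y) = (\<Sum>j<k. (\<Sum>b<n j. gen j (h j b) x y) + (if j = j' then gen j' h' x y else 0))" for x y
    by (intro sum.cong refl) auto
  then have "(\<lambda>x y. K x y + gen j' h' x y) = (\<lambda>x y. (\<Sum>t<n0. dyad (g t) x y) + (\<Sum>j<k. \<Sum>b<?n j. gen j (?h j b) x y))"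
    using cone_gen.hyps(2) unfolding K by (simp add: sum.distrib add.assoc)
  with g have "(\<forall>t<n0. g t \<in> polys \<beta>) \<and> (\<lambda>x y. K x y + gen j' h' x y) = (\<lambda>x y. (\<Sum>t<n0. dyad (g t) x y) + (\<Sum>j<k. \<Sum>b<?n j. gen j (?h j b) x y))"
    by simp
  then show ?case by (rule exI[of _ n0, OF exI[of _ g, OF exI[of _ ?n, OF exI[of _ ?h]]]])
qed

end

section \<open>A separating functional as a semi-inner product\<close>

context hermitian_kernels
begin

definition kernels :: "((complex ^ 'd) \<times> nat \<Rightarrow> (complex ^ 'd) \<times> nat \<Rightarrow> complex) set" where
  "kernels = span (dyad ` polys \<beta>)"

lemma fun2_plus: "K + K' = (\<lambda>x y. K x y + K' x y)"
  for K K' :: "'a \<Rightarrow> 'b \<Rightarrow> complex"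
  by (simp add: plus_fun_def)

lemma fun2_minus: "K - K' = (\<lambda>x y. K x y - K' x y)"
  for K K' :: "'a \<Rightarrow> 'b \<Rightarrow> complex"
  by (simp add: fun_diff_def)

lemma fun2_scaleR: "t *\<^sub>R K = (\<lambda>x y. of_real t * K x y)"
  for K :: "'a \<Rightarrow> 'b \<Rightarrow> complex"
  by (simp add: scaleR_fun_def scaleR_conv_of_real)

lemma kernels_zero: "(\<lambda>_ _. 0) \<in> kernels"
  using span_0[of "dyad ` polys \<beta>"] by (simp add: kernels_def zero_fun_def)

lemma kernels_add: "K \<in> kernels \<Longrightarrow> K' \<in> kernels \<Longrightarrow> (\<lambda>x y. K x y + K' x y) \<in> kernels"
  using span_add[of K "dyad ` polys \<beta>" K'] by (simp add: kernels_def fun2_plus)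

lemma kernels_diff: "K \<in> kernels \<Longrightarrow> K' \<in> kernels \<Longrightarrow> (\<lambda>x y. K x y - K' x y) \<in> kernels"
  using span_diff[of K "dyad ` polys \<beta>" K'] by (simp add: kernels_def fun2_minus)

lemma kernels_scale: "K \<in> kernels \<Longrightarrow> (\<lambda>x y. of_real t * K x y) \<in> kernels"
  using span_scale[of K "dyad ` polys \<beta>" t] by (simp add: kernels_def fun2_scaleR)

lemma kernels_dyad: "g \<in> polys \<beta> \<Longrightarrow> dyad g \<in> kernels"
  unfolding kernels_def by (rule span_base) simp

lemma kernels_sum: "(\<And>i. i \<in> I \<Longrightarrow> K i \<in> kernels) \<Longrightarrow> (\<lambda>x y. \<Sum>i\<in>I. K i x y) \<in> kernels"
proof (induction I rule: infinite_finite_induct)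
  case (insert i I)
  then show ?case using kernels_add[of "K i" "\<lambda>x y. \<Sum>i\<in>I. K i x y"] by simp
qed (simp_all add: kernels_zero)

lemma kernels_gen: "(\<And>s. s < m j \<Longrightarrow> h s \<in> polys \<beta>) \<Longrightarrow> gen j h \<in> kernels"
  unfolding gen_def by (intro kernels_diff kernels_sum kernels_dyad Pmult_closed) auto

lemma cone_subset_kernels: "cone \<subseteq> kernels"
proof
  fix K assume "K \<in> cone"
  then show "K \<in> kernels"
    by induction (auto intro: kernels_zero kernels_add kernels_dyad kernels_gen)
qed

lemma order_unit:
  assumes "K \<in> kernels"
  shows "\<exists>t. (\<lambda>x y. of_real t * unit_kernel x y - K x y) \<in> cone"
  using assms unfolding kernels_def
proof (induction rule: span_induct_alt)
  case base
  show ?case using cone_zero by (intro exI[of _ 0]) (simp add: zero_fun_def)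
next
  case (step a K1 K2)
  then obtain g where g: "g \<in> polys \<beta>" "K1 = dyad g" by auto
  obtain t where t: "(\<lambda>x y. of_real t * unit_kernel x y - K2 x y) \<in> cone" using step by blast
  have "\<exists>u. (\<lambda>x y. of_real u * unit_kernel x y - of_real a * dyad g x y) \<in> cone"
  proof (cases "0 \<le> a")
    case True
    obtain u where u: "(\<lambda>x y. of_real u * unit_kernel x y - dyad g x y) \<in> cone"
      using polys_bounded[OF g(1)] by blast
    have "(\<lambda>x y. of_real a * (of_real u * unit_kernel x y - dyad g x y)) \<in> cone"
      by (rule cone_scale[OF u True])
    then show ?thesis by (intro exI[of _ "a * u"]) (simp add: right_diff_distrib mult.assoc)
  next
    case False
    then have "(\<lambda>x y. of_real (- a) * dyad g x y) \<in> cone" by (intro cone_scale dyad_in_cone g(1)) simp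
    then show ?thesis by (intro exI[of _ 0]) simp
  qed
  then obtain u where "(\<lambda>x y. of_real u * unit_kernel x y - of_real a * dyad g x y) \<in> cone" by blast
  from cone_add[OF this t] show ?case
    by (intro exI[of _ "u + t"]) (simp add: g(2) fun2_plus fun2_scaleR algebra_simps)
qed

lemma separating_functional:
  assumes f: "f \<in> kernels" "f \<notin> cone"
  shows "\<exists>L :: ((complex ^ 'd) \<times> nat \<Rightarrow> (complex ^ 'd) \<times> nat \<Rightarrow> complex) \<Rightarrow> real.
    (\<forall>K\<in>kernels. \<forall>K'\<in>kernels. L (\<lambda>x y. K x y + K' x y) = L K + L K')
    \<and> (\<forall>t. \<forall>K\<in>kernels. L (\<lambda>x y. of_real t * K x y) = t * L K)
    \<and> (\<forall>K\<in>cone. 0 \<le> L K) \<and> L f \<le> 0 \<and> L unit_kernel = 1"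
proof (rule cone_separation[of cone kernels f unit_kernel])
  show "0 \<in> cone" using cone_zero by (simp add: zero_fun_def)
  show "K + K' \<in> cone" if "K \<in> cone" "K' \<in> cone" for K K'
    unfolding fun2_plus by (rule cone_add[OF that])
  show "t *\<^sub>R K \<in> cone" if "0 \<le> t" "K \<in> cone" for t K
    unfolding fun2_scaleR by (rule cone_scale[OF that(2,1)])
  show "subspace kernels" unfolding kernels_def by (rule subspace_span)
  show "cone \<subseteq> kernels" by (rule cone_subset_kernels)
  show "\<exists>t. t *\<^sub>R unit_kernel - K \<in> cone" if "K \<in> kernels" for K
    unfolding fun2_scaleR fun2_minus by (rule order_unit[OF that])
next
  fix L :: "((complex ^ 'd) \<times> nat \<Rightarrow> (complex ^ 'd) \<times> nat \<Rightarrow> complex) \<Rightarrow> real"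
  assume "\<And>x y. x \<in> kernels \<Longrightarrow> y \<in> kernels \<Longrightarrow> L (x + y) = L x + L y"
    "\<And>t x. x \<in> kernels \<Longrightarrow> L (t *\<^sub>R x) = t * L x"
    "\<And>x. x \<in> cone \<Longrightarrow> 0 \<le> L x" "L f \<le> 0" "L unit_kernel = 1"
  then show ?thesis by (intro exI[of _ L]) (simp add: fun2_plus fun2_scaleR)
qed (use f unit_in_cone in auto)

text \<open>The polarisation of \<open>2 dyad\<close>; a hermitian kernel, unlike \<open>cnj (g x) * h y\<close> alone.\<close>

definition cross :: "((complex ^ 'd) \<times> nat \<Rightarrow> complex) \<Rightarrow> ((complex ^ 'd) \<times> nat \<Rightarrow> complex) \<Rightarrow>
    (complex ^ 'd) \<times> nat \<Rightarrow> (complex ^ 'd) \<times> nat \<Rightarrow> complex" where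
  "cross g h = (\<lambda>x y. cnj (g x) * h y + cnj (h x) * g y)"

lemma cross_in_kernels: "g \<in> polys \<beta> \<Longrightarrow> h \<in> polys \<beta> \<Longrightarrow> cross g h \<in> kernels"
proof -
  assume gh: "g \<in> polys \<beta>" "h \<in> polys \<beta>"
  have "(\<lambda>x y. (dyad (\<lambda>x. g x + h x) x y - dyad g x y) - dyad h x y) \<in> kernels"
    by (intro kernels_diff kernels_dyad polys_add gh)
  moreover have "(\<lambda>x y. (dyad (\<lambda>x. g x + h x) x y - dyad g x y) - dyad h x y) = cross g h"
    by (simp add: cross_def dyad_def fun_eq_iff algebra_simps)
  ultimately show ?thesis by simp
qed

text \<open>The separating functional \<open>L\<close> is defined on hermitian kernels only and is real. So its values at the
  kernels \<open>cross g h\<close> provide twice the real part of the inner product of \<open>g\<close> and \<open>h\<close>, and the imaginary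
  part is obtained by rotating \<open>g\<close> by \<open>\<i>\<close>.\<close>

lemma separating_semi_inner_product:
  fixes p q :: nat
  assumes u: "\<And>b. b < p \<Longrightarrow> u b \<in> polys \<beta>" and v: "\<And>a. a < q \<Longrightarrow> v a \<in> polys \<beta>"
    and notin: "(\<lambda>x y. (\<Sum>b<p. dyad (u b) x y) - (\<Sum>a<q. dyad (v a) x y)) \<notin> cone"
  shows "\<exists>ip. semi_inner_product (polys \<beta>) ip
    \<and> (\<forall>g\<in>polys \<beta>. \<forall>i. Re (ip (\<lambda>x. vec_nth (fst x) i * g x) (\<lambda>x. vec_nth (fst x) i * g x)) \<le> c\<^sup>2 * Re (ip g g))
    \<and> (\<forall>j<k. \<forall>h. (\<forall>s<m j. h s \<in> polys \<beta>) \<longrightarrow>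
        (\<Sum>r<l j. Re (ip (Pmult j h r) (Pmult j h r))) \<le> (\<Sum>s<m j. Re (ip (h s) (h s))))
    \<and> (\<Sum>b<\<beta>. Re (ip (word [] b) (word [] b))) = 1
    \<and> (\<Sum>b<p. Re (ip (u b) (u b))) \<le> (\<Sum>a<q. Re (ip (v a) (v a)))"
proof -
  let ?f = "\<lambda>x y. (\<Sum>b<p. dyad (u b) x y) - (\<Sum>a<q. dyad (v a) x y)"
  have f: "?f \<in> kernels" by (intro kernels_diff kernels_sum kernels_dyad u v) auto
  obtain L :: "((complex ^ 'd) \<times> nat \<Rightarrow> (complex ^ 'd) \<times> nat \<Rightarrow> complex) \<Rightarrow> real"
    where L: "(\<forall>K\<in>kernels. \<forall>K'\<in>kernels. L (\<lambda>x y. K x y + K' x y) = L K + L K')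
    \<and> (\<forall>t. \<forall>K\<in>kernels. L (\<lambda>x y. of_real t * K x y) = t * L K)
    \<and> (\<forall>K\<in>cone. 0 \<le> L K) \<and> L ?f \<le> 0 \<and> L unit_kernel = 1"
    using separating_functional[OF f notin] by (rule exE)
  have Ladd: "L (\<lambda>x y. K x y + K' x y) = L K + L K'" if "K \<in> kernels" "K' \<in> kernels" for K K'
    using L that by simp
  have Lscale: "L (\<lambda>x y. of_real t * K x y) = t * L K" if "K \<in> kernels" for t K using L that by simp
  have Lpos: "0 \<le> L K" if "K \<in> cone" for K using L that by simp
  have Lneg: "L (\<lambda>x y. - K x y) = - L K" if "K \<in> kernels" for K
    using Lscale[OF that, of "- 1"] by simp
  have Ldiff: "L (\<lambda>x y. K x y - K' x y) = L K - L K'" if "K \<in> kernels" "K' \<in> kernels" for K K'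
    using Ladd[OF that(1) kernels_scale[OF that(2), of "- 1"]] Lscale[OF that(2), of "- 1"] by simp
  have Lsum: "L (\<lambda>x y. \<Sum>i\<in>I. K i x y) = (\<Sum>i\<in>I. L (K i))" if "\<And>i. i \<in> I \<Longrightarrow> K i \<in> kernels"
    for I and K :: "nat \<Rightarrow> (complex ^ 'd) \<times> nat \<Rightarrow> (complex ^ 'd) \<times> nat \<Rightarrow> complex"
    using that
  proof (induction I rule: infinite_finite_induct)
    case (insert i I)
    then show ?case using Ladd[of "K i" "\<lambda>x y. \<Sum>i\<in>I. K i x y"] kernels_sum[of I K] by simp
  qed (use Lscale[OF kernels_zero, of 0] in simp_all)
  define X where "X g h = L (cross g h)" for g h
  define J where "J g = (\<lambda>x. \<i> * g x)" for g :: "(complex ^ 'd) \<times> nat \<Rightarrow> complex"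
  have J: "J g \<in> polys \<beta>" if "g \<in> polys \<beta>" for g unfolding J_def by (rule polys_scale[OF that])
  note X_mem = cross_in_kernels
  have X_add: "X g (\<lambda>x. h x + h' x) = X g h + X g h'" if "g \<in> polys \<beta>" "h \<in> polys \<beta>" "h' \<in> polys \<beta>" for g h h'
  proof -
    have "cross g (\<lambda>x. h x + h' x) = (\<lambda>x y. cross g h x y + cross g h' x y)"
      by (simp add: cross_def algebra_simps)
    then show ?thesis using Ladd[OF X_mem[OF that(1,2)] X_mem[OF that(1,3)]] by (simp add: X_def)
  qed
  have X_sym: "X g h = X h g" for g h
    by (simp add: X_def cross_def add.commute)
  have X_J: "X g (J h) = - X (J g) h" if "g \<in> polys \<beta>" "h \<in> polys \<beta>" for g h
  proof -
    have "cross g (J h) = (\<lambda>x y. - cross (J g) h x y)"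
      by (simp add: cross_def J_def algebra_simps)
    then show ?thesis using Lneg[OF X_mem[OF J[OF that(1)] that(2)]] by (simp add: X_def)
  qed
  have X_JJ: "X (J g) (J h) = X g h" for g h
  proof -
    have "cross (J g) (J h) = cross g h"
      by (intro ext) (simp add: cross_def J_def algebra_simps)
    then show ?thesis by (simp add: X_def)
  qed
  have X_scale: "X g (\<lambda>x. a * h x) = Re a * X g h - Im a * X (J g) h"
    if "g \<in> polys \<beta>" "h \<in> polys \<beta>" for g h a
  proof -
    have "cross g (\<lambda>x. a * h x) = (\<lambda>x y. of_real (Re a) * cross g h x y + of_real (Im a) * cross g (J h) x y)"
    proof (intro ext)
      fix x y
      have a: "a = of_real (Re a) + \<i> * of_real (Im a)" by (simp add: complex_eq)
      show "cross g (\<lambda>x. a * h x) x y = of_real (Re a) * cross g h x y + of_real (Im a) * cross g (J h) x y"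
        by (subst a, subst a) (simp add: cross_def J_def algebra_simps)
    qed
    then have "X g (\<lambda>x. a * h x) = Re a * X g h + Im a * X g (J h)"
      using Ladd[OF kernels_scale[OF X_mem[OF that]] kernels_scale[OF X_mem[OF that(1) J[OF that(2)]]]]
        Lscale[OF X_mem[OF that]] Lscale[OF X_mem[OF that(1) J[OF that(2)]]] by (simp add: X_def)
    then show ?thesis using X_J[OF that] by simp
  qed
  have X_self: "X g g = 2 * L (dyad g)" if "g \<in> polys \<beta>" for g
  proof -
    have "cross g g = (\<lambda>x y. of_real 2 * dyad g x y)" by (simp add: cross_def dyad_def mult.commute)
    then show ?thesis using Lscale[OF kernels_dyad[OF that], of 2] by (simp add: X_def)
  qed
  \<comment> \<open>Linearity in the second argument and conjugate symmetry both reduce to \<open>X_J\<close> and \<open>X_JJ\<close>.\<close>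
  define ip where "ip g h = Complex (X g h / 2) (X (J g) h / 2)" for g h
  have ip_self: "Re (ip g g) = L (dyad g)" if "g \<in> polys \<beta>" for g
    using X_self[OF that] by (simp add: ip_def)
  have sip: "semi_inner_product (polys \<beta>) ip"
  proof
    show "(\<lambda>_. 0) \<in> polys \<beta>" by (rule polys_zero)
    show "(\<lambda>x. g x + h x) \<in> polys \<beta>" if "g \<in> polys \<beta>" "h \<in> polys \<beta>" for g h by (rule polys_add[OF that])
    show "(\<lambda>x. a * g x) \<in> polys \<beta>" if "g \<in> polys \<beta>" for g a by (rule polys_scale[OF that])
    show "ip f (\<lambda>x. g x + h x) = ip f g + ip f h" if "f \<in> polys \<beta>" "g \<in> polys \<beta>" "h \<in> polys \<beta>" for f g h
      using X_add[OF that] X_add[OF J[OF that(1)] that(2,3)] by (simp add: ip_def complex_eq_iff add_divide_distrib)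
    show "ip f (\<lambda>x. a * g x) = a * ip f g" if fg: "f \<in> polys \<beta>" "g \<in> polys \<beta>" for f g a
    proof -
      have "X (J (J f)) g = - X f g" using X_J[OF J[OF fg(1)] fg(2)] X_JJ[of f g] by simp
      then show ?thesis
        using X_scale[OF fg, of a] X_scale[OF J[OF fg(1)] fg(2), of a]
        by (simp add: ip_def complex_eq_iff field_simps)
    qed
    show "ip g f = cnj (ip f g)" if "f \<in> polys \<beta>" "g \<in> polys \<beta>" for f g
      using X_sym[of g f] X_sym[of "J g" f] X_J[OF that] by (simp add: ip_def complex_eq_iff)
    show "0 \<le> Re (ip g g)" if "g \<in> polys \<beta>" for g
      using ip_self[OF that] Lpos[OF dyad_in_cone[OF that]] by simp
  qed
  have coord: "Re (ip (\<lambda>x. vec_nth (fst x) i * g x) (\<lambda>x. vec_nth (fst x) i * g x)) \<le> c\<^sup>2 * Re (ip g g)"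
    if g: "g \<in> polys \<beta>" for g i
    using Lpos[OF coordinate_bound[OF g, of i]] ip_self[OF g] ip_self[OF polys_coord[OF g, of i]]
      Ldiff[OF kernels_scale[OF kernels_dyad[OF g]] kernels_dyad[OF polys_coord[OF g, of i]], of "c\<^sup>2"]
      Lscale[OF kernels_dyad[OF g], of "c\<^sup>2"] by simp
  have weight: "(\<Sum>r<l j. Re (ip (Pmult j h r) (Pmult j h r))) \<le> (\<Sum>s<m j. Re (ip (h s) (h s)))"
    if j: "j < k" and h: "\<And>s. s < m j \<Longrightarrow> h s \<in> polys \<beta>" for j h
  proof -
    have "0 \<le> L (gen j h)" by (rule Lpos[OF gen_in_cone[OF j h]])
    also have "L (gen j h) = (\<Sum>s<m j. L (dyad (h s))) - (\<Sum>r<l j. L (dyad (Pmult j h r)))"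
      unfolding gen_def
      by (subst Ldiff, (intro kernels_sum kernels_dyad Pmult_closed h; simp)+,
          subst Lsum, (intro kernels_dyad h; simp), subst Lsum, (intro kernels_dyad Pmult_closed h; simp)) simp
    finally show ?thesis using ip_self[OF h] ip_self[OF Pmult_closed[where h = h, OF h]] by simp
  qed
  have "L unit_kernel = (\<Sum>b<\<beta>. L (dyad (word [] b)))"
    unfolding unit_kernel_def by (rule Lsum) (simp add: kernels_dyad polys_word)
  then have one: "(\<Sum>b<\<beta>. Re (ip (word [] b) (word [] b))) = 1"
    using L ip_self[OF polys_word] by simp
  have "L ?f = (\<Sum>b<p. L (dyad (u b))) - (\<Sum>a<q. L (dyad (v a)))"
    using Ldiff[OF kernels_sum kernels_sum, of "{..<p}" "\<lambda>b. dyad (u b)" "{..<q}" "\<lambda>a. dyad (v a)"]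
      Lsum[of "{..<p}" "\<lambda>b. dyad (u b)"] Lsum[of "{..<q}" "\<lambda>a. dyad (v a)"] kernels_dyad u v by simp
  then have last: "(\<Sum>b<p. Re (ip (u b) (u b))) \<le> (\<Sum>a<q. Re (ip (v a) (v a)))"
    using L ip_self[OF u] ip_self[OF v] by simp
  show ?thesis
    by (rule exI[of _ ip]) (use sip coord weight one last in \<open>simp\<close>)
qed

end

section \<open>Direct sums\<close>

lemma sum_lessThan_add:
  fixes f :: "nat \<Rightarrow> 'a::comm_monoid_add"
  shows "(\<Sum>t<a + b. f t) = (\<Sum>t<a. f t) + (\<Sum>t<b. f (a + t))"
  by (induction b) (simp_all add: add.assoc)

lemma sum_blocks:
  fixes n :: "nat \<Rightarrow> nat" and f :: "nat \<Rightarrow> 'a::comm_monoid_add"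
  shows "(\<Sum>t<(\<Sum>i<k. n i). f t) = (\<Sum>i<k. \<Sum>r<n i. f ((\<Sum>t<i. n t) + r))"
  by (induction k) (simp_all add: sum_lessThan_add)

lemma block_index_less:
  fixes n :: "nat \<Rightarrow> nat"
  assumes "i < k" "r < n i" shows "(\<Sum>t<i. n t) + r < (\<Sum>t<k. n t)"
  using assms(1)
proof (induction k)
  case (Suc k)
  then show ?case using assms(2) by (cases "i = k") auto
qed simp

lemma direct_sum_Suc:
  "direct_sum (Suc k) P = (let A = direct_sum k P in
    four_block_mat A (0\<^sub>m (dim_row A) (dim_col (P k))) (0\<^sub>m (dim_row (P k)) (dim_col A)) (P k))"
  by (simp add: direct_sum_def diag_block_mat_last Let_def)

lemma direct_sum_carrier:
  assumes "\<And>j. j < k \<Longrightarrow> P j \<in> carrier_mat (l j) (m j)"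
  shows "direct_sum k P \<in> carrier_mat (\<Sum>j<k. l j) (\<Sum>j<k. m j)"
  using assms
proof (induction k)
  case (Suc k)
  then have "direct_sum k P \<in> carrier_mat (\<Sum>j<k. l j) (\<Sum>j<k. m j)" by simp
  then show ?case using Suc.prems[of k] by (simp add: direct_sum_Suc Let_def)
qed (simp add: direct_sum_def)

lemma direct_sum_index:
  assumes "\<And>j. j < k \<Longrightarrow> P j \<in> carrier_mat (l j) (m j)"
    and "i < k" "j < k" "r < l i" "s < m j"
  shows "direct_sum k P $$ ((\<Sum>t<i. l t) + r, (\<Sum>t<j. m t) + s) = (if i = j then P i $$ (r, s) else 0)"
  using assms
proof (induction k)
  case (Suc k)
  note D = direct_sum_carrier[of k P l m] 
  have A: "direct_sum k P \<in> carrier_mat (\<Sum>j<k. l j) (\<Sum>j<k. m j)" using D Suc.prems(1) by simp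
  have Pk: "P k \<in> carrier_mat (l k) (m k)" using Suc.prems(1) by simp
  let ?i = "(\<Sum>t<i. l t) + r" and ?j = "(\<Sum>t<j. m t) + s"
  have ii: "i < k \<Longrightarrow> ?i < (\<Sum>j<k. l j)" by (rule block_index_less[where n = l, OF _ Suc.prems(4)])
  have jj: "j < k \<Longrightarrow> ?j < (\<Sum>j<k. m j)" by (rule block_index_less[where n = m, OF _ Suc.prems(5)])
  have I: "?i < (\<Sum>t<Suc k. l t)" by (rule block_index_less[where n = l, OF Suc.prems(2,4)])
  have J: "?j < (\<Sum>t<Suc k. m t)" by (rule block_index_less[where n = m, OF Suc.prems(3,5)])
  have E: "direct_sum (Suc k) P $$ (?i, ?j) = (if ?i < (\<Sum>j<k. l j)
      then if ?j < (\<Sum>j<k. m j) then direct_sum k P $$ (?i, ?j) else 0\<^sub>m (\<Sum>j<k. l j) (m k) $$ (?i, ?j - (\<Sum>j<k. m j))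
      else if ?j < (\<Sum>j<k. m j) then 0\<^sub>m (l k) (\<Sum>j<k. m j) $$ (?i - (\<Sum>j<k. l j), ?j)
        else P k $$ (?i - (\<Sum>j<k. l j), ?j - (\<Sum>j<k. m j)))"
    using A Pk I J by (simp add: direct_sum_Suc Let_def index_mat_four_block)
  have "i < k \<or> i = k" "j < k \<or> j = k" using Suc.prems(2,3) by auto
  then consider "i < k" "j < k" | "i < k" "j = k" | "i = k" "j < k" | "i = k" "j = k" by blast
  then show ?case
  proof cases
    case 1
    have "direct_sum k P $$ (?i, ?j) = (if i = j then P i $$ (r, s) else 0)"
      by (rule Suc.IH[OF Suc.prems(1)[OF less_SucI] 1 Suc.prems(4,5)])
    then show ?thesis using E ii[OF 1(1)] jj[OF 1(2)] by simp
  next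
    case 2
    then show ?thesis using E ii[OF 2(1)] Suc.prems(5) by simp
  next
    case 3
    then show ?thesis using E jj[OF 3(2)] Suc.prems(4) by simp
  next
    case 4
    then show ?thesis using E by simp
  qed
qed simp

lemma direct_sum_row:
  fixes P :: "nat \<Rightarrow> 'a::semiring_0 mat"
  assumes P: "\<And>j. j < k \<Longrightarrow> P j \<in> carrier_mat (l j) (m j)" and i: "i < k" "r < l i"
    and \<phi>: "\<And>t. \<phi> 0 t = (0 :: 'b::comm_monoid_add)"
  shows "(\<Sum>t<(\<Sum>j<k. m j). \<phi> (direct_sum k P $$ ((\<Sum>t<i. l t) + r, t)) t)
    = (\<Sum>s<m i. \<phi> (P i $$ (r, s)) ((\<Sum>t<i. m t) + s))"
proof -
  have "(\<Sum>t<(\<Sum>j<k. m j). \<phi> (direct_sum k P $$ ((\<Sum>t<i. l t) + r, t)) t)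
    = (\<Sum>j<k. \<Sum>s<m j. \<phi> (if i = j then P i $$ (r, s) else 0) ((\<Sum>t<j. m t) + s))"
    unfolding sum_blocks by (intro sum.cong refl) (simp add: direct_sum_index[where l = l and m = m, OF P] i)
  also have "\<dots> = (\<Sum>j<k. if j = i then (\<Sum>s<m i. \<phi> (P i $$ (r, s)) ((\<Sum>t<i. m t) + s)) else 0)"
    by (intro sum.cong refl) (auto simp: \<phi>)
  finally show ?thesis using i by simp
qed

lemma mat_peval_direct_sum:
  assumes P: "\<And>j. j < k \<Longrightarrow> P j \<in> carrier_mat (l j) (m j)"
  shows "mat_peval (direct_sum k P) z = direct_sum k (\<lambda>j. mat_peval (P j) z)"
  using assms
proof (induction k)
  case 0
  show ?case by (intro eq_matI) (auto simp: direct_sum_def)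
next
  case (Suc k)
  have A: "direct_sum k P \<in> carrier_mat (\<Sum>j<k. l j) (\<Sum>j<k. m j)"
    using direct_sum_carrier[of k P l m] Suc.prems by simp
  have IH: "mat_peval (direct_sum k P) z = direct_sum k (\<lambda>j. mat_peval (P j) z)" using Suc by simp
  show ?case
    unfolding direct_sum_Suc Let_def IH[symmetric]
    by (intro eq_matI) (auto simp: mat_peval_def index_mat_four_block)
qed

text \<open>The direct sum is applied to a vector that is supported on the \<open>j\<close>-th block.\<close>

lemma dom_P_block_bound:
  fixes P :: "nat \<Rightarrow> 'd::finite mpoly mat"
  assumes P: "\<And>j. j < k \<Longrightarrow> P j \<in> carrier_mat (l j) (m j)" and j: "j < k"
  shows "(\<Sum>r<l j. (cmod (\<Sum>s<m j. peval (P j $$ (r, s)) z * h s))\<^sup>2)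
    \<le> (spectral_norm (mat_peval (direct_sum k P) z))\<^sup>2 * (\<Sum>s<m j. (cmod (h s))\<^sup>2)"
proof -
  let ?D = "mat_peval (direct_sum k P) z"
  let ?P = "\<lambda>j. mat_peval (P j) z"
  have P': "\<And>j. j < k \<Longrightarrow> ?P j \<in> carrier_mat (l j) (m j)" by (simp add: mat_peval_def P)
  have Deq: "?D = direct_sum k ?P" by (rule mat_peval_direct_sum[OF P])
  have D: "?D \<in> carrier_mat (\<Sum>j<k. l j) (\<Sum>j<k. m j)" unfolding Deq by (rule direct_sum_carrier[OF P'])
  have dims [simp]: "dim_row (direct_sum k P) = (\<Sum>j<k. l j)" "dim_col (direct_sum k P) = (\<Sum>j<k. m j)"
    using direct_sum_carrier[where l = l and m = m, OF P] by auto
  define V where "V = Matrix.vec (\<Sum>j<k. m j) (\<lambda>t. if (\<Sum>t<j. m t) \<le> t \<and> t < (\<Sum>t<j. m t) + m j then h (t - (\<Sum>t<j. m t)) else 0)"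
  have V: "V \<in> carrier_vec (dim_col ?D)" by (simp add: V_def)
  have Vj: "vec_index V ((\<Sum>t<j. m t) + s) = h s" if "s < m j" for s
    using block_index_less[OF j, of s m] that by (simp add: V_def)
  have less: "(\<Sum>t<i. m t) + m i \<le> (\<Sum>t<j. m t)" if "i < j" for i j
  proof -
    have "(\<Sum>t<Suc i. m t) \<le> (\<Sum>t<j. m t)" using that by (intro sum_mono2) auto
    then show ?thesis by simp
  qed
  have Vi: "vec_index V ((\<Sum>t<i. m t) + s) = 0" if "i < k" "i \<noteq> j" "s < m i" for i s
    using block_index_less[OF that(1), of s m] that less[of i j] less[of j i]
    by (cases "i < j") (auto simp: V_def)
  have nV: "(vec_l2norm V)\<^sup>2 = (\<Sum>s<m j. (cmod (h s))\<^sup>2)"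
  proof -
    have dV: "dim_vec V = (\<Sum>j<k. m j)" by (simp add: V_def)
    have "(vec_l2norm V)\<^sup>2 = (\<Sum>t<dim_vec V. (cmod (vec_index V t))\<^sup>2)"
      by (simp add: vec_l2norm_def sum_nonneg)
    also have "\<dots> = (\<Sum>i<k. \<Sum>s<m i. (cmod (vec_index V ((\<Sum>t<i. m t) + s)))\<^sup>2)"
      by (simp only: dV sum_blocks)
    also have "\<dots> = (\<Sum>i<k. if i = j then (\<Sum>s<m j. (cmod (h s))\<^sup>2) else 0)"
      using Vj Vi by (intro sum.cong refl) auto
    finally show ?thesis using j by simp
  qed
  have "(\<Sum>r<l j. (cmod (\<Sum>s<m j. peval (P j $$ (r, s)) z * h s))\<^sup>2)
    = (\<Sum>r<l j. (cmod (vec_index (?D *\<^sub>v V) ((\<Sum>t<j. l t) + r)))\<^sup>2)"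
  proof (intro sum.cong refl arg_cong[where f = "\<lambda>x. (cmod x)\<^sup>2"])
    fix r assume "r \<in> {..<l j}"
    then have r: "r < l j" by simp
    have "vec_index (?D *\<^sub>v V) ((\<Sum>t<j. l t) + r) = (\<Sum>t<(\<Sum>j<k. m j). ?D $$ ((\<Sum>t<j. l t) + r, t) * vec_index V t)"
      using mult_mat_vec_index_sum[OF _ V, of "(\<Sum>t<j. l t) + r"] block_index_less[OF j, of r l] r by simp
    also have "\<dots> = (\<Sum>s<m j. ?P j $$ (r, s) * vec_index V ((\<Sum>t<j. m t) + s))"
      unfolding Deq by (rule direct_sum_row[where l = l and m = m and \<phi> = "\<lambda>x t. x * vec_index V t", OF P' j r]) auto
    also have "\<dots> = (\<Sum>s<m j. peval (P j $$ (r, s)) z * h s)"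
      using P[OF j] r by (intro sum.cong) (auto simp: Vj)
    finally show "(\<Sum>s<m j. peval (P j $$ (r, s)) z * h s) = vec_index (?D *\<^sub>v V) ((\<Sum>t<j. l t) + r)" by simp
  qed
  also have "\<dots> \<le> (\<Sum>i<k. \<Sum>r<l i. (cmod (vec_index (?D *\<^sub>v V) ((\<Sum>t<i. l t) + r)))\<^sup>2)"
    using j by (intro member_le_sum[where f = "\<lambda>i. \<Sum>r<l i. (cmod (vec_index (?D *\<^sub>v V) ((\<Sum>t<i. l t) + r)))\<^sup>2"]) (auto simp: sum_nonneg)
  also have "\<dots> = (vec_l2norm (?D *\<^sub>v V))\<^sup>2"
  proof -
    have dV: "dim_vec (?D *\<^sub>v V) = (\<Sum>j<k. l j)" by simp
    have "(vec_l2norm (?D *\<^sub>v V))\<^sup>2 = (\<Sum>t<dim_vec (?D *\<^sub>v V). (cmod (vec_index (?D *\<^sub>v V) t))\<^sup>2)"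
      by (simp add: vec_l2norm_def sum_nonneg del: index_mult_mat_vec)
    then show ?thesis by (simp only: dV sum_blocks)
  qed
  also have "\<dots> \<le> (spectral_norm ?D * vec_l2norm V)\<^sup>2"
    by (intro power_mono spectral_norm_bound V) simp
  finally show ?thesis by (simp add: power_mult_distrib nV)
qed

context hermitian_kernels
begin

text \<open>On the diagonal \<open>w = z\<close> of the Archimedean identity all defects are nonnegative.\<close>

lemma coordinate_bounded_on_dom_P:
  assumes P: "\<And>j. j < k \<Longrightarrow> P j \<in> carrier_mat (l j) (m j)" and z: "z \<in> dom_P (direct_sum k P)"
  shows "cmod (vec_nth z i) \<le> \<bar>c\<bar>"
proof -
  obtain n0 :: nat and n :: "nat \<Rightarrow> nat" and h0 h where id: "\<forall>w z.
    complex_of_real (c\<^sup>2) - cnj (vec_nth w i) * vec_nth z i =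
      (\<Sum>t<n0. cnj (peval (h0 t) w) * peval (h0 t) z) +
      (\<Sum>j<k. \<Sum>b<n j. defect (l j) (m j) (\<lambda>r s. peval (P j $$ (r, s))) (\<lambda>s. peval (h j b s)) w z)"
    using arch[of i] by (elim exE)
  have sq: "cnj a * a = of_real ((cmod a)\<^sup>2)" for a by (simp only: complex_norm_square mult.commute)
  have s1: "spectral_norm (mat_peval (direct_sum k P) z) < 1" using z by (simp add: dom_P_def)
  let ?d = "\<lambda>j b. (\<Sum>s<m j. (cmod (peval (h j b s) z))\<^sup>2)
    - (\<Sum>r<l j. (cmod (\<Sum>s<m j. peval (P j $$ (r, s)) z * peval (h j b s) z))\<^sup>2)"
  have "complex_of_real (c\<^sup>2 - (cmod (vec_nth z i))\<^sup>2)
      = of_real ((\<Sum>t<n0. (cmod (peval (h0 t) z))\<^sup>2) + (\<Sum>j<k. \<Sum>b<n j. ?d j b))"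
    using id[rule_format, of z z] unfolding defect_def sq by (simp only: of_real_diff of_real_add of_real_sum)
  then have "c\<^sup>2 - (cmod (vec_nth z i))\<^sup>2 = (\<Sum>t<n0. (cmod (peval (h0 t) z))\<^sup>2) + (\<Sum>j<k. \<Sum>b<n j. ?d j b)"
    by (simp only: of_real_eq_iff)
  moreover have "0 \<le> ?d j b" if j: "j < k" for j b
  proof -
    have "(\<Sum>r<l j. (cmod (\<Sum>s<m j. peval (P j $$ (r, s)) z * peval (h j b s) z))\<^sup>2)
      \<le> (spectral_norm (mat_peval (direct_sum k P) z))\<^sup>2 * (\<Sum>s<m j. (cmod (peval (h j b s) z))\<^sup>2)"
      by (rule dom_P_block_bound[where l = l and m = m, OF P j])
    also have "\<dots> \<le> 1 * (\<Sum>s<m j. (cmod (peval (h j b s) z))\<^sup>2)"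
      using s1 by (intro mult_right_mono power_le_one spectral_norm_nonneg sum_nonneg) auto
    finally show ?thesis by simp
  qed
  ultimately have "0 \<le> c\<^sup>2 - (cmod (vec_nth z i))\<^sup>2"
    by (simp only:) (intro add_nonneg_nonneg sum_nonneg; simp)
  then show ?thesis using abs_le_square_iff[of "cmod (vec_nth z i)" c] by simp
qed

text \<open>The closure of the bounded domain is compact.\<close>

lemma lower_bound_on_dom_P:
  assumes P: "\<And>j. j < k \<Longrightarrow> P j \<in> carrier_mat (l j) (m j)"
    and q: "\<And>z. z \<in> closure (dom_P (direct_sum k P)) \<Longrightarrow> peval q z \<noteq> 0"
  shows "\<exists>d>0. \<forall>z\<in>dom_P (direct_sum k P). d \<le> cmod (peval q z)"
proof (cases "dom_P (direct_sum k P) = {}")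
  case True
  then show ?thesis by (intro exI[of _ 1]) simp
next
  case False
  let ?D = "dom_P (direct_sum k P)"
  have "bounded ?D"
  proof (rule boundedI)
    fix z assume z: "z \<in> ?D"
    have "norm z \<le> (\<Sum>i\<in>UNIV. cmod (vec_nth z i))" unfolding norm_vec_def by (rule L2_set_le_sum) simp
    also have "\<dots> \<le> (\<Sum>i\<in>(UNIV :: 'd set). \<bar>c\<bar>)"
      by (intro sum_mono coordinate_bounded_on_dom_P[OF P z])
    finally show "norm z \<le> (\<Sum>i\<in>(UNIV :: 'd set). \<bar>c\<bar>)" .
  qed
  then have "compact (closure ?D)" by (simp add: compact_closure)
  moreover have "continuous_on (closure ?D) (\<lambda>z. cmod (peval q z))"
    by (intro continuous_intros continuous_on_peval)
  ultimately obtain z0 where z0: "z0 \<in> closure ?D" "\<And>z. z \<in> closure ?D \<Longrightarrow> cmod (peval q z0) \<le> cmod (peval q z)"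
    using continuous_attains_inf[of "closure ?D" "\<lambda>z. cmod (peval q z)"] False by auto
  then show ?thesis using q[OF z0(1)] closure_subset[of ?D]
    by (intro exI[of _ "cmod (peval q z0)"]) auto
qed

end

section \<open>Lurking contractions\<close>

definition finite_ip :: "nat \<Rightarrow> (nat \<Rightarrow> complex) \<Rightarrow> (nat \<Rightarrow> complex) \<Rightarrow> complex" where
  "finite_ip N f g = (\<Sum>t<N. cnj (f t) * g t)"

text \<open>The inner product of \<open>\<complex>\<^sup>N\<close> as a semi-inner product on all sequences, so that vectors can carry
  further coordinates that it does not see.\<close>

interpretation finite_ip: semi_inner_product UNIV "finite_ip N" for N
proof
  show "finite_ip N f (\<lambda>x. g x + h x) = finite_ip N f g + finite_ip N f h" for f g h
    by (simp add: finite_ip_def distrib_left sum.distrib)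
  show "finite_ip N f (\<lambda>x. a * g x) = a * finite_ip N f g" for f g a
    by (simp add: finite_ip_def sum_distrib_left mult_ac)
  show "finite_ip N g f = cnj (finite_ip N f g)" for f g
    by (simp add: finite_ip_def mult.commute)
  show "0 \<le> Re (finite_ip N g g)" for g
    by (simp add: finite_ip_def sum_nonneg)
qed auto

lemma finite_ip_nrm2: "finite_ip.nrm2 N f = (\<Sum>t<N. (cmod (f t))\<^sup>2)"
proof -
  have "cnj (f t) * f t = of_real ((cmod (f t))\<^sup>2)" for t
    by (simp only: complex_norm_square mult.commute)
  then have "finite_ip N f f = of_real (\<Sum>t<N. (cmod (f t))\<^sup>2)"
    by (simp only: finite_ip_def of_real_sum)
  then show ?thesis by (simp add: finite_ip.nrm2_def)
qed

lemma bessel: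
  assumes e: "finite_ip.orthosystem N e n"
  shows "(\<Sum>j<n. (cmod (finite_ip N (e j) y))\<^sup>2) \<le> (\<Sum>t<N. (cmod (y t))\<^sup>2)"
proof -
  let ?ip = "finite_ip N" and ?p = "finite_ip.proj N e n y"
  let ?r = "\<lambda>x. y x - ?p x"
  note fi = finite_ip.ip_diff[where N = N, OF UNIV_I UNIV_I UNIV_I]
  have "?ip ?p ?r = cnj (?ip ?r ?p)" by (rule finite_ip.ip_cnj) auto
  also have "?ip ?r ?p = (\<Sum>k<n. ?ip (e k) y * ?ip ?r (e k))"
    unfolding finite_ip.proj_def by (rule finite_ip.ip_sum) auto
  also have "\<dots> = 0"
  proof (intro sum.neutral ballI)
    fix j assume "j \<in> {..<n}"
    then have "?ip (e j) ?r = 0" using finite_ip.residual_orthogonal[OF e UNIV_I, of j y] by simp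
    then show "?ip (e j) y * ?ip ?r (e j) = 0" using finite_ip.ip_cnj[OF UNIV_I UNIV_I, of N "?r" "e j"] by simp
  qed
  finally have pr: "?ip ?p ?r = 0" by simp
  have "?ip y ?r = ?ip ?r ?r + ?ip ?p ?r"
    using finite_ip.ip_add_left[OF UNIV_I UNIV_I UNIV_I, of N ?r ?p ?r] by simp
  then have "?ip y y - ?ip y ?p = ?ip ?r ?r" using fi[of y y ?p] pr by simp
  then have "0 \<le> Re (?ip y y - ?ip y ?p)" using finite_ip.ip_nonneg[OF UNIV_I, of N ?r] by simp
  moreover have "?ip y ?p = (\<Sum>k<n. ?ip (e k) y * ?ip y (e k))"
    unfolding finite_ip.proj_def by (rule finite_ip.ip_sum) auto
  moreover have "\<dots> = (\<Sum>k<n. of_real ((cmod (?ip (e k) y))\<^sup>2))"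
    by (intro sum.cong refl) (simp only: complex_norm_square finite_ip.ip_cnj[OF UNIV_I UNIV_I, of N y])
  ultimately have "(\<Sum>k<n. (cmod (?ip (e k) y))\<^sup>2) \<le> Re (?ip y y)" by simp
  then show ?thesis using finite_ip_nrm2[of N y] by (simp add: finite_ip.nrm2_def)
qed

text \<open>Bessel's inequality for the unit coordinate vectors, summed over the coordinates.\<close>

lemma orthonormal_card_le:
  assumes e: "finite_ip.orthosystem N e n" and unit: "\<And>j. j < n \<Longrightarrow> finite_ip N (e j) (e j) = 1"
  shows "n \<le> N"
proof -
  have "(\<Sum>j<n. (cmod (e j t))\<^sup>2) \<le> 1" if "t < N" for t
  proof -
    let ?d = "\<lambda>i. if i = t then 1 else 0 :: complex"
    have "finite_ip N (e j) ?d = cnj (e j t)" for j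
      using that by (simp add: finite_ip_def if_distrib[of "\<lambda>x. _ * x"] cong: if_cong)
    moreover have "(\<Sum>i<N. (cmod (?d i))\<^sup>2) = (\<Sum>i<N. if i = t then 1 else 0)"
      by (intro sum.cong) auto
    ultimately show ?thesis using bessel[OF e, of ?d] that by simp
  qed
  then have "(\<Sum>t<N. \<Sum>j<n. (cmod (e j t))\<^sup>2) \<le> (\<Sum>t<N. 1)" by (intro sum_mono) auto
  moreover have "(\<Sum>t<N. \<Sum>j<n. (cmod (e j t))\<^sup>2) = (\<Sum>j<n. \<Sum>t<N. (cmod (e j t))\<^sup>2)" by (rule sum.swap)
  moreover have "\<dots> = (\<Sum>j<n. 1)"
  proof (intro sum.cong refl)
    fix j assume "j \<in> {..<n}"
    then show "(\<Sum>t<N. (cmod (e j t))\<^sup>2) = 1"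
      using unit[of j] finite_ip_nrm2[of N "e j"] by (simp add: finite_ip.nrm2_def)
  qed
  ultimately show ?thesis by simp
qed

inductive_set lin_span :: "('p \<Rightarrow> nat \<Rightarrow> complex) \<Rightarrow> (nat \<Rightarrow> complex) set" for w where
  lin_span_zero: "(\<lambda>_. 0) \<in> lin_span w"
| lin_span_step: "f \<in> lin_span w \<Longrightarrow> (\<lambda>t. f t + a * w x t) \<in> lin_span w"

lemma lin_span_add:
  assumes "f \<in> lin_span w" "g \<in> lin_span w" shows "(\<lambda>t. f t + g t) \<in> lin_span w"
  using assms(2)
proof induction
  case (lin_span_step g a x)
  then show ?case using lin_span.lin_span_step[of "\<lambda>t. f t + g t" w a x] by (simp add: add.assoc)
qed (simp add: assms(1))

lemma lin_span_scale:
  assumes "f \<in> lin_span w" shows "(\<lambda>t. a * f t) \<in> lin_span w"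
  using assms
proof induction
  case (lin_span_step g a' x)
  then show ?case using lin_span.lin_span_step[of "\<lambda>t. a * g t" w "a * a'" x]
    by (simp add: distrib_left mult.assoc)
qed (simp add: lin_span_zero)

lemma lin_span_base: "w x \<in> lin_span w"
  using lin_span_step[OF lin_span_zero, where w = w and a = 1 and x = x] by simp

lemma lin_span_sum:
  assumes "\<And>i. i \<in> I \<Longrightarrow> f i \<in> lin_span w" shows "(\<lambda>t. \<Sum>i\<in>I. a i * f i t) \<in> lin_span w"
  using assms
proof (induction I rule: infinite_finite_induct)
  case (insert i I)
  then show ?case
    using lin_span_add[OF lin_span_scale[of "f i" w "a i"], of "\<lambda>t. \<Sum>i\<in>I. a i * f i t"] by simp
qed (simp_all add: lin_span_zero)

lemma sesquilinear_extension:
  assumes base: "\<And>x y. (\<Sum>t\<in>A. cnj (w x t) * w y t) = (\<Sum>t\<in>B. cnj (w x t) * w y t)"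
    and f: "f \<in> lin_span w" and g: "g \<in> lin_span w"
  shows "(\<Sum>t\<in>A. cnj (f t) * g t) = (\<Sum>t\<in>B. cnj (f t) * g t)"
proof -
  have 1: "(\<Sum>t\<in>A. cnj (w x t) * g t) = (\<Sum>t\<in>B. cnj (w x t) * g t)" for x
    using g
  proof induction
    case (lin_span_step g a y)
    have "(\<Sum>t\<in>D. cnj (w x t) * (g t + a * w y t)) = (\<Sum>t\<in>D. cnj (w x t) * g t) + a * (\<Sum>t\<in>D. cnj (w x t) * w y t)" for D
      by (simp add: distrib_left sum.distrib sum_distrib_left mult.left_commute)
    then show ?case using lin_span_step.IH base by simp
  qed simp
  show ?thesis
    using f
  proof induction
    case (lin_span_step f a x)
    have "(\<Sum>t\<in>D. cnj (f t + a * w x t) * g t) = (\<Sum>t\<in>D. cnj (f t) * g t) + cnj a * (\<Sum>t\<in>D. cnj (w x t) * g t)" for D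
      by (simp add: distrib_right sum.distrib sum_distrib_left mult.assoc)
    then show ?case using lin_span_step.IH 1 by simp
  qed simp
qed

text \<open>If the Gram kernel of the vectors \<open>u x\<close> exceeds that of the vectors \<open>v x\<close> by a positive kernel,
  then \<open>u x \<mapsto> v x\<close> extends to a linear contraction: it is well defined and contractive on the span
  of the \<open>u x\<close>, on whose orthogonal complement the extension vanishes. The vectors \<open>u x\<close>, \<open>v x\<close> and
  \<open>g x\<close> are stacked into one, and an orthonormal basis is chosen with respect to the first part.\<close>

lemma lurking_contraction:
  fixes u v g :: "'p \<Rightarrow> nat \<Rightarrow> complex"
  assumes gram: "\<And>x y. (\<Sum>t<N. cnj (u x t) * u y t)
      = (\<Sum>t<M. cnj (v x t) * v y t) + (\<Sum>t<n0. cnj (g x t) * g y t)"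
  shows "\<exists>W :: nat \<Rightarrow> nat \<Rightarrow> complex. (\<forall>x. \<forall>i<M. (\<Sum>t<N. W i t * u x t) = v x i)
    \<and> (\<forall>y :: nat \<Rightarrow> complex. (\<Sum>i<M. (cmod (\<Sum>t<N. W i t * y t))\<^sup>2) \<le> (\<Sum>t<N. (cmod (y t))\<^sup>2))"
proof -
  \<comment> \<open>The hypothesis says that the square norm of the first part of \<open>w x\<close> is that of the rest.\<close>
  define w where "w x t = (if t < N then u x t else if t < N + M then v x (t - N) else g x (t - N - M))" for x t
  have wv: "w x (N + i) = v x i" if "i < M" for x i using that by (simp add: w_def)
  have wg: "w x (N + (M + i)) = g x i" for x i by (simp add: w_def)
  let ?ip = "finite_ip N"
  have shift: "(\<Sum>t\<in>{N..<N + (M + n0)}. h t) = (\<Sum>t<M. h (N + t)) + (\<Sum>t<n0. h (N + (M + t)))" for h :: "nat \<Rightarrow> 'c::comm_monoid_add"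
  proof -
    have "(\<Sum>t\<in>{N..<N + (M + n0)}. h t) = (\<Sum>t<M + n0. h (N + t))"
      using sum.shift_bounds_nat_ivl[of h 0 N "M + n0"] by (simp add: atLeast0LessThan add.commute)
    then show ?thesis by (simp add: sum_lessThan_add)
  qed
  have base: "(\<Sum>t<N. cnj (w x t) * w y t) = (\<Sum>t\<in>{N..<N + (M + n0)}. cnj (w x t) * w y t)" for x y
  proof -
    have "(\<Sum>t<N. cnj (w x t) * w y t) = (\<Sum>t<N. cnj (u x t) * u y t)"
      by (intro sum.cong) (auto simp: w_def)
    then show ?thesis unfolding shift gram by (simp add: wv wg)
  qed
  have part: "(\<Sum>i<M. (cmod (f (N + i)))\<^sup>2) \<le> (\<Sum>t<N. (cmod (f t))\<^sup>2)" if f: "f \<in> lin_span w" for f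
  proof -
    have sq: "cnj a * a = of_real ((cmod a)\<^sup>2)" for a by (simp only: complex_norm_square mult.commute)
    have "complex_of_real (\<Sum>t<N. (cmod (f t))\<^sup>2) = of_real (\<Sum>t\<in>{N..<N + (M + n0)}. (cmod (f t))\<^sup>2)"
      using sesquilinear_extension[OF base f f] by (simp only: sq of_real_sum)
    then have "(\<Sum>t<N. (cmod (f t))\<^sup>2) = (\<Sum>t\<in>{N..<N + (M + n0)}. (cmod (f t))\<^sup>2)"
      by (simp only: of_real_eq_iff)
    then show ?thesis by (simp add: shift sum_nonneg)
  qed
  define good where "good n e \<longleftrightarrow> finite_ip.orthosystem N e n \<and> (\<forall>j<n. e j \<in> lin_span w \<and> ?ip (e j) (e j) = 1)" for n e
  have bound: "n \<le> N" if "\<exists>e. good n e" for n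
    using that orthonormal_card_le unfolding good_def by blast
  have "\<exists>e. good 0 e" by (simp add: good_def finite_ip.orthosystem_def)
  then have "\<exists>e. good (GREATEST n. \<exists>e. good n e) e"
    by (rule GreatestI_nat[where P = "\<lambda>n. \<exists>e. good n e" and b = N]) (use bound in blast)
  then obtain n e where n: "n = (GREATEST n. \<exists>e. good n e)" and ge: "good n e" by blast
  have max: "n' \<le> n" if "good n' e'" for n' e'
    unfolding n by (rule Greatest_le_nat[where b = N]) (use bound that in blast)+
  have os: "finite_ip.orthosystem N e n" and sp: "\<And>j. j < n \<Longrightarrow> e j \<in> lin_span w" and unit: "\<And>j. j < n \<Longrightarrow> ?ip (e j) (e j) = 1"
    using ge by (auto simp: good_def)
  have res0: "finite_ip.nrm2 N (\<lambda>t. f t - finite_ip.proj N e n f t) = 0" and spr: "(\<lambda>t. f t - finite_ip.proj N e n f t) \<in> lin_span w"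
    if f: "f \<in> lin_span w" for f
  proof -
    define r where "r = (\<lambda>t. f t - finite_ip.proj N e n f t)"
    define e' where "e' = e(n := (\<lambda>x. of_real (1 / sqrt (finite_ip.nrm2 N r)) * r x))"
    have "finite_ip.proj N e n f \<in> lin_span w"
      unfolding finite_ip.proj_def by (rule lin_span_sum) (use sp in auto)
    from lin_span_add[OF f lin_span_scale[OF this, of "- 1"]]
    have rs: "r \<in> lin_span w" by (simp add: r_def)
    then show "(\<lambda>t. f t - finite_ip.proj N e n f t) \<in> lin_span w" by (simp add: r_def)
    show "finite_ip.nrm2 N (\<lambda>t. f t - finite_ip.proj N e n f t) = 0"
    proof (rule ccontr)
      assume "finite_ip.nrm2 N (\<lambda>t. f t - finite_ip.proj N e n f t) \<noteq> 0"
      then have "?ip (e' n) (e' n) = 1"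
        unfolding e'_def r_def by (rule finite_ip.orthosystem_extend(3)[OF os UNIV_I])
      moreover have "finite_ip.orthosystem N e' (Suc n)"
        unfolding e'_def r_def by (rule finite_ip.orthosystem_extend(1)[OF os UNIV_I])
      moreover have "e' n \<in> lin_span w" unfolding e'_def fun_upd_same by (rule lin_span_scale[OF rs])
      moreover have "e' j = e j" if "j < n" for j using that by (simp add: e'_def)
      ultimately have "good (Suc n) e'"
        using sp unit unfolding good_def by (simp add: less_Suc_eq)
      then show False using max by fastforce
    qed
  qed
  \<comment> \<open>On the first parts of the \<open>e j\<close>, which are orthonormal, \<open>W\<close> takes the middle parts as values.\<close>
  define W where "W i t = (\<Sum>j<n. e j (N + i) * cnj (e j t))" for i t
  have Wy: "(\<Sum>t<N. W i t * y t) = (\<Sum>j<n. ?ip (e j) y * e j (N + i))" for i y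
  proof -
    have "(\<Sum>t<N. W i t * y t) = (\<Sum>t<N. \<Sum>j<n. e j (N + i) * cnj (e j t) * y t)"
      by (simp add: W_def sum_distrib_right)
    also have "\<dots> = (\<Sum>j<n. \<Sum>t<N. e j (N + i) * cnj (e j t) * y t)" by (rule sum.swap)
    finally show ?thesis by (simp add: finite_ip_def sum_distrib_left sum_distrib_right mult_ac)
  qed
  have "(\<Sum>t<N. W i t * u x t) = v x i" if i: "i < M" for x i
  proof -
    let ?r = "\<lambda>t. w x t - finite_ip.proj N e n (w x) t"
    have "(\<Sum>i<M. (cmod (?r (N + i)))\<^sup>2) \<le> 0"
      using part[OF spr[OF lin_span_base, of x]] res0[OF lin_span_base, of x] by (simp add: finite_ip_nrm2)
    moreover have "(cmod (?r (N + i)))\<^sup>2 \<le> (\<Sum>i<M. (cmod (?r (N + i)))\<^sup>2)"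
      using i by (intro member_le_sum) auto
    ultimately have "w x (N + i) = finite_ip.proj N e n (w x) (N + i)"
      by (smt (verit) zero_le_power2 power2_eq_iff_nonneg norm_ge_zero zero_power2 norm_eq_zero eq_iff_diff_eq_0)
    also have "\<dots> = (\<Sum>t<N. W i t * w x t)" unfolding Wy finite_ip.proj_def ..
    also have "\<dots> = (\<Sum>t<N. W i t * u x t)" by (intro sum.cong) (auto simp: w_def)
    finally show ?thesis using wv[OF i] by simp
  qed
  moreover have "(\<Sum>i<M. (cmod (\<Sum>t<N. W i t * y t))\<^sup>2) \<le> (\<Sum>t<N. (cmod (y t))\<^sup>2)" for y :: "nat \<Rightarrow> complex"
  proof -
    let ?a = "\<lambda>j. ?ip (e j) y"
    let ?f = "\<lambda>t. \<Sum>j<n. ?a j * e j t"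
    have "(\<Sum>i<M. (cmod (\<Sum>t<N. W i t * y t))\<^sup>2) = (\<Sum>i<M. (cmod (?f (N + i)))\<^sup>2)"
      by (simp only: Wy)
    also have "\<dots> \<le> (\<Sum>t<N. (cmod (?f t))\<^sup>2)"
      by (rule part[OF lin_span_sum]) (use sp in auto)
    also have "\<dots> = (\<Sum>j<n. (cmod (?a j))\<^sup>2)"
    proof -
      have c: "?ip ?f (e k) = cnj (?a k)" if "k < n" for k
      proof -
        have "?ip ?f (e k) = cnj (?ip (e k) ?f)" by (rule finite_ip.ip_cnj) auto
        also have "?ip (e k) ?f = ?a k * ?ip (e k) (e k)" by (rule finite_ip.ip_orthosystem_sum[OF os that])
        finally show ?thesis by (simp only: unit[OF that] mult_1_right)
      qed
      have "?ip ?f ?f = (\<Sum>k<n. ?a k * ?ip ?f (e k))" by (rule finite_ip.ip_sum) auto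
      also have "\<dots> = (\<Sum>k<n. of_real ((cmod (?a k))\<^sup>2))"
        by (intro sum.cong refl) (simp only: complex_norm_square c lessThan_iff)
      finally have "?ip ?f ?f = (\<Sum>k<n. of_real ((cmod (?a k))\<^sup>2))" .
      then have "finite_ip.nrm2 N ?f = (\<Sum>k<n. (cmod (?a k))\<^sup>2)" by (simp add: finite_ip.nrm2_def)
      then show ?thesis by (simp only: finite_ip_nrm2)
    qed
    also have "\<dots> \<le> (\<Sum>t<N. (cmod (y t))\<^sup>2)" by (rule bessel[OF os])
    finally show ?thesis .
  qed
  ultimately show ?thesis by (intro exI[of _ W] conjI) simp_all
qed

section \<open>The positivity certificate\<close>

definition word_seq :: "nat \<Rightarrow> nat \<Rightarrow> (complex ^ 'd::finite) \<times> nat \<Rightarrow> complex" where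
  "word_seq \<beta> n = (case from_nat n :: 'd list \<times> nat of (w, b) \<Rightarrow> if b < \<beta> then word w b else (\<lambda>_. 0))"

lemma word_seq_in_polys: "word_seq \<beta> n \<in> polys \<beta>"
  by (auto simp: word_seq_def polys_word polys_zero split: prod.split)

lemma polys_spanned:
  fixes g :: "(complex ^ 'd::finite) \<times> nat \<Rightarrow> complex"
  assumes "g \<in> polys \<beta>"
  shows "\<exists>N a. g = (\<lambda>x. \<Sum>n<(N::nat). a n * word_seq \<beta> n x)"
  using assms
proof induction
  case polys_zero
  show ?case by (intro exI[of _ 0]) simp
next
  case (polys_step g b a0 w)
  obtain N a where g: "g = (\<lambda>x. \<Sum>n<(N::nat). a n * word_seq \<beta> n x)" using polys_step.IH by (elim exE)
  define n0 where "n0 = to_nat (w, b)"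
  have n0: "word_seq \<beta> n0 = word w b" using polys_step.hyps(2) by (simp add: word_seq_def n0_def)
  define N' where "N' = max N (Suc n0)"
  let ?a = "\<lambda>n. (if n < N then a n else 0) + (if n = n0 then a0 else 0)"
  have "(\<Sum>n<N'. ?a n * word_seq \<beta> n x) = g x + a0 * word w b x" for x
  proof -
    have "(\<Sum>n<N'. ?a n * word_seq \<beta> n x) = (\<Sum>n<N'. if n < N then a n * word_seq \<beta> n x else 0)
        + (\<Sum>n<N'. if n = n0 then a0 * word_seq \<beta> n0 x else 0)"
      unfolding sum.distrib[symmetric] by (intro sum.cong) (auto simp: distrib_right)
    also have "(\<Sum>n<N'. if n < N then a n * word_seq \<beta> n x else 0) = (\<Sum>n<N. a n * word_seq \<beta> n x)"
      by (rule sum.mono_neutral_cong_right) (auto simp: N'_def)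
    also have "(\<Sum>n<N'. if n = n0 then a0 * word_seq \<beta> n0 x else 0) = a0 * word w b x"
      by (simp add: n0 N'_def)
    finally show ?thesis by (simp add: g)
  qed
  then have "(\<lambda>x. g x + a0 * word w b x) = (\<lambda>x. \<Sum>n<N'. ?a n * word_seq \<beta> n x)" by simp
  then show ?case by (rule exI[of _ N', OF exI[of _ ?a]])
qed

lemma block_norm_square: "(block_norm n w)\<^sup>2 = (\<Sum>t<n. (ell2_norm (w t))\<^sup>2)"
  by (simp add: block_norm_def sum_nonneg)

text \<open>Both sides of the estimate are continuous along truncations.\<close>

lemma opmat_norm_le_dense:
  assumes S: "S \<subseteq> range (\<iota> :: nat \<Rightarrow> 'x)" "inj \<iota>"
    and X: "\<And>i j. i < dim_row X \<Longrightarrow> j < dim_col X \<Longrightarrow> bounded_op S (X $$ (i, j))"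
    and bd: "\<And>v. (\<And>j. j < dim_col X \<Longrightarrow> v j \<in> finsupp S) \<Longrightarrow>
      block_norm (dim_row X) (opmat_apply X v) \<le> K * block_norm (dim_col X) v" and K: "0 \<le> K"
  shows "opmat_norm S X \<le> K"
proof (rule opmat_norm_le[OF _ K])
  fix v assume "\<forall>j<dim_col X. v j \<in> ell2 S"
  then have v: "v j \<in> ell2 S" if "j < dim_col X" for j using that by simp
  define cut where "cut n j = (\<lambda>x. if x \<in> \<iota> ` {..<n} then v j x else 0)" for n j
  have cut: "cut n j \<in> finsupp S" if "j < dim_col X" for n j
    unfolding cut_def by (rule truncation_finsupp[OF v[OF that]]) simp
  note cl = finsupp_ell2[OF cut]
  have lim: "(\<lambda>n. ell2_norm (\<lambda>x. cut n j x - v j x)) \<longlonglongrightarrow> 0" if "j < dim_col X" for j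
    unfolding cut_def by (rule ell2_truncations_converge[OF v[OF that] S])
  have "(\<lambda>n. block_norm (dim_col X) (cut n)) \<longlonglongrightarrow> block_norm (dim_col X) v"
    by (intro block_norm_tendsto ell2_norm_tendsto[OF cl v lim])
  then have 1: "(\<lambda>n. K * block_norm (dim_col X) (cut n)) \<longlonglongrightarrow> K * block_norm (dim_col X) v"
    by (rule tendsto_mult_left)
  have 2: "(\<lambda>n. block_norm (dim_row X) (opmat_apply X (cut n))) \<longlonglongrightarrow> block_norm (dim_row X) (opmat_apply X v)"
  proof (rule block_norm_tendsto, rule ell2_norm_tendsto[where S = S])
    fix i assume i: "i < dim_row X"
    show "opmat_apply X (cut n) i \<in> ell2 S" for n by (rule opmat_apply_mem[OF X cl i])
    show "opmat_apply X v i \<in> ell2 S" by (rule opmat_apply_mem[OF X v i])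
    show "(\<lambda>n. ell2_norm (\<lambda>x. opmat_apply X (cut n) i x - opmat_apply X v i x)) \<longlonglongrightarrow> 0"
      unfolding opmat_apply_def
    proof (rule ell2_limit_sum[where S = S])
      fix j assume "j \<in> {..<dim_col X}"
      then have j: "j < dim_col X" by simp
      show "(X $$ (i, j)) (cut n j) \<in> ell2 S" for n by (rule bounded_opD(1)[OF X[OF i j] cl[OF j]])
      show "(X $$ (i, j)) (v j) \<in> ell2 S" by (rule bounded_opD(1)[OF X[OF i j] v[OF j]])
      show "(\<lambda>n. ell2_norm (\<lambda>x. (X $$ (i, j)) (cut n j) x - (X $$ (i, j)) (v j) x)) \<longlonglongrightarrow> 0"
        by (rule bounded_op_continuous[OF X[OF i j] cl[OF j] v[OF j] lim[OF j]])
    qed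
  qed
  show "block_norm (dim_row X) (opmat_apply X v) \<le> K * block_norm (dim_col X) v"
    by (rule LIMSEQ_le[OF 2 1], intro exI[of _ 0] allI impI, rule bd[OF cut])
qed

text \<open>In the represented space the \<open>T i\<close> are the multiplications by the coordinates, hence \<open>p(T)\<close> is the
  multiplication by \<open>p\<close>.\<close>

lemma op_peval_representation:
  fixes T :: "'d::{finite,linorder} \<Rightarrow> 'x oper"
  assumes rep: "l2_representation (polys \<beta>) ip \<iota> S U R"
    and TU: "\<And>i g. g \<in> polys \<beta> \<Longrightarrow> T i (U g) = U (\<lambda>x. vec_nth (fst x) i * g x)" and g: "g \<in> polys \<beta>"
  shows "op_peval p T (U g) = U (\<lambda>x. peval p (fst x) * g x)"
proof -
  interpret l2_representation "polys \<beta>" ip \<iota> S U R by (rule rep)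
  have pow: "(T i ^^ n) (U g) = U (\<lambda>x. vec_nth (fst x) i ^ n * g x) \<and> (\<lambda>x. vec_nth (fst x) i ^ n * g x) \<in> polys \<beta>"
    if g: "g \<in> polys \<beta>" for i n g
  proof (induction n)
    case (Suc n)
    then show ?case using TU[where i = i and g = "\<lambda>x. vec_nth (fst x) i ^ n * g x"] polys_coord[where i = i and g = "\<lambda>x. vec_nth (fst x) i ^ n * g x"]
      by (simp add: mult.assoc)
  qed (simp add: g)
  define F where "F \<mu> i A = (T i ^^ Poly_Mapping.lookup \<mu> i) \<circ> A" for \<mu> i and A :: "('x \<Rightarrow> complex) \<Rightarrow> 'x \<Rightarrow> complex"
  have F: "F \<mu> i A h = (T i ^^ Poly_Mapping.lookup \<mu> i) (A h)" for \<mu> i A h by (simp add: F_def)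
  have monl: "foldr (F \<mu>) is id (U g) = U (\<lambda>x. (\<Prod>i\<leftarrow>is. vec_nth (fst x) i ^ Poly_Mapping.lookup \<mu> i) * g x)
    \<and> (\<lambda>x. (\<Prod>i\<leftarrow>is. vec_nth (fst x) i ^ Poly_Mapping.lookup \<mu> i) * g x) \<in> polys \<beta>" for "is" \<mu>
  proof (induction "is")
    case (Cons i "is")
    let ?h = "\<lambda>x. (\<Prod>i\<leftarrow>is. vec_nth (fst x) i ^ Poly_Mapping.lookup \<mu> i) * g x"
    have "foldr (F \<mu>) (i # is) id (U g) = (T i ^^ Poly_Mapping.lookup \<mu> i) (foldr (F \<mu>) is id (U g))"
      by (simp only: foldr.simps comp_apply F[of \<mu> i "foldr (F \<mu>) is id" "U g"])
    also have "\<dots> = (T i ^^ Poly_Mapping.lookup \<mu> i) (U ?h)" by (simp only: conjunct1[OF Cons.IH])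
    finally show ?case
      using pow[OF conjunct2[OF Cons.IH], where i = i and n = "Poly_Mapping.lookup \<mu> i"]
      by (simp only: list.map prod_list.Cons mult.assoc simp_thms)
  qed (simp add: g)
  have "meval \<mu> z = (\<Prod>i\<leftarrow>sorted_list_of_set UNIV. vec_nth z i ^ Poly_Mapping.lookup \<mu> i)" for \<mu> and z :: "complex ^ 'd::{finite,linorder}"
    by (simp add: meval_def prod.distinct_set_conv_list[symmetric])
  then have mon: "op_monom T \<mu> (U g) = U (\<lambda>x. meval \<mu> (fst x) * g x)" "(\<lambda>x. meval \<mu> (fst x) * g x) \<in> polys \<beta>" for \<mu>
    using monl[of \<mu> "sorted_list_of_set UNIV"] by (simp_all add: op_monom_def F_def[abs_def])
  have "op_peval p T (U g) = U (\<lambda>x. \<Sum>\<mu>\<in>Poly_Mapping.keys p. Poly_Mapping.lookup p \<mu> * (meval \<mu> (fst x) * g x))"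
    unfolding op_peval_def U_sum[OF mon(2)] by (simp only: mon(1))
  then show ?thesis by (simp add: peval_eq_sum sum_distrib_right mult.assoc)
qed

text \<open>Otherwise a separating functional yields, by the GNS construction, operators \<open>T\<close> with \<open>\<parallel>P(T)\<parallel> \<le> 1\<close> for
  which both \<open>\<parallel>Q(T) h\<parallel> \<ge> \<parallel>q(T) h\<parallel>\<close> (from the separation) and \<open>\<parallel>Q(T) h\<parallel> \<le> c \<parallel>q(T) h\<parallel>\<close>, \<open>c < 1\<close> (from the
  Agler norm and approximation) hold for the tuple \<open>h\<close> of cyclic vectors. This forces \<open>q(T) = 0\<close>, which
  contradicts the lower bound of \<open>\<bar>q\<bar>\<close> on the joint spectra of the approximating tuples.\<close>

lemma positivity_certificate:
  fixes P :: "nat \<Rightarrow> 'd::{finite,linorder} mpoly mat" and F :: "complex ^ 'd::{finite,linorder} \<Rightarrow> complex mat"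
    and q :: "'d mpoly" and Q :: "nat \<Rightarrow> nat \<Rightarrow> 'd mpoly"
  assumes inf: "infinite (UNIV :: 'x set)"
    and P: "\<And>j. j < k \<Longrightarrow> P j \<in> carrier_mat (l j) (m j)"
    and approx: "approximation_condition TYPE('x) (direct_sum k P)"
    and hk: "hermitian_kernels k l m P c"
    and agler: "agler_norm TYPE('x) (direct_sum k P) \<alpha> \<beta> F < 1"
    and q: "\<And>z. z \<in> closure (dom_P (direct_sum k P)) \<Longrightarrow> peval q z \<noteq> 0"
    and F: "\<And>z r b. z \<in> dom_P (direct_sum k P) \<Longrightarrow> r < \<alpha> \<Longrightarrow> b < \<beta> \<Longrightarrow> F z $$ (r, b) = peval (Q r b) z / peval q z"
  shows "(\<lambda>x y. (\<Sum>b<\<beta>. dyad (\<lambda>x. peval q (fst x) * word [] b x) x y)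
      - (\<Sum>a<\<alpha>. dyad (\<lambda>x. \<Sum>b<\<beta>. peval (Q a b) (fst x) * word [] b x) x y))
    \<in> hermitian_kernels.cone k \<beta> l m P"
proof (rule ccontr)
  interpret hermitian_kernels k \<beta> l m P c by (rule hk)
  let ?D = "direct_sum k P"
  define u where "u b = (\<lambda>x :: (complex ^ 'd::{finite,linorder}) \<times> nat. peval q (fst x) * word [] b x)" for b
  define v where "v a = (\<lambda>x :: (complex ^ 'd::{finite,linorder}) \<times> nat. \<Sum>b<\<beta>. peval (Q a b) (fst x) * word [] b x)" for a
  assume "(\<lambda>x y. (\<Sum>b<\<beta>. dyad (\<lambda>x. peval q (fst x) * word [] b x) x y)
      - (\<Sum>a<\<alpha>. dyad (\<lambda>x. \<Sum>b<\<beta>. peval (Q a b) (fst x) * word [] b x) x y)) \<notin> cone"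
  then have notin: "(\<lambda>x y. (\<Sum>b<\<beta>. dyad (u b) x y) - (\<Sum>a<\<alpha>. dyad (v a) x y)) \<notin> cone"
    by (simp add: u_def v_def)
  have u: "u b \<in> polys \<beta>" if "b < \<beta>" for b unfolding u_def by (intro polys_peval polys_word that)
  have v: "v a \<in> polys \<beta>" for a unfolding v_def by (intro polys_sum polys_peval polys_word) auto
  obtain ip where ip: "semi_inner_product (polys \<beta>) ip
    \<and> (\<forall>g\<in>polys \<beta>. \<forall>i. Re (ip (\<lambda>x. vec_nth (fst x) i * g x) (\<lambda>x. vec_nth (fst x) i * g x)) \<le> c\<^sup>2 * Re (ip g g))
    \<and> (\<forall>j<k. \<forall>h. (\<forall>s<m j. h s \<in> polys \<beta>) \<longrightarrow>
        (\<Sum>r<l j. Re (ip (Pmult j h r) (Pmult j h r))) \<le> (\<Sum>s<m j. Re (ip (h s) (h s))))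
    \<and> (\<Sum>b<\<beta>. Re (ip (word [] b) (word [] b))) = 1
    \<and> (\<Sum>b<\<beta>. Re (ip (u b) (u b))) \<le> (\<Sum>a<\<alpha>. Re (ip (v a) (v a)))"
    by (rule exE[OF separating_semi_inner_product[OF u v notin]])
  interpret semi_inner_product "polys \<beta>" ip using ip by simp
  have ip_coord: "nrm2 (\<lambda>x. vec_nth (fst x) i * g x) \<le> \<bar>c\<bar>\<^sup>2 * nrm2 g" if "g \<in> polys \<beta>" for g i
    using ip that by (simp add: nrm2_def)
  have ip_weight: "(\<Sum>r<l j. nrm2 (Pmult j h r)) \<le> (\<Sum>s<m j. nrm2 (h s))"
    if "j < k" "\<And>s. s < m j \<Longrightarrow> h s \<in> polys \<beta>" for j h
    using ip that by (simp add: nrm2_def)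
  have ip_one: "(\<Sum>b<\<beta>. nrm2 (word [] b)) = 1" and ip_uv: "(\<Sum>b<\<beta>. nrm2 (u b)) \<le> (\<Sum>a<\<alpha>. nrm2 (v a))"
    using ip by (simp_all add: nrm2_def)
  obtain \<iota> :: "nat \<Rightarrow> 'x" where \<iota>: "inj \<iota>" using infinite_countable_subset[OF inf] by blast
  have "\<exists>S U R. l2_representation (polys \<beta>) ip \<iota> S U R"
    by (rule l2_representation_exists[OF word_seq_in_polys polys_spanned \<iota>])
  then obtain S U R where rep: "l2_representation (polys \<beta>) ip \<iota> S U R" by (elim exE)
  interpret rep: l2_representation "polys \<beta>" ip \<iota> S U R by (rule rep)
  have "\<forall>i. \<exists>T. bounded_op S T \<and> (\<forall>g\<in>polys \<beta>. T (U g) = U (\<lambda>x. vec_nth (fst x) i * g x))"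
  proof
    fix i
    show "\<exists>T. bounded_op S T \<and> (\<forall>g\<in>polys \<beta>. T (U g) = U (\<lambda>x. vec_nth (fst x) i * g x))"
      by (rule rep.transported_operator[where A = "\<lambda>g x. vec_nth (fst x) i * g x" and K = "\<bar>c\<bar>"])
        (simp_all add: polys_coord ip_coord[simplified] distrib_left mult.left_commute)
  qed
  then have "\<exists>T. \<forall>i. bounded_op S (T i) \<and> (\<forall>g\<in>polys \<beta>. T i (U g) = U (\<lambda>x. vec_nth (fst x) i * g x))"
    by (rule choice)
  then obtain T where T: "\<forall>i. bounded_op S (T i) \<and> (\<forall>g\<in>polys \<beta>. T i (U g) = U (\<lambda>x. vec_nth (fst x) i * g x))"
    by (rule exE)
  have bT: "bounded_op S (T i)" and TU: "g \<in> polys \<beta> \<Longrightarrow> T i (U g) = U (\<lambda>x. vec_nth (fst x) i * g x)" for i g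
    using T by simp_all
  have pT: "op_peval p T (U g) = U (\<lambda>x. peval p (fst x) * g x)" if "g \<in> polys \<beta>" for p g
    by (rule op_peval_representation[OF rep TU that])
  have comm: "commuting_tuple S T"
    unfolding commuting_tuple_def
  proof (intro conjI allI ballI bT)
    fix i j f assume f: "f \<in> ell2 S"
    show "T i (T j f) = T j (T i f)"
    proof (rule rep.bounded_op_eqI[OF bounded_op_comp[OF bT bT] bounded_op_comp[OF bT bT] _ f])
      fix g :: "(complex ^ 'd::{finite,linorder}) \<times> nat \<Rightarrow> complex"
      assume g: "g \<in> polys \<beta>"
      show "T i (T j (U g)) = T j (T i (U g))"
        by (simp only: TU[OF g] TU[OF polys_coord[OF g]]) (simp only: mult.left_commute)
    qed
  qed
  have nT: "opmat_norm S (opmat_peval ?D T) \<le> 1"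
  proof (rule opmat_norm_le_dense[OF rep.S rep.inj])
    show "bounded_op S (opmat_peval ?D T $$ (i, j))"
      if "i < dim_row (opmat_peval ?D T)" "j < dim_col (opmat_peval ?D T)" for i j
      using that by (simp add: bounded_op_peval[OF bT])
    fix V assume V0: "\<And>j. j < dim_col (opmat_peval ?D T) \<Longrightarrow> V j \<in> finsupp S"
    have dims: "dim_row ?D = (\<Sum>j<k. l j)" "dim_col ?D = (\<Sum>j<k. m j)"
      using direct_sum_carrier[where l = l and m = m, OF P] by auto
    have V: "V t \<in> finsupp S" if "t < (\<Sum>j<k. m j)" for t using V0[of t] that by (simp add: dims)
    define H where "H t = R (V t)" for t
    have H: "H t \<in> polys \<beta>" "V t = U (H t)" if "t < (\<Sum>j<k. m j)" for t
      using rep.R_closed[OF V[OF that]] rep.U_R[OF V[OF that]] by (simp_all add: H_def)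
    let ?H = "\<lambda>j s. H ((\<Sum>t<j. m t) + s)"
    have Hj: "?H j s \<in> polys \<beta>" "V ((\<Sum>t<j. m t) + s) = U (?H j s)" if "j < k" "s < m j" for j s
      using H[OF block_index_less[where n = m, OF that]] by simp_all
    have row: "opmat_apply (opmat_peval ?D T) V ((\<Sum>t<i. l t) + r) = U (Pmult i (?H i) r)"
      if i: "i < k" "r < l i" for i r
    proof
      fix x
      have ir: "(\<Sum>t<i. l t) + r < (\<Sum>j<k. l j)" by (rule block_index_less[where n = l, OF i])
      have "opmat_apply (opmat_peval ?D T) V ((\<Sum>t<i. l t) + r) x
        = (\<Sum>t<(\<Sum>j<k. m j). op_peval (?D $$ ((\<Sum>t<i. l t) + r, t)) T (V t) x)"
        using ir by (simp add: opmat_apply_def dims)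
      also have "\<dots> = (\<Sum>s<m i. op_peval (P i $$ (r, s)) T (V ((\<Sum>t<i. m t) + s)) x)"
        by (rule direct_sum_row[where l = l and m = m and \<phi> = "\<lambda>p t. op_peval p T (V t) x", OF P i]) auto
      also have "\<dots> = (\<Sum>s<m i. 1 * U (\<lambda>x. peval (P i $$ (r, s)) (fst x) * ?H i s x) x)"
        by (intro sum.cong refl) (simp add: Hj[OF i(1)] pT)
      also have "\<dots> = U (\<lambda>x. \<Sum>s<m i. 1 * (peval (P i $$ (r, s)) (fst x) * ?H i s x)) x"
        by (subst rep.U_sum) (auto intro: polys_peval Hj[OF i(1)])
      finally show "opmat_apply (opmat_peval ?D T) V ((\<Sum>t<i. l t) + r) x = U (Pmult i (?H i) r) x"
        by (simp add: Pmult_def)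
    qed
    have "(block_norm (\<Sum>j<k. l j) (opmat_apply (opmat_peval ?D T) V))\<^sup>2
      = (\<Sum>i<k. \<Sum>r<l i. nrm2 (Pmult i (?H i) r))"
      unfolding block_norm_square sum_blocks
      by (intro sum.cong refl) (simp add: row rep.U_norm Pmult_closed Hj)
    also have "\<dots> \<le> (\<Sum>i<k. \<Sum>s<m i. nrm2 (?H i s))"
      by (intro sum_mono ip_weight Hj) auto
    also have "\<dots> = (block_norm (\<Sum>j<k. m j) V)\<^sup>2"
      unfolding block_norm_square sum_blocks
      by (intro sum.cong refl) (simp add: rep.U_norm Hj)
    finally have "block_norm (\<Sum>j<k. l j) (opmat_apply (opmat_peval ?D T) V) \<le> block_norm (\<Sum>j<k. m j) V"
      by (rule power2_le_imp_le) simp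
    then show "block_norm (dim_row (opmat_peval ?D T)) (opmat_apply (opmat_peval ?D T) V)
      \<le> 1 * block_norm (dim_col (opmat_peval ?D T)) V" by (simp add: dims)
  qed simp
  have "\<exists>Ts. (\<forall>n. Ts n \<in> class_T ?D S) \<and> (\<forall>i. (\<lambda>n. op_norm S (\<lambda>f x. Ts n i f x - T i f x)) \<longlonglongrightarrow> 0)"
    using approx comm nT unfolding approximation_condition_def by simp
  then obtain Ts where Ts: "\<forall>n. Ts n \<in> class_T ?D S" "\<forall>i. (\<lambda>n. op_norm S (\<lambda>f x. Ts n i f x - T i f x)) \<longlonglongrightarrow> 0"
    by (elim exE conjE)
  have Tsn: "Ts n \<in> class_T ?D S" for n using Ts(1) by simp
  note bTs = class_TD(2)[OF Tsn]
  have conv: "op_tendsto S (\<lambda>n. Ts n i) (T i)" for i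
    by (rule op_tendsto_op_norm[OF bTs bT]) (use Ts(2) in simp)
  note convp = op_tendsto_peval[where Ts = Ts and T = T, OF conv]
  obtain c0 :: real where c0: "agler_norm TYPE('x) ?D \<alpha> \<beta> F < ereal c0" "ereal c0 < 1"
    using ereal_dense2[OF agler] by blast
  \<comment> \<open>A nonnegative constant can be squared in inequalities.\<close>
  define c1 where "c1 = max c0 0"
  have c1: "0 \<le> c1" "c1 < 1" "agler_norm TYPE('x) ?D \<alpha> \<beta> F < ereal c1"
    using c0 less_le_trans[OF c0(1), of "ereal c1"] by (auto simp: c1_def one_ereal_def)
  have "\<exists>\<Phi>. taylor_calculus S (Ts n) \<Phi> \<and> opmat_norm S (calculus_mat \<alpha> \<beta> \<Phi> F) \<le> c1" for n
    by (rule agler_norm_lessD[OF c1(3) Tsn])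
  then have ex\<Phi>: "\<forall>n. \<exists>\<Phi>. taylor_calculus S (Ts n) \<Phi> \<and> opmat_norm S (calculus_mat \<alpha> \<beta> \<Phi> F) \<le> c1" by (rule allI)
  obtain \<Phi> where \<Phi>: "\<forall>n. taylor_calculus S (Ts n) (\<Phi> n) \<and> opmat_norm S (calculus_mat \<alpha> \<beta> (\<Phi> n) F) \<le> c1"
    by (rule exE[OF choice[OF ex\<Phi>]])
  define h where "h b = U (word [] b)" for b
  have h: "h b \<in> ell2 S" if "b < \<beta>" for b
    unfolding h_def by (rule rep.U_ell2[OF polys_word[OF that]])
  have est: "block_norm \<alpha> (\<lambda>r x. \<Sum>b<\<beta>. op_peval (Q r b) (Ts n) (h b) x) \<le> c1 * block_norm \<beta> (\<lambda>b. op_peval q (Ts n) (h b))" for n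
    by (rule rational_function_estimate[where \<Phi> = "\<Phi> n" and F = F, OF _ Tsn])
      (use \<Phi> q closure_subset[of "dom_P ?D"] F h in auto)
  have lim1: "(\<lambda>n. block_norm \<alpha> (\<lambda>r x. \<Sum>b<\<beta>. op_peval (Q r b) (Ts n) (h b) x))
      \<longlonglongrightarrow> block_norm \<alpha> (\<lambda>r x. \<Sum>b<\<beta>. op_peval (Q r b) T (h b) x)"
  proof (rule block_norm_tendsto, rule ell2_norm_tendsto[where S = S])
    fix r
    show "(\<lambda>x. \<Sum>b<\<beta>. op_peval (Q r b) (Ts n) (h b) x) \<in> ell2 S" for n
      by (intro ell2_sum bounded_opD(1)[OF bounded_op_peval[OF bTs]] h) simp
    show "(\<lambda>x. \<Sum>b<\<beta>. op_peval (Q r b) T (h b) x) \<in> ell2 S"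
      by (intro ell2_sum bounded_opD(1)[OF bounded_op_peval[OF bT]] h) simp
    show "(\<lambda>n. ell2_norm (\<lambda>x. (\<Sum>b<\<beta>. op_peval (Q r b) (Ts n) (h b) x) - (\<Sum>b<\<beta>. op_peval (Q r b) T (h b) x))) \<longlonglongrightarrow> 0"
    proof (rule ell2_limit_sum[where S = S])
      fix b assume "b \<in> {..<\<beta>}"
      then have b: "b < \<beta>" by simp
      show "op_peval (Q r b) (Ts n) (h b) \<in> ell2 S" for n by (rule bounded_opD(1)[OF bounded_op_peval[OF bTs] h[OF b]])
      show "op_peval (Q r b) T (h b) \<in> ell2 S" by (rule bounded_opD(1)[OF bounded_op_peval[OF bT] h[OF b]])
      show "(\<lambda>n. ell2_norm (\<lambda>x. op_peval (Q r b) (Ts n) (h b) x - op_peval (Q r b) T (h b) x)) \<longlonglongrightarrow> 0"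
        by (rule op_tendsto_pointwise[OF convp h[OF b]])
    qed
  qed
  have lim2: "(\<lambda>n. c1 * block_norm \<beta> (\<lambda>b. op_peval q (Ts n) (h b))) \<longlonglongrightarrow> c1 * block_norm \<beta> (\<lambda>b. op_peval q T (h b))"
  proof (rule tendsto_mult_left, rule block_norm_tendsto, rule ell2_norm_tendsto[where S = S])
    fix b assume b: "b < \<beta>"
    show "op_peval q (Ts n) (h b) \<in> ell2 S" for n by (rule bounded_opD(1)[OF bounded_op_peval[OF bTs] h[OF b]])
    show "op_peval q T (h b) \<in> ell2 S" by (rule bounded_opD(1)[OF bounded_op_peval[OF bT] h[OF b]])
    show "(\<lambda>n. ell2_norm (\<lambda>x. op_peval q (Ts n) (h b) x - op_peval q T (h b) x)) \<longlonglongrightarrow> 0"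
      by (rule op_tendsto_pointwise[OF convp h[OF b]])
  qed
  have estT: "block_norm \<alpha> (\<lambda>r x. \<Sum>b<\<beta>. op_peval (Q r b) T (h b) x) \<le> c1 * block_norm \<beta> (\<lambda>b. op_peval q T (h b))"
    by (rule LIMSEQ_le[OF lim1 lim2], intro exI[of _ 0] allI impI, rule est)
  have qh: "op_peval q T (h b) = U (u b)" if "b < \<beta>" for b
    unfolding h_def u_def by (rule pT[OF polys_word[OF that]])
  have Qh: "(\<lambda>x. \<Sum>b<\<beta>. op_peval (Q r b) T (h b) x) = U (v r)" for r
  proof -
    have "U (\<lambda>x. \<Sum>b<\<beta>. 1 * (peval (Q r b) (fst x) * word [] b x)) = (\<lambda>y. \<Sum>b<\<beta>. 1 * U (\<lambda>x. peval (Q r b) (fst x) * word [] b x) y)"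
      by (rule rep.U_sum) (simp add: polys_peval polys_word)
    then show ?thesis by (simp add: v_def h_def pT polys_word)
  qed
  have "(\<Sum>a<\<alpha>. nrm2 (v a)) = (block_norm \<alpha> (\<lambda>r x. \<Sum>b<\<beta>. op_peval (Q r b) T (h b) x))\<^sup>2"
    unfolding block_norm_square Qh by (simp add: rep.U_norm v)
  also have "\<dots> \<le> (c1 * block_norm \<beta> (\<lambda>b. op_peval q T (h b)))\<^sup>2"
    by (intro power_mono estT) simp
  also have "\<dots> = c1\<^sup>2 * (\<Sum>b<\<beta>. nrm2 (u b))"
    unfolding power_mult_distrib block_norm_square by (simp add: qh rep.U_norm u)
  finally have "(\<Sum>b<\<beta>. nrm2 (u b)) \<le> c1\<^sup>2 * (\<Sum>b<\<beta>. nrm2 (u b))" using ip_uv by simp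
  moreover have "c1\<^sup>2 < 1" using c1(1,2) by (simp add: power_less_one_iff abs_square_less_1)
  moreover have "0 \<le> (\<Sum>b<\<beta>. nrm2 (u b))" by (intro sum_nonneg nrm2_nonneg u) simp
  ultimately have "(\<Sum>b<\<beta>. nrm2 (u b)) = 0"
    by (smt (verit) mult_le_cancel_right1 mult_less_cancel_right2)
  then have u0: "nrm2 (u b) = 0" if "b < \<beta>" for b
    using that sum_nonneg_eq_0_iff[of "{..<\<beta>}" "\<lambda>b. nrm2 (u b)"] nrm2_nonneg[OF u] by simp
  have w0: "nrm2 (\<lambda>x. peval q (fst x) * word w b x) = 0" if b: "b < \<beta>" for w b
  proof (induction w)
    case Nil show ?case using u0[OF b] by (simp add: u_def)
  next
    case (Cons i w)
    let ?g = "\<lambda>x. peval q (fst x) * word w b x"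
    have g: "?g \<in> polys \<beta>" by (intro polys_peval polys_word b)
    have "nrm2 (\<lambda>x. vec_nth (fst x) i * ?g x) = 0"
      using ip_coord[OF g, of i] Cons.IH nrm2_nonneg[OF polys_coord[OF g, of i]] by simp
    then show ?case by (simp add: word_Cons mult.left_commute)
  qed
  have qU: "U (\<lambda>x. peval q (fst x) * g x) = (\<lambda>_. 0)" if "g \<in> polys \<beta>" for g
    using that
  proof induction
    case polys_zero
    show ?case using rep.U_scale[OF polys.polys_zero, of 0] by simp
  next
    case (polys_step g b a w)
    have w: "(\<lambda>x. peval q (fst x) * word w b x) \<in> polys \<beta>" by (intro polys_peval polys_word polys_step.hyps(2))
    have "ell2_norm (U (\<lambda>x. peval q (fst x) * word w b x)) = 0"
      using rep.ell2_norm_U[OF w] w0[OF polys_step.hyps(2), of w] by simp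
    then have "U (\<lambda>x. peval q (fst x) * word w b x) = (\<lambda>_. 0)"
      using ell2_norm_eq_zero_iff[OF rep.U_ell2[OF w]] by simp
    then show ?case
      using rep.U_add[OF polys_peval[OF polys_step.hyps(1), of q] polys_scale[OF w, of a]] rep.U_scale[OF w, of a] polys_step.IH
      by (simp add: distrib_left mult.left_commute)
  qed
  have qT0: "op_peval q T f = (\<lambda>_. 0)" if f: "f \<in> ell2 S" for f
    by (rule rep.bounded_op_eqI[OF bounded_op_peval[OF bT] bounded_op_const_zero _ f]) (simp add: pT qU)
  have "\<exists>b<\<beta>. nrm2 (word [] b) \<noteq> 0"
  proof (rule ccontr)
    assume "\<not> (\<exists>b<\<beta>. nrm2 (word [] b) \<noteq> 0)"
    then have "(\<Sum>b<\<beta>. nrm2 (word [] b)) = 0" by simp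
    then show False using ip_one by simp
  qed
  then obtain b where b: "b < \<beta>" "nrm2 (word [] b) \<noteq> 0" by blast
  then have hb: "h b \<noteq> (\<lambda>_. 0)"
    using rep.U_norm[OF polys_word[OF b(1), of "[]"]] by (auto simp: h_def)
  obtain e where e: "e \<longlonglongrightarrow> 0" "\<forall>n. 0 \<le> e n"
    "\<forall>n. \<forall>f\<in>ell2 S. ell2_norm (\<lambda>x. op_peval q (Ts n) f x - op_peval q T f x) \<le> e n * ell2_norm f"
    using op_tendsto_rate[OF convp, of q] by (elim exE conjE)
  obtain d where d: "0 < d" "\<forall>z\<in>dom_P ?D. d \<le> cmod (peval q z)"
    using lower_bound_on_dom_P[OF P q] by blast
  have "d \<le> e n" for n
  proof -
    have tc: "taylor_calculus S (Ts n) (\<Phi> n)" using \<Phi> by simp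
    obtain z where z: "z \<in> joint_spectrum S (Ts n)"
      using joint_spectrum_nonempty[OF tc h[OF b(1)] hb] by blast
    have "cmod (peval q z) \<le> e n"
    proof (rule peval_le_on_spectrum[OF tc bTs _ _ z])
      show "ell2_norm (op_peval q (Ts n) f) \<le> e n * ell2_norm f" if f: "f \<in> ell2 S" for f
        using e(3)[rule_format, OF f, of n] by (simp add: qT0[OF f])
    qed (use e(2) in simp)
    moreover have "z \<in> dom_P ?D" using joint_spectrum_subset_dom_P[OF tc Tsn] z by blast
    ultimately show ?thesis using d(2) order_trans by blast
  qed
  then have "d \<le> 0" by (intro LIMSEQ_le_const[OF e(1)]) auto
  then show False using d(1) by simp
qed

section \<open>The realization\<close>

lemma invertible_if_injective:
  fixes A :: "complex mat"
  assumes A: "A \<in> carrier_mat n n" and inj: "\<And>v. v \<in> carrier_vec n \<Longrightarrow> A *\<^sub>v v = 0\<^sub>v n \<Longrightarrow> v = 0\<^sub>v n"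
  shows "\<exists>R\<in>carrier_mat n n. inverts_mat A R \<and> inverts_mat R A"
proof -
  have "det A \<noteq> 0" using det_0_iff_vec_prod_zero_field[OF A] inj by blast
  from det_non_zero_imp_unit[OF A this, of "()"] obtain R where "R * A = 1\<^sub>m n" "A * R = 1\<^sub>m n" "R \<in> carrier_mat n n"
    unfolding Units_def ring_mat_def by auto
  then show ?thesis using A by (auto simp: inverts_mat_def)
qed

lemma block_family_exists:
  fixes N :: "nat \<Rightarrow> nat" and w :: "nat \<Rightarrow> nat \<Rightarrow> 'a"
  shows "\<exists>f. \<forall>j<k. \<forall>t<N j. f ((\<Sum>i<j. N i) + t) = w j t"
proof (induction k)
  case (Suc k)
  then obtain f where f: "\<forall>j<k. \<forall>t<N j. f ((\<Sum>i<j. N i) + t) = w j t" by (elim exE)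
  let ?f = "\<lambda>t. if t < (\<Sum>i<k. N i) then f t else w k (t - (\<Sum>i<k. N i))"
  have "?f ((\<Sum>i<j. N i) + t) = w j t" if "j < Suc k" "t < N j" for j t
  proof (cases "j = k")
    case False
    then have "j < k" using that(1) by simp
    then show ?thesis using f that(2) block_index_less[of j k t N] by simp
  qed simp
  then show ?case by (intro exI[of _ ?f]) simp
qed simp

lemma block_index_cases:
  fixes N :: "nat \<Rightarrow> nat"
  assumes "t < (\<Sum>i<k. N i)"
  shows "\<exists>i<k. \<exists>r<N i. t = (\<Sum>j<i. N j) + r"
  using assms
proof (induction k)
  case (Suc k)
  show ?case
  proof (cases "t < (\<Sum>i<k. N i)")
    case True
    then obtain i r where "i < k" "r < N i" "t = (\<Sum>j<i. N j) + r" using Suc.IH by blast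
    then show ?thesis by (intro exI[of _ i]) auto
  next
    case False
    then show ?thesis using Suc.prems by (intro exI[of _ k] conjI exI[of _ "t - (\<Sum>i<k. N i)"]) auto
  qed
qed simp

abbreviation ampliated :: "nat \<Rightarrow> (nat \<Rightarrow> 'd::finite mpoly mat) \<Rightarrow> (nat \<Rightarrow> nat) \<Rightarrow> complex ^ 'd \<Rightarrow> complex mat" where
  "ampliated k P n z \<equiv> direct_sum k (\<lambda>i. kron (mat_peval (P i) z) (1\<^sub>m (n i)))"

lemma ampliated_carrier:
  assumes P: "\<And>j. j < k \<Longrightarrow> P j \<in> carrier_mat (l j) (m j)"
  shows "ampliated k P n z \<in> carrier_mat (\<Sum>i<k. n i * l i) (\<Sum>i<k. n i * m i)"
proof (rule direct_sum_carrier)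
  fix j assume "j < k"
  from P[OF this] show "kron (mat_peval (P j) z) (1\<^sub>m (n j)) \<in> carrier_mat (n j * l j) (n j * m j)"
    by (intro carrier_matI) (auto simp: mult.commute)
qed

text \<open>Row \<open>t'\<close> of the block \<open>P\<^sub>i \<otimes> I\<close> consists of row \<open>t' div n\<^sub>i\<close> of \<open>P\<^sub>i\<close>, spread over the columns that are
  congruent to \<open>t'\<close> modulo \<open>n\<^sub>i\<close>.\<close>

lemma ampliated_row:
  assumes P: "\<And>j. j < k \<Longrightarrow> P j \<in> carrier_mat (l j) (m j)" and i: "i < k" "t' < n i * l i"
  shows "(\<Sum>t<(\<Sum>i<k. n i * m i). ampliated k P n z $$ ((\<Sum>j<i. n j * l j) + t', t) * f t)
    = (\<Sum>s<m i. peval (P i $$ (t' div n i, s)) z * f ((\<Sum>j<i. n j * m j) + (s * n i + t' mod n i)))"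
proof -
  let ?K = "\<lambda>i. kron (mat_peval (P i) z) (1\<^sub>m (n i))"
  have K: "?K j \<in> carrier_mat (n j * l j) (n j * m j)" if "j < k" for j
    using P[OF that] by (intro carrier_matI) (auto simp: mult.commute)
  have n: "0 < n i" using i(2) by (cases "n i") auto
  have r: "t' div n i < l i" using i(2) by (simp add: less_mult_imp_div_less mult.commute)
  let ?o = "\<Sum>j<i. n j * m j"
  have "(\<Sum>t<(\<Sum>i<k. n i * m i). ampliated k P n z $$ ((\<Sum>j<i. n j * l j) + t', t) * f t)
    = (\<Sum>s<n i * m i. ?K i $$ (t', s) * f (?o + s))"
    by (rule direct_sum_row[where l = "\<lambda>i. n i * l i" and m = "\<lambda>i. n i * m i" and \<phi> = "\<lambda>x t. x * f t", OF K i]) auto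
  also have "\<dots> = (\<Sum>s<m i * n i. peval (P i $$ (t' div n i, s div n i)) z * (if t' mod n i = s mod n i then 1 else 0) * f (?o + (s div n i * n i + s mod n i)))"
  proof (intro sum.cong)
    fix s assume "s \<in> {..<m i * n i}"
    then have s: "s < m i * n i" by simp
    then have "s div n i < m i" by (simp add: less_mult_imp_div_less)
    then show "?K i $$ (t', s) * f (?o + s) = peval (P i $$ (t' div n i, s div n i)) z * (if t' mod n i = s mod n i then 1 else 0) * f (?o + (s div n i * n i + s mod n i))"
      using P[OF i(1)] i(2) s r n by (simp add: mult.commute[of "n i" "l i"])
  qed (simp add: mult.commute)
  also have "\<dots> = (\<Sum>s<m i. \<Sum>b<n i. peval (P i $$ (t' div n i, s)) z * (if t' mod n i = b then 1 else 0) * f (?o + (s * n i + b)))"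
    by (rule sum_div_mod)
  also have "\<dots> = (\<Sum>s<m i. \<Sum>b<n i. if b = t' mod n i then peval (P i $$ (t' div n i, s)) z * f (?o + (s * n i + t' mod n i)) else 0)"
    by (intro sum.cong refl) auto
  finally show ?thesis using n by simp
qed

text \<open>The ampliation acts as a copy of \<open>P\<^sub>i\<close> for each of the \<open>n\<^sub>i\<close> residues.\<close>

lemma ampliated_bound:
  assumes P: "\<And>j. j < k \<Longrightarrow> P j \<in> carrier_mat (l j) (m j)"
  shows "(\<Sum>t'<(\<Sum>i<k. n i * l i). (cmod (\<Sum>t<(\<Sum>i<k. n i * m i). ampliated k P n z $$ (t', t) * f t))\<^sup>2)
    \<le> (spectral_norm (mat_peval (direct_sum k P) z))\<^sup>2 * (\<Sum>t<(\<Sum>i<k. n i * m i). (cmod (f t))\<^sup>2)"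
proof -
  let ?s = "(spectral_norm (mat_peval (direct_sum k P) z))\<^sup>2"
  let ?o = "\<lambda>i. \<Sum>j<i. n j * m j"
  let ?g = "\<lambda>i r b. (cmod (\<Sum>s<m i. peval (P i $$ (r, s)) z * f (?o i + (s * n i + b))))\<^sup>2"
  have "(\<Sum>t'<(\<Sum>i<k. n i * l i). (cmod (\<Sum>t<(\<Sum>i<k. n i * m i). ampliated k P n z $$ (t', t) * f t))\<^sup>2)
    = (\<Sum>i<k. \<Sum>t'<n i * l i. ?g i (t' div n i) (t' mod n i))"
    unfolding sum_blocks[where n = "\<lambda>i. n i * l i"]
    by (intro sum.cong refl arg_cong[where f = "\<lambda>x. (cmod x)\<^sup>2"] ampliated_row[where l = l and m = m, OF P]) auto
  also have "\<dots> = (\<Sum>i<k. \<Sum>r<l i. \<Sum>b<n i. ?g i r b)"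
    by (rule sum.cong[OF refl]) (rule sum_mod_div[where f = "?g _"])
  also have "\<dots> = (\<Sum>i<k. \<Sum>b<n i. \<Sum>r<l i. ?g i r b)"
    by (intro sum.cong refl sum.swap)
  also have "\<dots> \<le> (\<Sum>i<k. \<Sum>b<n i. ?s * (\<Sum>s<m i. (cmod (f (?o i + (s * n i + b))))\<^sup>2))"
    by (intro sum_mono dom_P_block_bound[where l = l and m = m, OF P]) auto
  also have "\<dots> = ?s * (\<Sum>i<k. \<Sum>b<n i. \<Sum>s<m i. (cmod (f (?o i + (s * n i + b))))\<^sup>2)"
    by (simp only: sum_distrib_left)
  also have "(\<Sum>i<k. \<Sum>b<n i. \<Sum>s<m i. (cmod (f (?o i + (s * n i + b))))\<^sup>2)
    = (\<Sum>i<k. \<Sum>s<m i. \<Sum>b<n i. (cmod (f (?o i + (s * n i + b))))\<^sup>2)"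
    by (intro sum.cong refl sum.swap)
  also have "\<dots> = (\<Sum>i<k. \<Sum>t<n i * m i. (cmod (f (?o i + (t div n i * n i + t mod n i))))\<^sup>2)"
    by (rule sum.cong[OF refl]) (rule sum_mod_div[where f = "\<lambda>s b. (cmod (f (?o _ + (s * n _ + b))))\<^sup>2", symmetric])
  also have "\<dots> = (\<Sum>t<(\<Sum>i<k. n i * m i). (cmod (f t))\<^sup>2)"
    by (simp add: sum_blocks)
  finally show ?thesis .
qed

text \<open>The vector is padded by zeros and the surplus rows are dropped.\<close>

lemma contraction_submatrix:
  fixes W :: "nat \<Rightarrow> nat \<Rightarrow> complex"
  assumes W: "\<And>y :: nat \<Rightarrow> complex. (\<Sum>i<M + M'. (cmod (\<Sum>t<N + N'. W i t * y t))\<^sup>2) \<le> (\<Sum>t<N + N'. (cmod (y t))\<^sup>2)"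
  shows "(\<Sum>i<M. (cmod (\<Sum>t<N. W i t * y t))\<^sup>2) \<le> (\<Sum>t<N. (cmod (y t))\<^sup>2)"
proof -
  let ?y = "\<lambda>t. if t < N then y t else 0 :: complex"
  have 1: "(\<Sum>t<N + N'. W i t * ?y t) = (\<Sum>t<N. W i t * y t)" for i
    by (simp add: sum_lessThan_add)
  have 2: "(\<Sum>t<N + N'. (cmod (?y t))\<^sup>2) = (\<Sum>t<N. (cmod (y t))\<^sup>2)"
    by (simp add: sum_lessThan_add)
  have "(\<Sum>i<M. (cmod (\<Sum>t<N. W i t * y t))\<^sup>2) \<le> (\<Sum>i<M + M'. (cmod (\<Sum>t<N. W i t * y t))\<^sup>2)"
    by (simp add: sum_lessThan_add sum_nonneg)
  then show ?thesis using W[of ?y] unfolding 1 2 by simp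
qed

text \<open>\<open>A P\<^sub>n\<close> is a contraction times a strict contraction, so it has no nonzero fixed vector.\<close>

lemma realization_invertible:
  fixes W :: "nat \<Rightarrow> nat \<Rightarrow> complex"
  assumes P: "\<And>j. j < k \<Longrightarrow> P j \<in> carrier_mat (l j) (m j)" and z: "z \<in> dom_P (direct_sum k P)"
    and A: "A \<in> carrier_mat (\<Sum>i<k. n i * m i) (\<Sum>i<k. n i * l i)"
    and contr: "\<And>y. (\<Sum>i<(\<Sum>i<k. n i * m i). (cmod (\<Sum>t<(\<Sum>i<k. n i * l i). A $$ (i, t) * y t))\<^sup>2)
      \<le> (\<Sum>t<(\<Sum>i<k. n i * l i). (cmod (y t))\<^sup>2)"
  defines "N \<equiv> \<Sum>i<k. n i * m i"
  shows "\<exists>R\<in>carrier_mat N N. inverts_mat (1\<^sub>m N - A * ampliated k P n z) R \<and> inverts_mat R (1\<^sub>m N - A * ampliated k P n z)"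
proof (rule invertible_if_injective)
  let ?Pn = "ampliated k P n z" and ?L = "\<Sum>i<k. n i * l i"
  let ?s = "spectral_norm (mat_peval (direct_sum k P) z)"
  have Pn: "?Pn \<in> carrier_mat ?L N" unfolding N_def by (rule ampliated_carrier[OF P])
  have A': "A \<in> carrier_mat N ?L" using A by (simp add: N_def)
  have APn: "A * ?Pn \<in> carrier_mat N N" using A' Pn by simp
  then show "1\<^sub>m N - A * ?Pn \<in> carrier_mat N N" by (rule minus_carrier_mat)
  fix v :: "complex Matrix.vec" assume v: "v \<in> carrier_vec N" and zero: "(1\<^sub>m N - A * ?Pn) *\<^sub>v v = 0\<^sub>v N"
  have "v - (A * ?Pn) *\<^sub>v v = 0\<^sub>v N"
    using zero minus_mult_distrib_mat_vec[OF one_carrier_mat APn v] v by simp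
  then have "vec_index (v - (A * ?Pn) *\<^sub>v v) i = 0" if "i < N" for i using that by simp
  then have vi: "vec_index v i = vec_index ((A * ?Pn) *\<^sub>v v) i" if "i < N" for i
    using that A' v by (simp del: index_mult_mat_vec)
  have AP: "(A * ?Pn) *\<^sub>v v = A *\<^sub>v (?Pn *\<^sub>v v)" by (rule assoc_mult_mat_vec[OF A' Pn v])
  have Pv: "?Pn *\<^sub>v v \<in> carrier_vec (dim_col A)"
    using mult_mat_vec_carrier[OF Pn v] carrier_matD(2)[OF A'] by (simp only:)
  let ?f = "vec_index v" and ?w = "vec_index (?Pn *\<^sub>v v)"
  have w: "?w t = (\<Sum>t'<N. ?Pn $$ (t, t') * ?f t')" if "t < ?L" for t
    using mult_mat_vec_index_sum[of t ?Pn v] Pn v that by simp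
  have "?f i = (\<Sum>t<?L. A $$ (i, t) * ?w t)" if "i < N" for i
    using vi[OF that] mult_mat_vec_index_sum[OF _ Pv, of i] A' that unfolding AP by simp
  then have "(\<Sum>i<N. (cmod (?f i))\<^sup>2) = (\<Sum>i<N. (cmod (\<Sum>t<?L. A $$ (i, t) * ?w t))\<^sup>2)" by simp
  also have "\<dots> \<le> (\<Sum>t<?L. (cmod (?w t))\<^sup>2)" unfolding N_def by (rule contr)
  also have "\<dots> = (\<Sum>t<?L. (cmod (\<Sum>t'<N. ?Pn $$ (t, t') * ?f t'))\<^sup>2)" by (intro sum.cong) (auto simp: w)
  also have "\<dots> \<le> ?s\<^sup>2 * (\<Sum>i<N. (cmod (?f i))\<^sup>2)" unfolding N_def by (rule ampliated_bound[OF P])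
  finally have le: "(\<Sum>i<N. (cmod (?f i))\<^sup>2) \<le> ?s\<^sup>2 * (\<Sum>i<N. (cmod (?f i))\<^sup>2)" .
  have s: "?s\<^sup>2 < 1" using z spectral_norm_nonneg[of "mat_peval (direct_sum k P) z"]
    by (simp add: dom_P_def power_less_one_iff abs_square_less_1)
  have "(1 - ?s\<^sup>2) * (\<Sum>i<N. (cmod (?f i))\<^sup>2) \<le> 0" using le by (simp add: algebra_simps)
  then have "(\<Sum>i<N. (cmod (?f i))\<^sup>2) \<le> 0" using s by (simp add: mult_le_0_iff)
  then have "(\<Sum>i<N. (cmod (?f i))\<^sup>2) = 0" by (intro antisym sum_nonneg) auto
  then have "?f i = 0" if "i < N" for i using that by (simp add: sum_nonneg_eq_0_iff)
  then show "v = 0\<^sub>v N" using v by (intro eq_vecI) auto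
qed

text \<open>The denominators of all entries are multiplied; each of them has no zeros on \<open>X\<close>.\<close>

lemma common_denominator:
  assumes "rational_regular_on X \<alpha> \<beta> F"
  shows "\<exists>q Q. \<forall>z\<in>X. peval q z \<noteq> 0 \<and> (\<forall>r<\<alpha>. \<forall>b<\<beta>. F z $$ (r, b) = peval (Q r b) z / peval q z)"
proof -
  have "\<forall>rb. \<exists>pq. fst rb < \<alpha> \<longrightarrow> snd rb < \<beta> \<longrightarrow>
      (\<forall>z\<in>X. peval (snd pq) z \<noteq> 0 \<and> F z $$ rb = peval (fst pq) z / peval (snd pq) z)"
  proof
    fix rb :: "nat \<times> nat"
    obtain r b where rb: "rb = (r, b)" by (cases rb)
    show "\<exists>pq. fst rb < \<alpha> \<longrightarrow> snd rb < \<beta> \<longrightarrow>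
      (\<forall>z\<in>X. peval (snd pq) z \<noteq> 0 \<and> F z $$ rb = peval (fst pq) z / peval (snd pq) z)"
    proof (cases "r < \<alpha> \<and> b < \<beta>")
      case True
      then obtain p q where "\<forall>z\<in>X. peval q z \<noteq> 0 \<and> F z $$ (r, b) = peval p z / peval q z"
        using assms unfolding rational_regular_on_def by blast
      then show ?thesis by (intro exI[of _ "(p, q)"]) (simp add: rb)
    qed (auto simp: rb)
  qed
  from choice[OF this] obtain pq where pq: "\<forall>rb. fst rb < \<alpha> \<longrightarrow> snd rb < \<beta> \<longrightarrow>
      (\<forall>z\<in>X. peval (snd (pq rb)) z \<noteq> 0 \<and> F z $$ rb = peval (fst (pq rb)) z / peval (snd (pq rb)) z)"
    by (rule exE)
  let ?I = "{..<\<alpha>} \<times> {..<\<beta>}"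
  let ?q = "\<Prod>i\<in>?I. snd (pq i)" and ?Q = "\<lambda>r b. fst (pq (r, b)) * (\<Prod>i\<in>?I - {(r, b)}. snd (pq i))"
  have "\<forall>z\<in>X. peval ?q z \<noteq> 0 \<and> (\<forall>r<\<alpha>. \<forall>b<\<beta>. F z $$ (r, b) = peval (?Q r b) z / peval ?q z)"
  proof (intro ballI conjI allI impI)
    fix z assume z: "z \<in> X"
    have nz: "peval (snd (pq i)) z \<noteq> 0" if "i \<in> ?I" for i using pq z that by auto
    then show "peval ?q z \<noteq> 0" by (simp add: peval_prod)
    fix r b assume rb: "r < \<alpha>" "b < \<beta>"
    then have i: "(r, b) \<in> ?I" by simp
    have "peval ?q z = peval (snd (pq (r, b))) z * (\<Prod>i\<in>?I - {(r, b)}. peval (snd (pq i)) z)"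
      unfolding peval_prod by (rule prod.remove[OF _ i]) simp
    moreover have "(\<Prod>i\<in>?I - {(r, b)}. peval (snd (pq i)) z) \<noteq> 0" using nz by auto
    moreover have "F z $$ (r, b) = peval (fst (pq (r, b))) z / peval (snd (pq (r, b))) z" using pq z rb by simp
    ultimately show "F z $$ (r, b) = peval (?Q r b) z / peval ?q z" by (simp add: peval_mult peval_prod)
  qed
  then show ?thesis by (rule exI[of _ ?q, OF exI[of _ ?Q]])
qed

theorem theorem3p4:
  fixes k \<alpha> \<beta> :: nat and l m :: "nat \<Rightarrow> nat"
    and P :: "nat \<Rightarrow> 'd::{finite,linorder} mpoly mat"
    and F :: "complex ^ 'd::{finite,linorder} \<Rightarrow> complex mat"
  assumes "infinite (UNIV :: 'x set)"
    and "\<forall>i<k. P i \<in> carrier_mat (l i) (m i)"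
    and "approximation_condition TYPE('x) (direct_sum k P)"
    and "archimedean_condition k m P"
    and "rational_regular_on (closure (dom_P (direct_sum k P))) \<alpha> \<beta> F"
    and "agler_norm TYPE('x) (direct_sum k P) \<alpha> \<beta> F < 1"
  shows "\<exists>(n :: nat \<Rightarrow> nat) A B C D.
    A \<in> carrier_mat (\<Sum>i<k. n i * m i) (\<Sum>i<k. n i * l i) \<and>
    B \<in> carrier_mat (\<Sum>i<k. n i * m i) \<beta> \<and>
    C \<in> carrier_mat \<alpha> (\<Sum>i<k. n i * l i) \<and>
    D \<in> carrier_mat \<alpha> \<beta> \<and>
    spectral_norm (four_block_mat A B C D) \<le> 1 \<and>
    (\<forall>z\<in>dom_P (direct_sum k P).
       let Pn = direct_sum k (\<lambda>i. kron (mat_peval (P i) z) (1\<^sub>m (n i)));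
           M = 1\<^sub>m (\<Sum>i<k. n i * m i) - A * Pn
       in \<exists>R \<in> carrier_mat (\<Sum>i<k. n i * m i) (\<Sum>i<k. n i * m i).
            inverts_mat M R \<and> inverts_mat R M \<and>
            F z = D + C * Pn * R * B)"
proof -
  have P: "\<And>j. j < k \<Longrightarrow> P j \<in> carrier_mat (l j) (m j)" using assms(2) by simp
  obtain c where hk: "hermitian_kernels k l m P c"
    using archimedean_identity[where l = l, OF assms(4) P] unfolding hermitian_kernels_def by blast
  interpret hermitian_kernels k \<beta> l m P c by (rule hk)
  let ?X = "closure (dom_P (direct_sum k P))"
  have sub: "dom_P (direct_sum k P) \<subseteq> ?X" by (rule closure_subset)
  obtain q Q where qQ: "\<forall>z\<in>?X. peval q z \<noteq> 0 \<and> (\<forall>r<\<alpha>. \<forall>b<\<beta>. F z $$ (r, b) = peval (Q r b) z / peval q z)"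
    using common_denominator[OF assms(5)] by (elim exE)
  have q: "peval q z \<noteq> 0" if "z \<in> ?X" for z using qQ that by simp
  have FQ: "F z $$ (r, b) = peval (Q r b) z / peval q z" if "z \<in> dom_P (direct_sum k P)" "r < \<alpha>" "b < \<beta>" for z r b
    using qQ that sub by blast
  define u where "u b = (\<lambda>x :: (complex ^ 'd::{finite,linorder}) \<times> nat. peval q (fst x) * word [] b x)" for b
  define v where "v a = (\<lambda>x :: (complex ^ 'd::{finite,linorder}) \<times> nat. \<Sum>b<\<beta>. peval (Q a b) (fst x) * word [] b x)" for a
  have "(\<lambda>x y. (\<Sum>b<\<beta>. dyad (u b) x y) - (\<Sum>a<\<alpha>. dyad (v a) x y)) \<in> cone"
    unfolding u_def v_def by (rule positivity_certificate[OF assms(1) P assms(3) hk assms(6) q FQ])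
  from cone_representation[OF this] obtain n0 :: nat and g and n :: "nat \<Rightarrow> nat" and h
    where rep: "(\<lambda>x y. (\<Sum>b<\<beta>. dyad (u b) x y) - (\<Sum>a<\<alpha>. dyad (v a) x y))
      = (\<lambda>x y. (\<Sum>t<n0. dyad (g t) x y) + (\<Sum>j<k. \<Sum>b<n j. gen j (h j b) x y))"
    by (elim exE conjE)
  define L where "L = (\<Sum>i<k. n i * l i)"
  define N where "N = (\<Sum>i<k. n i * m i)"
  \<comment> \<open>\<open>hf\<close> lists the entries of the stacked polynomial matrices \<open>H\<^sub>j\<close>, and \<open>Pf\<close> those of \<open>P\<^sub>n H\<close>, in the
    order of the block and Kronecker indices.\<close>
  obtain Pf where Pf: "\<forall>j<k. \<forall>t<n j * l j. Pf ((\<Sum>i<j. n i * l i) + t) = Pmult j (h j (t mod n j)) (t div n j)"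
    using block_family_exists[of k "\<lambda>j. n j * l j" "\<lambda>j t. Pmult j (h j (t mod n j)) (t div n j)"] by (elim exE)
  obtain hf where hf: "\<forall>j<k. \<forall>t<n j * m j. hf ((\<Sum>i<j. n i * m i) + t) = h j (t mod n j) (t div n j)"
    using block_family_exists[of k "\<lambda>j. n j * m j" "\<lambda>j t. h j (t mod n j) (t div n j)"] by (elim exE)
  have sumP: "(\<Sum>t<L. dyad (Pf t) x y) = (\<Sum>j<k. \<Sum>b<n j. \<Sum>r<l j. dyad (Pmult j (h j b) r) x y)" for x y
  proof -
    have "(\<Sum>t<L. dyad (Pf t) x y) = (\<Sum>j<k. \<Sum>t<n j * l j. dyad (Pmult j (h j (t mod n j)) (t div n j)) x y)"
      unfolding L_def sum_blocks[where n = "\<lambda>i. n i * l i"] by (intro sum.cong refl) (simp add: Pf)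
    also have "\<dots> = (\<Sum>j<k. \<Sum>r<l j. \<Sum>b<n j. dyad (Pmult j (h j b) r) x y)"
      by (rule sum.cong[OF refl]) (rule sum_mod_div[where f = "\<lambda>r b. dyad (Pmult _ (h _ b) r) x y"])
    also have "\<dots> = (\<Sum>j<k. \<Sum>b<n j. \<Sum>r<l j. dyad (Pmult j (h j b) r) x y)"
      by (intro sum.cong refl sum.swap)
    finally show ?thesis .
  qed
  have sumh: "(\<Sum>t<N. dyad (hf t) x y) = (\<Sum>j<k. \<Sum>b<n j. \<Sum>s<m j. dyad (h j b s) x y)" for x y
  proof -
    have "(\<Sum>t<N. dyad (hf t) x y) = (\<Sum>j<k. \<Sum>t<n j * m j. dyad (h j (t mod n j) (t div n j)) x y)"
      unfolding N_def sum_blocks[where n = "\<lambda>i. n i * m i"] by (intro sum.cong refl) (simp add: hf)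
    also have "\<dots> = (\<Sum>j<k. \<Sum>s<m j. \<Sum>b<n j. dyad (h j b s) x y)"
      by (rule sum.cong[OF refl]) (rule sum_mod_div[where f = "\<lambda>s b. dyad (h _ b s) x y"])
    also have "\<dots> = (\<Sum>j<k. \<Sum>b<n j. \<Sum>s<m j. dyad (h j b s) x y)"
      by (intro sum.cong refl sum.swap)
    finally show ?thesis .
  qed
  \<comment> \<open>At \<open>x = (z, b)\<close> these are column \<open>b\<close> of \<open>(P(z)\<^sub>n H(z), q(z) I)\<close> and of \<open>(H(z), Q(z))\<close>.\<close>
  define uu where "uu x t = (if t < L then Pf t x else u (t - L) x)" for x t
  define vv where "vv x t = (if t < N then hf t x else v (t - N) x)" for x t
  have gram: "(\<Sum>t<L + \<beta>. cnj (uu x t) * uu y t)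
    = (\<Sum>t<N + \<alpha>. cnj (vv x t) * vv y t) + (\<Sum>t<n0. cnj (g t x) * g t y)" for x y
  proof -
    have "(\<Sum>t<L + \<beta>. cnj (uu x t) * uu y t) = (\<Sum>t<L. dyad (Pf t) x y) + (\<Sum>b<\<beta>. dyad (u b) x y)"
      by (simp add: sum_lessThan_add uu_def dyad_def)
    moreover have "(\<Sum>t<N + \<alpha>. cnj (vv x t) * vv y t) = (\<Sum>t<N. dyad (hf t) x y) + (\<Sum>a<\<alpha>. dyad (v a) x y)"
      by (simp add: sum_lessThan_add vv_def dyad_def)
    moreover have "(\<Sum>b<\<beta>. dyad (u b) x y) - (\<Sum>a<\<alpha>. dyad (v a) x y)
      = (\<Sum>t<n0. dyad (g t) x y) + (\<Sum>j<k. \<Sum>b<n j. gen j (h j b) x y)"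
      using fun_cong[OF fun_cong[OF rep], of x y] by simp
    moreover have "(\<Sum>j<k. \<Sum>b<n j. gen j (h j b) x y) = (\<Sum>t<N. dyad (hf t) x y) - (\<Sum>t<L. dyad (Pf t) x y)"
      unfolding sumP sumh by (simp add: gen_def sum_subtractf)
    ultimately show ?thesis by (simp add: dyad_def algebra_simps)
  qed
  obtain W :: "nat \<Rightarrow> nat \<Rightarrow> complex" where W: "\<forall>x. \<forall>i<N + \<alpha>. (\<Sum>t<L + \<beta>. W i t * uu x t) = vv x i"
    and Wc: "\<forall>y :: nat \<Rightarrow> complex. (\<Sum>i<N + \<alpha>. (cmod (\<Sum>t<L + \<beta>. W i t * y t))\<^sup>2) \<le> (\<Sum>t<L + \<beta>. (cmod (y t))\<^sup>2)"
    using lurking_contraction[where g = "\<lambda>x t. g t x", OF gram] by (elim exE conjE)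
  define A where "A = Matrix.mat N L (\<lambda>(i, t). W i t)"
  define B where "B = Matrix.mat N \<beta> (\<lambda>(i, b). W i (L + b))"
  define C where "C = Matrix.mat \<alpha> L (\<lambda>(a, t). W (N + a) t)"
  define D where "D = Matrix.mat \<alpha> \<beta> (\<lambda>(a, b). W (N + a) (L + b))"
  have car: "A \<in> carrier_mat N L" "B \<in> carrier_mat N \<beta>" "C \<in> carrier_mat \<alpha> L" "D \<in> carrier_mat \<alpha> \<beta>"
    by (simp_all add: A_def B_def C_def D_def)
  have four: "four_block_mat A B C D = Matrix.mat (N + \<alpha>) (L + \<beta>) (\<lambda>(i, t). W i t)"
    by (intro eq_matI) (auto simp: A_def B_def C_def D_def index_mat_four_block)
  have norm: "spectral_norm (four_block_mat A B C D) \<le> 1"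
  proof (rule spectral_norm_le)
    fix y :: "complex Matrix.vec" assume "y \<in> carrier_vec (dim_col (four_block_mat A B C D))"
    then have y: "y \<in> carrier_vec (L + \<beta>)" by (simp add: four)
    let ?W = "Matrix.mat (N + \<alpha>) (L + \<beta>) (\<lambda>(i, t). W i t)"
    have "vec_index (?W *\<^sub>v y) i = (\<Sum>t<L + \<beta>. W i t * vec_index y t)" if "i < N + \<alpha>" for i
      using mult_mat_vec_index_sum[of i ?W y] that y by simp
    then have "(vec_l2norm (?W *\<^sub>v y))\<^sup>2 = (\<Sum>i<N + \<alpha>. (cmod (\<Sum>t<L + \<beta>. W i t * vec_index y t))\<^sup>2)"
      by (simp add: vec_l2norm_def sum_nonneg del: index_mult_mat_vec)
    also have "\<dots> \<le> (\<Sum>t<L + \<beta>. (cmod (vec_index y t))\<^sup>2)" using Wc by simp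
    also have "\<dots> = (vec_l2norm y)\<^sup>2" using y by (simp add: vec_l2norm_def sum_nonneg)
    finally have "vec_l2norm (?W *\<^sub>v y) \<le> vec_l2norm y" by (rule power2_le_imp_le) simp
    then show "vec_l2norm (four_block_mat A B C D *\<^sub>v y) \<le> 1 * vec_l2norm y" by (simp add: four)
  qed simp
  have real: "\<exists>R\<in>carrier_mat N N. inverts_mat (1\<^sub>m N - A * ampliated k P n z) R
      \<and> inverts_mat R (1\<^sub>m N - A * ampliated k P n z) \<and> F z = D + C * ampliated k P n z * R * B"
    if z: "z \<in> dom_P (direct_sum k P)" for z
  proof -
    let ?Pn = "ampliated k P n z"
    have Pn: "?Pn \<in> carrier_mat L N" unfolding L_def N_def by (rule ampliated_carrier[OF P])
    have "(\<Sum>i<N. (cmod (\<Sum>t<L. A $$ (i, t) * y t))\<^sup>2) \<le> (\<Sum>t<L. (cmod (y t))\<^sup>2)" for y :: "nat \<Rightarrow> complex"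
    proof -
      have "(\<Sum>i<N. (cmod (\<Sum>t<L. W i t * y t))\<^sup>2) \<le> (\<Sum>t<L. (cmod (y t))\<^sup>2)"
        by (rule contraction_submatrix[where M' = \<alpha> and N' = \<beta>]) (use Wc in simp)
      then show ?thesis by (simp add: A_def)
    qed
    then have "\<exists>R\<in>carrier_mat N N. inverts_mat (1\<^sub>m N - A * ?Pn) R \<and> inverts_mat R (1\<^sub>m N - A * ?Pn)"
      unfolding N_def L_def by (intro realization_invertible[OF P z]) (use car(1) in \<open>simp_all add: N_def L_def\<close>)
    then obtain R where R: "R \<in> carrier_mat N N" "inverts_mat (1\<^sub>m N - A * ?Pn) R" "inverts_mat R (1\<^sub>m N - A * ?Pn)"
      by blast
    define H where "H = Matrix.mat N \<beta> (\<lambda>(i, b). hf i (z, b))"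
    define qq where "qq = peval q z"
    have qq: "qq \<noteq> 0" using q z sub by (auto simp: qq_def)
    have Fz: "F z \<in> carrier_mat \<alpha> \<beta>" using assms(5) z sub unfolding rational_regular_on_def by blast
    have H: "H \<in> carrier_mat N \<beta>" by (simp add: H_def)
    have word_z: "word [] b' (z, b) = (if b' = b then 1 else 0)" for b b' by (simp add: word_def)
    have PH: "(?Pn * H) $$ (t, b) = Pf t (z, b)" if tb: "t < L" "b < \<beta>" for t b
    proof -
      obtain i t' where it: "i < k" "t' < n i * l i" "t = (\<Sum>j<i. n j * l j) + t'"
        using block_index_cases[of t "\<lambda>i. n i * l i" k] tb(1) unfolding L_def by blast
      have ni: "0 < n i" using it(2) by (cases "n i") auto
      have "(?Pn * H) $$ (t, b) = (\<Sum>t''<N. ?Pn $$ (t, t'') * hf t'' (z, b))"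
        using mat_mult_entry[of t ?Pn b H] Pn tb by (simp add: H_def)
      also have "\<dots> = (\<Sum>s<m i. peval (P i $$ (t' div n i, s)) z * hf ((\<Sum>j<i. n j * m j) + (s * n i + t' mod n i)) (z, b))"
        unfolding it(3) N_def by (rule ampliated_row[where l = l and m = m and n = n, OF P it(1,2)])
      also have "\<dots> = (\<Sum>s<m i. peval (P i $$ (t' div n i, s)) z * h i (t' mod n i) s (z, b))"
      proof (intro sum.cong refl)
        fix s assume "s \<in> {..<m i}"
        then have s: "s < m i" by simp
        have "s * n i + t' mod n i < Suc s * n i" using ni by simp
        also have "\<dots> \<le> m i * n i" using s by (intro mult_right_mono) auto
        finally have "s * n i + t' mod n i < n i * m i" by (simp add: mult.commute)
        then have "hf ((\<Sum>j<i. n j * m j) + (s * n i + t' mod n i)) = h i (t' mod n i) s"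
          using hf it(1) ni by simp
        then show "peval (P i $$ (t' div n i, s)) z * hf ((\<Sum>j<i. n j * m j) + (s * n i + t' mod n i)) (z, b)
          = peval (P i $$ (t' div n i, s)) z * h i (t' mod n i) s (z, b)" by simp
      qed
      also have "\<dots> = Pf t (z, b)" unfolding it(3) using Pf it(1,2) by (simp add: Pmult_def)
      finally show ?thesis .
    qed
    have key: "(\<Sum>t<L. W i t * (?Pn * H) $$ (t, b)) + W i (L + b) * qq = vv (z, b) i" if "i < N + \<alpha>" "b < \<beta>" for i b
    proof -
      have "vv (z, b) i = (\<Sum>t<L + \<beta>. W i t * uu (z, b) t)" using W that(1) by simp
      also have "\<dots> = (\<Sum>t<L. W i t * Pf t (z, b)) + (\<Sum>b'<\<beta>. W i (L + b') * u b' (z, b))"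
        by (simp add: sum_lessThan_add uu_def)
      also have "(\<Sum>b'<\<beta>. W i (L + b') * u b' (z, b)) = (\<Sum>b'<\<beta>. if b' = b then W i (L + b) * qq else 0)"
        by (intro sum.cong refl) (auto simp: u_def word_z qq_def)
      also have "\<dots> = W i (L + b) * qq" using that(2) by simp
      finally show ?thesis using PH that(2) by simp
    qed
    have PnH: "?Pn * H \<in> carrier_mat L \<beta>" using Pn H by simp
    have eq1: "A * (?Pn * H) + qq \<cdot>\<^sub>m B = H"
    proof (intro eq_matI)
      fix i b assume "i < dim_row H" "b < dim_col H"
      then have ib: "i < N" "b < \<beta>" by (simp_all add: H_def)
      have "(A * (?Pn * H)) $$ (i, b) = (\<Sum>t<L. W i t * (?Pn * H) $$ (t, b))"
        unfolding mat_mult_entry_carrier[OF car(1) PnH ib]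
        using ib by (intro sum.cong refl) (simp add: A_def del: index_mult_mat(1))
      then show "(A * (?Pn * H) + qq \<cdot>\<^sub>m B) $$ (i, b) = H $$ (i, b)"
        using key[of i b] ib car PnH by (simp add: B_def H_def vv_def mult.commute del: index_mult_mat(1))
    qed (use car H PnH in auto)
    have eq2: "C * (?Pn * H) + qq \<cdot>\<^sub>m D = qq \<cdot>\<^sub>m F z"
    proof (intro eq_matI)
      fix a b assume "a < dim_row (qq \<cdot>\<^sub>m F z)" "b < dim_col (qq \<cdot>\<^sub>m F z)"
      then have ab: "a < \<alpha>" "b < \<beta>" using Fz by simp_all
      have "(C * (?Pn * H)) $$ (a, b) = (\<Sum>t<L. W (N + a) t * (?Pn * H) $$ (t, b))"
        unfolding mat_mult_entry_carrier[OF car(3) PnH ab]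
        using ab by (intro sum.cong refl) (simp add: C_def del: index_mult_mat(1))
      moreover have "vv (z, b) (N + a) = peval (Q a b) z"
      proof -
        have "vv (z, b) (N + a) = (\<Sum>b'<\<beta>. peval (Q a b') z * (if b' = b then 1 else 0))"
          unfolding vv_def v_def word_z by simp
        also have "\<dots> = (\<Sum>b'<\<beta>. if b' = b then peval (Q a b) z else 0)"
          by (intro sum.cong refl) auto
        finally show ?thesis using ab(2) by simp
      qed
      ultimately show "(C * (?Pn * H) + qq \<cdot>\<^sub>m D) $$ (a, b) = (qq \<cdot>\<^sub>m F z) $$ (a, b)"
        using key[of "N + a" b] ab car PnH Fz qq FQ[OF z ab] by (simp add: D_def qq_def mult.commute del: index_mult_mat(1))
    qed (use car PnH Fz in auto)
    let ?M = "1\<^sub>m N - A * ?Pn"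
    have APn: "A * ?Pn \<in> carrier_mat N N" using car(1) Pn by simp
    have M: "?M \<in> carrier_mat N N" by (rule minus_carrier_mat[OF APn])
    have "?M * H = H - A * (?Pn * H)"
      using minus_mult_distrib_mat[OF one_carrier_mat APn H] assoc_mult_mat[OF car(1) Pn H] H by simp
    also have "\<dots> = qq \<cdot>\<^sub>m B"
    proof (intro eq_matI)
      fix i b assume "i < dim_row (qq \<cdot>\<^sub>m B)" "b < dim_col (qq \<cdot>\<^sub>m B)"
      then have ib: "i < N" "b < \<beta>" using car(2) by simp_all
      have "H $$ (i, b) = (A * (?Pn * H) + qq \<cdot>\<^sub>m B) $$ (i, b)" by (simp only: eq1)
      also have "\<dots> = (A * (?Pn * H)) $$ (i, b) + (qq \<cdot>\<^sub>m B) $$ (i, b)"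
        using ib car(2) by (intro index_add_mat) simp_all
      finally show "(H - A * (?Pn * H)) $$ (i, b) = (qq \<cdot>\<^sub>m B) $$ (i, b)"
        using ib car H PnH by (simp del: index_mult_mat(1))
    qed (use car H PnH in auto)
    finally have MH: "?M * H = qq \<cdot>\<^sub>m B" .
    have "R * ?M = 1\<^sub>m N" using R(1,3) by (simp add: inverts_mat_def)
    then have "H = R * (?M * H)" using assoc_mult_mat[OF R(1) M H] H by simp
    then have Heq: "H = qq \<cdot>\<^sub>m (R * B)" unfolding MH using mult_smult_distrib[OF R(1) car(2)] by simp
    have RB: "R * B \<in> carrier_mat N \<beta>" using R(1) car(2) by simp
    have PRB: "?Pn * (R * B) \<in> carrier_mat L \<beta>" using Pn RB by simp
    have "C * (?Pn * H) = qq \<cdot>\<^sub>m (C * (?Pn * (R * B)))"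
      unfolding Heq mult_smult_distrib[OF Pn RB] by (rule mult_smult_distrib[OF car(3) PRB])
    then have eq3: "qq \<cdot>\<^sub>m (C * (?Pn * (R * B))) + qq \<cdot>\<^sub>m D = qq \<cdot>\<^sub>m F z" using eq2 by simp
    have CPRB: "C * (?Pn * (R * B)) \<in> carrier_mat \<alpha> \<beta>" using car(3) PRB by simp
    define G where "G = C * (?Pn * (R * B))"
    have G: "G \<in> carrier_mat \<alpha> \<beta>" unfolding G_def by (rule CPRB)
    have "F z = D + G"
    proof (intro eq_matI)
      fix a b assume "a < dim_row (D + G)" "b < dim_col (D + G)"
      then have ab: "a < \<alpha>" "b < \<beta>"
        using carrier_matD[OF G] by (simp_all only: index_add_mat)
      have "(qq \<cdot>\<^sub>m G + qq \<cdot>\<^sub>m D) $$ (a, b) = (qq \<cdot>\<^sub>m F z) $$ (a, b)" unfolding G_def by (simp only: eq3)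
      moreover have "(qq \<cdot>\<^sub>m G + qq \<cdot>\<^sub>m D) $$ (a, b)
        = qq * G $$ (a, b) + qq * D $$ (a, b)"
        using ab G car(4) by (simp del: index_mult_mat(1))
      moreover have "(qq \<cdot>\<^sub>m F z) $$ (a, b) = qq * F z $$ (a, b)" using ab Fz by simp
      ultimately have "qq * (D $$ (a, b) + G $$ (a, b)) = qq * F z $$ (a, b)"
        by (simp add: algebra_simps)
      then have "D $$ (a, b) + G $$ (a, b) = F z $$ (a, b)" using qq by simp
      then show "F z $$ (a, b) = (D + G) $$ (a, b)"
        using ab G by (simp del: index_mult_mat(1))
    qed (use Fz G in auto)
    also have "G = C * ?Pn * R * B"
    proof -
      have CP: "C * ?Pn \<in> carrier_mat \<alpha> N" using car(3) Pn by simp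
      show ?thesis
        unfolding G_def by (simp only: assoc_mult_mat[OF CP R(1) car(2)] assoc_mult_mat[OF car(3) Pn RB])
    qed
    finally show ?thesis using R by (intro bexI[of _ R] conjI)
  qed
  show ?thesis
    by (rule exI[of _ n], rule exI[of _ A], rule exI[of _ B], rule exI[of _ C], rule exI[of _ D])
      (use car norm real in \<open>simp add: N_def L_def Let_def\<close>)
qed

end
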